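(* Let $Q$ be an associative ring, $f\in Q$ a central non-zero-divisor, $R=Q/(f)$, and let $M,N$ be $R$-modules. Let $\vartheta$ denote either one of the classes $\vartheta^M\in\operatorname{Ext}^2_R(M,M)$ or $\vartheta^N\in\operatorname{Ext}^2_R(N,N)$ described in the context, and let $(\ )_\vartheta$ be graded localization at the multiplicatively closed set $\{\vartheta^i\mid i\ge0\}$. There are induced structures of graded algebras on $\operatorname{Ext}_R(N,N)_\vartheta$ and $\operatorname{Ext}_R(M,M)_\vartheta$ (respectively, on $\widehat{\operatorname{Ext}}_R(N,N)_\vartheta$ and $\widehat{\operatorname{Ext}}_R(M,M)_\vartheta$), and an induced left-right-bimodule structure on $\operatorname{Ext}_R(M,N)_\vartheta$ (respectively, on $\widehat{\operatorname{Ext}}_R(M,N)_\vartheta$) over them. The canonical maps $\iota$ from absolute to stable cohomology induce isomorphisms of graded algebras $$\operatorname{Ext}_R(N,N)_\vartheta\longrightarrow\widehat{\operatorname{Ext}}_R(N,N)_\vartheta,\qquad \operatorname{Ext}_R(M,M)_\vartheta\longrightarrow\widehat{\operatorname{Ext}}_R(M,M)_\vartheta$$ and an equivariant isomorphism of graded bimodules over them $$\operatorname{Ext}_R(M,N)_\vartheta\longrightarrow\widehat{\operatorname{Ext}}_R(M,N)_\vartheta.$$ If $M$ or $N$ has finite projective dimension over $Q$, then $\widehat{\operatorname{Ext}}_R(M,N)_\vartheta=\widehat{\operatorname{Ext}}_R(M,N)$ (i.e. the localization map is bijective).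
   Context: Modules are left modules. For an associative ring $R$ and $R$-modules $M,N$ with projective resolutions $F\to M$, $G\to N$, let $\operatorname{Hom}_R(F,G)$ be the complex with $\operatorname{Hom}_R(F,G)^n=\prod_{i}\operatorname{Hom}_R(F_i,G_{i-n})$ and differential $\beta\mapsto\partial^G\beta-(-1)^{|\beta|}\beta\partial^F$; let $\overline{\operatorname{Hom}}_R(F,G)$ be the subcomplex of those $\beta$ with $\beta_i=0$ for all $i\gg0$, and $\widehat{\operatorname{Hom}}_R(F,G)$ the quotient complex. The cohomologies of $\operatorname{Hom}_R(F,G)$ and $\widehat{\operatorname{Hom}}_R(F,G)$ are the graded groups $\operatorname{Ext}_R(M,N)$ and $\widehat{\operatorname{Ext}}_R(M,N)$ (stable cohomology), independent of the resolutions. Composition makes $\operatorname{Ext}_R(M,M)$ and $\widehat{\operatorname{Ext}}_R(M,M)$ graded rings, $\operatorname{Ext}_R(M,N)$ a graded $\operatorname{Ext}_R(N,N)$-$\operatorname{Ext}_R(M,M)$-bimodule, and $\widehat{\operatorname{Ext}}_R(M,N)$ a graded $\widehat{\operatorname{Ext}}_R(N,N)$-$\widehat{\operatorname{Ext}}_R(M,M)$-bimodule; the quotient map of complexes induces $\iota\colon\operatorname{Ext}_R(M,N)\to\widehat{\operatorname{Ext}}_R(M,N)$, a ring homomorphism when $M=N$. Construction of $\vartheta^M$: let $F\to M$ be a projective resolution over $R$ that is liftable, i.e. $F=R\otimes_Q\widetilde F$ as graded modules for some graded projective $Q$-module $\widetilde F$ (for example, any free resolution). Choose a $Q$-linear map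 $\widetilde\partial\colon\widetilde F\to\widetilde F$ of degree $-1$ with $R\otimes_Q\widetilde\partial=\partial^F$. There is a unique $Q$-linear $\widetilde\theta\colon\widetilde F\to\widetilde F$ of degree $-2$ with $\widetilde\partial^2=f\widetilde\theta$, and $\theta^F=R\otimes_Q\widetilde\theta$ is a chain map of homological degree $-2$; $\vartheta^M\in\operatorname{Ext}^2_R(M,M)$ is its class, independent of choices. $\vartheta^N$ is defined likewise. The classes $\vartheta^M,\vartheta^N$ and their images under $\iota$ are central in $\operatorname{Ext}_R(M,M)$, $\operatorname{Ext}_R(N,N)$, $\widehat{\operatorname{Ext}}_R(M,M)$, $\widehat{\operatorname{Ext}}_R(N,N)$, respectively, and satisfy $\vartheta^N\xi=\xi\vartheta^M$ for every $\xi$ in $\operatorname{Ext}_R(M,N)$ or $\widehat{\operatorname{Ext}}_R(M,N)$, so localizing the bimodules by inverting either one gives the same result. *)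

theory Defs
  imports "HOL-Algebra.Module" "HOL-Algebra.QuotRing" "HOL-Algebra.Free_Abelian_Groups"
begin

section \<open>Left modules over an associative ring\<close>

text \<open>The library locale \<open>module\<close> requires a commutative ring, so left modules over an arbitrary
  ring are introduced here on the library record type \<open>module\<close>, whose fields \<open>mult\<close> and \<open>one\<close> are
  ignored.\<close>

locale left_module = R?: ring R + M?: abelian_group M
  for R :: "'a ring" (structure) and M :: "('a, 'b) module" (structure) +
  assumes smult_closed:
      "\<lbrakk>a \<in> carrier R; x \<in> carrier M\<rbrakk> \<Longrightarrow> a \<odot>\<^bsub>M\<^esub> x \<in> carrier M"
    and smult_l_distr:
      "\<lbrakk>a \<in> carrier R; b \<in> carrier R; x \<in> carrier M\<rbrakk> \<Longrightarrow>
        (a \<oplus>\<^bsub>R\<^esub> b) \<odot>\<^bsub>M\<^esub> x = a \<odot>\<^bsub>M\<^esub> x \<oplus>\<^bsub>M\<^esub> b \<odot>\<^bsub>M\<^esub> x"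
    and smult_r_distr:
      "\<lbrakk>a \<in> carrier R; x \<in> carrier M; y \<in> carrier M\<rbrakk> \<Longrightarrow>
        a \<odot>\<^bsub>M\<^esub> (x \<oplus>\<^bsub>M\<^esub> y) = a \<odot>\<^bsub>M\<^esub> x \<oplus>\<^bsub>M\<^esub> a \<odot>\<^bsub>M\<^esub> y"
    and smult_assoc:
      "\<lbrakk>a \<in> carrier R; b \<in> carrier R; x \<in> carrier M\<rbrakk> \<Longrightarrow>
        (a \<otimes>\<^bsub>R\<^esub> b) \<odot>\<^bsub>M\<^esub> x = a \<odot>\<^bsub>M\<^esub> (b \<odot>\<^bsub>M\<^esub> x)"
    and smult_one:
      "x \<in> carrier M \<Longrightarrow> \<one>\<^bsub>R\<^esub> \<odot>\<^bsub>M\<^esub> x = x"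

text \<open>Linear maps are taken extensional, so that equality of maps is equality on the carrier.\<close>

definition lin_hom :: "'a ring \<Rightarrow> ('a, 'b) module \<Rightarrow> ('a, 'c) module \<Rightarrow> ('b \<Rightarrow> 'c) set" where
  "lin_hom R X Y =
    {h \<in> carrier X \<rightarrow>\<^sub>E carrier Y.
      (\<forall>x \<in> carrier X. \<forall>y \<in> carrier X. h (x \<oplus>\<^bsub>X\<^esub> y) = h x \<oplus>\<^bsub>Y\<^esub> h y) \<and>
      (\<forall>a \<in> carrier R. \<forall>x \<in> carrier X. h (a \<odot>\<^bsub>X\<^esub> x) = a \<odot>\<^bsub>Y\<^esub> h x)}"

text \<open>Projectivity is the lifting property. In HOL the test modules must live in fixed types; those
  chosen here suffice to recover lifting against arbitrary surjections: the free module on the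
  carrier of \<open>P\<close> (finitely supported functions) lives in \<^typ>\<open>'b \<Rightarrow> 'a\<close>, so lifting the identity
  of \<open>P\<close> along the canonical surjection makes \<open>P\<close> a direct summand of a free module.\<close>

definition projective_module :: "'a ring \<Rightarrow> ('a, 'b) module \<Rightarrow> bool" where
  "projective_module R P \<longleftrightarrow> left_module R P \<and>
    (\<forall>(X :: ('a, 'b \<Rightarrow> 'a) module) (Y :: ('a, 'b) module). \<forall>g \<in> lin_hom R X Y. \<forall>h \<in> lin_hom R P Y.
      left_module R X \<longrightarrow> left_module R Y \<longrightarrow> g ` carrier X = carrier Y \<longrightarrow>
      (\<exists>k \<in> lin_hom R P X. \<forall>x \<in> carrier P. g (k x) = h x))"

definition restrict_scalars ::
    "('q \<Rightarrow> 'r) \<Rightarrow> ('r, 'm) module \<Rightarrow> ('q, 'm) module" where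
  "restrict_scalars \<pi> M =
    \<lparr>carrier = carrier M, monoid.mult = (\<otimes>\<^bsub>M\<^esub>), one = \<one>\<^bsub>M\<^esub>, ring.zero = \<zero>\<^bsub>M\<^esub>, add = (\<oplus>\<^bsub>M\<^esub>),
     smult = (\<lambda>q x. \<pi> q \<odot>\<^bsub>M\<^esub> x)\<rparr>"

subsection \<open>Extension of scalars\<close>

text \<open>For a ring map \<open>\<pi>\<close> from \<open>Q\<close> to \<open>R\<close> and a left \<open>Q\<close>-module \<open>X\<close>, the tensor product
  \<open>R \<otimes>\<^sub>Q X\<close> is the quotient of the free abelian group on the pairs \<open>(r, x)\<close> by the
  usual relations; \<open>r \<otimes> x\<close> is the coset of the generator \<open>frag_of (r, x)\<close>.\<close>

definition tensor_free ::
    "'r ring \<Rightarrow> ('q, 'x) module \<Rightarrow> (('r \<times> 'x) \<Rightarrow>\<^sub>0 int) monoid" where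
  "tensor_free R X = free_Abelian_group (carrier R \<times> carrier X)"

definition tensor_rels ::
    "'q ring \<Rightarrow> 'r ring \<Rightarrow> ('q \<Rightarrow> 'r) \<Rightarrow> ('q, 'x) module \<Rightarrow> (('r \<times> 'x) \<Rightarrow>\<^sub>0 int) set" where
  "tensor_rels Q R \<pi> X = generate (tensor_free R X)
    ({frag_of (r \<oplus>\<^bsub>R\<^esub> s, x) - frag_of (r, x) - frag_of (s, x) | r s x.
        r \<in> carrier R \<and> s \<in> carrier R \<and> x \<in> carrier X} \<union>
     {frag_of (r, x \<oplus>\<^bsub>X\<^esub> y) - frag_of (r, x) - frag_of (r, y) | r x y.
        r \<in> carrier R \<and> x \<in> carrier X \<and> y \<in> carrier X} \<union>
     {frag_of (r \<otimes>\<^bsub>R\<^esub> \<pi> q, x) - frag_of (r, q \<odot>\<^bsub>X\<^esub> x) | r q x.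
        r \<in> carrier R \<and> q \<in> carrier Q \<and> x \<in> carrier X})"

definition ext_scalars ::
    "'q ring \<Rightarrow> 'r ring \<Rightarrow> ('q \<Rightarrow> 'r) \<Rightarrow> ('q, 'x) module \<Rightarrow> ('r, (('r \<times> 'x) \<Rightarrow>\<^sub>0 int) set) module" where
  "ext_scalars Q R \<pi> X =
    \<lparr>carrier = carrier (tensor_free R X Mod tensor_rels Q R \<pi> X),
     monoid.mult = undefined, one = undefined,
     ring.zero = \<one>\<^bsub>tensor_free R X Mod tensor_rels Q R \<pi> X\<^esub>,
     add = (\<otimes>\<^bsub>tensor_free R X Mod tensor_rels Q R \<pi> X\<^esub>),
     smult = (\<lambda>s C. \<Union>c \<in> C. tensor_rels Q R \<pi> X #>\<^bsub>tensor_free R X\<^esub>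
       frag_extend (\<lambda>(r, x). frag_of (s \<otimes>\<^bsub>R\<^esub> r, x)) c)\<rparr>"

text \<open>The map \<open>R \<otimes>\<^sub>Q u\<close> into \<open>R \<otimes>\<^sub>Q Y\<close>, sending \<open>r \<otimes> x\<close> to \<open>r \<otimes> u x\<close>. Here and below, maps induced
  on quotients are written as unions over all representatives of the class of the result; when the
  operation is well defined, this is a union of copies of one and the same class.\<close>

definition ext_scalars_map ::
    "'q ring \<Rightarrow> 'r ring \<Rightarrow> ('q \<Rightarrow> 'r) \<Rightarrow> ('q, 'y) module \<Rightarrow> ('x \<Rightarrow> 'y) \<Rightarrow>
      (('r \<times> 'x) \<Rightarrow>\<^sub>0 int) set \<Rightarrow> (('r \<times> 'y) \<Rightarrow>\<^sub>0 int) set" where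
  "ext_scalars_map Q R \<pi> Y u C =
    (\<Union>c \<in> C. tensor_rels Q R \<pi> Y #>\<^bsub>tensor_free R Y\<^esub>
       frag_extend (\<lambda>(r, x). frag_of (r, u x)) c)"

section \<open>Resolutions\<close>

text \<open>Complexes of modules are indexed by all integers, with differential of degree \<open>-1\<close>:
  \<open>bd F i\<close> maps \<open>obj F i\<close> to \<open>obj F (i - 1)\<close>.\<close>

record ('a, 'b) chain_complex =
  obj :: "int \<Rightarrow> ('a, 'b) module"
  bd :: "int \<Rightarrow> 'b \<Rightarrow> 'b"

definition projective_resolution ::
    "'a ring \<Rightarrow> ('a, 'm) module \<Rightarrow> ('a, 'b) chain_complex \<Rightarrow> ('b \<Rightarrow> 'm) \<Rightarrow> bool" where
  "projective_resolution R M F \<epsilon> \<longleftrightarrow>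
    (\<forall>i. projective_module R (obj F i)) \<and>
    (\<forall>i<0. carrier (obj F i) = {\<zero>\<^bsub>obj F i\<^esub>}) \<and>
    (\<forall>i. bd F i \<in> lin_hom R (obj F i) (obj F (i - 1))) \<and>
    (\<forall>i>0. {x \<in> carrier (obj F i). bd F i x = \<zero>\<^bsub>obj F (i - 1)\<^esub>} = bd F (i + 1) ` carrier (obj F (i + 1))) \<and>
    \<epsilon> \<in> lin_hom R (obj F 0) M \<and>
    \<epsilon> ` carrier (obj F 0) = carrier M \<and>
    {x \<in> carrier (obj F 0). \<epsilon> x = \<zero>\<^bsub>M\<^esub>} = bd F 1 ` carrier (obj F 1)"

text \<open>The first argument names the type in which the finite resolution is sought.\<close>

definition finite_proj_dim :: "'p itself \<Rightarrow> 'a ring \<Rightarrow> ('a, 'm) module \<Rightarrow> bool" where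
  "finite_proj_dim _ Q M \<longleftrightarrow>
    (\<exists>(P :: ('a, 'p) chain_complex) \<epsilon> n. projective_resolution Q M P \<epsilon> \<and>
      (\<forall>i>n. carrier (obj P i) = {\<zero>\<^bsub>obj P i\<^esub>}))"

section \<open>Cochain complexes of abelian groups\<close>

text \<open>Abelian groups occurring as homogeneous components are library \<^typ>\<open>'a monoid\<close> records,
  written multiplicatively: \<open>\<otimes>\<close> is the addition and \<open>\<one>\<close> is zero. This makes the
  quotient \<open>Mod\<close> and the notions \<open>kernel\<close>, \<open>hom\<close> and \<open>iso\<close> of the library available.\<close>

record 'a cochain_complex =
  grp :: "int \<Rightarrow> 'a monoid"
  cbd :: "int \<Rightarrow> 'a \<Rightarrow> 'a"

definition coboundaries :: "'a cochain_complex \<Rightarrow> int \<Rightarrow> 'a set" where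
  "coboundaries C n = cbd C (n - 1) ` carrier (grp C (n - 1))"

definition cohomology :: "'a cochain_complex \<Rightarrow> int \<Rightarrow> 'a set monoid" where
  "cohomology C n =
    (grp C n)\<lparr>carrier := kernel (grp C n) (grp C (n + 1)) (cbd C n)\<rparr> Mod coboundaries C n"

definition coh_class :: "'a cochain_complex \<Rightarrow> int \<Rightarrow> 'a \<Rightarrow> 'a set" where
  "coh_class C n z = coboundaries C n #>\<^bsub>grp C n\<^esub> z"

subsection \<open>The Hom complex and its stable quotient\<close>

text \<open>A cochain of degree \<open>n\<close> is a family \<open>\<beta> i\<close> of linear maps from \<open>F\<^sub>i\<close> to \<open>G\<^sub>i\<^sub>-\<^sub>n\<close>.\<close>

definition hom_group ::
    "'r ring \<Rightarrow> ('r, 'c) chain_complex \<Rightarrow> ('r, 'd) chain_complex \<Rightarrow> int \<Rightarrow> (int \<Rightarrow> 'c \<Rightarrow> 'd) monoid" where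
  "hom_group R F G n =
    \<lparr>carrier = {\<beta>. \<forall>i. \<beta> i \<in> lin_hom R (obj F i) (obj G (i - n))},
     monoid.mult = (\<lambda>\<alpha> \<beta>. \<lambda>i. \<lambda>x \<in> carrier (obj F i). \<alpha> i x \<oplus>\<^bsub>obj G (i - n)\<^esub> \<beta> i x),
     one = (\<lambda>i. \<lambda>x \<in> carrier (obj F i). \<zero>\<^bsub>obj G (i - n)\<^esub>)\<rparr>"

definition hom_diff ::
    "('r, 'c) chain_complex \<Rightarrow> ('r, 'd) chain_complex \<Rightarrow> int \<Rightarrow> (int \<Rightarrow> 'c \<Rightarrow> 'd) \<Rightarrow> int \<Rightarrow> 'c \<Rightarrow> 'd" where
  "hom_diff F G n \<beta> = (\<lambda>i. \<lambda>x \<in> carrier (obj F i).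
    if even n
    then bd G (i - n) (\<beta> i x) \<ominus>\<^bsub>obj G (i - n - 1)\<^esub> \<beta> (i - 1) (bd F i x)
    else bd G (i - n) (\<beta> i x) \<oplus>\<^bsub>obj G (i - n - 1)\<^esub> \<beta> (i - 1) (bd F i x))"

definition hom_complex ::
    "'r ring \<Rightarrow> ('r, 'c) chain_complex \<Rightarrow> ('r, 'd) chain_complex \<Rightarrow> (int \<Rightarrow> 'c \<Rightarrow> 'd) cochain_complex" where
  "hom_complex R F G = \<lparr>grp = hom_group R F G, cbd = hom_diff F G\<rparr>"

definition bounded_homs ::
    "'r ring \<Rightarrow> ('r, 'c) chain_complex \<Rightarrow> ('r, 'd) chain_complex \<Rightarrow> int \<Rightarrow> (int \<Rightarrow> 'c \<Rightarrow> 'd) set" where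
  "bounded_homs R F G n =
    {\<beta> \<in> carrier (hom_group R F G n).
      \<exists>k. \<forall>i>k. \<forall>x \<in> carrier (obj F i). \<beta> i x = \<zero>\<^bsub>obj G (i - n)\<^esub>}"

definition stable_class ::
    "'r ring \<Rightarrow> ('r, 'c) chain_complex \<Rightarrow> ('r, 'd) chain_complex \<Rightarrow> int \<Rightarrow>
      (int \<Rightarrow> 'c \<Rightarrow> 'd) \<Rightarrow> (int \<Rightarrow> 'c \<Rightarrow> 'd) set" where
  "stable_class R F G n \<beta> = bounded_homs R F G n #>\<^bsub>hom_group R F G n\<^esub> \<beta>"

definition stable_hom_complex ::
    "'r ring \<Rightarrow> ('r, 'c) chain_complex \<Rightarrow> ('r, 'd) chain_complex \<Rightarrow>
      (int \<Rightarrow> 'c \<Rightarrow> 'd) set cochain_complex" where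
  "stable_hom_complex R F G =
    \<lparr>grp = (\<lambda>n. hom_group R F G n Mod bounded_homs R F G n),
     cbd = (\<lambda>n B. \<Union>\<beta> \<in> B. stable_class R F G (n + 1) (hom_diff F G n \<beta>))\<rparr>"

text \<open>The composite \<open>\<alpha> \<circ> \<beta>\<close>, where \<open>\<beta>\<close> has degree \<open>n\<close> and source \<open>F\<close>.\<close>

definition hom_comp ::
    "('r, 'c) chain_complex \<Rightarrow> int \<Rightarrow> (int \<Rightarrow> 'd \<Rightarrow> 'e) \<Rightarrow> (int \<Rightarrow> 'c \<Rightarrow> 'd) \<Rightarrow> int \<Rightarrow> 'c \<Rightarrow> 'e" where
  "hom_comp F n \<alpha> \<beta> = (\<lambda>i. compose (carrier (obj F i)) (\<alpha> (i - n)) (\<beta> i))"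

definition hom_ident :: "('r, 'c) chain_complex \<Rightarrow> int \<Rightarrow> 'c \<Rightarrow> 'c" where
  "hom_ident F = (\<lambda>i. \<lambda>x \<in> carrier (obj F i). x)"

section \<open>Graded rings and bimodules\<close>

text \<open>Graded objects are families of components indexed by the integers. Elements of different
  degrees are not required to be distinct, so every operation carries the degrees of its
  arguments.\<close>

record 'a gring =
  gr_comp :: "int \<Rightarrow> 'a monoid"
  gr_mult :: "int \<Rightarrow> int \<Rightarrow> 'a \<Rightarrow> 'a \<Rightarrow> 'a"
  gr_one :: 'a

record ('s, 't, 'x) gbimod =
  bm_comp :: "int \<Rightarrow> 'x monoid"
  bm_left :: "int \<Rightarrow> int \<Rightarrow> 's \<Rightarrow> 'x \<Rightarrow> 'x"
  bm_right :: "int \<Rightarrow> int \<Rightarrow> 'x \<Rightarrow> 't \<Rightarrow> 'x"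

abbreviation gr_elts :: "'a gring \<Rightarrow> int \<Rightarrow> 'a set" where
  "gr_elts A n \<equiv> carrier (gr_comp A n)"

abbreviation bm_elts :: "('s, 't, 'x) gbimod \<Rightarrow> int \<Rightarrow> 'x set" where
  "bm_elts X n \<equiv> carrier (bm_comp X n)"

text \<open>A biadditive pairing of two graded groups with values in a third.\<close>

definition graded_pairing ::
    "(int \<Rightarrow> 'a monoid) \<Rightarrow> (int \<Rightarrow> 'b monoid) \<Rightarrow> (int \<Rightarrow> 'c monoid) \<Rightarrow>
      (int \<Rightarrow> int \<Rightarrow> 'a \<Rightarrow> 'b \<Rightarrow> 'c) \<Rightarrow> bool" where
  "graded_pairing A B C p \<longleftrightarrow>
    (\<forall>m n. \<forall>x \<in> carrier (A m). \<forall>y \<in> carrier (B n). p m n x y \<in> carrier (C (m + n))) \<and>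
    (\<forall>m n. \<forall>x \<in> carrier (A m). \<forall>x' \<in> carrier (A m). \<forall>y \<in> carrier (B n).
      p m n (x \<otimes>\<^bsub>A m\<^esub> x') y = p m n x y \<otimes>\<^bsub>C (m + n)\<^esub> p m n x' y) \<and>
    (\<forall>m n. \<forall>x \<in> carrier (A m). \<forall>y \<in> carrier (B n). \<forall>y' \<in> carrier (B n).
      p m n x (y \<otimes>\<^bsub>B n\<^esub> y') = p m n x y \<otimes>\<^bsub>C (m + n)\<^esub> p m n x y')"

locale graded_ring =
  fixes A :: "'a gring"
  assumes comp_group: "comm_group (gr_comp A n)"
    and mult_pairing: "graded_pairing (gr_comp A) (gr_comp A) (gr_comp A) (gr_mult A)"
    and mult_assoc:
      "\<lbrakk>x \<in> gr_elts A k; y \<in> gr_elts A m; z \<in> gr_elts A n\<rbrakk> \<Longrightarrow>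
        gr_mult A (k + m) n (gr_mult A k m x y) z = gr_mult A k (m + n) x (gr_mult A m n y z)"
    and one_closed: "gr_one A \<in> gr_elts A 0"
    and one_left: "x \<in> gr_elts A n \<Longrightarrow> gr_mult A 0 n (gr_one A) x = x"
    and one_right: "x \<in> gr_elts A n \<Longrightarrow> gr_mult A n 0 x (gr_one A) = x"

locale graded_bimodule = S: graded_ring S + T: graded_ring T
  for S :: "'s gring" and T :: "'t gring" +
  fixes X :: "('s, 't, 'x) gbimod"
  assumes bm_comp_group: "comm_group (bm_comp X n)"
    and left_pairing: "graded_pairing (gr_comp S) (bm_comp X) (bm_comp X) (bm_left X)"
    and right_pairing: "graded_pairing (bm_comp X) (gr_comp T) (bm_comp X) (bm_right X)"
    and left_assoc:
      "\<lbrakk>a \<in> gr_elts S k; b \<in> gr_elts S m; x \<in> bm_elts X n\<rbrakk> \<Longrightarrow>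
        bm_left X (k + m) n (gr_mult S k m a b) x = bm_left X k (m + n) a (bm_left X m n b x)"
    and right_assoc:
      "\<lbrakk>x \<in> bm_elts X k; c \<in> gr_elts T m; d \<in> gr_elts T n\<rbrakk> \<Longrightarrow>
        bm_right X (k + m) n (bm_right X k m x c) d = bm_right X k (m + n) x (gr_mult T m n c d)"
    and left_right:
      "\<lbrakk>a \<in> gr_elts S k; x \<in> bm_elts X m; c \<in> gr_elts T n\<rbrakk> \<Longrightarrow>
        bm_right X (k + m) n (bm_left X k m a x) c = bm_left X k (m + n) a (bm_right X m n x c)"
    and left_one: "x \<in> bm_elts X n \<Longrightarrow> bm_left X 0 n (gr_one S) x = x"
    and right_one: "x \<in> bm_elts X n \<Longrightarrow> bm_right X n 0 x (gr_one T) = x"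

definition graded_ring_hom :: "'a gring \<Rightarrow> 'b gring \<Rightarrow> (int \<Rightarrow> 'a \<Rightarrow> 'b) \<Rightarrow> bool" where
  "graded_ring_hom A B h \<longleftrightarrow>
    (\<forall>n. h n \<in> hom (gr_comp A n) (gr_comp B n)) \<and>
    (\<forall>m n. \<forall>x \<in> gr_elts A m. \<forall>y \<in> gr_elts A n.
      h (m + n) (gr_mult A m n x y) = gr_mult B m n (h m x) (h n y)) \<and>
    h 0 (gr_one A) = gr_one B"

definition graded_ring_iso :: "'a gring \<Rightarrow> 'b gring \<Rightarrow> (int \<Rightarrow> 'a \<Rightarrow> 'b) \<Rightarrow> bool" where
  "graded_ring_iso A B h \<longleftrightarrow>
    graded_ring_hom A B h \<and> (\<forall>n. h n \<in> iso (gr_comp A n) (gr_comp B n))"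

text \<open>Homomorphisms of bimodules that are equivariant along \<open>hS\<close> and \<open>hT\<close>.\<close>

definition graded_bimodule_hom ::
    "'s gring \<Rightarrow> 't gring \<Rightarrow> ('s, 't, 'x) gbimod \<Rightarrow> ('s2, 't2, 'y) gbimod \<Rightarrow>
      (int \<Rightarrow> 's \<Rightarrow> 's2) \<Rightarrow> (int \<Rightarrow> 't \<Rightarrow> 't2) \<Rightarrow> (int \<Rightarrow> 'x \<Rightarrow> 'y) \<Rightarrow> bool" where
  "graded_bimodule_hom S T X Y hS hT h \<longleftrightarrow>
    (\<forall>n. h n \<in> hom (bm_comp X n) (bm_comp Y n)) \<and>
    (\<forall>m n. \<forall>a \<in> gr_elts S m. \<forall>x \<in> bm_elts X n.
      h (m + n) (bm_left X m n a x) = bm_left Y m n (hS m a) (h n x)) \<and>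
    (\<forall>m n. \<forall>x \<in> bm_elts X m. \<forall>b \<in> gr_elts T n.
      h (m + n) (bm_right X m n x b) = bm_right Y m n (h m x) (hT n b))"

definition graded_bimodule_iso ::
    "'s gring \<Rightarrow> 't gring \<Rightarrow> ('s, 't, 'x) gbimod \<Rightarrow> ('s2, 't2, 'y) gbimod \<Rightarrow>
      (int \<Rightarrow> 's \<Rightarrow> 's2) \<Rightarrow> (int \<Rightarrow> 't \<Rightarrow> 't2) \<Rightarrow> (int \<Rightarrow> 'x \<Rightarrow> 'y) \<Rightarrow> bool" where
  "graded_bimodule_iso S T X Y hS hT h \<longleftrightarrow>
    graded_bimodule_hom S T X Y hS hT h \<and> (\<forall>n. h n \<in> iso (bm_comp X n) (bm_comp Y n))"

subsection \<open>Graded localization at the powers of an element of degree two\<close>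

text \<open>The argument \<open>act k n x\<close> stands for \<open>t\<^sup>k x\<close>, where \<open>x\<close> has degree \<open>n\<close> and \<open>t\<close> has degree \<open>2\<close>.
  An element of degree \<open>n\<close> of the localization is a fraction \<open>x / t\<^sup>i\<close> with \<open>x\<close> of degree \<open>n + 2i\<close>,
  and \<open>x / t\<^sup>i = y / t\<^sup>j\<close> iff \<open>t\<^sup>k\<^sup>+\<^sup>j x = t\<^sup>k\<^sup>+\<^sup>i y\<close> for some \<open>k\<close>.\<close>

definition loc_frac ::
    "(int \<Rightarrow> 'x monoid) \<Rightarrow> (nat \<Rightarrow> int \<Rightarrow> 'x \<Rightarrow> 'x) \<Rightarrow> int \<Rightarrow> 'x \<Rightarrow> nat \<Rightarrow> ('x \<times> nat) set" where
  "loc_frac X act n x i =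
    {(y, j). y \<in> carrier (X (n + 2 * int j)) \<and>
      (\<exists>k. act (k + j) (n + 2 * int i) x = act (k + i) (n + 2 * int j) y)}"

definition loc_comp ::
    "(int \<Rightarrow> 'x monoid) \<Rightarrow> (nat \<Rightarrow> int \<Rightarrow> 'x \<Rightarrow> 'x) \<Rightarrow> int \<Rightarrow> ('x \<times> nat) set monoid" where
  "loc_comp X act n =
    \<lparr>carrier = {loc_frac X act n x i | x i. x \<in> carrier (X (n + 2 * int i))},
     monoid.mult = (\<lambda>U W. \<Union>(x, i) \<in> U. \<Union>(y, j) \<in> W. loc_frac X act n
       (act j (n + 2 * int i) x \<otimes>\<^bsub>X (n + 2 * int (i + j))\<^esub> act i (n + 2 * int j) y) (i + j)),
     one = loc_frac X act n \<one>\<^bsub>X n\<^esub> 0\<rparr>"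

definition loc_map ::
    "(int \<Rightarrow> 'x monoid) \<Rightarrow> (nat \<Rightarrow> int \<Rightarrow> 'x \<Rightarrow> 'x) \<Rightarrow> int \<Rightarrow> 'x \<Rightarrow> ('x \<times> nat) set" where
  "loc_map X act n x = loc_frac X act n x 0"

text \<open>The map of localizations \<open>x / t\<^sup>i \<mapsto> h x / u\<^sup>i\<close> induced by \<open>h\<close>; the arguments \<open>Y\<close> and \<open>act\<close>
  describe the target.\<close>

definition loc_induced ::
    "(int \<Rightarrow> 'y monoid) \<Rightarrow> (nat \<Rightarrow> int \<Rightarrow> 'y \<Rightarrow> 'y) \<Rightarrow> (int \<Rightarrow> 'x \<Rightarrow> 'y) \<Rightarrow> int \<Rightarrow>
      ('x \<times> nat) set \<Rightarrow> ('y \<times> nat) set" where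
  "loc_induced Y act h n U = (\<Union>(x, i) \<in> U. loc_frac Y act n (h (n + 2 * int i) x) i)"

fun gr_pow :: "'a gring \<Rightarrow> 'a \<Rightarrow> nat \<Rightarrow> 'a" where
  "gr_pow A t 0 = gr_one A"
| "gr_pow A t (Suc k) = gr_mult A (2 * int k) 2 (gr_pow A t k) t"

definition gr_act :: "'a gring \<Rightarrow> 'a \<Rightarrow> nat \<Rightarrow> int \<Rightarrow> 'a \<Rightarrow> 'a" where
  "gr_act A t k n x = gr_mult A (2 * int k) n (gr_pow A t k) x"

definition gr_loc :: "'a gring \<Rightarrow> 'a \<Rightarrow> ('a \<times> nat) set gring" where
  "gr_loc A t =
    \<lparr>gr_comp = loc_comp (gr_comp A) (gr_act A t),
     gr_mult = (\<lambda>m n U W. \<Union>(x, i) \<in> U. \<Union>(y, j) \<in> W. loc_frac (gr_comp A) (gr_act A t) (m + n)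
       (gr_mult A (m + 2 * int i) (n + 2 * int j) x y) (i + j)),
     gr_one = loc_map (gr_comp A) (gr_act A t) 0 (gr_one A)\<rparr>"

text \<open>A bimodule over \<open>S\<close> and \<open>T\<close> can be localized at a central \<open>s\<close> of \<open>S\<close>, acting on the left,
  or at a central \<open>t\<close> of \<open>T\<close>, acting on the right.\<close>

datatype loc_side = Left_Side | Right_Side

fun bm_act ::
    "loc_side \<Rightarrow> 's gring \<Rightarrow> 's \<Rightarrow> 't gring \<Rightarrow> 't \<Rightarrow> ('s, 't, 'x) gbimod \<Rightarrow> nat \<Rightarrow> int \<Rightarrow> 'x \<Rightarrow> 'x" where
  "bm_act Left_Side S s T t X k n x = bm_left X (2 * int k) n (gr_pow S s k) x"
| "bm_act Right_Side S s T t X k n x = bm_right X n (2 * int k) x (gr_pow T t k)"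

definition bm_loc ::
    "('s, 't, 'x) gbimod \<Rightarrow> (nat \<Rightarrow> int \<Rightarrow> 'x \<Rightarrow> 'x) \<Rightarrow>
      (('s \<times> nat) set, ('t \<times> nat) set, ('x \<times> nat) set) gbimod" where
  "bm_loc X act =
    \<lparr>bm_comp = loc_comp (bm_comp X) act,
     bm_left = (\<lambda>m n U W. \<Union>(a, i) \<in> U. \<Union>(x, j) \<in> W. loc_frac (bm_comp X) act (m + n)
       (bm_left X (m + 2 * int i) (n + 2 * int j) a x) (i + j)),
     bm_right = (\<lambda>m n W U. \<Union>(x, j) \<in> W. \<Union>(b, i) \<in> U. loc_frac (bm_comp X) act (m + n)
       (bm_right X (m + 2 * int j) (n + 2 * int i) x b) (j + i))\<rparr>"

section \<open>Absolute and stable cohomology\<close>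

text \<open>All groups are formed from chosen projective resolutions \<open>F\<close> of \<open>M\<close> and \<open>G\<close> of \<open>N\<close>:
  \<open>ext_bimod R F G\<close> is \<open>Ext\<^sub>R(M,N)\<close> as a bimodule over \<open>ext_ring R G = Ext\<^sub>R(N,N)\<close> and
  \<open>ext_ring R F = Ext\<^sub>R(M,M)\<close>, and similarly for stable cohomology.\<close>

definition ext_mult ::
    "'r ring \<Rightarrow> ('r, 'c) chain_complex \<Rightarrow> ('r, 'e) chain_complex \<Rightarrow> int \<Rightarrow> int \<Rightarrow>
      (int \<Rightarrow> 'd \<Rightarrow> 'e) set \<Rightarrow> (int \<Rightarrow> 'c \<Rightarrow> 'd) set \<Rightarrow> (int \<Rightarrow> 'c \<Rightarrow> 'e) set" where
  "ext_mult R F H m n A B =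
    (\<Union>\<alpha> \<in> A. \<Union>\<beta> \<in> B. coh_class (hom_complex R F H) (m + n) (hom_comp F n \<alpha> \<beta>))"

definition ext_ring :: "'r ring \<Rightarrow> ('r, 'c) chain_complex \<Rightarrow> (int \<Rightarrow> 'c \<Rightarrow> 'c) set gring" where
  "ext_ring R F =
    \<lparr>gr_comp = cohomology (hom_complex R F F),
     gr_mult = ext_mult R F F,
     gr_one = coh_class (hom_complex R F F) 0 (hom_ident F)\<rparr>"

definition ext_bimod ::
    "'r ring \<Rightarrow> ('r, 'c) chain_complex \<Rightarrow> ('r, 'd) chain_complex \<Rightarrow>
      ((int \<Rightarrow> 'd \<Rightarrow> 'd) set, (int \<Rightarrow> 'c \<Rightarrow> 'c) set, (int \<Rightarrow> 'c \<Rightarrow> 'd) set) gbimod" where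
  "ext_bimod R F G =
    \<lparr>bm_comp = cohomology (hom_complex R F G),
     bm_left = ext_mult R F G,
     bm_right = ext_mult R F G\<rparr>"

definition stable_comp ::
    "'r ring \<Rightarrow> ('r, 'c) chain_complex \<Rightarrow> ('r, 'e) chain_complex \<Rightarrow> int \<Rightarrow> int \<Rightarrow>
      (int \<Rightarrow> 'd \<Rightarrow> 'e) set \<Rightarrow> (int \<Rightarrow> 'c \<Rightarrow> 'd) set \<Rightarrow> (int \<Rightarrow> 'c \<Rightarrow> 'e) set" where
  "stable_comp R F H m n A B =
    (\<Union>\<alpha> \<in> A. \<Union>\<beta> \<in> B. stable_class R F H (m + n) (hom_comp F n \<alpha> \<beta>))"

definition stable_ext_mult ::
    "'r ring \<Rightarrow> ('r, 'c) chain_complex \<Rightarrow> ('r, 'e) chain_complex \<Rightarrow> int \<Rightarrow> int \<Rightarrow>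
      (int \<Rightarrow> 'd \<Rightarrow> 'e) set set \<Rightarrow> (int \<Rightarrow> 'c \<Rightarrow> 'd) set set \<Rightarrow> (int \<Rightarrow> 'c \<Rightarrow> 'e) set set" where
  "stable_ext_mult R F H m n A B =
    (\<Union>a \<in> A. \<Union>b \<in> B. coh_class (stable_hom_complex R F H) (m + n) (stable_comp R F H m n a b))"

definition stable_ext_ring ::
    "'r ring \<Rightarrow> ('r, 'c) chain_complex \<Rightarrow> (int \<Rightarrow> 'c \<Rightarrow> 'c) set set gring" where
  "stable_ext_ring R F =
    \<lparr>gr_comp = cohomology (stable_hom_complex R F F),
     gr_mult = stable_ext_mult R F F,
     gr_one = coh_class (stable_hom_complex R F F) 0 (stable_class R F F 0 (hom_ident F))\<rparr>"

definition stable_ext_bimod ::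
    "'r ring \<Rightarrow> ('r, 'c) chain_complex \<Rightarrow> ('r, 'd) chain_complex \<Rightarrow>
      ((int \<Rightarrow> 'd \<Rightarrow> 'd) set set, (int \<Rightarrow> 'c \<Rightarrow> 'c) set set, (int \<Rightarrow> 'c \<Rightarrow> 'd) set set) gbimod" where
  "stable_ext_bimod R F G =
    \<lparr>bm_comp = cohomology (stable_hom_complex R F G),
     bm_left = stable_ext_mult R F G,
     bm_right = stable_ext_mult R F G\<rparr>"

definition iota ::
    "'r ring \<Rightarrow> ('r, 'c) chain_complex \<Rightarrow> ('r, 'd) chain_complex \<Rightarrow> int \<Rightarrow>
      (int \<Rightarrow> 'c \<Rightarrow> 'd) set \<Rightarrow> (int \<Rightarrow> 'c \<Rightarrow> 'd) set set" where
  "iota R F G n A = (\<Union>\<alpha> \<in> A. coh_class (stable_hom_complex R F G) n (stable_class R F G n \<alpha>))"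

section \<open>Liftable resolutions and the class of degree two\<close>

definition quot_ring :: "'q ring \<Rightarrow> 'q \<Rightarrow> 'q set ring" where
  "quot_ring Q f = Q Quot (Idl\<^bsub>Q\<^esub> {f})"

definition quot_proj :: "'q ring \<Rightarrow> 'q \<Rightarrow> 'q \<Rightarrow> 'q set" where
  "quot_proj Q f q = (Idl\<^bsub>Q\<^esub> {f}) +>\<^bsub>Q\<^esub> q"

text \<open>\<open>\<phi>\<close> is the identification of \<open>R \<otimes>\<^sub>Q Ft\<close> with \<open>F\<close>, as graded modules, and \<open>dt\<close> is the chosen
  lift of the differential of \<open>F\<close> to \<open>Ft\<close>.\<close>

locale liftable_resolution =
  fixes Q :: "'q ring" and f :: 'q
    and M :: "('q set, 'm) module"
    and F :: "('q set, 'c) chain_complex" and \<epsilon> :: "'c \<Rightarrow> 'm"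
    and Ft :: "int \<Rightarrow> ('q, 'l) module"
    and \<phi> :: "int \<Rightarrow> (('q set \<times> 'l) \<Rightarrow>\<^sub>0 int) set \<Rightarrow> 'c"
    and dt :: "int \<Rightarrow> 'l \<Rightarrow> 'l"
  assumes resolution: "projective_resolution (quot_ring Q f) M F \<epsilon>"
    and lift_projective: "projective_module Q (Ft i)"
    and ident_lin:
      "\<phi> i \<in> lin_hom (quot_ring Q f) (ext_scalars Q (quot_ring Q f) (quot_proj Q f) (Ft i)) (obj F i)"
    and ident_bij:
      "bij_betw (\<phi> i) (carrier (ext_scalars Q (quot_ring Q f) (quot_proj Q f) (Ft i))) (carrier (obj F i))"
    and lift_lin: "dt i \<in> lin_hom Q (Ft i) (Ft (i - 1))"
    and lift_bd:
      "z \<in> carrier (ext_scalars Q (quot_ring Q f) (quot_proj Q f) (Ft i)) \<Longrightarrow>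
        bd F i (\<phi> i z) =
        \<phi> (i - 1) (ext_scalars_map Q (quot_ring Q f) (quot_proj Q f) (Ft (i - 1)) (dt i) z)"

text \<open>The unique map of degree \<open>-2\<close> on \<open>Ft\<close> whose product with \<open>f\<close> is the square of \<open>dt\<close>.\<close>

definition theta_lift ::
    "'q \<Rightarrow> (int \<Rightarrow> ('q, 'l) module) \<Rightarrow> (int \<Rightarrow> 'l \<Rightarrow> 'l) \<Rightarrow> int \<Rightarrow> 'l \<Rightarrow> 'l" where
  "theta_lift f Ft dt i = (\<lambda>x \<in> carrier (Ft i).
    THE y. y \<in> carrier (Ft (i - 2)) \<and> dt (i - 1) (dt i x) = f \<odot>\<^bsub>Ft (i - 2)\<^esub> y)"

definition theta ::
    "'q ring \<Rightarrow> 'q \<Rightarrow> ('q set, 'c) chain_complex \<Rightarrow> (int \<Rightarrow> ('q, 'l) module) \<Rightarrow>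
      (int \<Rightarrow> (('q set \<times> 'l) \<Rightarrow>\<^sub>0 int) set \<Rightarrow> 'c) \<Rightarrow> (int \<Rightarrow> 'l \<Rightarrow> 'l) \<Rightarrow> int \<Rightarrow> 'c \<Rightarrow> 'c" where
  "theta Q f F Ft \<phi> dt i = (\<lambda>x \<in> carrier (obj F i).
    \<phi> (i - 2) (ext_scalars_map Q (quot_ring Q f) (quot_proj Q f) (Ft (i - 2)) (theta_lift f Ft dt i)
      (inv_into (carrier (ext_scalars Q (quot_ring Q f) (quot_proj Q f) (Ft i))) (\<phi> i) x)))"

definition vartheta ::
    "'q ring \<Rightarrow> 'q \<Rightarrow> ('q set, 'c) chain_complex \<Rightarrow> (int \<Rightarrow> ('q, 'l) module) \<Rightarrow>
      (int \<Rightarrow> (('q set \<times> 'l) \<Rightarrow>\<^sub>0 int) set \<Rightarrow> 'c) \<Rightarrow> (int \<Rightarrow> 'l \<Rightarrow> 'l) \<Rightarrow> (int \<Rightarrow> 'c \<Rightarrow> 'c) set" where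
  "vartheta Q f F Ft \<phi> dt =
    coh_class (hom_complex (quot_ring Q f) F F) 2 (theta Q f F Ft \<phi> dt)"

end

theory Submission
  imports Defs
begin

text \<open>Since \<open>G\<close> vanishes in negative degrees, composing a bounded cochain with a high power of
  \<open>\<theta>\<^sup>G\<close> gives zero. Hence every cocycle that becomes a coboundary modulo bounded cochains, and the
  obstruction to lifting a stable cocycle to an actual one, are killed by a power of \<open>\<vartheta>\<close>: kernel and
  cokernel of \<open>\<iota>\<close> are \<open>\<vartheta>\<close>-torsion, so \<open>\<iota>\<close> becomes bijective after inverting \<open>\<vartheta>\<close>.

  Both classes act in the same way: lift a cocycle \<open>\<beta>\<close> to a map of the \<open>Q\<close>-modules; its failure to
  commute with the lifted differentials is \<open>f\<sigma>\<close> for some \<open>\<sigma>\<close>, and cancelling \<open>f\<close> from the commutator of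
  \<open>\<beta>\<close> with the squares of the lifted differentials shows that \<open>\<sigma>\<close> is a homotopy from \<open>\<theta>\<beta>\<close> to \<open>\<beta>\<theta>\<close>.

  If \<open>M\<close> has finite projective dimension over \<open>Q\<close>, the differential \<open>(x, y) \<mapsto> (dx - fy, \<theta>x - dy)\<close> on
  the cone of \<open>f\<close> on the lifted complex makes it a \<open>Q\<close>-projective resolution of \<open>M\<close>, which is
  contractible in high degrees. Modulo \<open>f\<close>, the off-diagonal component of a contraction is a stable
  inverse of \<open>\<theta>\<close> of degree \<open>-2\<close>, so the stable class \<open>\<vartheta>\<close> is already a unit.\<close>

section \<open>Localization of graded rings and bimodules\<close>

text \<open>The two classes induce the same operator on \<open>Ext\<close>, so torsion of kernel and
  cokernel of \<iota> is shown for left multiplication by powers of the class of \<open>N\<close>,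
  whichever of the two is inverted. A stable cocycle satisfies the cocycle condition in high degrees
  only. The homotopy \<sigma> is therefore built degree by degree: its identity in degree i depends
  on the condition in degrees i and i - 1, and one construction serves absolute and stable classes
  alike. Since f acts injectively on projective Q-modules, the cone of f on a lift of F is a model
  of F over Q. The lifted differential d squares to f\<theta> instead of 0; the entry \<theta> of
  the cone repairs this because \<theta> commutes with d. A contraction raises degrees by one and
  the second summand of the cone is shifted by one, so the off-diagonal entry raises degrees by two,
  as an inverse of \<theta> must. One column of the contraction yields the left inverse, the other
  the right inverse. For a pair (M, N) the inverse of one of the two classes is enough, again by
  commutation.\<close>

locale loc_system =
  fixes X :: "int \<Rightarrow> 'x monoid" and act :: "nat \<Rightarrow> int \<Rightarrow> 'x \<Rightarrow> 'x"
  assumes comp_comm_group: "comm_group (X n)"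
    and act_hom: "act k n \<in> hom (X n) (X (n + 2 * int k))"
    and act_0: "x \<in> carrier (X n) \<Longrightarrow> act 0 n x = x"
    and act_act_add: "x \<in> carrier (X n) \<Longrightarrow> act k (n + 2 * int l) (act l n x) = act (k + l) n x"
begin

sublocale comp: comm_group "X n" for n by (rule comp_comm_group)

abbreviation frac :: "int \<Rightarrow> 'x \<Rightarrow> nat \<Rightarrow> ('x \<times> nat) set" where
  "frac \<equiv> loc_frac X act"

text \<open>Here and in many later facts the degree of the result is a separate variable tied by an
  equation, because the same degree arises as n + 2 * int (i + j), as a sum of two degrees, or as an
  iterated difference.\<close>

lemma act_closed: "x \<in> carrier (X n) \<Longrightarrow> m = n + 2 * int k \<Longrightarrow> act k n x \<in> carrier (X m)"
  using act_hom[of k n] by (auto simp: hom_def)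

lemma act_mult:
  "x \<in> carrier (X n) \<Longrightarrow> y \<in> carrier (X n) \<Longrightarrow> m = n + 2 * int k \<Longrightarrow>
    act k n (x \<otimes>\<^bsub>X n\<^esub> y) = act k n x \<otimes>\<^bsub>X m\<^esub> act k n y"
  using act_hom[of k n] by (auto simp: hom_def)

lemma act_act: "x \<in> carrier (X n) \<Longrightarrow> m = n + 2 * int l \<Longrightarrow> act k m (act l n x) = act (k + l) n x"
  using act_act_add by simp

lemma act_one: "m = n + 2 * int k \<Longrightarrow> act k n \<one>\<^bsub>X n\<^esub> = \<one>\<^bsub>X m\<^esub>"
  using hom_one[OF act_hom[of k n]] by simp

lemma act_inv: "x \<in> carrier (X n) \<Longrightarrow> m = n + 2 * int k \<Longrightarrow> act k n (inv\<^bsub>X n\<^esub> x) = inv\<^bsub>X m\<^esub> (act k n x)"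
  by (metis act_hom comp.group_axioms group_hom.hom_inv group_hom.intro group_hom_axioms.intro)

lemma mem_frac:
  "(y, j) \<in> frac n x i \<longleftrightarrow> y \<in> carrier (X (n + 2 * int j)) \<and>
     (\<exists>k. act (k + j) (n + 2 * int i) x = act (k + i) (n + 2 * int j) y)"
  by (simp add: loc_frac_def)

text \<open>The middle denominator j occurs in both relations and cannot be cancelled, so it joins k
  and k' in the exponent of the combined relation.\<close>

lemma frac_trans:
  assumes x: "x \<in> carrier (X (n + 2 * int i))" and y: "y \<in> carrier (X (n + 2 * int j))"
    and z: "z \<in> carrier (X (n + 2 * int l))"
    and xy: "act (k + j) (n + 2 * int i) x = act (k + i) (n + 2 * int j) y"
    and yz: "act (k' + l) (n + 2 * int j) y = act (k' + j) (n + 2 * int l) z"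
  shows "\<exists>k. act (k + l) (n + 2 * int i) x = act (k + i) (n + 2 * int l) z"
proof (intro exI)
  have "act (k + k' + j + l) (n + 2 * int i) x = act (k' + l) (n + 2 * int i + 2 * int (k + j)) (act (k + j) (n + 2 * int i) x)"
    using x by (subst act_act) (auto simp: algebra_simps)
  also have "\<dots> = act (k + i) (n + 2 * int j + 2 * int (k' + l)) (act (k' + l) (n + 2 * int j) y)"
    unfolding xy using y by (subst (1 2) act_act) (auto simp: algebra_simps)
  also have "\<dots> = act (k + k' + j + i) (n + 2 * int l) z"
    unfolding yz using z by (subst act_act) (auto simp: algebra_simps)
  finally show "act (k + k' + j + l) (n + 2 * int i) x = act (k + k' + j + i) (n + 2 * int l) z" .
qed

text \<open>A fraction is the set of all pairs equivalent to the given one. Equality of two such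
  sets reduces to the relation itself because the relation is reflexive, symmetric and, by
  \<open>frac_trans\<close>, transitive.\<close>

lemma frac_eq_iff:
  assumes x: "x \<in> carrier (X (n + 2 * int i))" and y: "y \<in> carrier (X (n + 2 * int j))"
  shows "frac n x i = frac n y j \<longleftrightarrow> (\<exists>k. act (k + j) (n + 2 * int i) x = act (k + i) (n + 2 * int j) y)"
proof
  assume "frac n x i = frac n y j"
  moreover have "(y, j) \<in> frac n y j" using y by (auto simp: mem_frac)
  ultimately show "\<exists>k. act (k + j) (n + 2 * int i) x = act (k + i) (n + 2 * int j) y"
    by (metis mem_frac)
next
  assume "\<exists>k. act (k + j) (n + 2 * int i) x = act (k + i) (n + 2 * int j) y"
  then obtain k where k: "act (k + j) (n + 2 * int i) x = act (k + i) (n + 2 * int j) y" by blast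
  have "(z, l) \<in> frac n x i \<longleftrightarrow> (z, l) \<in> frac n y j" for z l
    unfolding mem_frac using frac_trans[OF x y _ k] frac_trans[OF y x _ k[symmetric]] by blast
  then show "frac n x i = frac n y j" by auto
qed

lemma frac_eqE:
  assumes "(y, j) \<in> frac n x i" and "x \<in> carrier (X (n + 2 * int i))"
  shows "y \<in> carrier (X (n + 2 * int j))" and "frac n x i = frac n y j"
  using assms frac_eq_iff by (auto simp: mem_frac)

text \<open>Operations on fractions are unions over representatives. A fraction contains the pair it
  was built from, so the union is over a nonempty set and equals c as soon as every representative
  gives c.\<close>

lemma frac_UN:
  assumes x: "x \<in> carrier (X (n + 2 * int i))"
    and g: "\<And>y j. \<lbrakk>y \<in> carrier (X (n + 2 * int j)); frac n x i = frac n y j\<rbrakk> \<Longrightarrow> g y j = c"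
  shows "(\<Union>(y, j) \<in> frac n x i. g y j) = c"
proof -
  have "(x, i) \<in> frac n x i" using x by (auto simp: mem_frac)
  moreover have "g y j = c" if "(y, j) \<in> frac n x i" for y j
    using frac_eqE[OF that x] g by simp
  ultimately show ?thesis by fastforce
qed

lemma frac_expand:
  assumes "x \<in> carrier (X (n + 2 * int i))" "m = n + 2 * int i"
  shows "frac n (act l m x) (i + l) = frac n x i"
  by (subst frac_eq_iff, use assms in \<open>auto intro!: act_closed simp: algebra_simps\<close>)
     (use assms in \<open>auto intro!: exI[of _ 0] simp: act_act algebra_simps\<close>)

text \<open>Over equal denominators the factor t^i on both sides can be absorbed into the free
  exponent.\<close>

lemma frac_eq_same_iff:
  assumes x: "x \<in> carrier (X (n + 2 * int i))" and y: "y \<in> carrier (X (n + 2 * int i))"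
  shows "frac n x i = frac n y i \<longleftrightarrow> (\<exists>k. act k (n + 2 * int i) x = act k (n + 2 * int i) y)"
  unfolding frac_eq_iff[OF x y]
proof
  assume "\<exists>k. act k (n + 2 * int i) x = act k (n + 2 * int i) y"
  then obtain k where "act k (n + 2 * int i) x = act k (n + 2 * int i) y" by blast
  then have "act (i + k) (n + 2 * int i) x = act (i + k) (n + 2 * int i) y"
    using act_act[OF x refl, of i k] act_act[OF y refl, of i k] by simp
  then show "\<exists>k. act (k + i) (n + 2 * int i) x = act (k + i) (n + 2 * int i) y"
    by (metis add.commute)
qed blast

lemma loc_carrier: "carrier (loc_comp X act n) = {frac n x i | x i. x \<in> carrier (X (n + 2 * int i))}"
  by (simp add: loc_comp_def)

lemma frac_closed: "x \<in> carrier (X (n + 2 * int i)) \<Longrightarrow> frac n x i \<in> carrier (loc_comp X act n)"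
  by (auto simp: loc_carrier)

text \<open>Addition of fractions does not depend on representatives: each of the two relations
  between representatives is multiplied by powers of t coming from the other one, after which the
  summands agree one by one.\<close>

lemma loc_mult_frac:
  assumes x: "x \<in> carrier (X (n + 2 * int i))" and y: "y \<in> carrier (X (n + 2 * int j))"
  shows "frac n x i \<otimes>\<^bsub>loc_comp X act n\<^esub> frac n y j =
    frac n (act j (n + 2 * int i) x \<otimes>\<^bsub>X (n + 2 * int (i + j))\<^esub> act i (n + 2 * int j) y) (i + j)"
  (is "_ = ?f x i y j")
proof -
  have "?f x' i' y' j' = ?f x i y j"
    if x': "x' \<in> carrier (X (n + 2 * int i'))" and xx: "frac n x i = frac n x' i'"
      and y': "y' \<in> carrier (X (n + 2 * int j'))" and yy: "frac n y j = frac n y' j'" for x' i' y' j'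
  proof -
    obtain k where k: "act (k + i) (n + 2 * int i') x' = act (k + i') (n + 2 * int i) x"
      using xx frac_eq_iff[OF x x'] by metis
    obtain l where l: "act (l + j) (n + 2 * int j') y' = act (l + j') (n + 2 * int j) y"
      using yy frac_eq_iff[OF y y'] by metis
    \<comment> \<open>The relation for x is multiplied by t^(l + j + j'): j and j' come from
      crossing the denominators, l from the relation for y.\<close>
    have 1: "act (k + l + i + j + j') (n + 2 * int i') x' = act (k + l + i' + j' + j) (n + 2 * int i) x"
      using act_act[OF x' refl, of "l + j + j'" "k + i"] act_act[OF x refl, of "l + j + j'" "k + i'"] k
      by (simp add: algebra_simps)
    have 2: "act (k + l + i + j + i') (n + 2 * int j') y' = act (k + l + i' + j' + i) (n + 2 * int j) y"
      using act_act[OF y' refl, of "k + i + i'" "l + j"] act_act[OF y refl, of "k + i + i'" "l + j'"] l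
      by (simp add: algebra_simps)
    have 3: "act (k + l + (i + j)) (n + 2 * int (i' + j'))
        (act j' (n + 2 * int i') x' \<otimes>\<^bsub>X (n + 2 * int (i' + j'))\<^esub> act i' (n + 2 * int j') y') =
       act (k + l + (i' + j')) (n + 2 * int (i + j))
        (act j (n + 2 * int i) x \<otimes>\<^bsub>X (n + 2 * int (i + j))\<^esub> act i (n + 2 * int j) y)"
      using 1 2 x y x' y'
      by (subst (1 2) act_mult[where m = "n + 2 * int (k + l + i + j + i' + j')"])
        (auto intro!: act_closed simp: act_act algebra_simps)
    show ?thesis
      by (subst frac_eq_iff) (use 3 x y x' y' in \<open>auto intro!: act_closed comp.m_closed simp: algebra_simps\<close>)
  qed
  then show ?thesis
    unfolding loc_comp_def monoid.simps by (intro frac_UN x y)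
qed

text \<open>The group axioms are checked after passing to one denominator, where addition acts on
  numerators. The factor t^i produced by the general formula cancels against the doubled
  denominator.\<close>

lemma loc_mult_same:
  assumes x: "x \<in> carrier (X m)" and y: "y \<in> carrier (X m)" and m: "m = n + 2 * int i"
  shows "frac n x i \<otimes>\<^bsub>loc_comp X act n\<^esub> frac n y i = frac n (x \<otimes>\<^bsub>X m\<^esub> y) i"
proof -
  have "act i m x \<otimes>\<^bsub>X (n + 2 * int (i + i))\<^esub> act i m y = act i m (x \<otimes>\<^bsub>X m\<^esub> y)"
    using x y m by (subst act_mult[where m = "n + 2 * int (i + i)"]) (auto simp: algebra_simps)
  then show ?thesis using x y m
    by (simp add: loc_mult_frac frac_expand)
qed

lemma loc_one: "\<one>\<^bsub>loc_comp X act n\<^esub> = frac n \<one>\<^bsub>X (n + 2 * int i)\<^esub> i"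
  using frac_expand[of "\<one>\<^bsub>X n\<^esub>" n 0 n i] act_one[OF refl, of i n] by (simp add: loc_comp_def)

lemma loc_elem:
  assumes "U \<in> carrier (loc_comp X act n)"
  obtains x i where "x \<in> carrier (X (n + 2 * int i))" "U = frac n x i"
  using assms by (auto simp: loc_carrier)

lemma loc_common2:
  assumes "U \<in> carrier (loc_comp X act n)" "W \<in> carrier (loc_comp X act n)"
  obtains x y i where "x \<in> carrier (X (n + 2 * int i))" "y \<in> carrier (X (n + 2 * int i))"
    "U = frac n x i" "W = frac n y i"
proof -
  obtain x i where x: "x \<in> carrier (X (n + 2 * int i))" "U = frac n x i" using assms loc_elem by blast
  obtain y j where y: "y \<in> carrier (X (n + 2 * int j))" "W = frac n y j" using assms loc_elem by blast
  show thesis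
    using that[of "act j (n + 2 * int i) x" "i + j" "act i (n + 2 * int j) y"]
      x y frac_expand[OF x(1) refl, of j] frac_expand[OF y(1) refl, of i]
    by (simp add: act_closed add.commute algebra_simps)
qed

lemma loc_common3:
  assumes "U \<in> carrier (loc_comp X act n)" "W \<in> carrier (loc_comp X act n)" "V \<in> carrier (loc_comp X act n)"
  obtains x y z i where "x \<in> carrier (X (n + 2 * int i))" "y \<in> carrier (X (n + 2 * int i))"
    "z \<in> carrier (X (n + 2 * int i))" "U = frac n x i" "W = frac n y i" "V = frac n z i"
proof -
  obtain x y i where x: "x \<in> carrier (X (n + 2 * int i))" "U = frac n x i"
    and y: "y \<in> carrier (X (n + 2 * int i))" "W = frac n y i" using assms loc_common2 by metis
  obtain z j where z: "z \<in> carrier (X (n + 2 * int j))" "V = frac n z j" using assms loc_elem by blast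
  show thesis
    using that[of "act j (n + 2 * int i) x" "i + j" "act j (n + 2 * int i) y" "act i (n + 2 * int j) z"]
      x y z frac_expand[OF x(1) refl, of j] frac_expand[OF y(1) refl, of j] frac_expand[OF z(1) refl, of i]
    by (simp add: act_closed add.commute algebra_simps)
qed

lemma frac_hom: "m = n + 2 * int i \<Longrightarrow> (\<lambda>x. frac n x i) \<in> hom (X m) (loc_comp X act n)"
  by (rule homI) (auto simp: frac_closed loc_mult_same)

lemma loc_map_hom: "loc_map X act n \<in> hom (X n) (loc_comp X act n)"
  using frac_hom[of n n 0] by (simp add: loc_map_def[abs_def])

lemma loc_comm_group: "comm_group (loc_comp X act n)"
proof (rule comm_groupI)
  fix U W V
  assume U: "U \<in> carrier (loc_comp X act n)" and W: "W \<in> carrier (loc_comp X act n)"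
  then obtain x y i where x: "x \<in> carrier (X (n + 2 * int i))" "U = frac n x i"
    and y: "y \<in> carrier (X (n + 2 * int i))" "W = frac n y i" using loc_common2 by metis
  then show "U \<otimes>\<^bsub>loc_comp X act n\<^esub> W \<in> carrier (loc_comp X act n)"
    and "U \<otimes>\<^bsub>loc_comp X act n\<^esub> W = W \<otimes>\<^bsub>loc_comp X act n\<^esub> U"
    by (auto simp: loc_mult_same frac_closed comp.m_comm)
  show "\<one>\<^bsub>loc_comp X act n\<^esub> \<otimes>\<^bsub>loc_comp X act n\<^esub> U = U"
    using x by (simp add: loc_one[of _ i] loc_mult_same[where m = "n + 2 * int i"])
  show "\<exists>y\<in>carrier (loc_comp X act n). y \<otimes>\<^bsub>loc_comp X act n\<^esub> U = \<one>\<^bsub>loc_comp X act n\<^esub>"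
    using x by (intro bexI[of _ "frac n (inv\<^bsub>X (n + 2 * int i)\<^esub> x) i"])
      (auto simp: loc_one[of _ i] loc_mult_same[where m = "n + 2 * int i"] frac_closed)
  assume "V \<in> carrier (loc_comp X act n)"
  with U W obtain x y z i where "x \<in> carrier (X (n + 2 * int i))" "y \<in> carrier (X (n + 2 * int i))"
    "z \<in> carrier (X (n + 2 * int i))" "U = frac n x i" "W = frac n y i" "V = frac n z i"
    using loc_common3 by metis
  then show "U \<otimes>\<^bsub>loc_comp X act n\<^esub> W \<otimes>\<^bsub>loc_comp X act n\<^esub> V = U \<otimes>\<^bsub>loc_comp X act n\<^esub> (W \<otimes>\<^bsub>loc_comp X act n\<^esub> V)"
    by (simp add: loc_mult_same[where m = "n + 2 * int i"] comp.m_assoc)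
qed (auto simp: loc_one[of _ 0] frac_closed)

text \<open>If t acts bijectively, so do its powers. Equality of x/1 and y/1 means equality after
  multiplication by some power of t, hence equality; and the numerator of x/t^i is divisible by
  t^i.\<close>

lemma loc_map_bij:
  assumes bij: "\<And>n. bij_betw (act 1 n) (carrier (X n)) (carrier (X (n + 2)))"
  shows "bij_betw (loc_map X act n) (carrier (X n)) (carrier (loc_comp X act n))"
proof -
  have bijk: "bij_betw (act k n) (carrier (X n)) (carrier (X (n + 2 * int k)))" for k n
  proof (induction k)
    case 0
    have "bij_betw (\<lambda>x. x) (carrier (X n)) (carrier (X n))" by (simp add: bij_betw_def)
    then show ?case using bij_betw_cong[of "carrier (X n)" "act 0 n" "\<lambda>x. x"] act_0[of _ n] by simp
  next
    case (Suc k)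
    have "bij_betw (act 1 (n + 2 * int k) \<circ> act k n) (carrier (X n)) (carrier (X (n + 2 * int (Suc k))))"
      using bij_betw_trans[OF Suc bij[of "n + 2 * int k"]] by (simp add: algebra_simps)
    moreover have "(act 1 (n + 2 * int k) \<circ> act k n) x = act (Suc k) n x" if "x \<in> carrier (X n)" for x
      using act_act_add[OF that, of 1 k] by simp
    ultimately show ?case by (simp cong: bij_betw_cong)
  qed
  have "inj_on (loc_map X act n) (carrier (X n))"
  proof (rule inj_onI)
    fix x y assume xy: "x \<in> carrier (X n)" "y \<in> carrier (X n)" "loc_map X act n x = loc_map X act n y"
    then obtain k where "act k n x = act k n y"
      using frac_eq_same_iff[of x n 0 y] by (auto simp: loc_map_def)
    then show "x = y" using xy bijk[of k n] by (auto simp: bij_betw_def inj_on_def)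
  qed
  moreover have "U \<in> loc_map X act n ` carrier (X n)" if U: "U \<in> carrier (loc_comp X act n)" for U
  proof -
    obtain x i where x: "x \<in> carrier (X (n + 2 * int i))" "U = frac n x i" using U loc_elem by blast
    then obtain y where y: "y \<in> carrier (X n)" "x = act i n y"
      using bijk[of i n] by (auto simp: bij_betw_def)
    then have "U = loc_map X act n y"
      using frac_expand[of y n 0 n i] x by (simp add: loc_map_def)
    then show ?thesis using y by blast
  qed
  ultimately show ?thesis using loc_map_hom[of n] by (auto simp: bij_betw_def hom_def)
qed

end

section \<open>Pairings of localized graded groups\<close>

definition loc_pair ::
    "(int \<Rightarrow> 'c monoid) \<Rightarrow> (nat \<Rightarrow> int \<Rightarrow> 'c \<Rightarrow> 'c) \<Rightarrow> (int \<Rightarrow> int \<Rightarrow> 'a \<Rightarrow> 'b \<Rightarrow> 'c) \<Rightarrow>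
      int \<Rightarrow> int \<Rightarrow> ('a \<times> nat) set \<Rightarrow> ('b \<times> nat) set \<Rightarrow> ('c \<times> nat) set" where
  "loc_pair C c p m n U W = (\<Union>(x, i) \<in> U. \<Union>(y, j) \<in> W.
     loc_frac C c (m + n) (p (m + 2 * int i) (n + 2 * int j) x y) (i + j))"

lemma gr_loc_simps:
  "gr_comp (gr_loc A t) = loc_comp (gr_comp A) (gr_act A t)"
  "gr_mult (gr_loc A t) = loc_pair (gr_comp A) (gr_act A t) (gr_mult A)"
  "gr_one (gr_loc A t) = loc_frac (gr_comp A) (gr_act A t) 0 (gr_one A) 0"
  by (simp_all add: gr_loc_def loc_pair_def[abs_def] loc_map_def)

lemma bm_loc_simps:
  "bm_comp (bm_loc X act) = loc_comp (bm_comp X) act"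
  "bm_left (bm_loc X act) = loc_pair (bm_comp X) act (bm_left X)"
  "bm_right (bm_loc X act) = loc_pair (bm_comp X) act (bm_right X)"
  by (simp_all add: bm_loc_def loc_pair_def[abs_def])

lemma graded_pairingD:
  assumes "graded_pairing A B C p"
  shows "\<lbrakk>x \<in> carrier (A m); y \<in> carrier (B n); k = m + n\<rbrakk> \<Longrightarrow> p m n x y \<in> carrier (C k)"
    and "\<lbrakk>x \<in> carrier (A m); x' \<in> carrier (A m); y \<in> carrier (B n); k = m + n\<rbrakk> \<Longrightarrow>
      p m n (x \<otimes>\<^bsub>A m\<^esub> x') y = p m n x y \<otimes>\<^bsub>C k\<^esub> p m n x' y"
    and "\<lbrakk>x \<in> carrier (A m); y \<in> carrier (B n); y' \<in> carrier (B n); k = m + n\<rbrakk> \<Longrightarrow>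
      p m n x (y \<otimes>\<^bsub>B n\<^esub> y') = p m n x y \<otimes>\<^bsub>C k\<^esub> p m n x y'"
  using assms unfolding graded_pairing_def by blast+

text \<open>One notion covers ring multiplication and both bimodule actions. The two equivariance
  conditions allow a power of t to be pulled out of either argument; for rings this rests on
  centrality, for bimodules on centrality and on the agreement of left and right action.\<close>

locale loc_pairing = A: loc_system A a + B: loc_system B b + C: loc_system C c
  for A :: "int \<Rightarrow> 'a monoid" and a and B :: "int \<Rightarrow> 'b monoid" and b
    and C :: "int \<Rightarrow> 'c monoid" and c +
  fixes p :: "int \<Rightarrow> int \<Rightarrow> 'a \<Rightarrow> 'b \<Rightarrow> 'c"
  assumes pairing: "graded_pairing A B C p"
    and act_left: "\<lbrakk>x \<in> carrier (A m); y \<in> carrier (B n)\<rbrakk> \<Longrightarrow>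
      p (m + 2 * int k) n (a k m x) y = c k (m + n) (p m n x y)"
    and act_right: "\<lbrakk>x \<in> carrier (A m); y \<in> carrier (B n)\<rbrakk> \<Longrightarrow>
      p m (n + 2 * int k) x (b k n y) = c k (m + n) (p m n x y)"
begin

lemmas p_closed = graded_pairingD(1)[OF pairing]
lemmas p_mult_left = graded_pairingD(2)[OF pairing]
lemmas p_mult_right = graded_pairingD(3)[OF pairing]

lemma p_act:
  assumes x: "x \<in> carrier (A m)" and y: "y \<in> carrier (B n)"
    and m': "m' = m + 2 * int k" and n': "n' = n + 2 * int l" and r: "r = m + n"
  shows "p m' n' (a k m x) (b l n y) = c (k + l) r (p m n x y)"
proof -
  have "p m' n' (a k m x) (b l n y) = c l (m' + n) (c k r (p m n x y))"
    unfolding n' using x y by (simp add: act_right A.act_closed m' act_left r)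
  also have "\<dots> = c (k + l) r (p m n x y)"
    by (subst C.act_act) (auto simp: m' r add.commute intro!: p_closed x y)
  finally show ?thesis .
qed

lemma loc_pair_frac:
  assumes x: "x \<in> carrier (A (m + 2 * int i))" and y: "y \<in> carrier (B (n + 2 * int j))" and r: "r = m + n"
  shows "loc_pair C c p m n (A.frac m x i) (B.frac n y j) =
    C.frac r (p (m + 2 * int i) (n + 2 * int j) x y) (i + j)"
  (is "_ = ?f x i y j")
proof -
  have "?f x' i' y' j' = ?f x i y j"
    if x': "x' \<in> carrier (A (m + 2 * int i'))" and xx: "A.frac m x i = A.frac m x' i'"
      and y': "y' \<in> carrier (B (n + 2 * int j'))" and yy: "B.frac n y j = B.frac n y' j'" for x' i' y' j'
  proof -
    obtain k where k: "a (k + i) (m + 2 * int i') x' = a (k + i') (m + 2 * int i) x"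
      using xx A.frac_eq_iff[OF x x'] by metis
    obtain l where l: "b (l + j) (n + 2 * int j') y' = b (l + j') (n + 2 * int j) y"
      using yy B.frac_eq_iff[OF y y'] by metis
    define s where "s = r + 2 * int (i' + j')"
    have s: "s = m + 2 * int i' + (n + 2 * int j')" by (simp add: s_def r)
    define s' where "s' = r + 2 * int (i + j)"
    have s': "s' = m + 2 * int i + (n + 2 * int j)" by (simp add: s'_def r)
    \<comment> \<open>The exponent is split and moved into the two arguments, each argument is
      replaced by its equivalent, and the exponents are moved out again.\<close>
    have "c (k + l + (i + j)) s (p (m + 2 * int i') (n + 2 * int j') x' y') =
        c ((k + i) + (l + j)) s (p (m + 2 * int i') (n + 2 * int j') x' y')"
      by (simp add: algebra_simps)
    also have "\<dots> = p (m + 2 * int (k + i + i')) (n + 2 * int (l + j + j'))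
        (a (k + i) (m + 2 * int i') x') (b (l + j) (n + 2 * int j') y')"
      using x' y' by (subst p_act[where m = "m + 2 * int i'" and n = "n + 2 * int j'" and r = s]) (auto simp: s)
    also have "\<dots> = c ((k + i') + (l + j')) s' (p (m + 2 * int i) (n + 2 * int j) x y)"
      unfolding k l using x y
      by (subst p_act[where m = "m + 2 * int i" and n = "n + 2 * int j" and r = s']) (auto simp: s')
    also have "\<dots> = c (k + l + (i' + j')) s' (p (m + 2 * int i) (n + 2 * int j) x y)"
      by (simp add: algebra_simps)
    finally have "\<exists>k. c (k + (i + j)) s (p (m + 2 * int i') (n + 2 * int j') x' y') =
       c (k + (i' + j')) s' (p (m + 2 * int i) (n + 2 * int j) x y)" by blast
    then show ?thesis unfolding s_def s'_def
      by (subst C.frac_eq_iff) (auto intro!: p_closed x y x' y' simp: r)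
  qed
  then show ?thesis
    unfolding loc_pair_def r by (intro A.frac_UN B.frac_UN x y) (simp add: r)
qed

lemma loc_pair_pairing: "graded_pairing (loc_comp A a) (loc_comp B b) (loc_comp C c) (loc_pair C c p)"
proof -
  have 1: "loc_pair C c p m n U W \<in> carrier (loc_comp C c (m + n))"
    if "U \<in> carrier (loc_comp A a m)" "W \<in> carrier (loc_comp B b n)" for m n U W
    using that by (elim A.loc_elem B.loc_elem)
      (auto simp: loc_pair_frac intro!: C.frac_closed p_closed)
  have 2: "loc_pair C c p m n (U \<otimes>\<^bsub>loc_comp A a m\<^esub> U') W =
      loc_pair C c p m n U W \<otimes>\<^bsub>loc_comp C c (m + n)\<^esub> loc_pair C c p m n U' W"
    if "U \<in> carrier (loc_comp A a m)" "U' \<in> carrier (loc_comp A a m)" "W \<in> carrier (loc_comp B b n)"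
    for m n U U' W
  proof -
    obtain x x' i where "x \<in> carrier (A (m + 2 * int i))" "x' \<in> carrier (A (m + 2 * int i))"
      "U = A.frac m x i" "U' = A.frac m x' i" using \<open>U \<in> _\<close> \<open>U' \<in> _\<close> A.loc_common2 by metis
    moreover obtain y j where "y \<in> carrier (B (n + 2 * int j))" "W = B.frac n y j"
      using \<open>W \<in> _\<close> B.loc_elem by metis
    ultimately show ?thesis
      by (simp add: A.loc_mult_same loc_pair_frac p_closed
          p_mult_left[where k = "m + n + 2 * int (i + j)"]
          C.loc_mult_same[where m = "m + n + 2 * int (i + j)"])
  qed
  have 3: "loc_pair C c p m n U (W \<otimes>\<^bsub>loc_comp B b n\<^esub> W') =
      loc_pair C c p m n U W \<otimes>\<^bsub>loc_comp C c (m + n)\<^esub> loc_pair C c p m n U W'"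
    if "U \<in> carrier (loc_comp A a m)" "W \<in> carrier (loc_comp B b n)" "W' \<in> carrier (loc_comp B b n)" for m n U W' W
  proof -
    obtain x i where "x \<in> carrier (A (m + 2 * int i))" "U = A.frac m x i"
      using \<open>U \<in> _\<close> A.loc_elem by metis
    moreover obtain y y' j where "y \<in> carrier (B (n + 2 * int j))" "y' \<in> carrier (B (n + 2 * int j))"
      "W = B.frac n y j" "W' = B.frac n y' j" using \<open>W \<in> _\<close> \<open>W' \<in> _\<close> B.loc_common2 by metis
    ultimately show ?thesis
      by (simp add: B.loc_mult_same loc_pair_frac p_closed
          p_mult_right[where k = "m + n + 2 * int (i + j)"]
          C.loc_mult_same[where m = "m + n + 2 * int (i + j)"])
  qed
  show ?thesis unfolding graded_pairing_def using 1 2 3 by blast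
qed

lemma loc_map_pair:
  assumes "x \<in> carrier (A m)" "y \<in> carrier (B n)"
  shows "loc_map C c (m + n) (p m n x y) = loc_pair C c p m n (loc_map A a m x) (loc_map B b n y)"
  using assms by (simp add: loc_map_def loc_pair_frac)

end

text \<open>Four pairings between unrelated groups are allowed, so that associativity of a ring, of
  a left action, of a right action, and the compatibility of the two actions are all
  instances.\<close>

lemma loc_pair_assoc:
  assumes AB: "loc_pairing A a B b D d p" and DC: "loc_pairing D d C c E e q"
    and BC: "loc_pairing B b C c F f p'" and AF: "loc_pairing A a F f E e q'"
    and assoc: "\<And>k m n x y z. \<lbrakk>x \<in> carrier (A k); y \<in> carrier (B m); z \<in> carrier (C n)\<rbrakk> \<Longrightarrow>
      q (k + m) n (p k m x y) z = q' k (m + n) x (p' m n y z)"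
    and U: "U \<in> carrier (loc_comp A a k)" and V: "V \<in> carrier (loc_comp B b m)"
    and W: "W \<in> carrier (loc_comp C c n)"
  shows "loc_pair E e q (k + m) n (loc_pair D d p k m U V) W =
    loc_pair E e q' k (m + n) U (loc_pair F f p' m n V W)"
proof -
  interpret AB: loc_pairing A a B b D d p by (rule AB)
  interpret DC: loc_pairing D d C c E e q by (rule DC)
  interpret BC: loc_pairing B b C c F f p' by (rule BC)
  interpret AF: loc_pairing A a F f E e q' by (rule AF)
  obtain x i where x: "x \<in> carrier (A (k + 2 * int i))" "U = AB.A.frac k x i" using U AB.A.loc_elem by blast
  obtain y j where y: "y \<in> carrier (B (m + 2 * int j))" "V = AB.B.frac m y j" using V AB.B.loc_elem by blast
  obtain z l where z: "z \<in> carrier (C (n + 2 * int l))" "W = DC.B.frac n z l" using W DC.B.loc_elem by blast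
  have "p (k + 2 * int i) (m + 2 * int j) x y \<in> carrier (D (k + m + 2 * int (i + j)))"
    "p' (m + 2 * int j) (n + 2 * int l) y z \<in> carrier (F (m + n + 2 * int (j + l)))"
    using x y z by (auto intro!: AB.p_closed BC.p_closed)
  then show ?thesis
    using assoc[OF x(1) y(1) z(1)] x y z
    by (simp add: AB.loc_pair_frac BC.loc_pair_frac DC.loc_pair_frac AF.loc_pair_frac ac_simps)
qed

lemma (in graded_ring) mult_assoc':
  "\<lbrakk>x \<in> gr_elts A k; y \<in> gr_elts A m; z \<in> gr_elts A n; km = k + m; mn = m + n\<rbrakk> \<Longrightarrow>
    gr_mult A km n (gr_mult A k m x y) z = gr_mult A k mn x (gr_mult A m n y z)"
  using mult_assoc by simp

section \<open>Localization of a graded ring at a central element\<close>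

locale central_element = graded_ring A for A :: "'a gring" +
  fixes t :: 'a
  assumes elt: "t \<in> gr_elts A 2"
    and central: "x \<in> gr_elts A n \<Longrightarrow> gr_mult A 2 n t x = gr_mult A n 2 x t"
begin

lemmas mult_closed = graded_pairingD(1)[OF mult_pairing]

lemma pow_closed: "m = 2 * int k \<Longrightarrow> gr_pow A t k \<in> gr_elts A m"
  by (induction k arbitrary: m) (auto intro!: mult_closed one_closed elt)

lemma pow_comm:
  "x \<in> gr_elts A n \<Longrightarrow> m = 2 * int k \<Longrightarrow> gr_mult A m n (gr_pow A t k) x = gr_mult A n m x (gr_pow A t k)"
proof (induction k arbitrary: m)
  case 0
  then show ?case by (simp add: one_left one_right)
next
  case (Suc k)
  let ?m = "2 * int k"
  have p: "gr_pow A t k \<in> gr_elts A ?m" by (simp add: pow_closed)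
  have "gr_mult A m n (gr_pow A t (Suc k)) x = gr_mult A ?m (2 + n) (gr_pow A t k) (gr_mult A 2 n t x)"
    using Suc.prems p elt by (simp add: mult_assoc')
  also have "\<dots> = gr_mult A ?m (n + 2) (gr_pow A t k) (gr_mult A n 2 x t)"
    using Suc.prems central[of x n] by (simp add: add.commute)
  also have "\<dots> = gr_mult A (n + ?m) 2 (gr_mult A n ?m x (gr_pow A t k)) t"
    using Suc.prems p elt Suc.IH[of ?m] mult_assoc[of "gr_pow A t k" ?m x n t 2] by (simp add: add.commute)
  also have "\<dots> = gr_mult A n m x (gr_pow A t (Suc k))"
    using Suc.prems p elt by (simp add: mult_assoc'[where mn = m])
  finally show ?case .
qed

lemma pow_add:
  "gr_mult A (2 * int k) (2 * int l) (gr_pow A t k) (gr_pow A t l) = gr_pow A t (k + l)"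
proof (induction l)
  case 0
  then show ?case by (simp add: one_right pow_closed)
next
  case (Suc l)
  have "gr_pow A t (k + Suc l) = gr_mult A (2 * int (k + l)) 2 (gr_pow A t (k + l)) t" by simp
  also have "\<dots> = gr_mult A (2 * int k) (2 * int l + 2) (gr_pow A t k) (gr_mult A (2 * int l) 2 (gr_pow A t l) t)"
    unfolding Suc[symmetric] by (simp add: mult_assoc' pow_closed elt)
  finally show ?case by (simp add: algebra_simps)
qed

lemma loc_system_act: "loc_system (gr_comp A) (gr_act A t)"
proof (rule loc_system.intro)
  show "comm_group (gr_comp A n)" for n by (rule comp_group)
  show "gr_act A t k n \<in> hom (gr_comp A n) (gr_comp A (n + 2 * int k))" for k n
    unfolding gr_act_def
    by (rule homI) (auto intro!: mult_closed graded_pairingD(3)[OF mult_pairing] pow_closed)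
  show "gr_act A t 0 n x = x" if "x \<in> gr_elts A n" for n x
    using that by (simp add: gr_act_def one_left)
  show "gr_act A t k (n + 2 * int l) (gr_act A t l n x) = gr_act A t (k + l) n x"
    if "x \<in> gr_elts A n" for k l n x
    using that pow_add[of k l, symmetric] by (simp add: gr_act_def mult_assoc'[where mn = "n + 2 * int l"] pow_closed)
qed

sublocale loc: loc_pairing "gr_comp A" "gr_act A t" "gr_comp A" "gr_act A t" "gr_comp A" "gr_act A t" "gr_mult A"
proof (intro loc_pairing.intro loc_pairing_axioms.intro loc_system_act)
  show "graded_pairing (gr_comp A) (gr_comp A) (gr_comp A) (gr_mult A)" by (rule mult_pairing)
  fix x y m n k
  assume x: "x \<in> gr_elts A m" and y: "y \<in> gr_elts A n"
  show "gr_mult A (m + 2 * int k) n (gr_act A t k m x) y = gr_act A t k (m + n) (gr_mult A m n x y)"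
    using x y by (simp add: gr_act_def mult_assoc' pow_closed add.commute)
  \<comment> \<open>The power of t now stands between x and y; centrality moves it in front of
    x.\<close>
  have "gr_mult A m (n + 2 * int k) x (gr_act A t k n y) =
      gr_mult A (m + 2 * int k) n (gr_mult A m (2 * int k) x (gr_pow A t k)) y"
    using x y by (simp add: gr_act_def mult_assoc'[where mn = "n + 2 * int k"] pow_closed)
  also have "\<dots> = gr_mult A (2 * int k + m) n (gr_mult A (2 * int k) m (gr_pow A t k) x) y"
    using pow_comm[OF x refl, of k] by (simp add: add.commute)
  also have "\<dots> = gr_act A t k (m + n) (gr_mult A m n x y)"
    using x y by (simp add: gr_act_def mult_assoc' pow_closed)
  finally show "gr_mult A m (n + 2 * int k) x (gr_act A t k n y) = gr_act A t k (m + n) (gr_mult A m n x y)" .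
qed

lemma gr_loc_graded_ring: "graded_ring (gr_loc A t)"
proof (rule graded_ring.intro, unfold gr_loc_simps)
  show "comm_group (loc_comp (gr_comp A) (gr_act A t) n)" for n by (rule loc.A.loc_comm_group)
  show "graded_pairing (loc_comp (gr_comp A) (gr_act A t)) (loc_comp (gr_comp A) (gr_act A t))
     (loc_comp (gr_comp A) (gr_act A t)) (loc_pair (gr_comp A) (gr_act A t) (gr_mult A))"
    by (rule loc.loc_pair_pairing)
  show "loc.A.frac 0 (gr_one A) 0 \<in> carrier (loc_comp (gr_comp A) (gr_act A t) 0)"
    by (simp add: loc.A.frac_closed one_closed)
  fix U n assume "U \<in> carrier (loc_comp (gr_comp A) (gr_act A t) n)"
  then obtain x i where "x \<in> gr_elts A (n + 2 * int i)" "U = loc.A.frac n x i" using loc.A.loc_elem by blast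
  then show "loc_pair (gr_comp A) (gr_act A t) (gr_mult A) 0 n (loc.A.frac 0 (gr_one A) 0) U = U"
    "loc_pair (gr_comp A) (gr_act A t) (gr_mult A) n 0 U (loc.A.frac 0 (gr_one A) 0) = U"
    by (simp_all add: loc.loc_pair_frac one_closed one_left one_right)
qed (intro loc_pair_assoc[OF loc.loc_pairing_axioms loc.loc_pairing_axioms loc.loc_pairing_axioms
      loc.loc_pairing_axioms mult_assoc])

lemma gr_loc_hom: "graded_ring_hom A (gr_loc A t) (loc_map (gr_comp A) (gr_act A t))"
  unfolding graded_ring_hom_def gr_loc_simps
  using loc.A.loc_map_hom loc.loc_map_pair by (auto simp: loc_map_def)

end

section \<open>Localization of a graded bimodule from either side\<close>

locale central_bimodule = graded_bimodule S T X + S: central_element S s + T: central_element T t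
  for S :: "'s gring" and T :: "'t gring" and X :: "('s, 't, 'x) gbimod" and s t +
  assumes balanced: "x \<in> bm_elts X n \<Longrightarrow> bm_left X 2 n s x = bm_right X n 2 x t"
begin

lemmas left_closed = graded_pairingD(1)[OF left_pairing]
lemmas right_closed = graded_pairingD(1)[OF right_pairing]

lemma left_assoc':
  "\<lbrakk>a \<in> gr_elts S k; b \<in> gr_elts S m; x \<in> bm_elts X n; km = k + m; mn = m + n\<rbrakk> \<Longrightarrow>
    bm_left X km n (gr_mult S k m a b) x = bm_left X k mn a (bm_left X m n b x)"
  using left_assoc by simp

lemma right_assoc':
  "\<lbrakk>x \<in> bm_elts X k; c \<in> gr_elts T m; d \<in> gr_elts T n; km = k + m; mn = m + n\<rbrakk> \<Longrightarrow>
    bm_right X km n (bm_right X k m x c) d = bm_right X k mn x (gr_mult T m n c d)"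
  using right_assoc by simp

lemma left_right':
  "\<lbrakk>a \<in> gr_elts S k; x \<in> bm_elts X m; c \<in> gr_elts T n; km = k + m; mn = m + n\<rbrakk> \<Longrightarrow>
    bm_right X km n (bm_left X k m a x) c = bm_left X k mn a (bm_right X m n x c)"
  using left_right by simp

lemma balanced_pow:
  "x \<in> bm_elts X n \<Longrightarrow> m = 2 * int k \<Longrightarrow> bm_left X m n (gr_pow S s k) x = bm_right X n m x (gr_pow T t k)"
proof (induction k arbitrary: m)
  case 0
  then show ?case by (simp add: left_one right_one)
next
  case (Suc k)
  let ?m = "2 * int k"
  have p: "gr_pow S s k \<in> gr_elts S ?m" "gr_pow T t k \<in> gr_elts T ?m"
    by (simp_all add: S.pow_closed T.pow_closed)
  have "bm_left X m n (gr_pow S s (Suc k)) x = bm_left X ?m (2 + n) (gr_pow S s k) (bm_left X 2 n s x)"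
    using Suc.prems p S.elt by (simp add: left_assoc')
  also have "\<dots> = bm_left X ?m (n + 2) (gr_pow S s k) (bm_right X n 2 x t)"
    using Suc.prems balanced[of x n] by (simp add: add.commute)
  also have "\<dots> = bm_right X (n + ?m) 2 (bm_right X n ?m x (gr_pow T t k)) t"
    using Suc.prems p T.elt Suc.IH[of ?m] left_right[of "gr_pow S s k" ?m x n t 2] by (simp add: add.commute)
  also have "\<dots> = bm_right X n m x (gr_pow T t (Suc k))"
    using Suc.prems p T.elt by (simp add: right_assoc'[where mn = m])
  finally show ?case .
qed

abbreviation act :: "loc_side \<Rightarrow> nat \<Rightarrow> int \<Rightarrow> 'x \<Rightarrow> 'x" where
  "act side \<equiv> bm_act side S s T t X"

text \<open>This removes the distinction between the two values of \<open>side\<close>: both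
  localizations are taken with respect to the same operators, expressed through the left
  action.\<close>

lemma act_eq: "x \<in> bm_elts X n \<Longrightarrow> act side k n x = bm_left X (2 * int k) n (gr_pow S s k) x"
  by (cases side) (simp_all add: balanced_pow)

lemma loc_system_act: "loc_system (bm_comp X) (act side)"
proof (rule loc_system.intro)
  show "comm_group (bm_comp X n)" for n by (rule bm_comp_group)
  show "act side k n \<in> hom (bm_comp X n) (bm_comp X (n + 2 * int k))" for k n
  proof (rule homI)
    fix x y assume x: "x \<in> bm_elts X n" "y \<in> bm_elts X n"
    have "x \<otimes>\<^bsub>bm_comp X n\<^esub> y \<in> bm_elts X n"
      using bm_comp_group x by (simp add: comm_group_def group_def monoid.m_closed)
    then show "act side k n (x \<otimes>\<^bsub>bm_comp X n\<^esub> y) =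
        act side k n x \<otimes>\<^bsub>bm_comp X (n + 2 * int k)\<^esub> act side k n y"
      using x by (auto simp: act_eq intro!: graded_pairingD(3)[OF left_pairing] S.pow_closed)
  qed (auto simp: act_eq intro!: left_closed S.pow_closed)
  show "act side 0 n x = x" if "x \<in> bm_elts X n" for n x
    using that by (simp add: act_eq left_one)
  show "act side k (n + 2 * int l) (act side l n x) = act side (k + l) n x"
    if "x \<in> bm_elts X n" for k l n x
    using that S.pow_add[of k l, symmetric]
    by (simp add: act_eq left_closed left_assoc'[where mn = "n + 2 * int l"] S.pow_closed)
qed

text \<open>A power of s in front of the ring element is moved out by associativity. In front of the
  bimodule element it stands behind the ring element and has to pass it, which is centrality in
  \<open>S\<close>.\<close>

lemma loc_pairing_left:
  "loc_pairing (gr_comp S) (gr_act S s) (bm_comp X) (act side) (bm_comp X) (act side) (bm_left X)"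
proof -
  interpret X: loc_system "bm_comp X" "act side" by (rule loc_system_act)
  show ?thesis
  proof (intro loc_pairing.intro loc_pairing_axioms.intro loc_system_act S.loc_system_act T.loc_system_act)
    show "graded_pairing (gr_comp S) (bm_comp X) (bm_comp X) (bm_left X)" by (rule left_pairing)
    fix a x m n k
    assume a: "a \<in> gr_elts S m" and x: "x \<in> bm_elts X n"
    show 1: "bm_left X (m + 2 * int k) n (gr_act S s k m a) x = act side k (m + n) (bm_left X m n a x)" for k
      using a x by (simp add: gr_act_def act_eq left_closed left_assoc' S.pow_closed add.commute)
    have "bm_left X m (n + 2 * int k) a (act side k n x) =
        bm_left X (m + 2 * int k) n (gr_mult S m (2 * int k) a (gr_pow S s k)) x"
      using a x by (simp add: act_eq left_assoc'[where mn = "n + 2 * int k"] S.pow_closed)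
    also have "\<dots> = bm_left X (m + 2 * int k) n (gr_act S s k m a) x"
      using S.pow_comm[OF a refl, of k] by (simp add: gr_act_def)
    finally have "bm_left X m (n + 2 * int k) a (act side k n x) = bm_left X (m + 2 * int k) n (gr_act S s k m a) x" .
    then show "bm_left X m (n + 2 * int k) a (act side k n x) = act side k (m + n) (bm_left X m n a x)"
      unfolding 1 .
  qed
qed

text \<open>A power of s on the left of x commutes with the right action. A power of t acting on the
  element of \<open>T\<close> is first moved next to x by associativity and then replaced by the
  same power of s on the left of x.\<close>

lemma loc_pairing_right:
  "loc_pairing (bm_comp X) (act side) (gr_comp T) (gr_act T t) (bm_comp X) (act side) (bm_right X)"
proof -
  interpret X: loc_system "bm_comp X" "act side" by (rule loc_system_act)
  show ?thesis
  proof (intro loc_pairing.intro loc_pairing_axioms.intro loc_system_act S.loc_system_act T.loc_system_act)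
    show "graded_pairing (bm_comp X) (gr_comp T) (bm_comp X) (bm_right X)" by (rule right_pairing)
    fix x c m n k
    assume x: "x \<in> bm_elts X m" and c: "c \<in> gr_elts T n"
    show 1: "bm_right X (m + 2 * int k) n (act side k m x) c = act side k (m + n) (bm_right X m n x c)" for k
      using c x by (simp add: gr_act_def act_eq right_closed left_right' S.pow_closed add.commute)
    have "bm_right X m (n + 2 * int k) x (gr_act T t k n c) = bm_right X (m + 2 * int k) n (act side k m x) c"
      using c x by (simp add: act_eq gr_act_def right_assoc'[where mn = "n + 2 * int k"] T.pow_closed balanced_pow)
    then show "bm_right X m (n + 2 * int k) x (gr_act T t k n c) = act side k (m + n) (bm_right X m n x c)"
      unfolding 1 .
  qed
qed

lemma bm_loc_graded_bimodule: "graded_bimodule (gr_loc S s) (gr_loc T t) (bm_loc X (act side))"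
proof -
  interpret X: loc_system "bm_comp X" "act side" by (rule loc_system_act)
  interpret L: loc_pairing "gr_comp S" "gr_act S s" "bm_comp X" "act side" "bm_comp X" "act side" "bm_left X"
    by (rule loc_pairing_left)
  interpret R: loc_pairing "bm_comp X" "act side" "gr_comp T" "gr_act T t" "bm_comp X" "act side" "bm_right X"
    by (rule loc_pairing_right)
  interpret LS: graded_ring "gr_loc S s" by (rule S.gr_loc_graded_ring)
  interpret LT: graded_ring "gr_loc T t" by (rule T.gr_loc_graded_ring)
  show ?thesis
  proof (intro graded_bimodule.intro graded_bimodule_axioms.intro LS.graded_ring_axioms LT.graded_ring_axioms, unfold gr_loc_simps bm_loc_simps)
    show "comm_group (loc_comp (bm_comp X) (act side) n)" for n by (rule X.loc_comm_group)
    show "graded_pairing (loc_comp (gr_comp S) (gr_act S s)) (loc_comp (bm_comp X) (act side))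
       (loc_comp (bm_comp X) (act side)) (loc_pair (bm_comp X) (act side) (bm_left X))"
      by (rule L.loc_pair_pairing)
    show "graded_pairing (loc_comp (bm_comp X) (act side)) (loc_comp (gr_comp T) (gr_act T t))
       (loc_comp (bm_comp X) (act side)) (loc_pair (bm_comp X) (act side) (bm_right X))"
      by (rule R.loc_pair_pairing)
    fix U n assume "U \<in> carrier (loc_comp (bm_comp X) (act side) n)"
    then obtain x i where "x \<in> bm_elts X (n + 2 * int i)" "U = X.frac n x i" using X.loc_elem by blast
    then show "loc_pair (bm_comp X) (act side) (bm_left X) 0 n (loc_frac (gr_comp S) (gr_act S s) 0 (gr_one S) 0) U = U"
      "loc_pair (bm_comp X) (act side) (bm_right X) n 0 U (loc_frac (gr_comp T) (gr_act T t) 0 (gr_one T) 0) = U"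
      by (simp_all add: L.loc_pair_frac R.loc_pair_frac S.one_closed T.one_closed left_one right_one)
  qed (intro loc_pair_assoc[OF S.loc.loc_pairing_axioms L.loc_pairing_axioms L.loc_pairing_axioms
        L.loc_pairing_axioms left_assoc]
      loc_pair_assoc[OF R.loc_pairing_axioms R.loc_pairing_axioms T.loc.loc_pairing_axioms
        R.loc_pairing_axioms right_assoc]
      loc_pair_assoc[OF L.loc_pairing_axioms R.loc_pairing_axioms R.loc_pairing_axioms
        L.loc_pairing_axioms left_right]; assumption)+
qed

lemma bm_loc_hom:
  "graded_bimodule_hom S T X (bm_loc X (act side)) (loc_map (gr_comp S) (gr_act S s))
     (loc_map (gr_comp T) (gr_act T t)) (loc_map (bm_comp X) (act side))"
  unfolding graded_bimodule_hom_def bm_loc_simps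
  by (intro conjI allI ballI loc_system.loc_map_hom loc_system_act
      loc_pairing.loc_map_pair[OF loc_pairing_left] loc_pairing.loc_map_pair[OF loc_pairing_right])

text \<open>The case k = 1 of the operators, for which the power of s is s itself up to the unit of
  \<open>S\<close>, is what the general criterion for localizations asks for.\<close>

lemma bm_loc_map_bij:
  assumes "\<And>n. bij_betw (bm_left X 2 n s) (bm_elts X n) (bm_elts X (n + 2))"
  shows "bij_betw (loc_map (bm_comp X) (act side) n) (bm_elts X n) (bm_elts (bm_loc X (act side)) n)"
proof -
  have "act side 1 m x = bm_left X 2 m s x" if "x \<in> bm_elts X m" for m x
    using that S.elt by (simp add: act_eq S.one_left)
  then have "bij_betw (act side 1 m) (bm_elts X m) (bm_elts X (m + 2))" for m
    using assms[of m] bij_betw_cong[of "bm_elts X m" "act side 1 m" "bm_left X 2 m s"] by simp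
  then show ?thesis
    unfolding bm_loc_simps by (rule loc_system.loc_map_bij[OF loc_system_act])
qed

end

section \<open>Maps induced on localizations\<close>

locale loc_hom = X: loc_system X a + Y: loc_system Y b
  for X :: "int \<Rightarrow> 'x monoid" and a and Y :: "int \<Rightarrow> 'y monoid" and b +
  fixes h :: "int \<Rightarrow> 'x \<Rightarrow> 'y"
  assumes hom: "h n \<in> hom (X n) (Y n)"
    and equivariant: "x \<in> carrier (X n) \<Longrightarrow> h (n + 2 * int k) (a k n x) = b k n (h n x)"
begin

lemma h_closed: "x \<in> carrier (X n) \<Longrightarrow> h n x \<in> carrier (Y n)"
  using hom[of n] by (auto simp: hom_def)

lemma h_mult: "x \<in> carrier (X n) \<Longrightarrow> y \<in> carrier (X n) \<Longrightarrow> h n (x \<otimes>\<^bsub>X n\<^esub> y) = h n x \<otimes>\<^bsub>Y n\<^esub> h n y"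
  using hom[of n] by (auto simp: hom_def)

lemma h_act: "x \<in> carrier (X n) \<Longrightarrow> m = n + 2 * int k \<Longrightarrow> h m (a k n x) = b k n (h n x)"
  using equivariant by simp

lemma loc_induced_frac:
  assumes x: "x \<in> carrier (X (n + 2 * int i))"
  shows "loc_induced Y b h n (X.frac n x i) = Y.frac n (h (n + 2 * int i) x) i"
  unfolding loc_induced_def
proof (rule X.frac_UN[OF x])
  fix y j assume y: "y \<in> carrier (X (n + 2 * int j))" and "X.frac n x i = X.frac n y j"
  then obtain k where k: "a (k + j) (n + 2 * int i) x = a (k + i) (n + 2 * int j) y"
    using X.frac_eq_iff[OF x y] by blast
  have "b (k + j) (n + 2 * int i) (h (n + 2 * int i) x) = h (n + 2 * int (i + j + k)) (a (k + j) (n + 2 * int i) x)"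
    using x by (subst h_act) auto
  also have "\<dots> = b (k + i) (n + 2 * int j) (h (n + 2 * int j) y)"
    unfolding k using y by (subst h_act) auto
  finally show "Y.frac n (h (n + 2 * int j) y) j = Y.frac n (h (n + 2 * int i) x) i"
    using Y.frac_eq_iff[OF h_closed[OF x] h_closed[OF y]] by blast
qed

lemma loc_induced_hom: "loc_induced Y b h n \<in> hom (loc_comp X a n) (loc_comp Y b n)"
proof (rule homI)
  fix U W assume "U \<in> carrier (loc_comp X a n)" "W \<in> carrier (loc_comp X a n)"
  then obtain x y i where "x \<in> carrier (X (n + 2 * int i))" "y \<in> carrier (X (n + 2 * int i))"
    "U = X.frac n x i" "W = X.frac n y i" using X.loc_common2 by metis
  then show "loc_induced Y b h n (U \<otimes>\<^bsub>loc_comp X a n\<^esub> W) =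
      loc_induced Y b h n U \<otimes>\<^bsub>loc_comp Y b n\<^esub> loc_induced Y b h n W"
    and "loc_induced Y b h n U \<in> carrier (loc_comp Y b n)"
    by (simp_all add: loc_induced_frac X.loc_mult_same[where m = "n + 2 * int i"] h_closed h_mult
        Y.loc_mult_same[where m = "n + 2 * int i"] Y.frac_closed)
qed

text \<open>Kernel and cokernel only need to be torsion. A power of t that kills a difference makes
  two fractions equal, and a power of t that moves y into the image supplies the denominator of a
  preimage.\<close>

lemma loc_induced_iso:
  assumes ker: "\<And>n x. \<lbrakk>x \<in> carrier (X n); h n x = \<one>\<^bsub>Y n\<^esub>\<rbrakk> \<Longrightarrow> \<exists>k. a k n x = \<one>\<^bsub>X (n + 2 * int k)\<^esub>"
    and coker: "\<And>n y. y \<in> carrier (Y n) \<Longrightarrow> \<exists>k. \<exists>x \<in> carrier (X (n + 2 * int k)). b k n y = h (n + 2 * int k) x"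
  shows "loc_induced Y b h n \<in> iso (loc_comp X a n) (loc_comp Y b n)"
proof -
  have "inj_on (loc_induced Y b h n) (carrier (loc_comp X a n))"
  proof (rule inj_onI)
    fix U W assume "U \<in> carrier (loc_comp X a n)" "W \<in> carrier (loc_comp X a n)"
      and UW: "loc_induced Y b h n U = loc_induced Y b h n W"
    then obtain x y i where x: "x \<in> carrier (X (n + 2 * int i))" and y: "y \<in> carrier (X (n + 2 * int i))"
      and U: "U = X.frac n x i" "W = X.frac n y i" using X.loc_common2 by metis
    let ?m = "n + 2 * int i"
    \<comment> \<open>Equal images of two fractions agree as numerators only after multiplication by
      a power of t. The multiplied numerators \<open>?x\<close> and \<open>?y\<close> then have
      equal images, so their difference lies in the kernel of h.\<close>
    obtain k where k: "b k ?m (h ?m x) = b k ?m (h ?m y)"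
      using UW x y by (auto simp: U loc_induced_frac Y.frac_eq_same_iff h_closed)
    let ?r = "?m + 2 * int k"
    let ?x = "a k ?m x" and ?y = "a k ?m y"
    have xy: "?x \<in> carrier (X ?r)" "?y \<in> carrier (X ?r)" "h ?r ?x = h ?r ?y"
      using x y k by (simp_all add: X.act_closed equivariant)
    interpret h: group_hom "X ?r" "Y ?r" "h ?r"
      using hom X.comp.group_axioms Y.comp.group_axioms by (simp add: group_hom_def group_hom_axioms_def)
    have "h ?r (?x \<otimes>\<^bsub>X ?r\<^esub> inv\<^bsub>X ?r\<^esub> ?y) = \<one>\<^bsub>Y ?r\<^esub>"
      using xy by (simp add: h_closed)
    then obtain l where l: "a l ?r (?x \<otimes>\<^bsub>X ?r\<^esub> inv\<^bsub>X ?r\<^esub> ?y) = \<one>\<^bsub>X (?r + 2 * int l)\<^esub>"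
      using ker[of "?x \<otimes>\<^bsub>X ?r\<^esub> inv\<^bsub>X ?r\<^esub> ?y" ?r] xy by auto
    then have "a l ?r ?x \<otimes>\<^bsub>X (?r + 2 * int l)\<^esub> inv\<^bsub>X (?r + 2 * int l)\<^esub> (a l ?r ?y) = \<one>\<^bsub>X (?r + 2 * int l)\<^esub>"
      using xy by (simp add: X.act_mult[where m = "?r + 2 * int l"] X.act_inv[where m = "?r + 2 * int l"])
    moreover have "a l ?r ?x \<in> carrier (X (?r + 2 * int l))" "a l ?r ?y \<in> carrier (X (?r + 2 * int l))"
      using xy by (simp_all add: X.act_closed)
    ultimately have "a l ?r ?x = a l ?r ?y"
      by (metis X.comp.inv_closed X.comp.inv_equality X.comp.inv_inv)
    then have "a (l + k) ?m x = a (l + k) ?m y"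
      using x y by (simp add: X.act_act)
    then show "U = W" using x y by (auto simp: U X.frac_eq_same_iff)
  qed
  moreover have "W \<in> loc_induced Y b h n ` carrier (loc_comp X a n)" if W: "W \<in> carrier (loc_comp Y b n)" for W
  proof -
    obtain y i where y: "y \<in> carrier (Y (n + 2 * int i))" "W = Y.frac n y i" using W Y.loc_elem by blast
    obtain k x where x: "x \<in> carrier (X (n + 2 * int i + 2 * int k))"
      "b k (n + 2 * int i) y = h (n + 2 * int i + 2 * int k) x"
      using coker[OF y(1)] by blast
    have e: "n + 2 * int i + 2 * int k = n + 2 * int (i + k)" by simp
    have "W = Y.frac n (b k (n + 2 * int i) y) (i + k)"
      using Y.frac_expand[OF y(1) refl, of k] y(2) by simp
    then have "W = loc_induced Y b h n (X.frac n x (i + k))"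
      using x unfolding e by (simp add: loc_induced_frac)
    moreover have "X.frac n x (i + k) \<in> carrier (loc_comp X a n)"
      using x unfolding e by (intro X.frac_closed)
    ultimately show ?thesis by blast
  qed
  ultimately show ?thesis
    using loc_induced_hom[of n] by (auto simp: iso_def bij_betw_def hom_def)
qed

end

text \<open>Three different maps are allowed on the two arguments and on the value, so that
  multiplicativity of ring maps and equivariance of bimodule maps on either side are
  instances.\<close>

lemma loc_induced_pair:
  assumes P: "loc_pairing A a B b C c p" and P': "loc_pairing A' a' B' b' C' c' p'"
    and hA: "loc_hom A a A' a' hA" and hB: "loc_hom B b B' b' hB" and hC: "loc_hom C c C' c' hC"
    and h: "\<And>m n x y. \<lbrakk>x \<in> carrier (A m); y \<in> carrier (B n)\<rbrakk> \<Longrightarrow> hC (m + n) (p m n x y) = p' m n (hA m x) (hB n y)"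
    and U: "U \<in> carrier (loc_comp A a m)" and W: "W \<in> carrier (loc_comp B b n)"
  shows "loc_induced C' c' hC (m + n) (loc_pair C c p m n U W) =
    loc_pair C' c' p' m n (loc_induced A' a' hA m U) (loc_induced B' b' hB n W)"
proof -
  interpret P: loc_pairing A a B b C c p by (rule P)
  interpret P': loc_pairing A' a' B' b' C' c' p' by (rule P')
  interpret hA: loc_hom A a A' a' hA by (rule hA)
  interpret hB: loc_hom B b B' b' hB by (rule hB)
  interpret hC: loc_hom C c C' c' hC by (rule hC)
  obtain x i where x: "x \<in> carrier (A (m + 2 * int i))" "U = P.A.frac m x i" using U P.A.loc_elem by blast
  obtain y j where y: "y \<in> carrier (B (n + 2 * int j))" "W = P.B.frac n y j" using W P.B.loc_elem by blast
  have "m + n + 2 * int (i + j) = (m + 2 * int i) + (n + 2 * int j)" by simp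
  moreover have "p (m + 2 * int i) (n + 2 * int j) x y \<in> carrier (C (m + n + 2 * int (i + j)))"
    using x y by (intro P.p_closed) auto
  ultimately show ?thesis using x y h[OF x(1) y(1)]
    by (simp add: P.loc_pair_frac P'.loc_pair_frac hA.loc_induced_frac hB.loc_induced_frac hC.loc_induced_frac
        hA.h_closed hB.h_closed ac_simps)
qed

locale central_ring_hom = A: central_element A t + B: central_element B u
  for A :: "'a gring" and t and B :: "'b gring" and u +
  fixes h :: "int \<Rightarrow> 'a \<Rightarrow> 'b"
  assumes ring_hom: "graded_ring_hom A B h" and h_elt: "h 2 t = u"
begin

lemma h_ring_mult: "\<lbrakk>x \<in> gr_elts A m; y \<in> gr_elts A n; k = m + n\<rbrakk> \<Longrightarrow>
    h k (gr_mult A m n x y) = gr_mult B m n (h m x) (h n y)"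
  using ring_hom by (auto simp: graded_ring_hom_def)

lemma h_pow: "m = 2 * int k \<Longrightarrow> h m (gr_pow A t k) = gr_pow B u k"
proof (induction k arbitrary: m)
  case 0
  then show ?case using ring_hom by (auto simp: graded_ring_hom_def)
next
  case (Suc k)
  then show ?case by (simp add: h_ring_mult A.pow_closed A.elt h_elt)
qed

sublocale loc_hom "gr_comp A" "gr_act A t" "gr_comp B" "gr_act B u" h
proof (intro loc_hom.intro loc_hom_axioms.intro A.loc_system_act B.loc_system_act)
  show "h n \<in> hom (gr_comp A n) (gr_comp B n)" for n using ring_hom by (auto simp: graded_ring_hom_def)
  show "h (n + 2 * int k) (gr_act A t k n x) = gr_act B u k n (h n x)" if "x \<in> gr_elts A n" for n k x
    using that by (simp add: gr_act_def h_ring_mult A.pow_closed h_pow)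
qed

lemma gr_loc_iso:
  assumes "\<And>n x. \<lbrakk>x \<in> gr_elts A n; h n x = \<one>\<^bsub>gr_comp B n\<^esub>\<rbrakk> \<Longrightarrow> \<exists>k. gr_act A t k n x = \<one>\<^bsub>gr_comp A (n + 2 * int k)\<^esub>"
    and "\<And>n y. y \<in> gr_elts B n \<Longrightarrow> \<exists>k. \<exists>x \<in> gr_elts A (n + 2 * int k). gr_act B u k n y = h (n + 2 * int k) x"
  shows "graded_ring_iso (gr_loc A t) (gr_loc B u) (loc_induced (gr_comp B) (gr_act B u) h)"
proof -
  have "h 0 (gr_one A) = gr_one B" using ring_hom by (auto simp: graded_ring_hom_def)
  then have "loc_induced (gr_comp B) (gr_act B u) h 0 (A.loc.A.frac 0 (gr_one A) 0) = B.loc.A.frac 0 (gr_one B) 0"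
    using A.one_closed by (simp add: loc_induced_frac)
  then show ?thesis
    unfolding graded_ring_iso_def graded_ring_hom_def gr_loc_simps
    by (intro conjI allI ballI loc_induced_hom loc_induced_iso assms
      loc_induced_pair[OF A.loc.loc_pairing_axioms B.loc.loc_pairing_axioms loc_hom_axioms loc_hom_axioms
        loc_hom_axioms h_ring_mult[OF _ _ refl]])
qed

end

locale central_bimodule_hom = X: central_bimodule S T X s t + Y: central_bimodule S' T' Y s' t' +
    hS: central_ring_hom S s S' s' hS + hT: central_ring_hom T t T' t' hT
  for S :: "'s gring" and T :: "'t gring" and X :: "('s, 't, 'x) gbimod" and s t
    and S' :: "'s2 gring" and T' :: "'t2 gring" and Y :: "('s2, 't2, 'y) gbimod" and s' t' and hS hT +
  fixes h :: "int \<Rightarrow> 'x \<Rightarrow> 'y"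
  assumes bimod_hom: "graded_bimodule_hom S T X Y hS hT h"
begin

lemma loc_hom_act: "loc_hom (bm_comp X) (X.act side) (bm_comp Y) (Y.act side) h"
proof -
  interpret LX: loc_system "bm_comp X" "X.act side" by (rule X.loc_system_act)
  interpret LY: loc_system "bm_comp Y" "Y.act side" by (rule Y.loc_system_act)
  show ?thesis
  proof (intro loc_hom.intro loc_hom_axioms.intro X.loc_system_act Y.loc_system_act)
    show h: "h n \<in> hom (bm_comp X n) (bm_comp Y n)" for n
      using bimod_hom by (auto simp: graded_bimodule_hom_def)
    fix x n k assume x: "x \<in> bm_elts X n"
    have "h (2 * int k + n) (bm_left X (2 * int k) n (gr_pow S s k) x) =
        bm_left Y (2 * int k) n (hS (2 * int k) (gr_pow S s k)) (h n x)"
      using bimod_hom x X.S.pow_closed[OF refl, of k] unfolding graded_bimodule_hom_def by blast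
    moreover have "h n x \<in> bm_elts Y n" using h[of n] x by (auto simp: hom_def)
    ultimately show "h (n + 2 * int k) (X.act side k n x) = Y.act side k n (h n x)"
      using x by (simp add: X.act_eq Y.act_eq hS.h_pow add.commute)
  qed
qed

text \<open>The torsion conditions are phrased with the left action, in which the nilpotence
  arguments take place; \<open>act_eq\<close> carries them over to the chosen
  \<open>side\<close>.\<close>

lemma bm_loc_iso:
  assumes ker: "\<And>n x. \<lbrakk>x \<in> bm_elts X n; h n x = \<one>\<^bsub>bm_comp Y n\<^esub>\<rbrakk> \<Longrightarrow>
      \<exists>k. bm_left X (2 * int k) n (gr_pow S s k) x = \<one>\<^bsub>bm_comp X (n + 2 * int k)\<^esub>"
    and coker: "\<And>n y. y \<in> bm_elts Y n \<Longrightarrow>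
      \<exists>k. \<exists>x \<in> bm_elts X (n + 2 * int k). bm_left Y (2 * int k) n (gr_pow S' s' k) y = h (n + 2 * int k) x"
  shows "graded_bimodule_iso (gr_loc S s) (gr_loc T t) (bm_loc X (X.act side)) (bm_loc Y (Y.act side))
    (loc_induced (gr_comp S') (gr_act S' s') hS) (loc_induced (gr_comp T') (gr_act T' t') hT)
    (loc_induced (bm_comp Y) (Y.act side) h)"
proof -
  interpret L: loc_hom "bm_comp X" "X.act side" "bm_comp Y" "Y.act side" h by (rule loc_hom_act)
  have iso: "loc_induced (bm_comp Y) (Y.act side) h n \<in>
      iso (loc_comp (bm_comp X) (X.act side) n) (loc_comp (bm_comp Y) (Y.act side) n)" for n
    by (rule L.loc_induced_iso) (use ker coker in \<open>auto simp: X.act_eq Y.act_eq\<close>)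
  have l: "h (m + n) (bm_left X m n a x) = bm_left Y m n (hS m a) (h n x)"
    if "a \<in> gr_elts S m" "x \<in> bm_elts X n" for m n a x
    using bimod_hom that by (auto simp: graded_bimodule_hom_def)
  have r: "h (m + n) (bm_right X m n x c) = bm_right Y m n (h m x) (hT n c)"
    if "x \<in> bm_elts X m" "c \<in> gr_elts T n" for m n c x
    using bimod_hom that by (auto simp: graded_bimodule_hom_def)
  show ?thesis
    unfolding graded_bimodule_iso_def graded_bimodule_hom_def gr_loc_simps bm_loc_simps
    by (intro conjI allI ballI iso L.loc_induced_hom
      loc_induced_pair[OF X.loc_pairing_left Y.loc_pairing_left hS.loc_hom_axioms L.loc_hom_axioms L.loc_hom_axioms l]
      loc_induced_pair[OF X.loc_pairing_right Y.loc_pairing_right L.loc_hom_axioms hT.loc_hom_axioms L.loc_hom_axioms r])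
qed

end

section \<open>Cohomology of a quotient complex\<close>

lemma (in comm_group) rcos_eq_iff:
  assumes H: "subgroup H G" and x: "x \<in> carrier G" and y: "y \<in> carrier G"
  shows "H #> x = H #> y \<longleftrightarrow> (\<exists>h \<in> H. x = h \<otimes> y)"
proof
  assume "H #> x = H #> y"
  then show "\<exists>h \<in> H. x = h \<otimes> y" using rcos_self[OF x H] by (auto simp: r_coset_def)
next
  assume "\<exists>h \<in> H. x = h \<otimes> y"
  then have "x \<in> H #> y" by (auto simp: r_coset_def)
  then show "H #> x = H #> y" using repr_independence[OF _ y H] by blast
qed

lemma (in comm_group) rcos_UN:
  assumes H: "subgroup H G" and x: "x \<in> carrier G"
    and g: "\<And>h. h \<in> H \<Longrightarrow> g (h \<otimes> x) = c"
  shows "(\<Union>y \<in> H #> x. g y) = c"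
proof -
  have "x \<in> H #> x" by (rule rcos_self[OF x H])
  moreover have "g y = c" if "y \<in> H #> x" for y using that g by (auto simp: r_coset_def)
  ultimately show ?thesis by fastforce
qed

lemma (in comm_group) FactGroup_mult:
  assumes H: "subgroup H G" and x: "x \<in> carrier G" and y: "y \<in> carrier G"
  shows "(H #> x) \<otimes>\<^bsub>G Mod H\<^esub> (H #> y) = H #> (x \<otimes> y)"
  using normal.rcos_sum[OF subgroup_imp_normal[OF H] x y] by simp

lemma (in comm_group) FactGroup_inv:
  assumes H: "subgroup H G" and x: "x \<in> carrier G"
  shows "inv\<^bsub>G Mod H\<^esub> (H #> x) = H #> inv x"
proof -
  interpret h: group_hom G "G Mod H" "\<lambda>x. H #> x"
    using normal.r_coset_hom_Mod[OF subgroup_imp_normal[OF H]] abelian_FactGroup[OF H]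
    by (simp add: group_hom_def group_hom_axioms_def comm_group_def)
  show ?thesis using x by simp
qed

locale cochain =
  fixes C :: "'a cochain_complex"
  assumes grp_comm_group: "comm_group (grp C n)"
    and cbd_hom: "cbd C n \<in> hom (grp C n) (grp C (n + 1))"
    and cbd_cbd_add: "x \<in> carrier (grp C n) \<Longrightarrow> cbd C (n + 1) (cbd C n x) = \<one>\<^bsub>grp C (n + 2)\<^esub>"
begin

sublocale comm_group "grp C n" for n by (rule grp_comm_group)

abbreviation Z :: "int \<Rightarrow> 'a set" where "Z n \<equiv> kernel (grp C n) (grp C (n + 1)) (cbd C n)"

lemma cbd_closed: "x \<in> carrier (grp C n) \<Longrightarrow> m = n + 1 \<Longrightarrow> cbd C n x \<in> carrier (grp C m)"
  using cbd_hom[of n] by (auto simp: hom_def)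

lemma cbd_mult: "\<lbrakk>x \<in> carrier (grp C n); y \<in> carrier (grp C n); m = n + 1\<rbrakk> \<Longrightarrow>
    cbd C n (x \<otimes>\<^bsub>grp C n\<^esub> y) = cbd C n x \<otimes>\<^bsub>grp C m\<^esub> cbd C n y"
  using cbd_hom[of n] by (auto simp: hom_def)

lemma cbd_group_hom: "m = n + 1 \<Longrightarrow> group_hom (grp C n) (grp C m) (cbd C n)"
  using cbd_hom[of n] by (simp add: group_hom_def group_hom_axioms_def)

lemma cbd_cbd: "\<lbrakk>x \<in> carrier (grp C n); m = n + 1; k = n + 2\<rbrakk> \<Longrightarrow> cbd C m (cbd C n x) = \<one>\<^bsub>grp C k\<^esub>"
  using cbd_cbd_add by simp

lemma Z_iff: "x \<in> Z n \<longleftrightarrow> x \<in> carrier (grp C n) \<and> cbd C n x = \<one>\<^bsub>grp C (n + 1)\<^esub>"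
  by (simp add: kernel_def)

lemma Z_closed: "x \<in> Z n \<Longrightarrow> x \<in> carrier (grp C n)"
  by (simp add: Z_iff)

lemma Z_subgroup: "subgroup (Z n) (grp C n)"
  using group_hom.subgroup_kernel[OF cbd_group_hom] by simp

lemma coboundary_iff: "x \<in> coboundaries C n \<longleftrightarrow> (\<exists>y \<in> carrier (grp C (n - 1)). x = cbd C (n - 1) y)"
  by (auto simp: coboundaries_def)

lemma coboundaries_subgroup: "subgroup (coboundaries C n) (grp C n)"
  unfolding coboundaries_def
  using group_hom.img_is_subgroup[OF cbd_group_hom[of n "n - 1"]] by simp

lemma coboundaries_Z: "coboundaries C n \<subseteq> Z n"
  by (auto simp: coboundary_iff Z_iff cbd_closed cbd_cbd[where k = "n + 1"])

lemma coboundaries_closed: "x \<in> coboundaries C n \<Longrightarrow> x \<in> carrier (grp C n)"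
  using coboundaries_Z Z_closed by blast

abbreviation ZG :: "int \<Rightarrow> 'a monoid" where "ZG n \<equiv> (grp C n)\<lparr>carrier := Z n\<rparr>"

lemma ZG_comm_group: "comm_group (ZG n)"
proof (rule group.group_comm_groupI)
  show "group (ZG n)" using Z_subgroup by (simp add: subgroup_imp_group)
qed (simp add: Z_closed m_comm)

lemma coboundaries_subgroup_ZG: "subgroup (coboundaries C n) (ZG n)"
  using coboundaries_subgroup Z_subgroup coboundaries_Z
  by (simp add: subgroup_incl)

lemma cohomology_comm_group: "comm_group (cohomology C n)"
  unfolding cohomology_def
  using comm_group.abelian_FactGroup[OF ZG_comm_group coboundaries_subgroup_ZG] by simp

lemma cohomology_carrier: "carrier (cohomology C n) = coh_class C n ` Z n"
  unfolding cohomology_def coh_class_def carrier_FactGroup by simp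

lemma coh_class_closed: "z \<in> Z n \<Longrightarrow> coh_class C n z \<in> carrier (cohomology C n)"
  by (auto simp: cohomology_carrier)

lemma coh_class_eq_iff:
  assumes "z \<in> Z n" "w \<in> Z n"
  shows "coh_class C n z = coh_class C n w \<longleftrightarrow>
    (\<exists>g \<in> carrier (grp C (n - 1)). z = cbd C (n - 1) g \<otimes>\<^bsub>grp C n\<^esub> w)"
  unfolding coh_class_def
  using rcos_eq_iff[OF coboundaries_subgroup Z_closed[OF assms(1)] Z_closed[OF assms(2)]]
  by (simp add: coboundaries_def)

lemma coh_class_mult:
  assumes "z \<in> Z n" "w \<in> Z n"
  shows "coh_class C n z \<otimes>\<^bsub>cohomology C n\<^esub> coh_class C n w = coh_class C n (z \<otimes>\<^bsub>grp C n\<^esub> w)"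
  using comm_group.FactGroup_mult[OF ZG_comm_group coboundaries_subgroup_ZG, of z n w] assms
  by (simp add: coh_class_def cohomology_def)

lemma coh_class_one: "coh_class C n \<one>\<^bsub>grp C n\<^esub> = \<one>\<^bsub>cohomology C n\<^esub>"
  unfolding coh_class_def cohomology_def
  by (simp add: coset_join2[OF _ coboundaries_subgroup] subgroup.one_closed[OF coboundaries_subgroup])

lemma Z_mult: "\<lbrakk>x \<in> Z n; y \<in> Z n\<rbrakk> \<Longrightarrow> x \<otimes>\<^bsub>grp C n\<^esub> y \<in> Z n"
  using Z_subgroup by (rule subgroup.m_closed)

text \<open>As for fractions, maps on cohomology are unions over a class. Every member of the class
  of z is again a cocycle because coboundaries are cocycles, so g has to be evaluated on cocycles
  only.\<close>

lemma coh_class_UN: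
  assumes z: "z \<in> Z n" and g: "\<And>w. \<lbrakk>w \<in> Z n; coh_class C n w = coh_class C n z\<rbrakk> \<Longrightarrow> g w = c"
  shows "(\<Union>w \<in> coh_class C n z. g w) = c"
  unfolding coh_class_def
proof (rule rcos_UN[OF coboundaries_subgroup Z_closed[OF z]])
  fix h assume h: "h \<in> coboundaries C n"
  then have "h \<otimes>\<^bsub>grp C n\<^esub> z \<in> Z n" using z coboundaries_Z by (blast intro: Z_mult)
  then show "g (h \<otimes>\<^bsub>grp C n\<^esub> z) = c"
    using h z by (intro g) (auto simp: coh_class_eq_iff coboundary_iff)
qed

lemma coh_elem:
  assumes "U \<in> carrier (cohomology C n)"
  obtains z where "z \<in> Z n" "U = coh_class C n z"
  using assms by (auto simp: cohomology_carrier)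

end

section \<open>Products on cohomology induced by pairings of complexes\<close>

definition coh_pair ::
    "'c cochain_complex \<Rightarrow> (int \<Rightarrow> int \<Rightarrow> 'a \<Rightarrow> 'b \<Rightarrow> 'c) \<Rightarrow> int \<Rightarrow> int \<Rightarrow> 'a set \<Rightarrow> 'b set \<Rightarrow> 'c set" where
  "coh_pair C p m n U W = (\<Union>\<alpha> \<in> U. \<Union>\<beta> \<in> W. coh_class C (m + n) (p m n \<alpha> \<beta>))"

text \<open>The graded Leibniz rule. Its sign (-1)^m appears as a case distinction between an
  element and its inverse, since the homogeneous components are written multiplicatively.\<close>

locale dg_pairing = A: cochain A + B: cochain B + C: cochain C
  for A :: "'a cochain_complex" and B :: "'b cochain_complex" and C :: "'c cochain_complex" +
  fixes p :: "int \<Rightarrow> int \<Rightarrow> 'a \<Rightarrow> 'b \<Rightarrow> 'c"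
  assumes pairing: "graded_pairing (grp A) (grp B) (grp C) p"
    and leibniz: "\<lbrakk>x \<in> carrier (grp A m); y \<in> carrier (grp B n)\<rbrakk> \<Longrightarrow>
      cbd C (m + n) (p m n x y) = p (m + 1) n (cbd A m x) y \<otimes>\<^bsub>grp C (m + n + 1)\<^esub>
        (if even m then p m (n + 1) x (cbd B n y)
         else inv\<^bsub>grp C (m + n + 1)\<^esub> (p m (n + 1) x (cbd B n y)))"
begin

lemmas p_closed = graded_pairingD(1)[OF pairing]
lemmas p_mult_left = graded_pairingD(2)[OF pairing]
lemmas p_mult_right = graded_pairingD(3)[OF pairing]

lemma p_one_left:
  assumes y: "y \<in> carrier (grp B n)" and k: "k = m + n"
  shows "p m n \<one>\<^bsub>grp A m\<^esub> y = \<one>\<^bsub>grp C k\<^esub>"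
proof -
  have "p m n \<one>\<^bsub>grp A m\<^esub> y \<otimes>\<^bsub>grp C k\<^esub> p m n \<one>\<^bsub>grp A m\<^esub> y = p m n \<one>\<^bsub>grp A m\<^esub> y"
    using p_mult_left[OF A.one_closed A.one_closed y k] by simp
  then show ?thesis using y k p_closed C.l_cancel_one' by (metis A.one_closed)
qed

lemma p_one_right:
  assumes x: "x \<in> carrier (grp A m)" and k: "k = m + n"
  shows "p m n x \<one>\<^bsub>grp B n\<^esub> = \<one>\<^bsub>grp C k\<^esub>"
proof -
  have "p m n x \<one>\<^bsub>grp B n\<^esub> \<otimes>\<^bsub>grp C k\<^esub> p m n x \<one>\<^bsub>grp B n\<^esub> = p m n x \<one>\<^bsub>grp B n\<^esub>"
    using p_mult_right[OF x B.one_closed B.one_closed k] by simp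
  then show ?thesis using x k p_closed C.l_cancel_one' by (metis B.one_closed)
qed

lemma p_Z:
  assumes "x \<in> A.Z m" "y \<in> B.Z n" "k = m + n"
  shows "p m n x y \<in> C.Z k"
proof -
  have x: "x \<in> carrier (grp A m)" "cbd A m x = \<one>\<^bsub>grp A (m + 1)\<^esub>"
    and y: "y \<in> carrier (grp B n)" "cbd B n y = \<one>\<^bsub>grp B (n + 1)\<^esub>"
    using assms by (auto simp: A.Z_iff B.Z_iff)
  then show ?thesis using assms(3)
    by (simp add: C.Z_iff p_closed leibniz p_one_left[where k = "m + n + 1"] p_one_right[where k = "m + n + 1"])
qed

lemma p_coboundary_left:
  assumes "x \<in> coboundaries A m" "y \<in> B.Z n" "k = m + n"
  shows "p m n x y \<in> coboundaries C k"
proof -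
  obtain w where w: "w \<in> carrier (grp A (m - 1))" "x = cbd A (m - 1) w"
    using assms A.coboundary_iff by blast
  have y: "y \<in> carrier (grp B n)" "cbd B n y = \<one>\<^bsub>grp B (n + 1)\<^esub>" using assms B.Z_iff by auto
  have x: "x \<in> carrier (grp A m)" using w A.cbd_closed[of w "m - 1" m] by simp
  have "cbd C (k - 1) (p (m - 1) n w y) = p m n x y"
    using leibniz[OF w(1) y(1)] w y x
    by (simp add: assms(3) p_one_right[where k = "m + n"] p_closed algebra_simps)
  moreover have "p (m - 1) n w y \<in> carrier (grp C (k - 1))"
    using w y by (intro p_closed) (auto simp: assms)
  ultimately show ?thesis unfolding C.coboundary_iff by force
qed

text \<open>The Leibniz rule exhibits the product as a coboundary up to the sign (-1)^m, and
  coboundaries are closed under inverses.\<close>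

lemma p_coboundary_right:
  assumes "x \<in> A.Z m" "y \<in> coboundaries B n" "k = m + n"
  shows "p m n x y \<in> coboundaries C k"
proof -
  obtain w where w: "w \<in> carrier (grp B (n - 1))" "y = cbd B (n - 1) w"
    using assms B.coboundary_iff by blast
  have x: "x \<in> carrier (grp A m)" "cbd A m x = \<one>\<^bsub>grp A (m + 1)\<^esub>" using assms A.Z_iff by auto
  have y: "y \<in> carrier (grp B n)" using w B.cbd_closed[of w "n - 1" n] by simp
  have p: "p m n x y \<in> carrier (grp C k)" using x y by (intro p_closed) (auto simp: assms)
  have 1: "cbd C (k - 1) (p m (n - 1) x w) = (if even m then p m n x y else inv\<^bsub>grp C k\<^esub> (p m n x y))"
    using leibniz[OF x(1) w(1)] w x p
    by (simp add: assms(3) p_one_left[where k = "m + n"] p_closed algebra_simps)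
  have 2: "p m (n - 1) x w \<in> carrier (grp C (k - 1))"
    using w x by (intro p_closed) (auto simp: assms)
  have 3: "(if even m then p m n x y else inv\<^bsub>grp C k\<^esub> (p m n x y)) \<in> coboundaries C k"
    using 1 2 unfolding C.coboundary_iff by metis
  show ?thesis
  proof (cases "even m")
    case False
    then show ?thesis
      using subgroup.m_inv_closed[OF C.coboundaries_subgroup 3] p by simp
  qed (use 3 in simp)
qed

text \<open>With x' = g + x and y' = h + y, additively written, p(x', y') - p(x, y) = p(g, y') +
  p(x, h). Pairing g with y' instead of y absorbs the cross term, and both terms pair a coboundary
  with a cocycle.\<close>

lemma coh_pair_class:
  assumes x: "x \<in> A.Z m" and y: "y \<in> B.Z n" and k: "k = m + n"
  shows "coh_pair C p m n (coh_class A m x) (coh_class B n y) = coh_class C k (p m n x y)"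
proof -
  have "coh_class C (m + n) (p m n x' y') = coh_class C k (p m n x y)"
    if x': "x' \<in> A.Z m" "coh_class A m x' = coh_class A m x"
      and y': "y' \<in> B.Z n" "coh_class B n y' = coh_class B n y" for x' y'
  proof -
    obtain g where g: "g \<in> coboundaries A m" "x' = g \<otimes>\<^bsub>grp A m\<^esub> x"
      using A.coh_class_eq_iff[OF x'(1) x] x' A.coboundary_iff by metis
    obtain h where h: "h \<in> coboundaries B n" "y' = h \<otimes>\<^bsub>grp B n\<^esub> y"
      using B.coh_class_eq_iff[OF y'(1) y] y' B.coboundary_iff by metis
    note closed = A.Z_closed[OF x] B.Z_closed[OF y] A.coboundaries_closed[OF g(1)]
      B.coboundaries_closed[OF h(1)] B.Z_closed[OF y'(1)]
    have "p m n x' y' = p m n g y' \<otimes>\<^bsub>grp C k\<^esub> (p m n x h \<otimes>\<^bsub>grp C k\<^esub> p m n x y)"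
      unfolding g(2) using closed k
      by (simp add: p_mult_left[where k = k]) (simp add: h(2) p_mult_right[where k = k])
    also have "\<dots> = (p m n g y' \<otimes>\<^bsub>grp C k\<^esub> p m n x h) \<otimes>\<^bsub>grp C k\<^esub> p m n x y"
      using closed k by (simp add: C.m_assoc p_closed)
    finally have eq: "p m n x' y' = \<dots>" .
    have "p m n g y' \<otimes>\<^bsub>grp C k\<^esub> p m n x h \<in> coboundaries C k"
      using g h x y' k
      by (intro subgroup.m_closed[OF C.coboundaries_subgroup] p_coboundary_left p_coboundary_right) auto
    then show ?thesis
      using C.coh_class_eq_iff[OF p_Z[OF x'(1) y'(1) k] p_Z[OF x y k]] eq k C.coboundary_iff by metis
  qed
  then show ?thesis unfolding coh_pair_def by (intro A.coh_class_UN B.coh_class_UN x y)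
qed

lemma coh_pair_pairing:
  "graded_pairing (cohomology A) (cohomology B) (cohomology C) (coh_pair C p)"
  unfolding graded_pairing_def
proof (intro conjI allI ballI)
  fix m n U W assume "U \<in> carrier (cohomology A m)" "W \<in> carrier (cohomology B n)"
  then obtain x y where x: "x \<in> A.Z m" "U = coh_class A m x" and y: "y \<in> B.Z n" "W = coh_class B n y"
    using A.coh_elem B.coh_elem by metis
  show "coh_pair C p m n U W \<in> carrier (cohomology C (m + n))"
    using x y by (simp add: coh_pair_class C.coh_class_closed p_Z)
  show "coh_pair C p m n (U \<otimes>\<^bsub>cohomology A m\<^esub> U') W =
      coh_pair C p m n U W \<otimes>\<^bsub>cohomology C (m + n)\<^esub> coh_pair C p m n U' W"
    if "U' \<in> carrier (cohomology A m)" for U'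
  proof -
    obtain x' where "x' \<in> A.Z m" "U' = coh_class A m x'" using \<open>U' \<in> _\<close> A.coh_elem by metis
    then show ?thesis
      using x y by (simp add: A.coh_class_mult coh_pair_class C.coh_class_mult p_Z A.Z_mult
          p_mult_left[OF A.Z_closed A.Z_closed B.Z_closed refl])
  qed
  show "coh_pair C p m n U (W \<otimes>\<^bsub>cohomology B n\<^esub> W') =
      coh_pair C p m n U W \<otimes>\<^bsub>cohomology C (m + n)\<^esub> coh_pair C p m n U W'"
    if "W' \<in> carrier (cohomology B n)" for W'
  proof -
    obtain y' where "y' \<in> B.Z n" "W' = coh_class B n y'" using \<open>W' \<in> _\<close> B.coh_elem by metis
    then show ?thesis
      using x y by (simp add: B.coh_class_mult coh_pair_class C.coh_class_mult p_Z B.Z_mult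
          p_mult_right[OF A.Z_closed B.Z_closed B.Z_closed refl])
  qed
qed

end

section \<open>Quotient complexes and their classes\<close>

definition quot_complex :: "'a cochain_complex \<Rightarrow> (int \<Rightarrow> 'a set) \<Rightarrow> 'a set cochain_complex" where
  "quot_complex C D = \<lparr>grp = (\<lambda>n. grp C n Mod D n),
     cbd = (\<lambda>n U. \<Union>\<beta> \<in> U. D (n + 1) #>\<^bsub>grp C (n + 1)\<^esub> cbd C n \<beta>)\<rparr>"

locale subcomplex = cochain C for C :: "'a cochain_complex" +
  fixes D :: "int \<Rightarrow> 'a set"
  assumes sub: "subgroup (D n) (grp C n)"
    and sub_cbd: "x \<in> D n \<Longrightarrow> cbd C n x \<in> D (n + 1)"
begin

abbreviation qcl :: "int \<Rightarrow> 'a \<Rightarrow> 'a set" where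
  "qcl n x \<equiv> D n #>\<^bsub>grp C n\<^esub> x"

lemma sub_closed: "x \<in> D n \<Longrightarrow> x \<in> carrier (grp C n)"
  by (rule subgroup.mem_carrier[OF sub])

lemmas sub_mult = subgroup.m_closed[OF sub]
lemma quot_grp: "grp (quot_complex C D) n = grp C n Mod D n"
  by (simp add: quot_complex_def)

lemma quot_comm_group: "comm_group (grp (quot_complex C D) n)"
  unfolding quot_grp by (rule abelian_FactGroup[OF sub])

lemma quot_carrier: "carrier (grp (quot_complex C D) n) = qcl n ` carrier (grp C n)"
  by (simp add: quot_grp carrier_FactGroup)

lemma qcl_closed: "x \<in> carrier (grp C n) \<Longrightarrow> qcl n x \<in> carrier (grp (quot_complex C D) n)"
  by (simp add: quot_carrier)

lemma qcl_elem:
  assumes "U \<in> carrier (grp (quot_complex C D) n)"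
  obtains x where "x \<in> carrier (grp C n)" "U = qcl n x"
  using assms by (auto simp: quot_carrier)

lemma qcl_mult:
  "\<lbrakk>x \<in> carrier (grp C n); y \<in> carrier (grp C n)\<rbrakk> \<Longrightarrow>
    qcl n x \<otimes>\<^bsub>grp (quot_complex C D) n\<^esub> qcl n y = qcl n (x \<otimes>\<^bsub>grp C n\<^esub> y)"
  unfolding quot_grp by (rule FactGroup_mult[OF sub])

lemma qcl_inv: "x \<in> carrier (grp C n) \<Longrightarrow> inv\<^bsub>grp (quot_complex C D) n\<^esub> (qcl n x) = qcl n (inv\<^bsub>grp C n\<^esub> x)"
  unfolding quot_grp by (rule FactGroup_inv[OF sub])

lemmas qcl_eq_iff = rcos_eq_iff[OF sub]
lemmas qcl_UN = rcos_UN[OF sub]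

lemma qcl_eq_one_iff: "x \<in> carrier (grp C n) \<Longrightarrow> qcl n x = \<one>\<^bsub>grp (quot_complex C D) n\<^esub> \<longleftrightarrow> x \<in> D n"
proof -
  assume x: "x \<in> carrier (grp C n)"
  have "D n \<subseteq> carrier (grp C n)" using sub_closed by blast
  then show ?thesis
    unfolding quot_grp one_FactGroup using coset_join1[OF _ x sub] coset_join2[OF x sub] by blast
qed

lemma qcl_cbd:
  assumes x: "x \<in> carrier (grp C n)" and m: "m = n + 1"
  shows "cbd (quot_complex C D) n (qcl n x) = qcl m (cbd C n x)"
  unfolding quot_complex_def cochain_complex.simps
proof (rule qcl_UN[OF x])
  fix h assume h: "h \<in> D n"
  have "cbd C n (h \<otimes>\<^bsub>grp C n\<^esub> x) = cbd C n h \<otimes>\<^bsub>grp C m\<^esub> cbd C n x"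
    using h x m by (simp add: cbd_mult sub_closed)
  then show "qcl (n + 1) (cbd C n (h \<otimes>\<^bsub>grp C n\<^esub> x)) = qcl m (cbd C n x)"
    using h x m sub_cbd[OF h] unfolding m by (intro qcl_eq_iff[THEN iffD2] bexI[of _ "cbd C n h"])
      (simp_all add: cbd_closed sub_closed)
qed

sublocale quot: cochain "quot_complex C D"
proof (rule cochain.intro)
  show "comm_group (grp (quot_complex C D) n)" for n by (rule quot_comm_group)
  show "cbd (quot_complex C D) n \<in> hom (grp (quot_complex C D) n) (grp (quot_complex C D) (n + 1))" for n
    by (rule homI; elim qcl_elem)
      (simp_all add: qcl_cbd[where m = "n + 1"] qcl_mult qcl_closed cbd_closed cbd_mult[where m = "n + 1"])
  show "cbd (quot_complex C D) (n + 1) (cbd (quot_complex C D) n U) = \<one>\<^bsub>grp (quot_complex C D) (n + 2)\<^esub>"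
    if "U \<in> carrier (grp (quot_complex C D) n)" for n U
    using that
    by (elim qcl_elem) (simp add: qcl_cbd[where m = "n + 1"] qcl_cbd[where m = "n + 2"] cbd_closed
        cbd_cbd[where k = "n + 2"] qcl_eq_one_iff subgroup.one_closed[OF sub])
qed

abbreviation scl :: "int \<Rightarrow> 'a \<Rightarrow> 'a set set" where
  "scl n x \<equiv> coh_class (quot_complex C D) n (qcl n x)"

text \<open>Stable cocycles are handled through representing cochains: a coset is a cocycle of the
  quotient when the coboundary of its representative falls into the subcomplex.\<close>

lemma quot_Z_iff: "x \<in> carrier (grp C n) \<Longrightarrow> qcl n x \<in> quot.Z n \<longleftrightarrow> cbd C n x \<in> D (n + 1)"
  by (simp add: quot.Z_iff qcl_closed qcl_cbd[where m = "n + 1"] qcl_eq_one_iff cbd_closed)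

lemma quot_Z: "x \<in> carrier (grp C n) \<Longrightarrow> cbd C n x \<in> D m \<Longrightarrow> m = n + 1 \<Longrightarrow> qcl n x \<in> quot.Z n"
  using quot_Z_iff by simp

lemma scl_elem:
  assumes "U \<in> carrier (cohomology (quot_complex C D) n)"
  obtains x where "x \<in> carrier (grp C n)" "cbd C n x \<in> D (n + 1)" "U = scl n x"
proof -
  obtain V where V: "V \<in> quot.Z n" "U = coh_class (quot_complex C D) n V" using assms quot.coh_elem by blast
  then obtain x where "x \<in> carrier (grp C n)" "V = qcl n x" using quot.Z_closed qcl_elem by metis
  with V show thesis using that quot_Z_iff by blast
qed

text \<open>A class here is a coset of cosets. Unfolding both layers leaves one coboundary, from
  cohomology, and one element of the subcomplex, from the quotient.\<close>

lemma scl_eq_iff: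
  assumes x: "x \<in> carrier (grp C n)" "cbd C n x \<in> D (n + 1)"
    and y: "y \<in> carrier (grp C n)" "cbd C n y \<in> D (n + 1)"
  shows "scl n x = scl n y \<longleftrightarrow> (\<exists>g \<in> carrier (grp C (n - 1)). \<exists>h \<in> D n.
    x = h \<otimes>\<^bsub>grp C n\<^esub> (cbd C (n - 1) g \<otimes>\<^bsub>grp C n\<^esub> y))"
proof -
  have "scl n x = scl n y \<longleftrightarrow> (\<exists>g \<in> carrier (grp C (n - 1)).
      qcl n x = qcl n (cbd C (n - 1) g) \<otimes>\<^bsub>grp (quot_complex C D) n\<^esub> qcl n y)"
    using x y by (subst quot.coh_class_eq_iff) (auto simp: quot_Z quot_carrier qcl_cbd[where m = n])
  also have "\<dots> \<longleftrightarrow> (\<exists>g \<in> carrier (grp C (n - 1)).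
      qcl n x = qcl n (cbd C (n - 1) g \<otimes>\<^bsub>grp C n\<^esub> y))"
    using x y cbd_closed[of _ "n - 1" n] by (auto simp: qcl_mult)
  finally show ?thesis
    using x y cbd_closed[of _ "n - 1" n] by (auto simp: qcl_eq_iff)
qed

text \<open>Cohomologous cocycles remain cohomologous in the quotient: the same cochain g serves,
  with the neutral element as the correction in the subcomplex.\<close>

lemma iota_class:
  assumes z: "z \<in> Z n"
  shows "(\<Union>\<alpha> \<in> coh_class C n z. scl n \<alpha>) = scl n z"
proof (rule coh_class_UN[OF z])
  fix w assume w: "w \<in> Z n" and "coh_class C n w = coh_class C n z"
  then obtain g where g: "g \<in> carrier (grp C (n - 1))" "w = cbd C (n - 1) g \<otimes>\<^bsub>grp C n\<^esub> z"
    using z coh_class_eq_iff by blast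
  have "\<one>\<^bsub>grp C n\<^esub> \<in> D n" "\<one>\<^bsub>grp C (n + 1)\<^esub> \<in> D (n + 1)" by (rule subgroup.one_closed[OF sub])+
  moreover have "w = \<one>\<^bsub>grp C n\<^esub> \<otimes>\<^bsub>grp C n\<^esub> (cbd C (n - 1) g \<otimes>\<^bsub>grp C n\<^esub> z)"
    using w g by (simp add: Z_closed)
  ultimately show "scl n w = scl n z"
    using w z g(1) by (subst scl_eq_iff) (auto simp: Z_iff)
qed

end

section \<open>Products on quotient complexes\<close>

definition quot_pair ::
    "'c cochain_complex \<Rightarrow> (int \<Rightarrow> 'c set) \<Rightarrow> (int \<Rightarrow> int \<Rightarrow> 'a \<Rightarrow> 'b \<Rightarrow> 'c) \<Rightarrow>
      int \<Rightarrow> int \<Rightarrow> 'a set \<Rightarrow> 'b set \<Rightarrow> 'c set" where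
  "quot_pair C D p m n U W = (\<Union>\<alpha> \<in> U. \<Union>\<beta> \<in> W. D (m + n) #>\<^bsub>grp C (m + n)\<^esub> p m n \<alpha> \<beta>)"

text \<open>The subcomplexes absorb products from both sides, as an ideal does; this is what lets
  the pairing descend to the quotients.\<close>

locale sub_pairing = dg_pairing A B C p + A: subcomplex A DA + B: subcomplex B DB + C: subcomplex C DC
  for A :: "'a cochain_complex" and B :: "'b cochain_complex" and C :: "'c cochain_complex" and p and DA DB DC +
  assumes sub_left: "\<lbrakk>x \<in> DA m; y \<in> carrier (grp B n)\<rbrakk> \<Longrightarrow> p m n x y \<in> DC (m + n)"
    and sub_right: "\<lbrakk>x \<in> carrier (grp A m); y \<in> DB n\<rbrakk> \<Longrightarrow> p m n x y \<in> DC (m + n)"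
begin

lemma quot_pair_qcl:
  assumes x: "x \<in> carrier (grp A m)" and y: "y \<in> carrier (grp B n)" and k: "k = m + n"
  shows "quot_pair C DC p m n (A.qcl m x) (B.qcl n y) = C.qcl k (p m n x y)"
  unfolding quot_pair_def
proof (intro A.qcl_UN[OF x] B.qcl_UN[OF y])
  fix g h assume g: "g \<in> DA m" and h: "h \<in> DB n"
  note closed = x y A.sub_closed[OF g] B.sub_closed[OF h]
  have "p m n (g \<otimes>\<^bsub>grp A m\<^esub> x) (h \<otimes>\<^bsub>grp B n\<^esub> y) =
      (p m n g (h \<otimes>\<^bsub>grp B n\<^esub> y) \<otimes>\<^bsub>grp C k\<^esub> p m n x h) \<otimes>\<^bsub>grp C k\<^esub> p m n x y"
    using closed k by (simp add: p_mult_left[where k = k] p_mult_right[where k = k] C.m_ac p_closed)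
  moreover have "p m n g (h \<otimes>\<^bsub>grp B n\<^esub> y) \<otimes>\<^bsub>grp C k\<^esub> p m n x h \<in> DC k"
    unfolding k using g h closed by (intro C.sub_mult sub_left sub_right) auto
  ultimately show "C.qcl (m + n) (p m n (g \<otimes>\<^bsub>grp A m\<^esub> x) (h \<otimes>\<^bsub>grp B n\<^esub> y)) = C.qcl k (p m n x y)"
    using closed unfolding k by (intro C.qcl_eq_iff[THEN iffD2]
        bexI[of _ "p m n g (h \<otimes>\<^bsub>grp B n\<^esub> y) \<otimes>\<^bsub>grp C (m + n)\<^esub> p m n x h"]) (simp_all add: p_closed)
qed

sublocale quot: dg_pairing "quot_complex A DA" "quot_complex B DB" "quot_complex C DC" "quot_pair C DC p"
proof (intro dg_pairing.intro dg_pairing_axioms.intro A.quot.cochain_axioms B.quot.cochain_axioms C.quot.cochain_axioms)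
  show "graded_pairing (grp (quot_complex A DA)) (grp (quot_complex B DB)) (grp (quot_complex C DC)) (quot_pair C DC p)"
    unfolding graded_pairing_def
    by (intro conjI allI ballI; elim A.qcl_elem B.qcl_elem)
      (auto simp: quot_pair_qcl A.qcl_mult B.qcl_mult C.qcl_mult C.qcl_closed p_closed
          p_mult_left[OF _ _ _ refl] p_mult_right[OF _ _ _ refl])
  fix U W m n
  assume "U \<in> carrier (grp (quot_complex A DA) m)" "W \<in> carrier (grp (quot_complex B DB) n)"
  then obtain x y where x: "x \<in> carrier (grp A m)" "U = A.qcl m x"
    and y: "y \<in> carrier (grp B n)" "W = B.qcl n y" using A.qcl_elem B.qcl_elem by metis
  show "cbd (quot_complex C DC) (m + n) (quot_pair C DC p m n U W) =
      quot_pair C DC p (m + 1) n (cbd (quot_complex A DA) m U) W \<otimes>\<^bsub>grp (quot_complex C DC) (m + n + 1)\<^esub>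
        (if even m then quot_pair C DC p m (n + 1) U (cbd (quot_complex B DB) n W)
         else inv\<^bsub>grp (quot_complex C DC) (m + n + 1)\<^esub> (quot_pair C DC p m (n + 1) U (cbd (quot_complex B DB) n W)))"
    using x y
    by (simp add: quot_pair_qcl[where k = "m + n"] A.qcl_cbd[where m = "m + 1"] B.qcl_cbd[where m = "n + 1"]
        C.qcl_cbd[where m = "m + n + 1"] p_closed A.cbd_closed B.cbd_closed leibniz
        quot_pair_qcl[where k = "m + n + 1"] C.qcl_inv C.qcl_mult)
qed

lemma coh_pair_scl:
  assumes "x \<in> carrier (grp A m)" "cbd A m x \<in> DA (m + 1)" "y \<in> carrier (grp B n)" "cbd B n y \<in> DB (n + 1)"
    "k = m + n"
  shows "coh_pair (quot_complex C DC) (quot_pair C DC p) m n (A.scl m x) (B.scl n y) = C.scl k (p m n x y)"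
  using assms by (simp add: quot.coh_pair_class A.quot_Z B.quot_Z quot_pair_qcl)

text \<open>Read off in the quotient, where a product of two cocycles is already known to be a
  cocycle, instead of going through the Leibniz rule again.\<close>

lemma p_sub_cbd:
  assumes "x \<in> carrier (grp A m)" "cbd A m x \<in> DA (m + 1)" "y \<in> carrier (grp B n)" "cbd B n y \<in> DB (n + 1)"
    "k = m + n"
  shows "cbd C k (p m n x y) \<in> DC (k + 1)"
proof -
  have "quot_pair C DC p m n (A.qcl m x) (B.qcl n y) \<in> C.quot.Z k"
    using assms by (intro quot.p_Z A.quot_Z B.quot_Z) auto
  then have "C.qcl k (p m n x y) \<in> C.quot.Z k"
    using quot_pair_qcl[OF assms(1,3,5)] by simp
  moreover have "p m n x y \<in> carrier (grp C k)" using assms by (intro p_closed)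
  ultimately show ?thesis using C.quot_Z_iff by blast
qed

end

section \<open>Elementary facts on left modules and linear maps\<close>

lemma (in left_module) smult_l_null: "x \<in> carrier M \<Longrightarrow> \<zero>\<^bsub>R\<^esub> \<odot>\<^bsub>M\<^esub> x = \<zero>\<^bsub>M\<^esub>"
  using smult_l_distr[of "\<zero>\<^bsub>R\<^esub>" "\<zero>\<^bsub>R\<^esub>" x] smult_closed[of "\<zero>\<^bsub>R\<^esub>" x] by simp

lemma (in left_module) smult_r_null: "a \<in> carrier R \<Longrightarrow> a \<odot>\<^bsub>M\<^esub> \<zero>\<^bsub>M\<^esub> = \<zero>\<^bsub>M\<^esub>"
  using smult_r_distr[of a "\<zero>\<^bsub>M\<^esub>" "\<zero>\<^bsub>M\<^esub>"] smult_closed[of a "\<zero>\<^bsub>M\<^esub>"] by simp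

lemma (in left_module) smult_r_minus:
  assumes "a \<in> carrier R" "x \<in> carrier M"
  shows "a \<odot>\<^bsub>M\<^esub> (\<ominus>\<^bsub>M\<^esub> x) = \<ominus>\<^bsub>M\<^esub> (a \<odot>\<^bsub>M\<^esub> x)"
proof -
  have "a \<odot>\<^bsub>M\<^esub> (\<ominus>\<^bsub>M\<^esub> x) \<oplus>\<^bsub>M\<^esub> a \<odot>\<^bsub>M\<^esub> x = \<zero>\<^bsub>M\<^esub>"
    using assms smult_r_distr[of a "\<ominus>\<^bsub>M\<^esub> x" x] by (simp add: M.l_neg smult_r_null)
  then show ?thesis using assms M.minus_equality by (simp add: smult_closed)
qed

lemma (in left_module) smult_r_diff:
  assumes "a \<in> carrier R" "x \<in> carrier M" "y \<in> carrier M"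
  shows "a \<odot>\<^bsub>M\<^esub> (x \<ominus>\<^bsub>M\<^esub> y) = a \<odot>\<^bsub>M\<^esub> x \<ominus>\<^bsub>M\<^esub> a \<odot>\<^bsub>M\<^esub> y"
  using assms by (simp add: M.minus_eq smult_r_distr smult_r_minus)

lemma (in abelian_group) diff_eq_zero_iff: "x \<in> carrier G \<Longrightarrow> y \<in> carrier G \<Longrightarrow> x \<ominus> y = \<zero> \<longleftrightarrow> x = y"
  by (metis a_inv_closed add.inv_equality add.inv_inv minus_eq r_neg)

lemma (in abelian_group) diff_self: "x \<in> carrier G \<Longrightarrow> x \<ominus> x = \<zero>"
  by (simp add: minus_eq r_neg)

lemma (in abelian_group) diff_zero: "x \<in> carrier G \<Longrightarrow> x \<ominus> \<zero> = x"
  by (simp add: minus_eq)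

lemma left_module_abelian_group: "left_module R M \<Longrightarrow> abelian_group M"
  by (simp add: left_module_def)

lemma lin_homI:
  assumes "\<And>x. x \<in> carrier X \<Longrightarrow> h x \<in> carrier Y"
    and "\<And>x y. \<lbrakk>x \<in> carrier X; y \<in> carrier X\<rbrakk> \<Longrightarrow> h (x \<oplus>\<^bsub>X\<^esub> y) = h x \<oplus>\<^bsub>Y\<^esub> h y"
    and "\<And>a x. \<lbrakk>a \<in> carrier R; x \<in> carrier X\<rbrakk> \<Longrightarrow> h (a \<odot>\<^bsub>X\<^esub> x) = a \<odot>\<^bsub>Y\<^esub> h x"
    and "left_module R X"
  shows "(\<lambda>x \<in> carrier X. h x) \<in> lin_hom R X Y"
proof -
  interpret X: left_module R X by (rule assms(4))
  show ?thesis using assms(1-3) by (auto simp: lin_hom_def X.smult_closed)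
qed

lemma lin_hom_closed: "h \<in> lin_hom R X Y \<Longrightarrow> x \<in> carrier X \<Longrightarrow> h x \<in> carrier Y"
  by (auto simp: lin_hom_def)

lemma lin_hom_add: "h \<in> lin_hom R X Y \<Longrightarrow> x \<in> carrier X \<Longrightarrow> y \<in> carrier X \<Longrightarrow> h (x \<oplus>\<^bsub>X\<^esub> y) = h x \<oplus>\<^bsub>Y\<^esub> h y"
  by (auto simp: lin_hom_def)

lemma lin_hom_smult: "h \<in> lin_hom R X Y \<Longrightarrow> a \<in> carrier R \<Longrightarrow> x \<in> carrier X \<Longrightarrow> h (a \<odot>\<^bsub>X\<^esub> x) = a \<odot>\<^bsub>Y\<^esub> h x"
  by (auto simp: lin_hom_def)

lemma lin_hom_extensional: "h \<in> lin_hom R X Y \<Longrightarrow> h \<in> extensional (carrier X)"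
  by (auto simp: lin_hom_def PiE_def)

lemma lin_hom_eqI:
  assumes "h \<in> lin_hom R X Y" "k \<in> lin_hom R X Y'" "\<And>x. x \<in> carrier X \<Longrightarrow> h x = k x"
  shows "h = k"
  using assms lin_hom_extensional extensionalityI by metis

lemma lin_hom_zero:
  assumes "h \<in> lin_hom R X Y" "abelian_group X" "abelian_group Y"
  shows "h \<zero>\<^bsub>X\<^esub> = \<zero>\<^bsub>Y\<^esub>"
proof -
  interpret X: abelian_group X by fact
  interpret Y: abelian_group Y by fact
  have "h \<zero>\<^bsub>X\<^esub> \<oplus>\<^bsub>Y\<^esub> h \<zero>\<^bsub>X\<^esub> = h \<zero>\<^bsub>X\<^esub>"
    using lin_hom_add[OF assms(1), of "\<zero>\<^bsub>X\<^esub>" "\<zero>\<^bsub>X\<^esub>"] by simp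
  then show ?thesis using lin_hom_closed[OF assms(1)] by simp
qed

lemma lin_hom_minus:
  assumes "h \<in> lin_hom R X Y" "abelian_group X" "abelian_group Y" "x \<in> carrier X"
  shows "h (\<ominus>\<^bsub>X\<^esub> x) = \<ominus>\<^bsub>Y\<^esub> h x"
proof -
  interpret X: abelian_group X by fact
  interpret Y: abelian_group Y by fact
  have "h (\<ominus>\<^bsub>X\<^esub> x) \<oplus>\<^bsub>Y\<^esub> h x = \<zero>\<^bsub>Y\<^esub>"
    using lin_hom_add[OF assms(1), of "\<ominus>\<^bsub>X\<^esub> x" x] lin_hom_zero[OF assms(1-3)] assms(4) by (simp add: X.l_neg)
  then show ?thesis using lin_hom_closed[OF assms(1)] assms(4) by (simp add: Y.minus_equality)
qed

lemma lin_hom_diff: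
  assumes "h \<in> lin_hom R X Y" "abelian_group X" "abelian_group Y" "x \<in> carrier X" "y \<in> carrier X"
  shows "h (x \<ominus>\<^bsub>X\<^esub> y) = h x \<ominus>\<^bsub>Y\<^esub> h y"
proof -
  interpret X: abelian_group X by fact
  interpret Y: abelian_group Y by fact
  show ?thesis using assms by (simp add: X.minus_eq Y.minus_eq lin_hom_add[OF assms(1)] lin_hom_minus[OF assms(1-3)])
qed

lemma lin_hom_compose:
  assumes "g \<in> lin_hom R Y Z" "h \<in> lin_hom R X Y" "left_module R X"
  shows "compose (carrier X) g h \<in> lin_hom R X Z"
  unfolding compose_def using assms(3)
  by (intro lin_homI) (simp_all add: lin_hom_add[OF assms(1)] lin_hom_add[OF assms(2)]
      lin_hom_smult[OF assms(1)] lin_hom_smult[OF assms(2)] lin_hom_closed[OF assms(1)] lin_hom_closed[OF assms(2)])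

lemma lin_hom_plus:
  assumes "g \<in> lin_hom R X Y" "h \<in> lin_hom R X Y" "left_module R X" "left_module R Y"
  shows "(\<lambda>x \<in> carrier X. g x \<oplus>\<^bsub>Y\<^esub> h x) \<in> lin_hom R X Y"
proof -
  interpret Y: left_module R Y by fact
  show ?thesis using assms
    by (intro lin_homI) (auto simp: lin_hom_closed[OF assms(1)] lin_hom_closed[OF assms(2)]
      lin_hom_add[OF assms(1)] lin_hom_add[OF assms(2)] lin_hom_smult[OF assms(1)] lin_hom_smult[OF assms(2)]
      Y.smult_r_distr Y.M.a_ac)
qed

lemma lin_hom_uminus:
  assumes "g \<in> lin_hom R X Y" "left_module R X" "left_module R Y"
  shows "(\<lambda>x \<in> carrier X. \<ominus>\<^bsub>Y\<^esub> g x) \<in> lin_hom R X Y"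
proof -
  interpret Y: left_module R Y by fact
  show ?thesis using assms
    by (intro lin_homI) (auto simp: lin_hom_closed[OF assms(1)]
      lin_hom_add[OF assms(1)] lin_hom_smult[OF assms(1)] Y.smult_r_minus Y.M.minus_add)
qed

lemma lin_hom_sub:
  assumes "g \<in> lin_hom R X Y" "h \<in> lin_hom R X Y" "left_module R X" "left_module R Y"
  shows "(\<lambda>x \<in> carrier X. g x \<ominus>\<^bsub>Y\<^esub> h x) \<in> lin_hom R X Y"
proof -
  interpret Y: left_module R Y by fact
  have "(\<lambda>x \<in> carrier X. g x \<ominus>\<^bsub>Y\<^esub> h x) = (\<lambda>x \<in> carrier X. g x \<oplus>\<^bsub>Y\<^esub> (\<lambda>x \<in> carrier X. \<ominus>\<^bsub>Y\<^esub> h x) x)"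
    by (auto simp: Y.M.minus_eq)
  then show ?thesis using lin_hom_plus[OF assms(1) lin_hom_uminus[OF assms(2-4)] assms(3,4)] by simp
qed

lemma lin_hom_const_zero:
  assumes "left_module R X" "left_module R Y"
  shows "(\<lambda>x \<in> carrier X. \<zero>\<^bsub>Y\<^esub>) \<in> lin_hom R X Y"
proof -
  interpret Y: left_module R Y by fact
  show ?thesis using assms by (intro lin_homI) (auto simp: Y.smult_r_null)
qed

lemma lin_hom_id: "left_module R X \<Longrightarrow> (\<lambda>x \<in> carrier X. x) \<in> lin_hom R X X"
  by (intro lin_homI) auto

lemma lin_hom_finsum:
  assumes h: "h \<in> lin_hom R X Y" and X: "abelian_group X" and Y: "abelian_group Y"
    and e: "e \<in> S \<rightarrow> carrier X" and "finite S"
  shows "h (finsum X e S) = finsum Y (\<lambda>b. h (e b)) S"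
proof -
  interpret X: abelian_group X by fact
  interpret Y: abelian_group Y by fact
  show ?thesis using \<open>finite S\<close> e
  proof (induction S)
    case empty
    then show ?case using lin_hom_zero[OF h X Y] by simp
  next
    case (insert b S)
    then have "e \<in> S \<rightarrow> carrier X" "e b \<in> carrier X" "(\<lambda>b. h (e b)) \<in> S \<rightarrow> carrier Y" "h (e b) \<in> carrier Y"
      using lin_hom_closed[OF h] by auto
    then show ?case using insert by (simp add: lin_hom_add[OF h] X.finsum_closed)
  qed
qed

section \<open>Free modules and the lifting property\<close>

text \<open>The functions are extensional, so equality is equality on \<open>B\<close>. With
  \<open>B\<close> the carrier of a module, the free module has the type of the larger test modules
  in \<open>projective_module\<close>.\<close>

definition free_module :: "'a ring \<Rightarrow> 'b set \<Rightarrow> ('a, 'b \<Rightarrow> 'a) module" where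
  "free_module R B =
    \<lparr>carrier = {c \<in> B \<rightarrow>\<^sub>E carrier R. finite {b \<in> B. c b \<noteq> \<zero>\<^bsub>R\<^esub>}},
     monoid.mult = undefined, one = undefined,
     ring.zero = (\<lambda>b \<in> B. \<zero>\<^bsub>R\<^esub>), add = (\<lambda>c d. \<lambda>b \<in> B. c b \<oplus>\<^bsub>R\<^esub> d b),
     smult = (\<lambda>a c. \<lambda>b \<in> B. a \<otimes>\<^bsub>R\<^esub> c b)\<rparr>"

lemma free_module_elem:
  assumes "c \<in> carrier (free_module R B)"
  shows "b \<in> B \<Longrightarrow> c b \<in> carrier R" "finite {b \<in> B. c b \<noteq> \<zero>\<^bsub>R\<^esub>}"
  using assms by (auto simp: free_module_def)

lemma free_module_eqI:
  assumes "c \<in> carrier (free_module R B)" "d \<in> carrier (free_module R B)" "\<And>b. b \<in> B \<Longrightarrow> c b = d b"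
  shows "c = d"
proof -
  have "c \<in> extensional B" "d \<in> extensional B" using assms(1,2) by (simp_all add: free_module_def PiE_def)
  then show ?thesis using assms(3) by (rule extensionalityI)
qed

lemma free_module_carrierI:
  assumes "\<And>b. b \<in> B \<Longrightarrow> g b \<in> carrier R" "finite S" "\<And>b. b \<in> B \<Longrightarrow> b \<notin> S \<Longrightarrow> g b = \<zero>\<^bsub>R\<^esub>"
  shows "(\<lambda>b \<in> B. g b) \<in> carrier (free_module R B)"
proof -
  have "{b \<in> B. (\<lambda>b \<in> B. g b) b \<noteq> \<zero>\<^bsub>R\<^esub>} \<subseteq> S" using assms(3) by auto
  then have "finite {b \<in> B. (\<lambda>b \<in> B. g b) b \<noteq> \<zero>\<^bsub>R\<^esub>}" using assms(2) finite_subset by blast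
  moreover have "(\<lambda>b \<in> B. g b) \<in> B \<rightarrow>\<^sub>E carrier R" using assms(1) by auto
  ultimately show ?thesis unfolding free_module_def by simp
qed

lemma free_module_left_module:
  assumes "ring R"
  shows "left_module R (free_module R B)"
proof -
  interpret R: ring R by fact
  let ?L = "free_module R B"
  have add_eq: "c \<oplus>\<^bsub>?L\<^esub> d = (\<lambda>b \<in> B. c b \<oplus>\<^bsub>R\<^esub> d b)"
    and smult_eq: "a \<odot>\<^bsub>?L\<^esub> c = (\<lambda>b \<in> B. a \<otimes>\<^bsub>R\<^esub> c b)"
    and zero_eq: "\<zero>\<^bsub>?L\<^esub> = (\<lambda>b \<in> B. \<zero>\<^bsub>R\<^esub>)" for a c d by (simp_all add: free_module_def)
  note el = free_module_elem
  note eqI = free_module_eqI[of _ R B]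
  have add: "c \<oplus>\<^bsub>?L\<^esub> d \<in> carrier ?L" if "c \<in> carrier ?L" "d \<in> carrier ?L" for c d
    unfolding add_eq
    by (rule free_module_carrierI[OF _ finite_UnI[OF el(2)[OF that(1)] el(2)[OF that(2)]]])
      (use el(1)[OF that(1)] el(1)[OF that(2)] in auto)
  have smult: "a \<odot>\<^bsub>?L\<^esub> c \<in> carrier ?L" if "a \<in> carrier R" "c \<in> carrier ?L" for a c
    unfolding smult_eq
    by (rule free_module_carrierI[OF _ el(2)[OF that(2)]]) (use that(1) el(1)[OF that(2)] in auto)
  have zero: "\<zero>\<^bsub>?L\<^esub> \<in> carrier ?L" unfolding zero_eq by (rule free_module_carrierI[of _ _ _ "{}"]) auto
  have minus: "(\<lambda>b \<in> B. \<ominus>\<^bsub>R\<^esub> c b) \<in> carrier ?L" if "c \<in> carrier ?L" for c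
    by (rule free_module_carrierI[OF _ el(2)[OF that]]) (use el(1)[OF that] in auto)
  have ag: "abelian_group ?L"
  proof (rule abelian_groupI)
    fix c d assume c: "c \<in> carrier ?L" and d: "d \<in> carrier ?L"
    show "c \<oplus>\<^bsub>?L\<^esub> d = d \<oplus>\<^bsub>?L\<^esub> c"
      using c d by (intro eqI add) (simp_all add: add_eq R.a_comm el(1))
    show "c \<oplus>\<^bsub>?L\<^esub> d \<oplus>\<^bsub>?L\<^esub> e = c \<oplus>\<^bsub>?L\<^esub> (d \<oplus>\<^bsub>?L\<^esub> e)" if "e \<in> carrier ?L" for e
      using c d that by (intro eqI add) (simp_all add: add_eq R.a_assoc el(1))
    show "\<zero>\<^bsub>?L\<^esub> \<oplus>\<^bsub>?L\<^esub> c = c"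
      using c by (intro eqI add zero) (simp_all add: add_eq zero_eq el(1))
    show "\<exists>d\<in>carrier ?L. d \<oplus>\<^bsub>?L\<^esub> c = \<zero>\<^bsub>?L\<^esub>"
      using c by (intro bexI[OF _ minus] eqI add zero minus) (simp_all add: add_eq zero_eq R.l_neg el(1))
  qed (simp_all add: add zero)
  show ?thesis
  proof (intro left_module.intro left_module_axioms.intro assms ag)
    fix a b c d assume a: "a \<in> carrier R" and c: "c \<in> carrier ?L"
    show "a \<odot>\<^bsub>?L\<^esub> c \<in> carrier ?L" by (rule smult[OF a c])
    show "(a \<oplus>\<^bsub>R\<^esub> b) \<odot>\<^bsub>?L\<^esub> c = a \<odot>\<^bsub>?L\<^esub> c \<oplus>\<^bsub>?L\<^esub> b \<odot>\<^bsub>?L\<^esub> c" if "b \<in> carrier R"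
      using a c that by (intro eqI add smult) (simp_all add: add_eq smult_eq R.l_distr el(1))
    show "(a \<otimes>\<^bsub>R\<^esub> b) \<odot>\<^bsub>?L\<^esub> c = a \<odot>\<^bsub>?L\<^esub> (b \<odot>\<^bsub>?L\<^esub> c)" if "b \<in> carrier R"
      using a c that by (intro eqI add smult) (simp_all add: smult_eq R.m_assoc el(1))
    show "a \<odot>\<^bsub>?L\<^esub> (c \<oplus>\<^bsub>?L\<^esub> d) = a \<odot>\<^bsub>?L\<^esub> c \<oplus>\<^bsub>?L\<^esub> a \<odot>\<^bsub>?L\<^esub> d" if "d \<in> carrier ?L"
      using a c that by (intro eqI add smult) (simp_all add: add_eq smult_eq R.r_distr el(1))
  next
    fix c assume c: "c \<in> carrier ?L"
    then show "\<one>\<^bsub>R\<^esub> \<odot>\<^bsub>?L\<^esub> c = c"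
      by (intro eqI smult) (simp_all add: smult_eq el(1))
  qed
qed

text \<open>The linear map out of the free module that is prescribed by \<open>e\<close> on the
  basis. The index set of the sum is the support of \<open>c\<close> and thus varies with
  \<open>c\<close>.\<close>

definition lincomb :: "'a ring \<Rightarrow> ('a, 'x) module \<Rightarrow> 'b set \<Rightarrow> ('b \<Rightarrow> 'x) \<Rightarrow> ('b \<Rightarrow> 'a) \<Rightarrow> 'x" where
  "lincomb R X B e = (\<lambda>c \<in> carrier (free_module R B).
     finsum X (\<lambda>b. c b \<odot>\<^bsub>X\<^esub> e b) {b \<in> B. c b \<noteq> \<zero>\<^bsub>R\<^esub>})"

context left_module
begin

text \<open>Additivity compares sums over three different supports; coefficients outside the support
  contribute zero, so all three can be taken over a common finite set.\<close>

lemma lincomb_superset: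
  assumes c: "c \<in> carrier (free_module R B)" and e: "e \<in> B \<rightarrow> carrier M"
    and S: "finite S" "S \<subseteq> B" "{b \<in> B. c b \<noteq> \<zero>\<^bsub>R\<^esub>} \<subseteq> S"
  shows "lincomb R M B e c = finsum M (\<lambda>b. c b \<odot>\<^bsub>M\<^esub> e b) S"
proof -
  have "finsum M (\<lambda>b. c b \<odot>\<^bsub>M\<^esub> e b) {b \<in> B. c b \<noteq> \<zero>\<^bsub>R\<^esub>} = finsum M (\<lambda>b. c b \<odot>\<^bsub>M\<^esub> e b) S"
    using c e S funcset_mem[OF e] by (intro M.add.finprod_mono_neutral_cong_left)
      (auto simp: smult_l_null free_module_elem(1)[OF c] intro!: smult_closed)
  then show ?thesis using c by (simp add: lincomb_def)
qed

lemma lincomb_lin_hom: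
  assumes e: "e \<in> B \<rightarrow> carrier M"
  shows "lincomb R M B e \<in> lin_hom R (free_module R B) M"
proof -
  interpret L: left_module R "free_module R B" by (rule free_module_left_module) (rule R.ring_axioms)
  have tm: "c b \<odot>\<^bsub>M\<^esub> e b \<in> carrier M" if "c \<in> carrier (free_module R B)" "b \<in> B" for c b
    using that e by (auto simp: free_module_def PiE_iff intro!: smult_closed)
  have cb: "c b \<in> carrier R" if "c \<in> carrier (free_module R B)" "b \<in> B" for c b
    using that by (auto simp: free_module_def PiE_iff)
  have fin: "finite {b \<in> B. c b \<noteq> \<zero>\<^bsub>R\<^esub>}" if "c \<in> carrier (free_module R B)" for c
    using that by (auto simp: free_module_def)
  have "(\<lambda>c \<in> carrier (free_module R B). lincomb R M B e c) \<in> lin_hom R (free_module R B) M"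
  proof (rule lin_homI)
    show "lincomb R M B e c \<in> carrier M" if "c \<in> carrier (free_module R B)" for c
    proof -
      have "finsum M (\<lambda>b. c b \<odot>\<^bsub>M\<^esub> e b) {b \<in> B. c b \<noteq> \<zero>\<^bsub>R\<^esub>} \<in> carrier M"
        by (rule M.finsum_closed) (use tm[OF that] in blast)
      then show ?thesis using that by (simp add: lincomb_def)
    qed
  next
    fix c d assume c: "c \<in> carrier (free_module R B)" and d: "d \<in> carrier (free_module R B)"
    let ?S = "{b \<in> B. c b \<noteq> \<zero>\<^bsub>R\<^esub>} \<union> {b \<in> B. d b \<noteq> \<zero>\<^bsub>R\<^esub>}"
    have S: "finite ?S" "?S \<subseteq> B" using fin c d by auto
    have cd: "c \<oplus>\<^bsub>free_module R B\<^esub> d \<in> carrier (free_module R B)" using c d by simp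
    have val: "(c \<oplus>\<^bsub>free_module R B\<^esub> d) b = c b \<oplus>\<^bsub>R\<^esub> d b" if "b \<in> B" for b
      using that by (simp add: free_module_def)
    have "lincomb R M B e (c \<oplus>\<^bsub>free_module R B\<^esub> d) =
        finsum M (\<lambda>b. (c \<oplus>\<^bsub>free_module R B\<^esub> d) b \<odot>\<^bsub>M\<^esub> e b) ?S"
      by (rule lincomb_superset[OF cd e S]) (auto simp: val)
    also have "\<dots> = finsum M (\<lambda>b. c b \<odot>\<^bsub>M\<^esub> e b \<oplus>\<^bsub>M\<^esub> d b \<odot>\<^bsub>M\<^esub> e b) ?S"
    proof (rule M.finsum_cong'[OF refl])
      show "(\<lambda>b. c b \<odot>\<^bsub>M\<^esub> e b \<oplus>\<^bsub>M\<^esub> d b \<odot>\<^bsub>M\<^esub> e b) \<in> ?S \<rightarrow> carrier M"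
        using tm[OF c] tm[OF d] by auto
      fix b assume "b \<in> ?S"
      then have b: "b \<in> B" by blast
      show "(c \<oplus>\<^bsub>free_module R B\<^esub> d) b \<odot>\<^bsub>M\<^esub> e b = c b \<odot>\<^bsub>M\<^esub> e b \<oplus>\<^bsub>M\<^esub> d b \<odot>\<^bsub>M\<^esub> e b"
        unfolding val[OF b] by (rule smult_l_distr[OF cb[OF c b] cb[OF d b] funcset_mem[OF e b]])
    qed
    also have "\<dots> = finsum M (\<lambda>b. c b \<odot>\<^bsub>M\<^esub> e b) ?S \<oplus>\<^bsub>M\<^esub> finsum M (\<lambda>b. d b \<odot>\<^bsub>M\<^esub> e b) ?S"
      by (rule M.finsum_addf) (use tm[OF c] tm[OF d] in auto)
    also have "\<dots> = lincomb R M B e c \<oplus>\<^bsub>M\<^esub> lincomb R M B e d"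
      using lincomb_superset[OF c e S] lincomb_superset[OF d e S] by simp
    finally show "lincomb R M B e (c \<oplus>\<^bsub>free_module R B\<^esub> d) = lincomb R M B e c \<oplus>\<^bsub>M\<^esub> lincomb R M B e d" .
  next
    fix a c assume a: "a \<in> carrier R" and c: "c \<in> carrier (free_module R B)"
    let ?S = "{b \<in> B. c b \<noteq> \<zero>\<^bsub>R\<^esub>}"
    have S: "finite ?S" "?S \<subseteq> B" using fin c by auto
    have ac: "a \<odot>\<^bsub>free_module R B\<^esub> c \<in> carrier (free_module R B)" using a c by (simp add: L.smult_closed)
    have val: "(a \<odot>\<^bsub>free_module R B\<^esub> c) b = a \<otimes>\<^bsub>R\<^esub> c b" if "b \<in> B" for b
      using that by (simp add: free_module_def)
    have "(\<lambda>x \<in> carrier M. a \<odot>\<^bsub>M\<^esub> x) (finsum M (\<lambda>b. c b \<odot>\<^bsub>M\<^esub> e b) ?S) =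
        finsum M (\<lambda>b. (\<lambda>x \<in> carrier M. a \<odot>\<^bsub>M\<^esub> x) (c b \<odot>\<^bsub>M\<^esub> e b)) ?S"
    proof -
      \<comment> \<open>Multiplication by a is additive, but not linear over a noncommutative ring.
        Over an empty set of scalars additivity is all that linearity asks, and this suffices to
        move the map through the finite sum.\<close>
      have "(\<lambda>x \<in> carrier M. a \<odot>\<^bsub>M\<^esub> x) \<in> lin_hom (R\<lparr>carrier := {}\<rparr>) M M"
        using a by (auto simp: lin_hom_def smult_closed smult_r_distr)
      then show ?thesis
        by (rule lin_hom_finsum[OF _ M.abelian_group_axioms M.abelian_group_axioms]) (use S tm[OF c] in auto)
    qed
    moreover have "finsum M (\<lambda>b. (\<lambda>x \<in> carrier M. a \<odot>\<^bsub>M\<^esub> x) (c b \<odot>\<^bsub>M\<^esub> e b)) ?S =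
        finsum M (\<lambda>b. (a \<odot>\<^bsub>free_module R B\<^esub> c) b \<odot>\<^bsub>M\<^esub> e b) ?S"
    proof (rule M.finsum_cong'[OF refl])
      have eq: "(a \<odot>\<^bsub>free_module R B\<^esub> c) b \<odot>\<^bsub>M\<^esub> e b = a \<odot>\<^bsub>M\<^esub> (c b \<odot>\<^bsub>M\<^esub> e b)" if "b \<in> ?S" for b
        using that val smult_assoc[OF a cb[OF c] funcset_mem[OF e]] by simp
      show "(\<lambda>b. (a \<odot>\<^bsub>free_module R B\<^esub> c) b \<odot>\<^bsub>M\<^esub> e b) \<in> ?S \<rightarrow> carrier M"
        using tm[OF c] smult_closed[OF a] by (simp add: eq)
      fix b assume b: "b \<in> ?S"
      then show "(\<lambda>x \<in> carrier M. a \<odot>\<^bsub>M\<^esub> x) (c b \<odot>\<^bsub>M\<^esub> e b) = (a \<odot>\<^bsub>free_module R B\<^esub> c) b \<odot>\<^bsub>M\<^esub> e b"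
        using tm[OF c, of b] by (simp add: eq)
    qed
    moreover have "finsum M (\<lambda>b. (a \<odot>\<^bsub>free_module R B\<^esub> c) b \<odot>\<^bsub>M\<^esub> e b) ?S = lincomb R M B e (a \<odot>\<^bsub>free_module R B\<^esub> c)"
      by (rule lincomb_superset[OF ac e S, symmetric]) (use a in \<open>auto simp: val\<close>)
    moreover have "finsum M (\<lambda>b. c b \<odot>\<^bsub>M\<^esub> e b) ?S \<in> carrier M"
      by (rule M.finsum_closed) (use tm[OF c] in auto)
    ultimately show "lincomb R M B e (a \<odot>\<^bsub>free_module R B\<^esub> c) = a \<odot>\<^bsub>M\<^esub> lincomb R M B e c"
      using c by (simp add: lincomb_def)
  qed (rule L.left_module_axioms)
  moreover have "(\<lambda>c \<in> carrier (free_module R B). lincomb R M B e c) = lincomb R M B e"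
    by (auto simp: lincomb_def)
  ultimately show ?thesis by simp
qed

lemma lincomb_surj: "lincomb R M (carrier M) (\<lambda>x. x) ` carrier (free_module R (carrier M)) = carrier M"
proof -
  let ?L = "free_module R (carrier M)"
  have "x \<in> lincomb R M (carrier M) (\<lambda>x. x) ` carrier ?L" if x: "x \<in> carrier M" for x
  proof -
    let ?c = "\<lambda>b \<in> carrier M. if b = x then \<one>\<^bsub>R\<^esub> else \<zero>\<^bsub>R\<^esub>"
    have "{b \<in> carrier M. ?c b \<noteq> \<zero>\<^bsub>R\<^esub>} \<subseteq> {x}" by auto
    then have c: "?c \<in> carrier ?L" by (auto simp: free_module_def intro: finite_subset)
    have "lincomb R M (carrier M) (\<lambda>x. x) ?c = finsum M (\<lambda>b. ?c b \<odot>\<^bsub>M\<^esub> b) {x}"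
      using x by (intro lincomb_superset c) auto
    also have "\<dots> = x" using x by (simp add: M.finsum_insert[of "{}"] smult_one)
    finally show ?thesis using c by force
  qed
  moreover have "lincomb R M (carrier M) (\<lambda>x. x) \<in> lin_hom R ?L M" by (rule lincomb_lin_hom) auto
  ultimately show ?thesis by (auto dest: lin_hom_closed)
qed

end

text \<open>The support depends on the coefficients only, so both sides are sums over the same
  finite set and g can be applied term by term.\<close>

lemma lin_hom_lincomb:
  assumes g: "g \<in> lin_hom R X Y" and X: "left_module R X" and Y: "left_module R Y"
    and e: "e \<in> B \<rightarrow> carrier X" and c: "c \<in> carrier (free_module R B)"
  shows "g (lincomb R X B e c) = lincomb R Y B (\<lambda>b. g (e b)) c"
proof -
  interpret X: left_module R X by fact
  interpret Y: left_module R Y by fact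
  let ?S = "{b \<in> B. c b \<noteq> \<zero>\<^bsub>R\<^esub>}"
  have cb: "c b \<in> carrier R" if "b \<in> B" for b using that c by (auto simp: free_module_def PiE_iff)
  have "finite ?S" using c by (auto simp: free_module_def)
  then have "g (lincomb R X B e c) = finsum Y (\<lambda>b. g (c b \<odot>\<^bsub>X\<^esub> e b)) ?S"
    using c e cb X.M.abelian_group_axioms Y.M.abelian_group_axioms unfolding lincomb_def
    by (simp, intro lin_hom_finsum[OF g]) (auto intro!: X.smult_closed)
  also have "\<dots> = finsum Y (\<lambda>b. c b \<odot>\<^bsub>Y\<^esub> g (e b)) ?S"
    using e cb by (intro Y.M.finsum_cong') (auto simp: lin_hom_smult[OF g] Pi_def intro!: Y.smult_closed lin_hom_closed[OF g])
  finally show ?thesis using c by (simp add: lincomb_def)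
qed

text \<open>The identity is lifted along the canonical surjection from the free module on the
  carrier, which is among the test modules of the definition.\<close>

lemma projective_section:
  assumes "projective_module R P"
  shows "\<exists>s \<in> lin_hom R P (free_module R (carrier P)).
    \<forall>x \<in> carrier P. lincomb R P (carrier P) (\<lambda>x. x) (s x) = x"
proof -
  interpret P: left_module R P using assms by (simp add: projective_module_def)
  have L: "left_module R (free_module R (carrier P))"
    by (rule free_module_left_module) (rule P.R.ring_axioms)
  have l: "lincomb R P (carrier P) (\<lambda>x. x) \<in> lin_hom R (free_module R (carrier P)) P"
    by (rule P.lincomb_lin_hom) auto
  have "\<exists>s \<in> lin_hom R P (free_module R (carrier P)).
      \<forall>x \<in> carrier P. lincomb R P (carrier P) (\<lambda>x. x) (s x) = (\<lambda>x \<in> carrier P. x) x"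
    using assms l lin_hom_id[OF P.left_module_axioms] L P.left_module_axioms P.lincomb_surj
    unfolding projective_module_def by blast
  then show ?thesis by simp
qed

text \<open>The definition tests modules in two fixed types. Through the section into a free module,
  where maps can be prescribed on a basis, lifting follows against modules of any type. Surjectivity
  is replaced by a condition on the image of h, so that g may be a differential and h a map into its
  image.\<close>

lemma projective_lift:
  assumes P: "projective_module R P" and X: "left_module R X" and Y: "left_module R Y"
    and g: "g \<in> lin_hom R X Y" and h: "h \<in> lin_hom R P Y"
    and img: "\<And>x. x \<in> carrier P \<Longrightarrow> h x \<in> g ` carrier X"
  shows "\<exists>k \<in> lin_hom R P X. \<forall>x \<in> carrier P. g (k x) = h x"
proof -
  interpret P: left_module R P using P by (simp add: projective_module_def)
  interpret X: left_module R X by fact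
  let ?B = "carrier P"
  obtain s where s: "s \<in> lin_hom R P (free_module R ?B)"
    and s2: "\<forall>x \<in> ?B. lincomb R P ?B (\<lambda>x. x) (s x) = x"
    using projective_section[OF P] by blast
  \<comment> \<open>The basis of the free module is the whole carrier of P, so one preimage is
    chosen for every element of P; the resulting assignment is not linear, its extension to the free
    module is.\<close>
  have "\<forall>b \<in> ?B. \<exists>y. y \<in> carrier X \<and> g y = h b" using img by fastforce
  then obtain e where "\<forall>b \<in> ?B. e b \<in> carrier X \<and> g (e b) = h b" by (rule bchoice[THEN exE])
  then have e: "\<And>b. b \<in> ?B \<Longrightarrow> e b \<in> carrier X" "\<And>b. b \<in> ?B \<Longrightarrow> g (e b) = h b" by auto
  let ?k = "compose ?B (lincomb R X ?B e) s"
  have "?k \<in> lin_hom R P X"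
    using e by (intro lin_hom_compose[OF X.lincomb_lin_hom s] P.left_module_axioms) auto
  moreover have "g (?k x) = h x" if x: "x \<in> ?B" for x
  proof -
    have sx: "s x \<in> carrier (free_module R ?B)" using lin_hom_closed[OF s x] .
    have "g (?k x) = lincomb R Y ?B (\<lambda>b. g (e b)) (s x)"
      using x sx e by (simp add: compose_def) (intro lin_hom_lincomb[OF g X Y], auto)
    also have "\<dots> = lincomb R Y ?B h (s x)"
    proof -
      interpret Y: left_module R Y by fact
      show ?thesis unfolding lincomb_def using sx e
        by (simp, intro Y.M.finsum_cong')
          (auto simp: free_module_def PiE_iff intro!: Y.smult_closed lin_hom_closed[OF h])
    qed
    also have "\<dots> = h (lincomb R P ?B (\<lambda>x. x) (s x))"
      by (rule lin_hom_lincomb[OF h P.left_module_axioms Y _ sx, symmetric]) auto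
    finally show ?thesis using bspec[OF s2 x] by simp
  qed
  ultimately show ?thesis by blast
qed

text \<open>In the free module f acts coordinatewise and is regular by hypothesis; the section
  embeds P there and commutes with f.\<close>

lemma projective_central_regular:
  assumes P: "projective_module R P" and f: "f \<in> carrier R"
    and central: "\<forall>q \<in> carrier R. f \<otimes>\<^bsub>R\<^esub> q = q \<otimes>\<^bsub>R\<^esub> f"
    and regular: "\<forall>q \<in> carrier R. f \<otimes>\<^bsub>R\<^esub> q = \<zero>\<^bsub>R\<^esub> \<longrightarrow> q = \<zero>\<^bsub>R\<^esub>"
    and x: "x \<in> carrier P" and fx: "f \<odot>\<^bsub>P\<^esub> x = \<zero>\<^bsub>P\<^esub>"
  shows "x = \<zero>\<^bsub>P\<^esub>"
proof -
  interpret P: left_module R P using P by (simp add: projective_module_def)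
  let ?L = "free_module R (carrier P)"
  interpret L: left_module R ?L by (rule free_module_left_module) (rule P.R.ring_axioms)
  obtain s where s: "s \<in> lin_hom R P ?L"
    and s2: "\<forall>x \<in> carrier P. lincomb R P (carrier P) (\<lambda>x. x) (s x) = x"
    using projective_section[OF P] by blast
  have sx: "s x \<in> carrier ?L" by (rule lin_hom_closed[OF s x])
  have "f \<odot>\<^bsub>?L\<^esub> s x = \<zero>\<^bsub>?L\<^esub>"
    using lin_hom_smult[OF s f x] fx lin_hom_zero[OF s] P.M.abelian_group_axioms L.M.abelian_group_axioms by simp
  then have "f \<otimes>\<^bsub>R\<^esub> s x b = \<zero>\<^bsub>R\<^esub>" if "b \<in> carrier P" for b
    using that by (simp add: free_module_def fun_eq_iff restrict_def) meson
  then have "s x b = \<zero>\<^bsub>R\<^esub>" if "b \<in> carrier P" for b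
    using that regular sx by (auto simp: free_module_def PiE_iff)
  then have "s x = \<zero>\<^bsub>?L\<^esub>" using sx by (auto simp: free_module_def PiE_iff extensional_def)
  then show ?thesis
    using bspec[OF s2 x] bspec[OF s2 P.M.zero_closed] lin_hom_zero[OF s] P.M.abelian_group_axioms L.M.abelian_group_axioms by simp
qed

section \<open>Projective resolutions, comparison maps and homotopies\<close>

locale resolution =
  fixes R :: "'a ring" and M :: "('a, 'm) module" and F :: "('a, 'b) chain_complex" and \<epsilon> :: "'b \<Rightarrow> 'm"
  assumes res: "projective_resolution R M F \<epsilon>" and target: "left_module R M"
begin

lemma projective: "projective_module R (obj F i)"
  using res by (simp add: projective_resolution_def)

lemma obj_module: "left_module R (obj F i)"
  using projective by (simp add: projective_module_def)

sublocale obj: left_module R "obj F i" for i by (rule obj_module)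

lemma obj_group: "abelian_group (obj F i)"
  by (rule obj.M.abelian_group_axioms)

lemma target_group: "abelian_group M"
  using target by (rule left_module_abelian_group)

lemma negative: "i < 0 \<Longrightarrow> x \<in> carrier (obj F i) \<Longrightarrow> x = \<zero>\<^bsub>obj F i\<^esub>"
  using res by (auto simp: projective_resolution_def)

lemma bd_hom: "j = i - 1 \<Longrightarrow> bd F i \<in> lin_hom R (obj F i) (obj F j)"
  using res by (simp add: projective_resolution_def)

lemma bd_closed: "x \<in> carrier (obj F i) \<Longrightarrow> j = i - 1 \<Longrightarrow> bd F i x \<in> carrier (obj F j)"
  using lin_hom_closed[OF bd_hom[OF refl]] by simp

lemma bd_add: "\<lbrakk>x \<in> carrier (obj F i); y \<in> carrier (obj F i); j = i - 1\<rbrakk> \<Longrightarrow>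
    bd F i (x \<oplus>\<^bsub>obj F i\<^esub> y) = bd F i x \<oplus>\<^bsub>obj F j\<^esub> bd F i y"
  using lin_hom_add[OF bd_hom[OF refl]] by simp

lemma bd_zero: "j = i - 1 \<Longrightarrow> bd F i \<zero>\<^bsub>obj F i\<^esub> = \<zero>\<^bsub>obj F j\<^esub>"
  using lin_hom_zero[OF bd_hom[OF refl] obj_group obj_group] by simp

lemma bd_diff: "\<lbrakk>x \<in> carrier (obj F i); y \<in> carrier (obj F i); j = i - 1\<rbrakk> \<Longrightarrow>
    bd F i (x \<ominus>\<^bsub>obj F i\<^esub> y) = bd F i x \<ominus>\<^bsub>obj F j\<^esub> bd F i y"
  using lin_hom_diff[OF bd_hom[OF refl] obj_group obj_group] by simp

lemma exact: "\<lbrakk>0 < i; x \<in> carrier (obj F i); j = i - 1; bd F i x = \<zero>\<^bsub>obj F j\<^esub>; k = i + 1\<rbrakk> \<Longrightarrow>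
    x \<in> bd F k ` carrier (obj F k)"
  using res unfolding projective_resolution_def by blast

text \<open>For j > 0 this is half of exactness in degree j. Otherwise the composite ends in a
  negative degree, where the resolution is zero.\<close>

lemma bd_bd:
  assumes x: "x \<in> carrier (obj F i)" and j: "j = i - 1" and k: "k = i - 2"
  shows "bd F j (bd F i x) = \<zero>\<^bsub>obj F k\<^esub>"
proof (cases "j > 0")
  case True
  have "{x \<in> carrier (obj F j). bd F j x = \<zero>\<^bsub>obj F (j - 1)\<^esub>} = bd F (j + 1) ` carrier (obj F (j + 1))"
    using res True unfolding projective_resolution_def by blast
  moreover have "j + 1 = i" "j - 1 = k" using j k by auto
  ultimately show ?thesis using x by auto
next
  case False
  then show ?thesis using negative[of k] bd_closed[OF bd_closed[OF x j], of k] j k by simp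
qed

lemma augmentation: "\<epsilon> \<in> lin_hom R (obj F 0) M"
  using res by (simp add: projective_resolution_def)

lemma augmentation_surj: "y \<in> carrier M \<Longrightarrow> y \<in> \<epsilon> ` carrier (obj F 0)"
  using res by (simp add: projective_resolution_def)

lemma augmentation_exact: "x \<in> carrier (obj F 0) \<Longrightarrow> \<epsilon> x = \<zero>\<^bsub>M\<^esub> \<Longrightarrow> x \<in> bd F 1 ` carrier (obj F 1)"
  using res unfolding projective_resolution_def by blast

lemma augmentation_bd:
  assumes "x \<in> carrier (obj F 1)"
  shows "\<epsilon> (bd F 1 x) = \<zero>\<^bsub>M\<^esub>"
proof -
  have "bd F 1 x \<in> {x \<in> carrier (obj F 0). \<epsilon> x = \<zero>\<^bsub>M\<^esub>}"
    using res assms unfolding projective_resolution_def by blast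
  then show ?thesis by simp
qed

end

text \<open>The comparison theorem, by recursive choice. The property carried along,
  \<open>?img\<close>, says that the current map sends boundaries to boundaries; this is exactly
  what the next lift requires, and the augmentation provides it at the start.\<close>

lemma resolution_chain_map:
  assumes "resolution R M P \<epsilon>" "resolution R M T \<eta>"
  shows "\<exists>u :: nat \<Rightarrow> _. (\<forall>n. u n \<in> lin_hom R (obj P (int n)) (obj T (int n))) \<and>
    (\<forall>x \<in> carrier (obj P 0). \<eta> (u 0 x) = \<epsilon> x) \<and>
    (\<forall>n. \<forall>x \<in> carrier (obj P (int n + 1)). bd T (int n + 1) (u (Suc n) x) = u n (bd P (int n + 1) x))"
proof -
  interpret P: resolution R M P \<epsilon> by fact
  interpret T: resolution R M T \<eta> by fact
  let ?img = "\<lambda>n u. \<forall>x \<in> carrier (obj P (int n + 1)). u (bd P (int n + 1) x) \<in> bd T (int n + 1) ` carrier (obj T (int n + 1))"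
  let ?A = "\<lambda>n u. u \<in> lin_hom R (obj P (int n)) (obj T (int n)) \<and> ?img n u \<and>
    (n = 0 \<longrightarrow> (\<forall>x \<in> carrier (obj P 0). \<eta> (u x) = \<epsilon> x))"
  let ?B = "\<lambda>n u v. \<forall>x \<in> carrier (obj P (int n + 1)). bd T (int n + 1) (v x) = u (bd P (int n + 1) x)"
  have "\<exists>u. \<forall>n. ?A n (u n) \<and> ?B n (u n) (u (Suc n))"
  proof (rule dependent_nat_choice)
    have "\<exists>u \<in> lin_hom R (obj P 0) (obj T 0). \<forall>x \<in> carrier (obj P 0). \<eta> (u x) = \<epsilon> x"
    proof (rule projective_lift[OF P.projective T.obj_module P.target T.augmentation P.augmentation])
      show "\<epsilon> x \<in> \<eta> ` carrier (obj T 0)" if "x \<in> carrier (obj P 0)" for x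
        using lin_hom_closed[OF P.augmentation that] by (rule T.augmentation_surj)
    qed
    then obtain u where u: "u \<in> lin_hom R (obj P 0) (obj T 0)"
      "\<And>x. x \<in> carrier (obj P 0) \<Longrightarrow> \<eta> (u x) = \<epsilon> x" by blast
    have "u (bd P 1 x) \<in> bd T 1 ` carrier (obj T 1)" if x: "x \<in> carrier (obj P 1)" for x
      using x u(2)[of "bd P 1 x"] P.bd_closed[OF x, of 0] P.augmentation_bd[OF x] lin_hom_closed[OF u(1)]
      by (intro T.augmentation_exact) simp_all
    then show "\<exists>u. ?A 0 u" using u by (intro exI[of _ u]) simp
  next
    fix u n assume "?A n u"
    then have u: "u \<in> lin_hom R (obj P (int n)) (obj T (int n))" and img: "?img n u" by blast+
    let ?i = "int n + 1"
    have ud: "compose (carrier (obj P ?i)) u (bd P ?i) \<in> lin_hom R (obj P ?i) (obj T (int n))"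
      by (rule lin_hom_compose[OF u P.bd_hom P.obj_module]) simp
    have dT: "bd T ?i \<in> lin_hom R (obj T ?i) (obj T (int n))" by (rule T.bd_hom) simp
    have "\<exists>v \<in> lin_hom R (obj P ?i) (obj T ?i).
      \<forall>x \<in> carrier (obj P ?i). bd T ?i (v x) = compose (carrier (obj P ?i)) u (bd P ?i) x"
    proof (rule projective_lift[OF P.projective T.obj_module T.obj_module dT ud])
      show "compose (carrier (obj P ?i)) u (bd P ?i) x \<in> bd T ?i ` carrier (obj T ?i)"
        if "x \<in> carrier (obj P ?i)" for x using that img by (simp add: compose_def)
    qed
    then obtain v where v: "v \<in> lin_hom R (obj P ?i) (obj T ?i)"
      "\<And>x. x \<in> carrier (obj P ?i) \<Longrightarrow> bd T ?i (v x) = compose (carrier (obj P ?i)) u (bd P ?i) x" by blast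
    have v2: "bd T ?i (v x) = u (bd P ?i x)" if "x \<in> carrier (obj P ?i)" for x
      using that v(2) by (simp add: compose_def)
    have "v (bd P (?i + 1) x) \<in> bd T (?i + 1) ` carrier (obj T (?i + 1))"
      if x: "x \<in> carrier (obj P (?i + 1))" for x
    proof -
      have c: "bd P (?i + 1) x \<in> carrier (obj P ?i)" by (rule P.bd_closed[OF x]) simp
      have "bd T ?i (v (bd P (?i + 1) x)) = u (bd P ?i (bd P (?i + 1) x))" by (rule v2[OF c])
      also have "\<dots> = \<zero>\<^bsub>obj T (int n)\<^esub>"
        using P.bd_bd[OF x, of ?i "int n"] lin_hom_zero[OF u P.obj_group T.obj_group] by simp
      finally show ?thesis
        using lin_hom_closed[OF v(1) c] by (intro T.exact[of ?i _ "int n"]) simp_all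
    qed
    then have "?A (Suc n) v" using v(1) by (simp add: add.commute)
    moreover have "?B n u v" using v2 by blast
    ultimately show "\<exists>v. ?A (Suc n) v \<and> ?B n u v" by blast
  qed
  then obtain u where u: "\<And>n. ?A n (u n) \<and> ?B n (u n) (u (Suc n))" by blast
  show ?thesis
    by (rule exI[of _ u]) (use u in simp)
qed

text \<open>A chain map that induces zero on the resolved module is null-homotopic. The property
  carried along is dhd = wd: it makes w - hd take values in cycles of the next degree, so that
  exactness and projectivity produce the next h.\<close>

lemma resolution_homotopy:
  assumes "resolution R M P \<epsilon>"
    and w: "\<And>n. w n \<in> lin_hom R (obj P (int n)) (obj P (int n))"
    and w0: "\<And>x. x \<in> carrier (obj P 0) \<Longrightarrow> \<epsilon> (w 0 x) = \<zero>\<^bsub>M\<^esub>"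
    and wd: "\<And>n x. x \<in> carrier (obj P (int n + 1)) \<Longrightarrow> bd P (int n + 1) (w (Suc n) x) = w n (bd P (int n + 1) x)"
  shows "\<exists>h :: nat \<Rightarrow> _. (\<forall>n. h n \<in> lin_hom R (obj P (int n)) (obj P (int n + 1))) \<and>
    (\<forall>n. \<forall>x \<in> carrier (obj P (int n + 1)). bd P (int n + 2) (h (Suc n) x) =
      w (Suc n) x \<ominus>\<^bsub>obj P (int n + 1)\<^esub> h n (bd P (int n + 1) x))"
proof -
  interpret P: resolution R M P \<epsilon> by fact
  let ?A = "\<lambda>n h. h \<in> lin_hom R (obj P (int n)) (obj P (int n + 1)) \<and>
    (\<forall>x \<in> carrier (obj P (int n + 1)). bd P (int n + 1) (h (bd P (int n + 1) x)) = w n (bd P (int n + 1) x))"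
  let ?B = "\<lambda>n h k. \<forall>x \<in> carrier (obj P (int n + 1)). bd P (int n + 2) (k x) =
      w (Suc n) x \<ominus>\<^bsub>obj P (int n + 1)\<^esub> h (bd P (int n + 1) x)"
  have "\<exists>h. \<forall>n. ?A n (h n) \<and> ?B n (h n) (h (Suc n))"
  proof (rule dependent_nat_choice)
    have d: "bd P 1 \<in> lin_hom R (obj P 1) (obj P 0)" by (rule P.bd_hom) simp
    have w0': "w 0 \<in> lin_hom R (obj P 0) (obj P 0)" using w[of 0] by simp
    have "\<exists>h \<in> lin_hom R (obj P 0) (obj P 1). \<forall>x \<in> carrier (obj P 0). bd P 1 (h x) = w 0 x"
    proof (rule projective_lift[OF P.projective P.obj_module P.obj_module d w0'])
      show "w 0 x \<in> bd P 1 ` carrier (obj P 1)" if "x \<in> carrier (obj P 0)" for x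
        using that lin_hom_closed[OF w0' that] w0 by (intro P.augmentation_exact) simp_all
    qed
    then obtain h where h: "h \<in> lin_hom R (obj P 0) (obj P 1)"
      "\<And>x. x \<in> carrier (obj P 0) \<Longrightarrow> bd P 1 (h x) = w 0 x" by blast
    have "bd P 1 x \<in> carrier (obj P 0)" if "x \<in> carrier (obj P 1)" for x using that by (intro P.bd_closed) simp_all
    then show "\<exists>h. ?A 0 h" using h by (intro exI[of _ h]) simp
  next
    fix h n assume "?A n h"
    then have h: "h \<in> lin_hom R (obj P (int n)) (obj P (int n + 1))"
      and hd: "\<And>x. x \<in> carrier (obj P (int n + 1)) \<Longrightarrow> bd P (int n + 1) (h (bd P (int n + 1) x)) = w n (bd P (int n + 1) x)"
      by blast+
    let ?i = "int n + 1"
    have ws: "w (Suc n) \<in> lin_hom R (obj P ?i) (obj P ?i)" using w[of "Suc n"] by (simp add: add.commute)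
    have dn: "bd P ?i x \<in> carrier (obj P (int n))" if "x \<in> carrier (obj P ?i)" for x
      using that by (rule P.bd_closed) simp
    let ?c = "\<lambda>x \<in> carrier (obj P ?i). w (Suc n) x \<ominus>\<^bsub>obj P ?i\<^esub> compose (carrier (obj P ?i)) h (bd P ?i) x"
    have hdl: "compose (carrier (obj P ?i)) h (bd P ?i) \<in> lin_hom R (obj P ?i) (obj P ?i)"
      by (rule lin_hom_compose[OF h P.bd_hom P.obj_module]) simp
    have c: "?c \<in> lin_hom R (obj P ?i) (obj P ?i)"
      by (rule lin_hom_sub[OF ws hdl P.obj_module P.obj_module])
    have d: "bd P (?i + 1) \<in> lin_hom R (obj P (?i + 1)) (obj P ?i)" by (rule P.bd_hom) simp
    have "\<exists>k \<in> lin_hom R (obj P ?i) (obj P (?i + 1)). \<forall>x \<in> carrier (obj P ?i). bd P (?i + 1) (k x) = ?c x"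
    proof (rule projective_lift[OF P.projective P.obj_module P.obj_module d c])
      fix x assume x: "x \<in> carrier (obj P ?i)"
      note cl = lin_hom_closed[OF ws x] lin_hom_closed[OF h dn[OF x]]
      have "bd P ?i (w (Suc n) x \<ominus>\<^bsub>obj P ?i\<^esub> h (bd P ?i x)) = \<zero>\<^bsub>obj P (int n)\<^esub>"
        using cl x by (simp add: P.bd_diff[where j = "int n"] wd hd P.obj.M.diff_self lin_hom_closed[OF w dn])
      then show "?c x \<in> bd P (?i + 1) ` carrier (obj P (?i + 1))"
        using x cl by (intro P.exact[of ?i _ "int n"]) (simp_all add: compose_def)
    qed
    then obtain k where k: "k \<in> lin_hom R (obj P ?i) (obj P (?i + 1))"
      "\<And>x. x \<in> carrier (obj P ?i) \<Longrightarrow> bd P (?i + 1) (k x) = ?c x" by blast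
    have k2: "bd P (?i + 1) (k x) = w (Suc n) x \<ominus>\<^bsub>obj P ?i\<^esub> h (bd P ?i x)" if "x \<in> carrier (obj P ?i)" for x
      using k(2)[OF that] that by (simp add: compose_def)
    have "bd P (?i + 1) (k (bd P (?i + 1) x)) = w (Suc n) (bd P (?i + 1) x)"
      if x: "x \<in> carrier (obj P (?i + 1))" for x
    proof -
      have b: "bd P (?i + 1) x \<in> carrier (obj P ?i)" by (rule P.bd_closed[OF x]) simp
      have "h (bd P ?i (bd P (?i + 1) x)) = \<zero>\<^bsub>obj P ?i\<^esub>"
        using P.bd_bd[OF x, of ?i "int n"] lin_hom_zero[OF h P.obj_group P.obj_group] by simp
      then show ?thesis using k2[OF b] lin_hom_closed[OF ws b] by (simp add: P.obj.M.diff_zero)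
    qed
    moreover have e: "int (Suc n) = ?i" "?i + 1 = int n + 2" by simp_all
    ultimately have "?A (Suc n) k" using k(1) unfolding e(1) by blast
    moreover have "?B n h k" using k2 unfolding e(2) by blast
    ultimately show "\<exists>k. ?A (Suc n) k \<and> ?B n h k" by blast
  qed
  then obtain h where h: "\<And>n. ?A n (h n) \<and> ?B n (h n) (h (Suc n))" by blast
  show ?thesis
    by (rule exI[of _ h]) (use h in simp)
qed

text \<open>Let u and v be comparison maps to and from the finite resolution. Then 1 - vu is
  null-homotopic, and above the length of the finite resolution vu vanishes, so the homotopy becomes
  a contraction there.\<close>

lemma finite_resolution_contraction:
  assumes "resolution R M P \<epsilon>" "resolution R M T \<eta>"
    and bounded: "\<And>i x. N < i \<Longrightarrow> x \<in> carrier (obj T i) \<Longrightarrow> x = \<zero>\<^bsub>obj T i\<^esub>"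
  shows "\<exists>h. (\<forall>i. h i \<in> lin_hom R (obj P i) (obj P (i + 1))) \<and>
    (\<forall>i > max 0 N. \<forall>x \<in> carrier (obj P i). bd P (i + 1) (h i x) \<oplus>\<^bsub>obj P i\<^esub> h (i - 1) (bd P i x) = x)"
proof -
  interpret P: resolution R M P \<epsilon> by fact
  interpret T: resolution R M T \<eta> by fact
  obtain u where u: "\<And>n. u n \<in> lin_hom R (obj P (int n)) (obj T (int n))"
    "\<And>x. x \<in> carrier (obj P 0) \<Longrightarrow> \<eta> (u 0 x) = \<epsilon> x"
    "\<And>n x. x \<in> carrier (obj P (int n + 1)) \<Longrightarrow> bd T (int n + 1) (u (Suc n) x) = u n (bd P (int n + 1) x)"
    using resolution_chain_map[OF assms(1,2)] by metis
  obtain v where v: "\<And>n. v n \<in> lin_hom R (obj T (int n)) (obj P (int n))"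
    "\<And>x. x \<in> carrier (obj T 0) \<Longrightarrow> \<epsilon> (v 0 x) = \<eta> x"
    "\<And>n x. x \<in> carrier (obj T (int n + 1)) \<Longrightarrow> bd P (int n + 1) (v (Suc n) x) = v n (bd T (int n + 1) x)"
    using resolution_chain_map[OF assms(2,1)] by metis
  define w where "w n = (\<lambda>x \<in> carrier (obj P (int n)). (\<lambda>x \<in> carrier (obj P (int n)). x) x \<ominus>\<^bsub>obj P (int n)\<^esub>
    compose (carrier (obj P (int n))) (v n) (u n) x)" for n
  have w: "w n \<in> lin_hom R (obj P (int n)) (obj P (int n))" for n
    unfolding w_def by (intro lin_hom_sub lin_hom_id lin_hom_compose[OF v(1) u(1)] P.obj_module)
  have w_eq: "w n x = x \<ominus>\<^bsub>obj P (int n)\<^esub> v n (u n x)" if "x \<in> carrier (obj P (int n))" for n x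
    using that by (simp add: w_def compose_def)
  have uc: "u n x \<in> carrier (obj T (int n))" if "x \<in> carrier (obj P (int n))" for n x
    using lin_hom_closed[OF u(1) that] .
  have vc: "v n x \<in> carrier (obj P (int n))" if "x \<in> carrier (obj T (int n))" for n x
    using lin_hom_closed[OF v(1) that] .
  have e: "int (Suc n) = int n + 1" for n by simp
  have "\<exists>h :: nat \<Rightarrow> _. (\<forall>n. h n \<in> lin_hom R (obj P (int n)) (obj P (int n + 1))) \<and>
    (\<forall>n. \<forall>x \<in> carrier (obj P (int n + 1)). bd P (int n + 2) (h (Suc n) x) =
      w (Suc n) x \<ominus>\<^bsub>obj P (int n + 1)\<^esub> h n (bd P (int n + 1) x))"
  proof (rule resolution_homotopy[OF assms(1) w])
    show "\<epsilon> (w 0 x) = \<zero>\<^bsub>M\<^esub>" if x: "x \<in> carrier (obj P 0)" for x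
    proof -
      interpret M: abelian_group M by (rule P.target_group)
      have "\<epsilon> (w 0 x) = \<epsilon> x \<ominus>\<^bsub>M\<^esub> \<epsilon> (v 0 (u 0 x))"
        using w_eq[of x 0] x uc[of x 0] vc[of "u 0 x" 0]
          lin_hom_diff[OF P.augmentation P.obj_group P.target_group] by simp
      then show ?thesis
        using x uc[of x 0] v(2) u(2) lin_hom_closed[OF P.augmentation x] by (simp add: M.diff_self)
    qed
    fix n x assume x: "x \<in> carrier (obj P (int n + 1))"
    have dx: "bd P (int n + 1) x \<in> carrier (obj P (int n))" by (rule P.bd_closed[OF x]) simp
    have "bd P (int n + 1) (w (Suc n) x) = bd P (int n + 1) x \<ominus>\<^bsub>obj P (int n)\<^esub> bd P (int n + 1) (v (Suc n) (u (Suc n) x))"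
      using w_eq[of x "Suc n"] x uc[of x "Suc n"] vc[of "u (Suc n) x" "Suc n"] unfolding e
      by (simp add: P.bd_diff[where j = "int n"])
    also have "\<dots> = w n (bd P (int n + 1) x)"
      using x uc[of x "Suc n"] unfolding e by (simp add: v(3) u(3) w_eq[OF dx])
    finally show "bd P (int n + 1) (w (Suc n) x) = w n (bd P (int n + 1) x)" .
  qed
  then obtain h where h: "\<And>n. h n \<in> lin_hom R (obj P (int n)) (obj P (int n + 1))"
    "\<And>n x. x \<in> carrier (obj P (int n + 1)) \<Longrightarrow> bd P (int n + 2) (h (Suc n) x) =
      w (Suc n) x \<ominus>\<^bsub>obj P (int n + 1)\<^esub> h n (bd P (int n + 1) x)" by metis
  \<comment> \<open>The homotopy is indexed by natural numbers and is extended by zero. Its equation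
    is available in positive degrees only, whence the bound \<open>max 0 N\<close>.\<close>
  define k where "k i = (if i < 0 then \<lambda>x \<in> carrier (obj P i). \<zero>\<^bsub>obj P (i + 1)\<^esub> else h (nat i))" for i :: int
  have k: "k i \<in> lin_hom R (obj P i) (obj P (i + 1))" for i
  proof (cases "i < 0")
    case False
    then show ?thesis using h(1)[of "nat i"] by (simp add: k_def)
  qed (simp add: k_def lin_hom_const_zero P.obj_module)
  have "bd P (i + 1) (k i x) \<oplus>\<^bsub>obj P i\<^esub> k (i - 1) (bd P i x) = x"
    if i: "i > max 0 N" and x: "x \<in> carrier (obj P i)" for i x
  proof -
    have n: "i = int (nat (i - 1)) + 1" using i by simp
    define n where "n = nat (i - 1)"
    note n = n[folded n_def]
    have "u (Suc n) x = \<zero>\<^bsub>obj T i\<^esub>" using bounded[of i] uc[of x "Suc n"] i x n by (simp add: add.commute)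
    then have "v (Suc n) (u (Suc n) x) = \<zero>\<^bsub>obj P i\<^esub>"
      using lin_hom_zero[OF v(1)[of "Suc n"] T.obj_group P.obj_group] n by (simp add: add.commute)
    then have "w (Suc n) x = x"
      using w_eq[of x "Suc n"] x n by (simp add: add.commute P.obj.M.diff_zero)
    then have "bd P (i + 1) (k i x) = x \<ominus>\<^bsub>obj P i\<^esub> h n (bd P i x)"
      using h(2)[of x n] x n by (simp add: k_def nat_add_distrib ac_simps)
    moreover have "k (i - 1) (bd P i x) = h n (bd P i x)" using n by (simp add: k_def)
    moreover have "h n (bd P i x) \<in> carrier (obj P i)"
      using lin_hom_closed[OF h(1)[of n] P.bd_closed] x n by simp
    ultimately show ?thesis using x by (simp add: P.obj.M.minus_eq P.obj.M.a_assoc P.obj.M.l_neg)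
  qed
  then show ?thesis using k by blast
qed

section \<open>The Hom complex and its products\<close>

context abelian_group
begin

text \<open>This and the next three identities are the four sign patterns that occur in the Leibniz
  rule for composition, one for each pair of parities.\<close>

lemma telescope_diff_diff:
  assumes "x \<in> carrier G" "y \<in> carrier G" "z \<in> carrier G"
  shows "(x \<ominus> y) \<oplus> (y \<ominus> z) = x \<ominus> z"
proof -
  have "(x \<ominus> y) \<oplus> (y \<ominus> z) = x \<oplus> ((\<ominus> y \<oplus> y) \<oplus> \<ominus> z)"
    using assms by (simp add: minus_eq a_assoc del: l_neg r_neg)
  then show ?thesis using assms by (simp add: minus_eq l_neg)
qed

lemma telescope_diff_add:
  assumes "x \<in> carrier G" "y \<in> carrier G" "z \<in> carrier G"
  shows "(x \<ominus> y) \<oplus> (y \<oplus> z) = x \<oplus> z"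
proof -
  have "(x \<ominus> y) \<oplus> (y \<oplus> z) = x \<oplus> ((\<ominus> y \<oplus> y) \<oplus> z)"
    using assms by (simp add: minus_eq a_assoc del: l_neg r_neg)
  then show ?thesis using assms by (simp add: l_neg)
qed

lemma telescope_add_diff:
  assumes "x \<in> carrier G" "y \<in> carrier G" "z \<in> carrier G"
  shows "(x \<oplus> y) \<ominus> (y \<oplus> z) = x \<ominus> z"
proof -
  have "(x \<oplus> y) \<ominus> (y \<oplus> z) = x \<oplus> ((y \<oplus> \<ominus> y) \<oplus> \<ominus> z)"
    using assms by (simp add: minus_eq minus_add a_ac del: l_neg r_neg)
  then show ?thesis using assms by (simp add: minus_eq r_neg)
qed

lemma telescope_add_minus:
  assumes "x \<in> carrier G" "y \<in> carrier G" "z \<in> carrier G"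
  shows "(x \<oplus> y) \<ominus> (y \<ominus> z) = x \<oplus> z"
  using telescope_add_diff[of x y "\<ominus> z"] assms by (simp add: minus_eq)

lemma swap_add: 
  assumes "x \<in> carrier G" "y \<in> carrier G" "z \<in> carrier G" "w \<in> carrier G"
  shows "(x \<oplus> y) \<oplus> (z \<oplus> w) = (x \<oplus> z) \<oplus> (y \<oplus> w)"
  using assms by (simp add: a_ac)

lemma swap_diff: 
  assumes "x \<in> carrier G" "y \<in> carrier G" "z \<in> carrier G" "w \<in> carrier G"
  shows "(x \<oplus> y) \<ominus> (z \<oplus> w) = (x \<ominus> z) \<oplus> (y \<ominus> w)"
  using assms by (simp add: minus_eq minus_add a_ac)

end

section \<open>The Hom complex of two resolutions and its bounded subcomplex\<close>

locale hom_pair = F: resolution R M F \<epsilon> + G: resolution R N G \<eta>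
  for R :: "'a ring" and M :: "('a, 'm) module" and F :: "('a, 'c) chain_complex" and \<epsilon>
    and N :: "('a, 'n) module" and G :: "('a, 'd) chain_complex" and \<eta>
begin

abbreviation H :: "int \<Rightarrow> (int \<Rightarrow> 'c \<Rightarrow> 'd) set" where
  "H n \<equiv> carrier (hom_group R F G n)"

lemma H_iff: "\<beta> \<in> H n \<longleftrightarrow> (\<forall>i. \<beta> i \<in> lin_hom R (obj F i) (obj G (i - n)))"
  by (simp add: hom_group_def)

lemma H_lin: "\<beta> \<in> H n \<Longrightarrow> j = i - n \<Longrightarrow> \<beta> i \<in> lin_hom R (obj F i) (obj G j)"
  by (simp add: H_iff)

lemma H_closed: "\<beta> \<in> H n \<Longrightarrow> x \<in> carrier (obj F i) \<Longrightarrow> j = i - n \<Longrightarrow> \<beta> i x \<in> carrier (obj G j)"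
  using lin_hom_closed[OF H_lin[OF _ refl]] by simp

lemma H_add: "\<lbrakk>\<beta> \<in> H n; x \<in> carrier (obj F i); y \<in> carrier (obj F i); j = i - n\<rbrakk> \<Longrightarrow>
    \<beta> i (x \<oplus>\<^bsub>obj F i\<^esub> y) = \<beta> i x \<oplus>\<^bsub>obj G j\<^esub> \<beta> i y"
  using lin_hom_add[OF H_lin[OF _ refl]] by simp

lemma H_diff: "\<lbrakk>\<beta> \<in> H n; x \<in> carrier (obj F i); y \<in> carrier (obj F i); j = i - n\<rbrakk> \<Longrightarrow>
    \<beta> i (x \<ominus>\<^bsub>obj F i\<^esub> y) = \<beta> i x \<ominus>\<^bsub>obj G j\<^esub> \<beta> i y"
  using lin_hom_diff[OF H_lin[OF _ refl] F.obj_group G.obj_group] by simp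

lemma H_zero: "\<beta> \<in> H n \<Longrightarrow> j = i - n \<Longrightarrow> \<beta> i \<zero>\<^bsub>obj F i\<^esub> = \<zero>\<^bsub>obj G j\<^esub>"
  using lin_hom_zero[OF H_lin[OF _ refl] F.obj_group G.obj_group] by simp

lemma H_eqI:
  assumes "\<alpha> \<in> H n" "\<beta> \<in> H n" "\<And>i x. x \<in> carrier (obj F i) \<Longrightarrow> \<alpha> i x = \<beta> i x"
  shows "\<alpha> = \<beta>"
  by (rule ext, rule lin_hom_eqI[OF H_lin[OF assms(1) refl] H_lin[OF assms(2) refl]]) (rule assms(3))

lemma mult_apply: "x \<in> carrier (obj F i) \<Longrightarrow> j = i - n \<Longrightarrow>
    (\<alpha> \<otimes>\<^bsub>hom_group R F G n\<^esub> \<beta>) i x = \<alpha> i x \<oplus>\<^bsub>obj G j\<^esub> \<beta> i x"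
  by (simp add: hom_group_def)

lemma one_apply: "x \<in> carrier (obj F i) \<Longrightarrow> j = i - n \<Longrightarrow> \<one>\<^bsub>hom_group R F G n\<^esub> i x = \<zero>\<^bsub>obj G j\<^esub>"
  by (simp add: hom_group_def)

lemma mult_closed:
  assumes "\<alpha> \<in> H n" "\<beta> \<in> H n"
  shows "\<alpha> \<otimes>\<^bsub>hom_group R F G n\<^esub> \<beta> \<in> H n"
  unfolding H_iff unfolding hom_group_def monoid.simps
  using lin_hom_plus[OF H_lin[OF assms(1) refl] H_lin[OF assms(2) refl] F.obj_module G.obj_module] by blast

lemma one_closed: "\<one>\<^bsub>hom_group R F G n\<^esub> \<in> H n"
  unfolding H_iff unfolding hom_group_def monoid.simps using lin_hom_const_zero[OF F.obj_module G.obj_module] by blast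

lemma uminus_closed: "\<beta> \<in> H n \<Longrightarrow> (\<lambda>i. \<lambda>x \<in> carrier (obj F i). \<ominus>\<^bsub>obj G (i - n)\<^esub> \<beta> i x) \<in> H n"
  unfolding H_iff using lin_hom_uminus[OF _ F.obj_module G.obj_module] by blast

lemma hom_group_comm: "comm_group (hom_group R F G n)"
proof (rule comm_groupI)
  show "\<one>\<^bsub>hom_group R F G n\<^esub> \<in> H n" by (rule one_closed)
next
  fix \<alpha> \<beta> assume a: "\<alpha> \<in> H n" and b: "\<beta> \<in> H n"
  show "\<alpha> \<otimes>\<^bsub>hom_group R F G n\<^esub> \<beta> \<in> H n" by (rule mult_closed[OF a b])
  show "\<alpha> \<otimes>\<^bsub>hom_group R F G n\<^esub> \<beta> = \<beta> \<otimes>\<^bsub>hom_group R F G n\<^esub> \<alpha>"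
    using a b by (intro H_eqI[of _ n] mult_closed) (simp_all add: mult_apply G.obj.M.a_comm H_closed)
next
  fix \<alpha> \<beta> \<gamma> assume "\<alpha> \<in> H n" "\<beta> \<in> H n" "\<gamma> \<in> H n"
  then show "\<alpha> \<otimes>\<^bsub>hom_group R F G n\<^esub> \<beta> \<otimes>\<^bsub>hom_group R F G n\<^esub> \<gamma> =
      \<alpha> \<otimes>\<^bsub>hom_group R F G n\<^esub> (\<beta> \<otimes>\<^bsub>hom_group R F G n\<^esub> \<gamma>)"
    by (intro H_eqI[of _ n] mult_closed) (simp_all add: mult_apply G.obj.M.a_assoc H_closed)
next
  fix \<alpha> assume a: "\<alpha> \<in> H n"
  then show "\<one>\<^bsub>hom_group R F G n\<^esub> \<otimes>\<^bsub>hom_group R F G n\<^esub> \<alpha> = \<alpha>"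
    by (intro H_eqI[of _ n] mult_closed one_closed) (simp_all add: mult_apply one_apply H_closed)
  show "\<exists>\<beta>\<in>H n. \<beta> \<otimes>\<^bsub>hom_group R F G n\<^esub> \<alpha> = \<one>\<^bsub>hom_group R F G n\<^esub>"
    using a by (intro bexI[OF _ uminus_closed[OF a]] H_eqI[of _ n] mult_closed one_closed uminus_closed)
      (simp_all add: mult_apply one_apply H_closed G.obj.M.l_neg)
qed

lemma inv_eq: "\<beta> \<in> H n \<Longrightarrow> inv\<^bsub>hom_group R F G n\<^esub> \<beta> = (\<lambda>i. \<lambda>x \<in> carrier (obj F i). \<ominus>\<^bsub>obj G (i - n)\<^esub> \<beta> i x)"
proof (rule group.inv_equality)
  assume b: "\<beta> \<in> H n"
  show "group (hom_group R F G n)" using hom_group_comm by (simp add: comm_group_def)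
  show "(\<lambda>i. \<lambda>x \<in> carrier (obj F i). \<ominus>\<^bsub>obj G (i - n)\<^esub> \<beta> i x) \<otimes>\<^bsub>hom_group R F G n\<^esub> \<beta> = \<one>\<^bsub>hom_group R F G n\<^esub>"
    using b by (intro H_eqI[of _ n] mult_closed one_closed uminus_closed)
      (simp_all add: mult_apply one_apply H_closed G.obj.M.l_neg)
qed (auto intro: uminus_closed)

lemma inv_apply: "\<beta> \<in> H n \<Longrightarrow> x \<in> carrier (obj F i) \<Longrightarrow> j = i - n \<Longrightarrow>
    (inv\<^bsub>hom_group R F G n\<^esub> \<beta>) i x = \<ominus>\<^bsub>obj G j\<^esub> \<beta> i x"
  by (simp add: inv_eq)

lemma diff_apply: "x \<in> carrier (obj F i) \<Longrightarrow> j = i - n - 1 \<Longrightarrow>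
    hom_diff F G n \<beta> i x =
      (if even n then bd G (i - n) (\<beta> i x) \<ominus>\<^bsub>obj G j\<^esub> \<beta> (i - 1) (bd F i x)
       else bd G (i - n) (\<beta> i x) \<oplus>\<^bsub>obj G j\<^esub> \<beta> (i - 1) (bd F i x))"
  by (simp add: hom_diff_def)

lemma bd_after: "\<beta> \<in> H n \<Longrightarrow> j = i - n - 1 \<Longrightarrow> compose (carrier (obj F i)) (bd G (i - n)) (\<beta> i) \<in> lin_hom R (obj F i) (obj G j)"
  by (rule lin_hom_compose[OF G.bd_hom H_lin F.obj_module]) auto

lemma bd_before: "\<beta> \<in> H n \<Longrightarrow> j = i - n - 1 \<Longrightarrow> compose (carrier (obj F i)) (\<beta> (i - 1)) (bd F i) \<in> lin_hom R (obj F i) (obj G j)"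
  by (rule lin_hom_compose[OF H_lin F.bd_hom F.obj_module]) auto

lemma hom_diff_closed: "\<beta> \<in> H n \<Longrightarrow> m = n + 1 \<Longrightarrow> hom_diff F G n \<beta> \<in> H m"
  unfolding H_iff
proof
  fix i assume m: "m = n + 1" and b: "\<forall>i. \<beta> i \<in> lin_hom R (obj F i) (obj G (i - n))"
  have b: "\<beta> \<in> H n" unfolding H_iff by (rule b)
  have j: "i - m = i - n - 1" using m by simp
  have "hom_diff F G n \<beta> i = (if even n
      then (\<lambda>x \<in> carrier (obj F i). compose (carrier (obj F i)) (bd G (i - n)) (\<beta> i) x \<ominus>\<^bsub>obj G (i - n - 1)\<^esub>
          compose (carrier (obj F i)) (\<beta> (i - 1)) (bd F i) x)
      else (\<lambda>x \<in> carrier (obj F i). compose (carrier (obj F i)) (bd G (i - n)) (\<beta> i) x \<oplus>\<^bsub>obj G (i - n - 1)\<^esub>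
          compose (carrier (obj F i)) (\<beta> (i - 1)) (bd F i) x))"
    by (auto simp: hom_diff_def compose_def)
  then show "hom_diff F G n \<beta> i \<in> lin_hom R (obj F i) (obj G (i - m))"
    unfolding j using lin_hom_plus[OF bd_after[OF b refl] bd_before[OF b refl] F.obj_module G.obj_module]
      lin_hom_sub[OF bd_after[OF b refl] bd_before[OF b refl] F.obj_module G.obj_module] by simp
qed

lemma hom_diff_mult:
  assumes a: "\<alpha> \<in> H n" and b: "\<beta> \<in> H n" and m: "m = n + 1"
  shows "hom_diff F G n (\<alpha> \<otimes>\<^bsub>hom_group R F G n\<^esub> \<beta>) = hom_diff F G n \<alpha> \<otimes>\<^bsub>hom_group R F G m\<^esub> hom_diff F G n \<beta>"
proof (rule H_eqI[of _ m])
  show "hom_diff F G n (\<alpha> \<otimes>\<^bsub>hom_group R F G n\<^esub> \<beta>) \<in> H m"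
    "hom_diff F G n \<alpha> \<otimes>\<^bsub>hom_group R F G m\<^esub> hom_diff F G n \<beta> \<in> H m"
    using a b m by (auto intro!: hom_diff_closed mult_closed)
  fix i x assume x: "x \<in> carrier (obj F i)"
  let ?j = "i - n - 1"
  have dx: "bd F i x \<in> carrier (obj F (i - 1))" using x by (rule F.bd_closed) simp
  have c: "\<alpha> i x \<in> carrier (obj G (i - n))" "\<beta> i x \<in> carrier (obj G (i - n))"
    "\<alpha> (i - 1) (bd F i x) \<in> carrier (obj G ?j)" "\<beta> (i - 1) (bd F i x) \<in> carrier (obj G ?j)"
    using x dx by (auto intro!: H_closed[OF a] H_closed[OF b])
  note c' = G.bd_closed[OF c(1), of ?j] G.bd_closed[OF c(2), of ?j]
  have j: "?j = i - m" "?j = i - 1 - n" using m by simp_all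
  show "hom_diff F G n (\<alpha> \<otimes>\<^bsub>hom_group R F G n\<^esub> \<beta>) i x = (hom_diff F G n \<alpha> \<otimes>\<^bsub>hom_group R F G m\<^esub> hom_diff F G n \<beta>) i x"
    using x c c' dx
    by (simp add: mult_apply[OF x j(1)] mult_apply[OF dx j(2)] mult_apply[where n = n, OF x refl] diff_apply
        G.bd_add[where j = ?j] G.obj.M.swap_add G.obj.M.swap_diff)
qed

text \<open>The mixed terms d\<beta>d cancel because the sign alternates with the degree; the
  remaining two terms contain a square of a differential of G or of F.\<close>

lemma hom_diff_diff:
  assumes b: "\<beta> \<in> H n" and m: "m = n + 1" and k: "k = n + 2"
  shows "hom_diff F G m (hom_diff F G n \<beta>) = \<one>\<^bsub>hom_group R F G k\<^esub>"
proof (rule H_eqI[of _ k])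
  have d: "hom_diff F G n \<beta> \<in> H m" by (rule hom_diff_closed[OF b m])
  show "hom_diff F G m (hom_diff F G n \<beta>) \<in> H k" by (rule hom_diff_closed[OF d]) (simp add: m k)
  show "\<one>\<^bsub>hom_group R F G k\<^esub> \<in> H k" by (rule one_closed)
  fix i x assume x: "x \<in> carrier (obj F i)"
  let ?j = "i - n - 1" and ?l = "i - n - 2"
  have dx: "bd F i x \<in> carrier (obj F (i - 1))" using x by (rule F.bd_closed) simp
  have c: "\<beta> i x \<in> carrier (obj G (i - n))" "\<beta> (i - 1) (bd F i x) \<in> carrier (obj G ?j)"
    using x dx by (auto intro!: H_closed[OF b])
  have c': "bd G (i - n) (\<beta> i x) \<in> carrier (obj G ?j)" "bd G ?j (\<beta> (i - 1) (bd F i x)) \<in> carrier (obj G ?l)"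
    "bd G (i - 1 - n) (\<beta> (i - 1) (bd F i x)) = bd G ?j (\<beta> (i - 1) (bd F i x))"
    using c by (auto intro: G.bd_closed simp: algebra_simps)
  have z: "bd G ?j (bd G (i - n) (\<beta> i x)) = \<zero>\<^bsub>obj G ?l\<^esub>" by (rule G.bd_bd[OF c(1)]) simp_all
  have z': "\<beta> (i - 2) (bd F (i - 1) (bd F i x)) = \<zero>\<^bsub>obj G ?l\<^esub>"
    using F.bd_bd[OF x, of "i - 1" "i - 2"] H_zero[OF b, of ?l "i - 2"] by simp
  have "hom_diff F G m (hom_diff F G n \<beta>) i x =
    (if even m then bd G ?j (hom_diff F G n \<beta> i x) \<ominus>\<^bsub>obj G ?l\<^esub> hom_diff F G n \<beta> (i - 1) (bd F i x)
     else bd G ?j (hom_diff F G n \<beta> i x) \<oplus>\<^bsub>obj G ?l\<^esub> hom_diff F G n \<beta> (i - 1) (bd F i x))"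
    using diff_apply[OF x, of ?l m] m by (simp add: algebra_simps)
  also have "\<dots> = \<zero>\<^bsub>obj G ?l\<^esub>"
    using diff_apply[OF x, of ?j n \<beta>] diff_apply[OF dx, of ?l n \<beta>] c c' z z' m
    by (simp add: G.bd_add[where j = ?l] G.bd_diff[where j = ?l] G.obj.M.diff_self G.obj.M.telescope_diff_diff)
  finally show "hom_diff F G m (hom_diff F G n \<beta>) i x = \<one>\<^bsub>hom_group R F G k\<^esub> i x"
    using one_apply[OF x, of ?l k] k by simp
qed

lemma bounded_iff: "\<beta> \<in> bounded_homs R F G n \<longleftrightarrow> \<beta> \<in> H n \<and>
    (\<exists>k. \<forall>i>k. \<forall>x \<in> carrier (obj F i). \<beta> i x = \<zero>\<^bsub>obj G (i - n)\<^esub>)"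
  by (simp add: bounded_homs_def)

lemma boundedI: "\<beta> \<in> H n \<Longrightarrow> (\<And>i x. k < i \<Longrightarrow> x \<in> carrier (obj F i) \<Longrightarrow> \<beta> i x = \<zero>\<^bsub>obj G (i - n)\<^esub>) \<Longrightarrow>
    \<beta> \<in> bounded_homs R F G n"
  unfolding bounded_iff by blast

lemma boundedE:
  assumes "\<beta> \<in> bounded_homs R F G n"
  obtains k where "\<And>i j x. k < i \<Longrightarrow> x \<in> carrier (obj F i) \<Longrightarrow> j = i - n \<Longrightarrow> \<beta> i x = \<zero>\<^bsub>obj G j\<^esub>"
  using assms unfolding bounded_iff by metis

lemma bounded_subgroup: "subgroup (bounded_homs R F G n) (hom_group R F G n)"
proof (rule group.subgroupI)
  show "group (hom_group R F G n)" using hom_group_comm by (simp add: comm_group_def)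
  show "bounded_homs R F G n \<subseteq> H n" by (auto simp: bounded_iff)
  have "\<one>\<^bsub>hom_group R F G n\<^esub> \<in> bounded_homs R F G n"
    by (rule boundedI[OF one_closed]) (simp add: one_apply)
  then show "bounded_homs R F G n \<noteq> {}" by blast
  fix \<alpha> \<beta> assume ab: "\<alpha> \<in> bounded_homs R F G n"
  then have a: "\<alpha> \<in> H n" by (simp add: bounded_iff)
  obtain k where k: "\<And>i j x. k < i \<Longrightarrow> x \<in> carrier (obj F i) \<Longrightarrow> j = i - n \<Longrightarrow> \<alpha> i x = \<zero>\<^bsub>obj G j\<^esub>"
    using boundedE[OF ab] by blast
  have "inv\<^bsub>hom_group R F G n\<^esub> \<alpha> \<in> H n"
    using uminus_closed[OF a] by (simp add: inv_eq[OF a])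
  then show "inv\<^bsub>hom_group R F G n\<^esub> \<alpha> \<in> bounded_homs R F G n"
    by (rule boundedI[where k = k]) (simp add: inv_apply[OF a] k)
  assume bb: "\<beta> \<in> bounded_homs R F G n"
  then have b: "\<beta> \<in> H n" by (simp add: bounded_iff)
  obtain l where l: "\<And>i j x. l < i \<Longrightarrow> x \<in> carrier (obj F i) \<Longrightarrow> j = i - n \<Longrightarrow> \<beta> i x = \<zero>\<^bsub>obj G j\<^esub>"
    using boundedE[OF bb] by blast
  show "\<alpha> \<otimes>\<^bsub>hom_group R F G n\<^esub> \<beta> \<in> bounded_homs R F G n"
    by (rule boundedI[where k = "max k l", OF mult_closed[OF a b]]) (simp add: mult_apply k l)
qed

lemma bounded_diff:
  assumes bb: "\<beta> \<in> bounded_homs R F G n"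
  shows "hom_diff F G n \<beta> \<in> bounded_homs R F G (n + 1)"
proof -
  have b: "\<beta> \<in> H n" using bb by (simp add: bounded_iff)
  obtain k where k: "\<And>i j x. k < i \<Longrightarrow> x \<in> carrier (obj F i) \<Longrightarrow> j = i - n \<Longrightarrow> \<beta> i x = \<zero>\<^bsub>obj G j\<^esub>"
    using boundedE[OF bb] by blast
  show ?thesis
  proof (rule boundedI[where k = "k + 1", OF hom_diff_closed[OF b refl]])
    fix i x assume i: "k + 1 < i" and x: "x \<in> carrier (obj F i)"
    have dx: "bd F i x \<in> carrier (obj F (i - 1))" using x by (rule F.bd_closed) simp
    have "\<beta> i x = \<zero>\<^bsub>obj G (i - n)\<^esub>" "\<beta> (i - 1) (bd F i x) = \<zero>\<^bsub>obj G (i - n - 1)\<^esub>"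
      using i by (auto intro!: k x dx)
    then show "hom_diff F G n \<beta> i x = \<zero>\<^bsub>obj G (i - (n + 1))\<^esub>"
      using x by (simp add: diff_apply[where j = "i - n - 1"] G.bd_zero[where j = "i - n - 1"] G.obj.M.diff_zero diff_diff_eq)
  qed
qed

lemma hom_complex_simps: "grp (hom_complex R F G) = hom_group R F G" "cbd (hom_complex R F G) = hom_diff F G"
  by (simp_all add: hom_complex_def)

lemma hom_subcomplex: "subcomplex (hom_complex R F G) (bounded_homs R F G)"
proof (intro subcomplex.intro subcomplex_axioms.intro cochain.intro, unfold hom_complex_simps)
  show "comm_group (hom_group R F G n)" for n by (rule hom_group_comm)
  show "hom_diff F G n \<in> hom (hom_group R F G n) (hom_group R F G (n + 1))" for n
    by (rule homI) (simp_all add: hom_diff_closed hom_diff_mult[where m = "n + 1"])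
  show "hom_diff F G (n + 1) (hom_diff F G n \<beta>) = \<one>\<^bsub>hom_group R F G (n + 2)\<^esub>" if "\<beta> \<in> H n" for n \<beta>
    by (rule hom_diff_diff[OF that refl refl])
qed (rule bounded_subgroup bounded_diff, assumption?)+

sublocale hom: subcomplex "hom_complex R F G" "bounded_homs R F G"
  rewrites "grp (hom_complex R F G) = hom_group R F G" and "cbd (hom_complex R F G) = hom_diff F G"
  by (rule hom_subcomplex) (rule hom_complex_simps)+

end

definition hom_Z :: "'r ring \<Rightarrow> ('r, 'c) chain_complex \<Rightarrow> ('r, 'd) chain_complex \<Rightarrow> int \<Rightarrow> (int \<Rightarrow> 'c \<Rightarrow> 'd) set" where
  "hom_Z R F G n = {\<beta> \<in> carrier (hom_group R F G n). hom_diff F G n \<beta> = \<one>\<^bsub>hom_group R F G (n + 1)\<^esub>}"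

text \<open>Cochains that satisfy the cocycle condition in all sufficiently high degrees; they
  represent the stable cocycles, and all later stable arguments are made with them.\<close>

definition stable_Z :: "'r ring \<Rightarrow> ('r, 'c) chain_complex \<Rightarrow> ('r, 'd) chain_complex \<Rightarrow> int \<Rightarrow> (int \<Rightarrow> 'c \<Rightarrow> 'd) set" where
  "stable_Z R F G n = {\<beta> \<in> carrier (hom_group R F G n). hom_diff F G n \<beta> \<in> bounded_homs R F G (n + 1)}"

abbreviation ext_cl where
  "ext_cl R F G n \<beta> \<equiv> coh_class (hom_complex R F G) n \<beta>"

abbreviation stable_cl where
  "stable_cl R F G n \<beta> \<equiv> coh_class (stable_hom_complex R F G) n (stable_class R F G n \<beta>)"

lemma stable_hom_complex_eq: "stable_hom_complex R F G = quot_complex (hom_complex R F G) (bounded_homs R F G)"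
  by (simp add: stable_hom_complex_def quot_complex_def hom_complex_def stable_class_def)

context hom_pair
begin

abbreviation scl :: "int \<Rightarrow> (int \<Rightarrow> 'c \<Rightarrow> 'd) \<Rightarrow> (int \<Rightarrow> 'c \<Rightarrow> 'd) set set" where
  "scl n \<beta> \<equiv> coh_class (quot_complex (hom_complex R F G) (bounded_homs R F G)) n
    (bounded_homs R F G n #>\<^bsub>hom_group R F G n\<^esub> \<beta>)"

lemma hom_Z_eq: "hom_Z R F G n = kernel (hom_group R F G n) (hom_group R F G (n + 1)) (hom_diff F G n)"
  by (auto simp: hom_Z_def hom.Z_iff)

lemma hom_Z_closed: "\<beta> \<in> hom_Z R F G n \<Longrightarrow> \<beta> \<in> H n"
  by (simp add: hom_Z_def)

lemma stable_Z_closed: "\<beta> \<in> stable_Z R F G n \<Longrightarrow> \<beta> \<in> H n"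
  by (simp add: stable_Z_def)

lemma hom_Z_stable: "\<beta> \<in> hom_Z R F G n \<Longrightarrow> \<beta> \<in> stable_Z R F G n"
  using subgroup.one_closed[OF bounded_subgroup] by (simp add: hom_Z_def stable_Z_def)

lemma ext_comm_group: "comm_group (cohomology (hom_complex R F G) n)"
  by (rule hom.cohomology_comm_group)

lemma ext_elem:
  assumes "U \<in> carrier (cohomology (hom_complex R F G) n)"
  obtains \<beta> where "\<beta> \<in> hom_Z R F G n" "U = ext_cl R F G n \<beta>"
  using hom.coh_elem[OF assms] unfolding hom_Z_eq by metis

lemma ext_cl_closed: "\<beta> \<in> hom_Z R F G n \<Longrightarrow> ext_cl R F G n \<beta> \<in> carrier (cohomology (hom_complex R F G) n)"
  unfolding hom_Z_eq by (rule hom.coh_class_closed)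

lemma ext_cl_mult: "\<lbrakk>\<alpha> \<in> hom_Z R F G n; \<beta> \<in> hom_Z R F G n\<rbrakk> \<Longrightarrow>
    ext_cl R F G n \<alpha> \<otimes>\<^bsub>cohomology (hom_complex R F G) n\<^esub> ext_cl R F G n \<beta> =
    ext_cl R F G n (\<alpha> \<otimes>\<^bsub>hom_group R F G n\<^esub> \<beta>)"
  unfolding hom_Z_eq by (rule hom.coh_class_mult)

lemma ext_cl_eqI:
  assumes a: "\<alpha> \<in> hom_Z R F G n" and b: "\<beta> \<in> hom_Z R F G n" and g: "\<gamma> \<in> H m" and m: "m = n - 1"
    and eq: "\<And>i x. x \<in> carrier (obj F i) \<Longrightarrow> \<alpha> i x = hom_diff F G m \<gamma> i x \<oplus>\<^bsub>obj G (i - n)\<^esub> \<beta> i x"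
  shows "ext_cl R F G n \<alpha> = ext_cl R F G n \<beta>"
proof -
  have "hom_diff F G m \<gamma> \<in> H n" by (rule hom_diff_closed[OF g]) (simp add: m)
  then have "\<alpha> = hom_diff F G m \<gamma> \<otimes>\<^bsub>hom_group R F G n\<^esub> \<beta>"
    using a b by (intro H_eqI[of _ n] mult_closed) (simp_all add: hom_Z_closed mult_apply eq)
  then show ?thesis
    using a b g unfolding hom_Z_eq by (subst hom.coh_class_eq_iff) (auto simp: m)
qed

lemma stable_comm_group: "comm_group (cohomology (stable_hom_complex R F G) n)"
  unfolding stable_hom_complex_eq by (rule hom.quot.cohomology_comm_group)

lemma stable_cl_eq: "stable_cl R F G n \<beta> = scl n \<beta>"
  by (simp add: stable_hom_complex_eq stable_class_def)

lemma stable_elem: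
  assumes "U \<in> carrier (cohomology (stable_hom_complex R F G) n)"
  obtains \<beta> where "\<beta> \<in> stable_Z R F G n" "U = stable_cl R F G n \<beta>"
proof -
  obtain \<beta> where "\<beta> \<in> H n" "hom_diff F G n \<beta> \<in> bounded_homs R F G (n + 1)" "U = scl n \<beta>"
    using hom.scl_elem[OF assms[unfolded stable_hom_complex_eq]] by blast
  then show thesis using that[of \<beta>] unfolding stable_cl_eq by (simp add: stable_Z_def)
qed

lemma stable_cl_closed: "\<beta> \<in> stable_Z R F G n \<Longrightarrow> stable_cl R F G n \<beta> \<in> carrier (cohomology (stable_hom_complex R F G) n)"
  unfolding stable_cl_eq unfolding stable_hom_complex_eq
  by (rule hom.quot.coh_class_closed[OF hom.quot_Z]) (auto simp: stable_Z_def)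

lemma stable_cl_mult:
  assumes "\<alpha> \<in> stable_Z R F G n" "\<beta> \<in> stable_Z R F G n"
  shows "stable_cl R F G n \<alpha> \<otimes>\<^bsub>cohomology (stable_hom_complex R F G) n\<^esub> stable_cl R F G n \<beta> =
    stable_cl R F G n (\<alpha> \<otimes>\<^bsub>hom_group R F G n\<^esub> \<beta>)"
  using assms unfolding stable_cl_eq stable_Z_def unfolding stable_hom_complex_eq
  by (simp add: hom.quot.coh_class_mult hom.quot_Z[where m = "n + 1"] hom.qcl_mult)

lemma stable_cl_eq_iff:
  "\<lbrakk>\<alpha> \<in> stable_Z R F G n; \<beta> \<in> stable_Z R F G n\<rbrakk> \<Longrightarrow>
    stable_cl R F G n \<alpha> = stable_cl R F G n \<beta> \<longleftrightarrow>
    (\<exists>\<gamma> \<in> H (n - 1). \<exists>\<delta> \<in> bounded_homs R F G n.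
      \<alpha> = \<delta> \<otimes>\<^bsub>hom_group R F G n\<^esub> (hom_diff F G (n - 1) \<gamma> \<otimes>\<^bsub>hom_group R F G n\<^esub> \<beta>))"
  unfolding stable_cl_eq stable_Z_def by (simp add: hom.scl_eq_iff)

text \<open>A homotopy identity above some degree k is enough: the discrepancy \<open>?d\<close>
  vanishes there, so it is a bounded cochain and disappears in the quotient.\<close>

lemma stable_cl_eqI:
  assumes a: "\<alpha> \<in> stable_Z R F G n" and b: "\<beta> \<in> stable_Z R F G n" and g: "\<gamma> \<in> H m" and m: "m = n - 1"
    and eq: "\<And>i x. k < i \<Longrightarrow> x \<in> carrier (obj F i) \<Longrightarrow> \<alpha> i x = hom_diff F G m \<gamma> i x \<oplus>\<^bsub>obj G (i - n)\<^esub> \<beta> i x"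
  shows "stable_cl R F G n \<alpha> = stable_cl R F G n \<beta>"
proof -
  note ah = stable_Z_closed[OF a] and bh = stable_Z_closed[OF b]
  have d: "hom_diff F G m \<gamma> \<in> H n" by (rule hom_diff_closed[OF g]) (simp add: m)
  let ?b = "hom_diff F G m \<gamma> \<otimes>\<^bsub>hom_group R F G n\<^esub> \<beta>"
  let ?d = "\<alpha> \<otimes>\<^bsub>hom_group R F G n\<^esub> inv\<^bsub>hom_group R F G n\<^esub> ?b"
  have b': "?b \<in> H n" using d bh by (rule mult_closed)
  have "?d \<in> bounded_homs R F G n"
  proof (rule boundedI[where k = k])
    show "?d \<in> H n" using ah b' by simp
    fix i x assume "k < i" and x: "x \<in> carrier (obj F i)"
    then have "?d i x = ?b i x \<oplus>\<^bsub>obj G (i - n)\<^esub> \<ominus>\<^bsub>obj G (i - n)\<^esub> ?b i x"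
      using b' by (simp add: mult_apply inv_apply eq)
    then show "?d i x = \<zero>\<^bsub>obj G (i - n)\<^esub>"
      using H_closed[OF b' x refl] by (simp add: G.obj.M.r_neg)
  qed
  moreover have "\<alpha> = ?d \<otimes>\<^bsub>hom_group R F G n\<^esub> ?b"
    using ah b' by (simp add: hom.m_assoc)
  ultimately show ?thesis
    unfolding stable_cl_eq_iff[OF a b] using g m by blast
qed

lemma iota_cl:
  assumes "\<beta> \<in> hom_Z R F G n"
  shows "iota R F G n (ext_cl R F G n \<beta>) = stable_cl R F G n \<beta>"
  using hom.iota_class[of \<beta> n] assms
  by (simp add: hom_Z_eq iota_def stable_cl_eq)

lemma stable_cl_eq_one_iff:
  assumes b: "\<beta> \<in> stable_Z R F G n"
  shows "stable_cl R F G n \<beta> = \<one>\<^bsub>cohomology (stable_hom_complex R F G) n\<^esub> \<longleftrightarrow>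
    (\<exists>\<gamma> \<in> H (n - 1). \<exists>\<delta> \<in> bounded_homs R F G n. \<beta> = \<delta> \<otimes>\<^bsub>hom_group R F G n\<^esub> hom_diff F G (n - 1) \<gamma>)"
proof -
  have "\<one>\<^bsub>cohomology (stable_hom_complex R F G) n\<^esub> = scl n \<one>\<^bsub>hom_group R F G n\<^esub>"
    using hom.quot.coh_class_one[of n] hom.qcl_eq_one_iff[of "\<one>\<^bsub>hom_group R F G n\<^esub>" n] subgroup.one_closed[OF bounded_subgroup]
    by (simp add: stable_hom_complex_eq one_closed)
  moreover have "\<one>\<^bsub>hom_group R F G n\<^esub> \<in> stable_Z R F G n"
    using subgroup.one_closed[OF bounded_subgroup[of n]] bounded_diff by (simp add: stable_Z_def one_closed)
  moreover have "hom_diff F G (n - 1) \<gamma> \<otimes>\<^bsub>hom_group R F G n\<^esub> \<one>\<^bsub>hom_group R F G n\<^esub> = hom_diff F G (n - 1) \<gamma>"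
    if "\<gamma> \<in> H (n - 1)" for \<gamma> using that hom_diff_closed[OF that, of n] by simp
  ultimately show ?thesis
    using stable_cl_eq_iff[OF b] by (simp add: stable_cl_eq)
qed

end

section \<open>Composition products\<close>

lemma hom_comp_apply: "x \<in> carrier (obj F i) \<Longrightarrow> j = i - n \<Longrightarrow> hom_comp F n \<alpha> \<beta> i x = \<alpha> j (\<beta> i x)"
  by (simp add: hom_comp_def compose_def)

locale hom_triple = FG: hom_pair R M F \<epsilon> N G \<eta> + GH: hom_pair R N G \<eta> K H \<kappa> + FH: hom_pair R M F \<epsilon> K H \<kappa>
  for R :: "'a ring" and M :: "('a, 'm) module" and F :: "('a, 'c) chain_complex" and \<epsilon>
    and N :: "('a, 'n) module" and G :: "('a, 'd) chain_complex" and \<eta>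
    and K :: "('a, 'k) module" and H :: "('a, 'e) chain_complex" and \<kappa>
begin

lemma comp_closed:
  assumes a: "\<alpha> \<in> GH.H m" and b: "\<beta> \<in> FG.H n" and k: "k = m + n"
  shows "hom_comp F n \<alpha> \<beta> \<in> FH.H k"
  unfolding FH.H_iff hom_comp_def
proof
  show "compose (carrier (obj F i)) (\<alpha> (i - n)) (\<beta> i) \<in> lin_hom R (obj F i) (obj H (i - k))" for i
    by (rule lin_hom_compose[OF GH.H_lin[OF a] FG.H_lin[OF b refl] FG.F.obj_module]) (simp add: k)
qed

lemma comp_pairing: "graded_pairing (hom_group R G H) (hom_group R F G) (hom_group R F H) (\<lambda>m n. hom_comp F n)"
  unfolding graded_pairing_def
proof (intro conjI allI ballI)
  fix m n \<alpha> \<beta> assume a: "\<alpha> \<in> GH.H m" and b: "\<beta> \<in> FG.H n"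
  show "hom_comp F n \<alpha> \<beta> \<in> FH.H (m + n)" by (rule comp_closed[OF a b refl])
  show "hom_comp F n (\<alpha> \<otimes>\<^bsub>hom_group R G H m\<^esub> \<alpha>') \<beta> = hom_comp F n \<alpha> \<beta> \<otimes>\<^bsub>hom_group R F H (m + n)\<^esub> hom_comp F n \<alpha>' \<beta>"
    if a': "\<alpha>' \<in> GH.H m" for \<alpha>'
  proof (rule FH.H_eqI[of _ "m + n"])
    fix i x assume x: "x \<in> carrier (obj F i)"
    have bx: "\<beta> i x \<in> carrier (obj G (i - n))" by (rule FG.H_closed[OF b x refl])
    have j: "i - (m + n) = i - n - m" by simp
    show "hom_comp F n (\<alpha> \<otimes>\<^bsub>hom_group R G H m\<^esub> \<alpha>') \<beta> i x =
      (hom_comp F n \<alpha> \<beta> \<otimes>\<^bsub>hom_group R F H (m + n)\<^esub> hom_comp F n \<alpha>' \<beta>) i x"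
      unfolding FH.mult_apply[OF x refl] hom_comp_apply[OF x refl] GH.mult_apply[OF bx refl] j by (rule refl)
  qed (use a b a' in \<open>auto intro!: comp_closed FH.mult_closed GH.mult_closed\<close>)
  show "hom_comp F n \<alpha> (\<beta> \<otimes>\<^bsub>hom_group R F G n\<^esub> \<beta>') = hom_comp F n \<alpha> \<beta> \<otimes>\<^bsub>hom_group R F H (m + n)\<^esub> hom_comp F n \<alpha> \<beta>'"
    if b': "\<beta>' \<in> FG.H n" for \<beta>'
  proof (rule FH.H_eqI[of _ "m + n"])
    fix i x assume x: "x \<in> carrier (obj F i)"
    have bx: "\<beta> i x \<in> carrier (obj G (i - n))" "\<beta>' i x \<in> carrier (obj G (i - n))"
      using FG.H_closed[OF b x refl] FG.H_closed[OF b' x refl] .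
    have j: "i - (m + n) = i - n - m" by simp
    show "hom_comp F n \<alpha> (\<beta> \<otimes>\<^bsub>hom_group R F G n\<^esub> \<beta>') i x =
      (hom_comp F n \<alpha> \<beta> \<otimes>\<^bsub>hom_group R F H (m + n)\<^esub> hom_comp F n \<alpha> \<beta>') i x"
      unfolding FH.mult_apply[OF x refl] FG.mult_apply[OF x refl] hom_comp_apply[OF x refl] j
      by (rule GH.H_add[OF a bx refl])
  qed (use a b b' in \<open>auto intro!: comp_closed FH.mult_closed FG.mult_closed\<close>)
qed

lemma comp_leibniz:
  assumes a: "\<alpha> \<in> GH.H m" and b: "\<beta> \<in> FG.H n"
  shows "hom_diff F H (m + n) (hom_comp F n \<alpha> \<beta>) =
    hom_comp F n (hom_diff G H m \<alpha>) \<beta> \<otimes>\<^bsub>hom_group R F H (m + n + 1)\<^esub>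
      (if even m then hom_comp F (n + 1) \<alpha> (hom_diff F G n \<beta>)
       else inv\<^bsub>hom_group R F H (m + n + 1)\<^esub> (hom_comp F (n + 1) \<alpha> (hom_diff F G n \<beta>)))"
  (is "?l = ?r")
proof (rule FH.H_eqI[of _ "m + n + 1"])
  have da: "hom_diff G H m \<alpha> \<in> GH.H (m + 1)" by (rule GH.hom_diff_closed[OF a refl])
  have db: "hom_diff F G n \<beta> \<in> FG.H (n + 1)" by (rule FG.hom_diff_closed[OF b refl])
  have c: "hom_comp F (n + 1) \<alpha> (hom_diff F G n \<beta>) \<in> FH.H (m + n + 1)" by (rule comp_closed[OF a db]) simp
  show "?l \<in> FH.H (m + n + 1)" by (rule FH.hom_diff_closed[OF comp_closed[OF a b refl] refl])
  have "hom_comp F n (hom_diff G H m \<alpha>) \<beta> \<in> FH.H (m + n + 1)" by (rule comp_closed[OF da b]) simp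
  then show "?r \<in> FH.H (m + n + 1)" using c by simp
  fix i x assume x: "x \<in> carrier (obj F i)"
  define j where "j = i - (m + n) - 1"
  have j: "j = i - n - m - 1" "j = i - (m + n + 1)" "i - n - 1 - m = j" "i - 1 - n - m = j" "j = i - (m + n) - 1"
    "i - (n + 1) = i - n - 1" by (simp_all add: j_def)
  have dx: "bd F i x \<in> carrier (obj F (i - 1))" by (rule FG.F.bd_closed[OF x refl])
  have bx: "\<beta> i x \<in> carrier (obj G (i - n))" by (rule FG.H_closed[OF b x refl])
  have bdx: "\<beta> (i - 1) (bd F i x) \<in> carrier (obj G (i - n - 1))" by (rule FG.H_closed[OF b dx]) simp
  have dbx: "bd G (i - n) (\<beta> i x) \<in> carrier (obj G (i - n - 1))" by (rule FG.G.bd_closed[OF bx refl])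
  \<comment> \<open>The terms d\<alpha>\<beta>, \<alpha>d\<beta> and \<alpha>\<beta>d. The left side
    contains the first and the last; the middle one occurs twice on the right and telescopes out in
    each of the four parity cases.\<close>
  let ?A = "bd H (i - n - m) (\<alpha> (i - n) (\<beta> i x))" and ?B = "\<alpha> (i - n - 1) (bd G (i - n) (\<beta> i x))"
    and ?C = "\<alpha> (i - n - 1) (\<beta> (i - 1) (bd F i x))"
  have cl: "?A \<in> carrier (obj H j)" "?B \<in> carrier (obj H j)" "?C \<in> carrier (obj H j)"
    by (rule GH.G.bd_closed[OF GH.H_closed[OF a bx refl] j(1)] GH.H_closed[OF a dbx j(3)[symmetric]]
        GH.H_closed[OF a bdx j(3)[symmetric]])+
  have l: "?l i x = (if even (m + n) then ?A \<ominus>\<^bsub>obj H j\<^esub> ?C else ?A \<oplus>\<^bsub>obj H j\<^esub> ?C)"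
    unfolding FH.diff_apply[OF x j(5)] hom_comp_apply[OF x refl] hom_comp_apply[OF dx refl]
    by (simp add: algebra_simps)
  have r1: "hom_comp F n (hom_diff G H m \<alpha>) \<beta> i x = (if even m then ?A \<ominus>\<^bsub>obj H j\<^esub> ?B else ?A \<oplus>\<^bsub>obj H j\<^esub> ?B)"
    unfolding hom_comp_apply[OF x refl] GH.diff_apply[OF bx j(1)] ..
  have "hom_comp F (n + 1) \<alpha> (hom_diff F G n \<beta>) i x =
      \<alpha> (i - n - 1) (if even n then bd G (i - n) (\<beta> i x) \<ominus>\<^bsub>obj G (i - n - 1)\<^esub> \<beta> (i - 1) (bd F i x)
        else bd G (i - n) (\<beta> i x) \<oplus>\<^bsub>obj G (i - n - 1)\<^esub> \<beta> (i - 1) (bd F i x))"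
    unfolding hom_comp_apply[OF x refl] FG.diff_apply[OF x refl] j(6) ..
  also have "\<dots> = (if even n then ?B \<ominus>\<^bsub>obj H j\<^esub> ?C else ?B \<oplus>\<^bsub>obj H j\<^esub> ?C)"
    using GH.H_diff[OF a dbx bdx j(3)[symmetric]] GH.H_add[OF a dbx bdx j(3)[symmetric]] by simp
  finally have r2: "hom_comp F (n + 1) \<alpha> (hom_diff F G n \<beta>) i x =
    (if even n then ?B \<ominus>\<^bsub>obj H j\<^esub> ?C else ?B \<oplus>\<^bsub>obj H j\<^esub> ?C)" .
  show "?l i x = ?r i x"
    unfolding l FH.mult_apply[OF x j(2)] r1 if_distrib[of "\<lambda>\<gamma>. \<gamma> i x"] FH.inv_apply[OF c x j(2)] r2
    using cl by (auto simp: GH.G.obj.M.telescope_diff_diff GH.G.obj.M.telescope_diff_add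
      GH.G.obj.M.telescope_add_diff GH.G.obj.M.telescope_add_minus GH.G.obj.M.minus_eq[symmetric])
qed

lemma comp_bounded_left:
  assumes a: "\<alpha> \<in> bounded_homs R G H m" and b: "\<beta> \<in> FG.H n"
  shows "hom_comp F n \<alpha> \<beta> \<in> bounded_homs R F H (m + n)"
proof -
  obtain k where k: "\<And>i j x. k < i \<Longrightarrow> x \<in> carrier (obj G i) \<Longrightarrow> j = i - m \<Longrightarrow> \<alpha> i x = \<zero>\<^bsub>obj H j\<^esub>"
    using GH.boundedE[OF a] by blast
  have "\<alpha> \<in> GH.H m" using a by (simp add: GH.bounded_iff)
  then show ?thesis
    \<comment> \<open>\<beta> lowers degrees by n, so from source degrees above k + n its values lie
      in degrees above k, where \<alpha> vanishes.\<close>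
    by (rule FH.boundedI[where k = "k + n", OF comp_closed[OF _ b refl]])
      (simp add: hom_comp_apply k FG.H_closed[OF b] diff_diff_eq add.commute)
qed

text \<open>The bound stays the same, since \<alpha> is applied after \<beta> and maps zero to
  zero.\<close>

lemma comp_bounded_right:
  assumes a: "\<alpha> \<in> GH.H m" and b: "\<beta> \<in> bounded_homs R F G n"
  shows "hom_comp F n \<alpha> \<beta> \<in> bounded_homs R F H (m + n)"
proof -
  obtain k where k: "\<And>i j x. k < i \<Longrightarrow> x \<in> carrier (obj F i) \<Longrightarrow> j = i - n \<Longrightarrow> \<beta> i x = \<zero>\<^bsub>obj G j\<^esub>"
    using FG.boundedE[OF b] by blast
  have "\<beta> \<in> FG.H n" using b by (simp add: FG.bounded_iff)
  then show ?thesis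
    by (rule FH.boundedI[where k = k, OF comp_closed[OF a _ refl]])
      (simp add: hom_comp_apply k GH.H_zero[OF a] diff_diff_eq add.commute)
qed

lemma comp_sub_pairing:
  "sub_pairing (hom_complex R G H) (hom_complex R F G) (hom_complex R F H) (\<lambda>m n. hom_comp F n)
    (bounded_homs R G H) (bounded_homs R F G) (bounded_homs R F H)"
proof -
  have "dg_pairing (hom_complex R G H) (hom_complex R F G) (hom_complex R F H) (\<lambda>m n. hom_comp F n)"
  proof (intro dg_pairing.intro dg_pairing_axioms.intro)
    show "cochain (hom_complex R G H)" by (rule subcomplex.axioms(1)[OF GH.hom_subcomplex])
    show "cochain (hom_complex R F G)" by (rule subcomplex.axioms(1)[OF FG.hom_subcomplex])
    show "cochain (hom_complex R F H)" by (rule subcomplex.axioms(1)[OF FH.hom_subcomplex])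
  qed (unfold hom_complex_def cochain_complex.simps, rule comp_pairing, rule comp_leibniz)
  then show ?thesis
    by (intro sub_pairing.intro sub_pairing_axioms.intro GH.hom_subcomplex FG.hom_subcomplex FH.hom_subcomplex,
      unfold hom_complex_def cochain_complex.simps) (simp_all add: comp_bounded_left comp_bounded_right)
qed

lemma ext_mult_eq: "ext_mult R F H = coh_pair (hom_complex R F H) (\<lambda>m n. hom_comp F n)"
  by (simp add: fun_eq_iff ext_mult_def coh_pair_def)

lemma stable_ext_mult_eq:
  "stable_ext_mult R F H = coh_pair (quot_complex (hom_complex R F H) (bounded_homs R F H))
    (quot_pair (hom_complex R F H) (bounded_homs R F H) (\<lambda>m n. hom_comp F n))"
  by (simp add: fun_eq_iff stable_ext_mult_def coh_pair_def stable_comp_def quot_pair_def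
      stable_hom_complex_eq stable_class_def FH.hom_complex_simps)

lemma ext_pairing:
  "graded_pairing (cohomology (hom_complex R G H)) (cohomology (hom_complex R F G)) (cohomology (hom_complex R F H))
    (ext_mult R F H)"
proof -
  interpret P: sub_pairing "hom_complex R G H" "hom_complex R F G" "hom_complex R F H" "\<lambda>m n. hom_comp F n"
    "bounded_homs R G H" "bounded_homs R F G" "bounded_homs R F H" by (rule comp_sub_pairing)
  show ?thesis unfolding ext_mult_eq by (rule P.coh_pair_pairing)
qed

lemma stable_pairing:
  "graded_pairing (cohomology (stable_hom_complex R G H)) (cohomology (stable_hom_complex R F G))
    (cohomology (stable_hom_complex R F H)) (stable_ext_mult R F H)"
proof -
  interpret P: sub_pairing "hom_complex R G H" "hom_complex R F G" "hom_complex R F H" "\<lambda>m n. hom_comp F n"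
    "bounded_homs R G H" "bounded_homs R F G" "bounded_homs R F H" by (rule comp_sub_pairing)
  show ?thesis unfolding stable_ext_mult_eq stable_hom_complex_eq by (rule P.quot.coh_pair_pairing)
qed

lemma comp_hom_Z:
  assumes "\<alpha> \<in> hom_Z R G H m" "\<beta> \<in> hom_Z R F G n" "k = m + n"
  shows "hom_comp F n \<alpha> \<beta> \<in> hom_Z R F H k"
proof -
  interpret P: sub_pairing "hom_complex R G H" "hom_complex R F G" "hom_complex R F H" "\<lambda>m n. hom_comp F n"
    "bounded_homs R G H" "bounded_homs R F G" "bounded_homs R F H" by (rule comp_sub_pairing)
  show ?thesis using P.p_Z[of \<alpha> m \<beta> n k] assms
    unfolding GH.hom_Z_eq FG.hom_Z_eq FH.hom_Z_eq GH.hom_complex_simps FG.hom_complex_simps FH.hom_complex_simps by blast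
qed

lemma ext_mult_cl:
  assumes "\<alpha> \<in> hom_Z R G H m" "\<beta> \<in> hom_Z R F G n" "k = m + n"
  shows "ext_mult R F H m n (ext_cl R G H m \<alpha>) (ext_cl R F G n \<beta>) = ext_cl R F H k (hom_comp F n \<alpha> \<beta>)"
proof -
  interpret P: sub_pairing "hom_complex R G H" "hom_complex R F G" "hom_complex R F H" "\<lambda>m n. hom_comp F n"
    "bounded_homs R G H" "bounded_homs R F G" "bounded_homs R F H" by (rule comp_sub_pairing)
  show ?thesis unfolding ext_mult_eq using P.coh_pair_class[of \<alpha> m \<beta> n k] assms
    unfolding GH.hom_Z_eq FG.hom_Z_eq GH.hom_complex_simps FG.hom_complex_simps by blast
qed

lemma comp_stable_Z:
  assumes "\<alpha> \<in> stable_Z R G H m" "\<beta> \<in> stable_Z R F G n" "k = m + n"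
  shows "hom_comp F n \<alpha> \<beta> \<in> stable_Z R F H k"
proof -
  interpret P: sub_pairing "hom_complex R G H" "hom_complex R F G" "hom_complex R F H" "\<lambda>m n. hom_comp F n"
    "bounded_homs R G H" "bounded_homs R F G" "bounded_homs R F H" by (rule comp_sub_pairing)
  show ?thesis using P.p_sub_cbd[of \<alpha> m \<beta> n k] comp_closed[of \<alpha> m \<beta> n k] assms
    by (simp add: stable_Z_def GH.hom_complex_simps FG.hom_complex_simps FH.hom_complex_simps)
qed

lemma stable_mult_cl:
  assumes "\<alpha> \<in> stable_Z R G H m" "\<beta> \<in> stable_Z R F G n" "k = m + n"
  shows "stable_ext_mult R F H m n (stable_cl R G H m \<alpha>) (stable_cl R F G n \<beta>) = stable_cl R F H k (hom_comp F n \<alpha> \<beta>)"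
proof -
  interpret P: sub_pairing "hom_complex R G H" "hom_complex R F G" "hom_complex R F H" "\<lambda>m n. hom_comp F n"
    "bounded_homs R G H" "bounded_homs R F G" "bounded_homs R F H" by (rule comp_sub_pairing)
  show ?thesis using P.coh_pair_scl[of \<alpha> m \<beta> n k] assms
    by (simp add: stable_Z_def GH.hom_complex_simps FG.hom_complex_simps FH.hom_complex_simps
        stable_ext_mult_eq GH.stable_cl_eq FG.stable_cl_eq FH.stable_cl_eq)
qed

end

section \<open>Associativity and units of the composition products\<close>

lemma hom_tripleI:
  "\<lbrakk>resolution R M F \<epsilon>; resolution R N G \<eta>; resolution R K H \<kappa>\<rbrakk> \<Longrightarrow> hom_triple R M F \<epsilon> N G \<eta> K H \<kappa>"
  by (intro hom_triple.intro hom_pair.intro)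

lemma (in hom_pair) hom_comp_assoc:
  assumes "\<gamma> \<in> H n"
  shows "hom_comp F n (hom_comp G m \<alpha> \<beta>) \<gamma> = hom_comp F (m + n) \<alpha> (hom_comp F n \<beta> \<gamma>)"
proof (intro ext)
  fix i x
  have e: "i - (m + n) = i - n - m" by simp
  show "hom_comp F n (hom_comp G m \<alpha> \<beta>) \<gamma> i x = hom_comp F (m + n) \<alpha> (hom_comp F n \<beta> \<gamma>) i x"
    using H_closed[OF assms _ refl, of x i] unfolding hom_comp_def compose_def e by simp
qed

text \<open>Four resolutions are allowed, so that the associativity of the rings and the three
  associativity laws of the bimodule are obtained by repeating F or G.\<close>

lemma ext_mult_assoc:
  assumes F: "resolution R M F \<epsilon>" and G: "resolution R N G \<eta>" and H: "resolution R K H \<kappa>" and L: "resolution R P L \<theta>"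
    and x: "x \<in> carrier (cohomology (hom_complex R H L) k)" and y: "y \<in> carrier (cohomology (hom_complex R G H) m)"
    and z: "z \<in> carrier (cohomology (hom_complex R F G) n)"
  shows "ext_mult R F L (k + m) n (ext_mult R G L k m x y) z = ext_mult R F L k (m + n) x (ext_mult R F H m n y z)"
proof -
  interpret FGH: hom_triple R M F \<epsilon> N G \<eta> K H \<kappa> by (rule hom_tripleI[OF F G H])
  interpret GHL: hom_triple R N G \<eta> K H \<kappa> P L \<theta> by (rule hom_tripleI[OF G H L])
  interpret FHL: hom_triple R M F \<epsilon> K H \<kappa> P L \<theta> by (rule hom_tripleI[OF F H L])
  interpret FGL: hom_triple R M F \<epsilon> N G \<eta> P L \<theta> by (rule hom_tripleI[OF F G L])
  obtain \<alpha> where a: "\<alpha> \<in> hom_Z R H L k" "x = ext_cl R H L k \<alpha>" using GHL.GH.ext_elem[OF x] .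
  obtain \<beta> where b: "\<beta> \<in> hom_Z R G H m" "y = ext_cl R G H m \<beta>" using FGH.GH.ext_elem[OF y] .
  obtain \<gamma> where c: "\<gamma> \<in> hom_Z R F G n" "z = ext_cl R F G n \<gamma>" using FGH.FG.ext_elem[OF z] .
  show ?thesis
    using a b c by (simp add: GHL.ext_mult_cl FGH.ext_mult_cl FGL.ext_mult_cl FHL.ext_mult_cl GHL.comp_hom_Z FGH.comp_hom_Z
        FGH.FG.hom_comp_assoc FGH.FG.hom_Z_closed add.assoc)
qed

lemma stable_ext_mult_assoc:
  assumes F: "resolution R M F \<epsilon>" and G: "resolution R N G \<eta>" and H: "resolution R K H \<kappa>" and L: "resolution R P L \<theta>"
    and x: "x \<in> carrier (cohomology (stable_hom_complex R H L) k)" and y: "y \<in> carrier (cohomology (stable_hom_complex R G H) m)"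
    and z: "z \<in> carrier (cohomology (stable_hom_complex R F G) n)"
  shows "stable_ext_mult R F L (k + m) n (stable_ext_mult R G L k m x y) z =
    stable_ext_mult R F L k (m + n) x (stable_ext_mult R F H m n y z)"
proof -
  interpret FGH: hom_triple R M F \<epsilon> N G \<eta> K H \<kappa> by (rule hom_tripleI[OF F G H])
  interpret GHL: hom_triple R N G \<eta> K H \<kappa> P L \<theta> by (rule hom_tripleI[OF G H L])
  interpret FHL: hom_triple R M F \<epsilon> K H \<kappa> P L \<theta> by (rule hom_tripleI[OF F H L])
  interpret FGL: hom_triple R M F \<epsilon> N G \<eta> P L \<theta> by (rule hom_tripleI[OF F G L])
  obtain \<alpha> where a: "\<alpha> \<in> stable_Z R H L k" "x = stable_cl R H L k \<alpha>" using GHL.GH.stable_elem[OF x] .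
  obtain \<beta> where b: "\<beta> \<in> stable_Z R G H m" "y = stable_cl R G H m \<beta>" using FGH.GH.stable_elem[OF y] .
  obtain \<gamma> where c: "\<gamma> \<in> stable_Z R F G n" "z = stable_cl R F G n \<gamma>" using FGH.FG.stable_elem[OF z] .
  show ?thesis
    using a b c by (simp add: GHL.stable_mult_cl FGH.stable_mult_cl FGL.stable_mult_cl FHL.stable_mult_cl
        GHL.comp_stable_Z FGH.comp_stable_Z FGH.FG.hom_comp_assoc FGH.FG.stable_Z_closed add.assoc)
qed

lemma ident_hom_Z:
  assumes F: "resolution R M F \<epsilon>"
  shows "hom_ident F \<in> hom_Z R F F 0"
proof -
  interpret hom_pair R M F \<epsilon> M F \<epsilon> by (intro hom_pair.intro F)
  have c: "hom_ident F \<in> H 0"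
    unfolding H_iff hom_ident_def by (simp add: lin_hom_id F.obj_module)
  moreover have "hom_diff F F 0 (hom_ident F) = \<one>\<^bsub>hom_group R F F (0 + 1)\<^esub>"
  proof (rule H_eqI[of _ "0 + 1"])
    show "hom_diff F F 0 (hom_ident F) i x = \<one>\<^bsub>hom_group R F F (0 + 1)\<^esub> i x" if x: "x \<in> carrier (obj F i)" for i x
      using F.bd_closed[OF x refl] x
      by (simp add: diff_apply[OF x refl] one_apply[OF x refl] hom_ident_def F.obj.M.diff_self)
  qed (use hom_diff_closed[OF c] one_closed in simp_all)
  ultimately show ?thesis by (simp add: hom_Z_def)
qed

text \<open>Cochains are extensional in each degree. The identity cochain is therefore a unit for
  composition as an equality of functions, also off the carriers, and unit laws hold before passing
  to classes.\<close>

lemma (in hom_pair) H_undefined: "\<beta> \<in> H n \<Longrightarrow> x \<notin> carrier (obj F i) \<Longrightarrow> \<beta> i x = undefined"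
  using lin_hom_extensional[OF H_lin[OF _ refl]] by (rule extensional_arb)

lemma (in hom_pair) comp_ident_right:
  assumes "\<beta> \<in> H n"
  shows "hom_comp F 0 \<beta> (hom_ident F) = \<beta>"
  by (intro ext) (simp add: hom_comp_def hom_ident_def compose_def H_undefined[OF assms])

lemma (in hom_pair) comp_ident_left:
  assumes "\<beta> \<in> H n"
  shows "hom_comp F n (hom_ident G) \<beta> = \<beta>"
  by (intro ext) (simp add: hom_comp_def hom_ident_def compose_def H_undefined[OF assms] H_closed[OF assms])

lemma ext_mult_one_left:
  assumes F: "resolution R M F \<epsilon>" and G: "resolution R N G \<eta>"
    and x: "x \<in> carrier (cohomology (hom_complex R F G) n)"
  shows "ext_mult R F G 0 n (ext_cl R G G 0 (hom_ident G)) x = x"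
proof -
  interpret T: hom_triple R M F \<epsilon> N G \<eta> N G \<eta> by (rule hom_tripleI[OF F G G])
  obtain \<alpha> where a: "\<alpha> \<in> hom_Z R F G n" "x = ext_cl R F G n \<alpha>" using T.FG.ext_elem[OF x] .
  then show ?thesis
    by (simp add: T.ext_mult_cl ident_hom_Z[OF G] T.FG.comp_ident_left T.FG.hom_Z_closed)
qed

lemma ext_mult_one_right:
  assumes F: "resolution R M F \<epsilon>" and G: "resolution R N G \<eta>"
    and x: "x \<in> carrier (cohomology (hom_complex R F G) n)"
  shows "ext_mult R F G n 0 x (ext_cl R F F 0 (hom_ident F)) = x"
proof -
  interpret T: hom_triple R M F \<epsilon> M F \<epsilon> N G \<eta> by (rule hom_tripleI[OF F F G])
  obtain \<alpha> where a: "\<alpha> \<in> hom_Z R F G n" "x = ext_cl R F G n \<alpha>" using T.GH.ext_elem[OF x] .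
  then show ?thesis
    by (simp add: T.ext_mult_cl ident_hom_Z[OF F] T.GH.comp_ident_right[of _ n] T.GH.hom_Z_closed)
qed

lemma stable_mult_one_left:
  assumes F: "resolution R M F \<epsilon>" and G: "resolution R N G \<eta>"
    and x: "x \<in> carrier (cohomology (stable_hom_complex R F G) n)"
  shows "stable_ext_mult R F G 0 n (stable_cl R G G 0 (hom_ident G)) x = x"
proof -
  interpret T: hom_triple R M F \<epsilon> N G \<eta> N G \<eta> by (rule hom_tripleI[OF F G G])
  obtain \<alpha> where a: "\<alpha> \<in> stable_Z R F G n" "x = stable_cl R F G n \<alpha>" using T.FG.stable_elem[OF x] .
  then show ?thesis
    by (simp add: T.stable_mult_cl T.GH.hom_Z_stable ident_hom_Z[OF G] T.FG.comp_ident_left T.FG.stable_Z_closed)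
qed

lemma stable_mult_one_right:
  assumes F: "resolution R M F \<epsilon>" and G: "resolution R N G \<eta>"
    and x: "x \<in> carrier (cohomology (stable_hom_complex R F G) n)"
  shows "stable_ext_mult R F G n 0 x (stable_cl R F F 0 (hom_ident F)) = x"
proof -
  interpret T: hom_triple R M F \<epsilon> M F \<epsilon> N G \<eta> by (rule hom_tripleI[OF F F G])
  obtain \<alpha> where a: "\<alpha> \<in> stable_Z R F G n" "x = stable_cl R F G n \<alpha>" using T.GH.stable_elem[OF x] .
  then show ?thesis
    by (simp add: T.stable_mult_cl T.FG.hom_Z_stable ident_hom_Z[OF F] T.GH.comp_ident_right[of _ n] T.GH.stable_Z_closed)
qed

lemma ext_ring_simps:
  "gr_comp (ext_ring R F) = cohomology (hom_complex R F F)" "gr_mult (ext_ring R F) = ext_mult R F F"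
  "gr_one (ext_ring R F) = ext_cl R F F 0 (hom_ident F)"
  "gr_comp (stable_ext_ring R F) = cohomology (stable_hom_complex R F F)"
  "gr_mult (stable_ext_ring R F) = stable_ext_mult R F F"
  "gr_one (stable_ext_ring R F) = stable_cl R F F 0 (hom_ident F)"
  by (simp_all add: ext_ring_def stable_ext_ring_def)

lemma ext_bimod_simps:
  "bm_comp (ext_bimod R F G) = cohomology (hom_complex R F G)"
  "bm_left (ext_bimod R F G) = ext_mult R F G" "bm_right (ext_bimod R F G) = ext_mult R F G"
  "bm_comp (stable_ext_bimod R F G) = cohomology (stable_hom_complex R F G)"
  "bm_left (stable_ext_bimod R F G) = stable_ext_mult R F G" "bm_right (stable_ext_bimod R F G) = stable_ext_mult R F G"
  by (simp_all add: ext_bimod_def stable_ext_bimod_def)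

lemma ext_graded_ring:
  assumes F: "resolution R M F \<epsilon>"
  shows "graded_ring (ext_ring R F)"
proof -
  interpret T: hom_triple R M F \<epsilon> M F \<epsilon> M F \<epsilon> by (rule hom_tripleI[OF F F F])
  show ?thesis
    by (rule graded_ring.intro; unfold ext_ring_simps)
      (rule T.FG.ext_comm_group T.ext_pairing ext_mult_assoc[OF F F F F] T.FG.ext_cl_closed[OF ident_hom_Z[OF F]]
        ext_mult_one_left[OF F F] ext_mult_one_right[OF F F]; assumption?)+
qed

lemma stable_ext_graded_ring:
  assumes F: "resolution R M F \<epsilon>"
  shows "graded_ring (stable_ext_ring R F)"
proof -
  interpret T: hom_triple R M F \<epsilon> M F \<epsilon> M F \<epsilon> by (rule hom_tripleI[OF F F F])
  show ?thesis
    by (rule graded_ring.intro; unfold ext_ring_simps)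
      (rule T.FG.stable_comm_group T.stable_pairing stable_ext_mult_assoc[OF F F F F]
        T.FG.stable_cl_closed[OF T.FG.hom_Z_stable[OF ident_hom_Z[OF F]]]
        stable_mult_one_left[OF F F] stable_mult_one_right[OF F F]; assumption?)+
qed

lemma ext_graded_bimodule:
  assumes F: "resolution R M F \<epsilon>" and G: "resolution R N G \<eta>"
  shows "graded_bimodule (ext_ring R G) (ext_ring R F) (ext_bimod R F G)"
proof -
  interpret L: hom_triple R M F \<epsilon> N G \<eta> N G \<eta> by (rule hom_tripleI[OF F G G])
  interpret R: hom_triple R M F \<epsilon> M F \<epsilon> N G \<eta> by (rule hom_tripleI[OF F F G])
  show ?thesis
    by (intro graded_bimodule.intro graded_bimodule_axioms.intro ext_graded_ring[OF F] ext_graded_ring[OF G];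
        unfold ext_ring_simps ext_bimod_simps)
      (rule L.FG.ext_comm_group L.ext_pairing R.ext_pairing ext_mult_assoc[OF F G G G] ext_mult_assoc[OF F F F G]
        ext_mult_assoc[OF F F G G] ext_mult_one_left[OF F G] ext_mult_one_right[OF F G]; assumption)+
qed

lemma stable_ext_graded_bimodule:
  assumes F: "resolution R M F \<epsilon>" and G: "resolution R N G \<eta>"
  shows "graded_bimodule (stable_ext_ring R G) (stable_ext_ring R F) (stable_ext_bimod R F G)"
proof -
  interpret L: hom_triple R M F \<epsilon> N G \<eta> N G \<eta> by (rule hom_tripleI[OF F G G])
  interpret R: hom_triple R M F \<epsilon> M F \<epsilon> N G \<eta> by (rule hom_tripleI[OF F F G])
  show ?thesis
    by (intro graded_bimodule.intro graded_bimodule_axioms.intro stable_ext_graded_ring[OF F] stable_ext_graded_ring[OF G];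
        unfold ext_ring_simps ext_bimod_simps)
      (rule L.FG.stable_comm_group L.stable_pairing R.stable_pairing stable_ext_mult_assoc[OF F G G G]
        stable_ext_mult_assoc[OF F F F G] stable_ext_mult_assoc[OF F F G G]
        stable_mult_one_left[OF F G] stable_mult_one_right[OF F G]; assumption)+
qed

section \<open>The comparison map from absolute to stable cohomology\<close>

lemma (in hom_pair) iota_hom:
  "iota R F G n \<in> hom (cohomology (hom_complex R F G) n) (cohomology (stable_hom_complex R F G) n)"
proof (rule homI)
  fix x y assume x: "x \<in> carrier (cohomology (hom_complex R F G) n)" and y: "y \<in> carrier (cohomology (hom_complex R F G) n)"
  obtain \<alpha> where a: "\<alpha> \<in> hom_Z R F G n" "x = ext_cl R F G n \<alpha>" using ext_elem[OF x] .
  obtain \<beta> where b: "\<beta> \<in> hom_Z R F G n" "y = ext_cl R F G n \<beta>" using ext_elem[OF y] .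
  have "\<alpha> \<otimes>\<^bsub>hom_group R F G n\<^esub> \<beta> \<in> hom_Z R F G n"
    using a(1) b(1) unfolding hom_Z_eq by (rule hom.Z_mult)
  then show "iota R F G n (x \<otimes>\<^bsub>cohomology (hom_complex R F G) n\<^esub> y) =
      iota R F G n x \<otimes>\<^bsub>cohomology (stable_hom_complex R F G) n\<^esub> iota R F G n y"
    using a b by (simp add: ext_cl_mult stable_cl_mult iota_cl hom_Z_stable)
next
  fix x assume x: "x \<in> carrier (cohomology (hom_complex R F G) n)"
  obtain \<alpha> where a: "\<alpha> \<in> hom_Z R F G n" "x = ext_cl R F G n \<alpha>" using ext_elem[OF x] .
  then show "iota R F G n x \<in> carrier (cohomology (stable_hom_complex R F G) n)"
    by (simp add: iota_cl stable_cl_closed hom_Z_stable)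
qed

lemma (in hom_triple) iota_mult:
  assumes x: "x \<in> carrier (cohomology (hom_complex R G H) m)" and y: "y \<in> carrier (cohomology (hom_complex R F G) n)"
  shows "iota R F H (m + n) (ext_mult R F H m n x y) = stable_ext_mult R F H m n (iota R G H m x) (iota R F G n y)"
proof -
  obtain \<alpha> where a: "\<alpha> \<in> hom_Z R G H m" "x = ext_cl R G H m \<alpha>" using GH.ext_elem[OF x] .
  obtain \<beta> where b: "\<beta> \<in> hom_Z R F G n" "y = ext_cl R F G n \<beta>" using FG.ext_elem[OF y] .
  show ?thesis using a b
    by (simp add: ext_mult_cl stable_mult_cl GH.iota_cl FG.iota_cl FH.iota_cl comp_hom_Z GH.hom_Z_stable FG.hom_Z_stable)
qed

lemma iota_ring_hom:
  assumes F: "resolution R M F \<epsilon>"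
  shows "graded_ring_hom (ext_ring R F) (stable_ext_ring R F) (iota R F F)"
proof -
  interpret T: hom_triple R M F \<epsilon> M F \<epsilon> M F \<epsilon> by (rule hom_tripleI[OF F F F])
  show ?thesis
    unfolding graded_ring_hom_def ext_ring_simps
    using T.FG.iota_hom T.iota_mult T.FG.iota_cl[OF ident_hom_Z[OF F]] by simp
qed

lemma iota_bimodule_hom:
  assumes F: "resolution R M F \<epsilon>" and G: "resolution R N G \<eta>"
  shows "graded_bimodule_hom (ext_ring R G) (ext_ring R F) (ext_bimod R F G) (stable_ext_bimod R F G)
    (iota R G G) (iota R F F) (iota R F G)"
proof -
  interpret L: hom_triple R M F \<epsilon> N G \<eta> N G \<eta> by (rule hom_tripleI[OF F G G])
  interpret R: hom_triple R M F \<epsilon> M F \<epsilon> N G \<eta> by (rule hom_tripleI[OF F F G])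
  show ?thesis
    unfolding graded_bimodule_hom_def ext_ring_simps ext_bimod_simps
    using L.FG.iota_hom L.iota_mult R.iota_mult by simp
qed

section \<open>Nilpotence on bounded cochains\<close>

text \<open>One cochain p represents the power in both rings, so that a computation with p yields
  statements on absolute and on stable classes.\<close>

lemma gr_pow_ext:
  assumes G: "resolution R N G \<eta>" and t: "t \<in> hom_Z R G G 2"
  shows "\<exists>p \<in> hom_Z R G G (2 * int k). gr_pow (ext_ring R G) (ext_cl R G G 2 t) k = ext_cl R G G (2 * int k) p \<and>
    gr_pow (stable_ext_ring R G) (stable_cl R G G 2 t) k = stable_cl R G G (2 * int k) p"
proof -
  interpret T: hom_triple R N G \<eta> N G \<eta> N G \<eta> by (rule hom_tripleI[OF G G G])
  show ?thesis
  proof (induction k)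
    case 0
    then show ?case by (intro bexI[of _ "hom_ident G"]) (simp_all add: ext_ring_simps ident_hom_Z[OF G])
  next
    case (Suc k)
    then obtain p where "p \<in> hom_Z R G G (2 * int k)" "gr_pow (ext_ring R G) (ext_cl R G G 2 t) k = ext_cl R G G (2 * int k) p"
      "gr_pow (stable_ext_ring R G) (stable_cl R G G 2 t) k = stable_cl R G G (2 * int k) p" by blast
    then show ?case using t
      by (intro bexI[of _ "hom_comp G 2 p t"])
        (simp_all add: ext_ring_simps T.ext_mult_cl[where k = "2 + 2 * int k"] T.stable_mult_cl[where k = "2 + 2 * int k"]
          T.FG.hom_Z_stable T.comp_hom_Z)
  qed
qed

text \<open>In source degrees i > l already \<delta> is zero. For i \<le> l the composite lands in
  degree i - n - 2k \<le> l - n - 2k < 0, where G is zero. The vanishing holds for cochains, not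
  just for classes.\<close>

lemma comp_bounded_zero:
  assumes F: "resolution R M F \<epsilon>" and G: "resolution R N G \<eta>"
    and p: "p \<in> carrier (hom_group R G G (2 * int k))" and d: "\<delta> \<in> carrier (hom_group R F G n)"
    and zero: "\<And>i j x. l < i \<Longrightarrow> x \<in> carrier (obj F i) \<Longrightarrow> j = i - n \<Longrightarrow> \<delta> i x = \<zero>\<^bsub>obj G j\<^esub>"
    and k: "l - n < 2 * int k" and r: "r = 2 * int k + n"
  shows "hom_comp F n p \<delta> = \<one>\<^bsub>hom_group R F G r\<^esub>"
proof -
  interpret T: hom_triple R M F \<epsilon> N G \<eta> N G \<eta> by (rule hom_tripleI[OF F G G])
  have c: "hom_comp F n p \<delta> \<in> T.FG.H r" by (rule T.comp_closed[OF p d r])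
  show ?thesis
  proof (rule T.FG.H_eqI[OF c T.FG.one_closed])
    fix i x assume x: "x \<in> carrier (obj F i)"
    have "hom_comp F n p \<delta> i x = \<zero>\<^bsub>obj G (i - r)\<^esub>"
    proof (cases "l < i")
      case True
      then show ?thesis using x r
        by (simp add: hom_comp_apply zero T.GH.H_zero[OF p] diff_diff_eq add.commute)
    next
      case False
      then show ?thesis using T.FG.H_closed[OF c x refl] k r by (intro T.FG.G.negative) simp_all
    qed
    then show "hom_comp F n p \<delta> i x = \<one>\<^bsub>hom_group R F G r\<^esub> i x"
      using T.FG.one_apply[OF x refl] by simp
  qed
qed

text \<open>A class killed by \<iota> has a bounded representative, and a high power of the
  degree-two cocycle composes with that representative to zero.\<close>

lemma iota_kernel_nilpotent:
  assumes F: "resolution R M F \<epsilon>" and G: "resolution R N G \<eta>" and t: "t \<in> hom_Z R G G 2"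
    and x: "x \<in> carrier (cohomology (hom_complex R F G) n)"
    and ix: "iota R F G n x = \<one>\<^bsub>cohomology (stable_hom_complex R F G) n\<^esub>"
  shows "\<exists>k. ext_mult R F G (2 * int k) n (gr_pow (ext_ring R G) (ext_cl R G G 2 t) k) x =
    \<one>\<^bsub>cohomology (hom_complex R F G) (n + 2 * int k)\<^esub>"
proof -
  interpret T: hom_triple R M F \<epsilon> N G \<eta> N G \<eta> by (rule hom_tripleI[OF F G G])
  obtain \<alpha> where a: "\<alpha> \<in> hom_Z R F G n" "x = ext_cl R F G n \<alpha>" using T.FG.ext_elem[OF x] .
  then have "stable_cl R F G n \<alpha> = \<one>\<^bsub>cohomology (stable_hom_complex R F G) n\<^esub>"
    using ix by (simp add: T.FG.iota_cl)
  then obtain \<gamma> \<delta> where g: "\<gamma> \<in> T.FG.H (n - 1)" and db: "\<delta> \<in> bounded_homs R F G n"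
    and eq: "\<alpha> = \<delta> \<otimes>\<^bsub>hom_group R F G n\<^esub> hom_diff F G (n - 1) \<gamma>"
    using T.FG.stable_cl_eq_one_iff T.FG.hom_Z_stable[OF a(1)] by blast
  have d: "\<delta> \<in> T.FG.H n" using db by (simp add: T.FG.bounded_iff)
  have dg: "hom_diff F G (n - 1) \<gamma> \<in> T.FG.H n" by (rule T.FG.hom_diff_closed[OF g]) simp
  \<comment> \<open>The bounded summand \<delta> differs from the cocycle \<alpha> by a coboundary,
    hence is itself a cocycle and represents the same absolute class.\<close>
  have "hom_diff F G n \<alpha> = hom_diff F G n \<delta> \<otimes>\<^bsub>hom_group R F G (n + 1)\<^esub> \<one>\<^bsub>hom_group R F G (n + 1)\<^esub>"
    unfolding eq T.FG.hom_diff_mult[OF d dg refl] by (subst T.FG.hom_diff_diff[OF g, of n "n + 1"]) simp_all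
  then have dZ: "\<delta> \<in> hom_Z R F G n"
    using a(1) d T.FG.hom_diff_closed[OF d refl] by (simp add: hom_Z_def)
  have xd: "x = ext_cl R F G n \<delta>"
    unfolding a(2)
  proof (rule T.FG.ext_cl_eqI[OF a(1) dZ g refl])
    show "\<alpha> i x = hom_diff F G (n - 1) \<gamma> i x \<oplus>\<^bsub>obj G (i - n)\<^esub> \<delta> i x" if x: "x \<in> carrier (obj F i)" for i x
      unfolding eq T.FG.mult_apply[OF x refl]
      by (rule T.FG.G.obj.M.a_comm) (rule T.FG.H_closed[OF d x refl] T.FG.H_closed[OF dg x refl])+
  qed
  obtain l where l: "\<And>i j x. l < i \<Longrightarrow> x \<in> carrier (obj F i) \<Longrightarrow> j = i - n \<Longrightarrow> \<delta> i x = \<zero>\<^bsub>obj G j\<^esub>"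
    using T.FG.boundedE[OF db] by blast
  \<comment> \<open>The value guarantees 2k > l - n, also when l < n.\<close>
  define k where "k = nat (l - n) + 1"
  have k: "l - n < 2 * int k" by (simp add: k_def)
  obtain p where p: "p \<in> hom_Z R G G (2 * int k)" "gr_pow (ext_ring R G) (ext_cl R G G 2 t) k = ext_cl R G G (2 * int k) p"
    using gr_pow_ext[OF G t] by blast
  have "hom_comp F n p \<delta> = \<one>\<^bsub>hom_group R F G (n + 2 * int k)\<^esub>"
    by (rule comp_bounded_zero[OF F G T.GH.hom_Z_closed[OF p(1)] d l k]) simp_all
  then have "ext_mult R F G (2 * int k) n (gr_pow (ext_ring R G) (ext_cl R G G 2 t) k) x =
      ext_cl R F G (n + 2 * int k) \<one>\<^bsub>hom_group R F G (n + 2 * int k)\<^esub>"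
    unfolding xd p(2) by (subst T.ext_mult_cl[OF p(1) dZ]) auto
  also have "\<dots> = \<one>\<^bsub>cohomology (hom_complex R F G) (n + 2 * int k)\<^esub>"
    by (rule T.FG.hom.coh_class_one)
  finally show ?thesis by blast
qed

text \<open>A stable cocycle \<alpha> fails to be a cocycle by the bounded cochain d\<alpha>. For a
  cocycle p of even degree, d(p\<alpha>) = p(d\<alpha>), which is zero when p represents a high
  enough power; then p\<alpha> is an absolute cocycle and its class maps to the product.\<close>

lemma iota_cokernel_nilpotent:
  assumes F: "resolution R M F \<epsilon>" and G: "resolution R N G \<eta>" and t: "t \<in> hom_Z R G G 2"
    and y: "y \<in> carrier (cohomology (stable_hom_complex R F G) n)"
  shows "\<exists>k. \<exists>x \<in> carrier (cohomology (hom_complex R F G) (n + 2 * int k)).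
    stable_ext_mult R F G (2 * int k) n (gr_pow (stable_ext_ring R G) (stable_cl R G G 2 t) k) y = iota R F G (n + 2 * int k) x"
proof -
  interpret T: hom_triple R M F \<epsilon> N G \<eta> N G \<eta> by (rule hom_tripleI[OF F G G])
  obtain \<alpha> where a: "\<alpha> \<in> stable_Z R F G n" "y = stable_cl R F G n \<alpha>" using T.FG.stable_elem[OF y] .
  have aH: "\<alpha> \<in> T.FG.H n" and db: "hom_diff F G n \<alpha> \<in> bounded_homs R F G (n + 1)"
    using a(1) by (simp_all add: stable_Z_def)
  obtain l where l: "\<And>i j x. l < i \<Longrightarrow> x \<in> carrier (obj F i) \<Longrightarrow> j = i - (n + 1) \<Longrightarrow> hom_diff F G n \<alpha> i x = \<zero>\<^bsub>obj G j\<^esub>"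
    using T.FG.boundedE[OF db] by blast
  define k where "k = nat (l - n) + 1"
  \<comment> \<open>The bounded cochain is now the coboundary, of degree n + 1 instead of n.\<close>
  have k: "l - (n + 1) < 2 * int k" by (simp add: k_def)
  obtain p where p: "p \<in> hom_Z R G G (2 * int k)"
    "gr_pow (stable_ext_ring R G) (stable_cl R G G 2 t) k = stable_cl R G G (2 * int k) p"
    using gr_pow_ext[OF G t] by blast
  have pH: "p \<in> T.GH.H (2 * int k)" by (rule T.GH.hom_Z_closed[OF p(1)])
  let ?r = "2 * int k + n"
  have c: "hom_comp F n p \<alpha> \<in> T.FG.H ?r" by (rule T.comp_closed[OF pH aH refl])
  have "hom_comp F (n + 1) p (hom_diff F G n \<alpha>) = \<one>\<^bsub>hom_group R F G (?r + 1)\<^esub>"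
    by (rule comp_bounded_zero[OF F G pH T.FG.hom_diff_closed[OF aH refl] l k]) simp_all
  moreover have "hom_comp F n (hom_diff G G (2 * int k) p) \<alpha> = \<one>\<^bsub>hom_group R F G (?r + 1)\<^esub>"
  proof -
    have dp: "hom_diff G G (2 * int k) p = \<one>\<^bsub>hom_group R G G (2 * int k + 1)\<^esub>" using p(1) by (simp add: hom_Z_def)
    show ?thesis unfolding dp
    proof (rule T.FG.H_eqI[of _ "?r + 1"])
      show "hom_comp F n \<one>\<^bsub>hom_group R G G (2 * int k + 1)\<^esub> \<alpha> \<in> T.FG.H (?r + 1)"
        by (rule T.comp_closed[OF T.GH.one_closed aH]) simp
      show "hom_comp F n \<one>\<^bsub>hom_group R G G (2 * int k + 1)\<^esub> \<alpha> i x = \<one>\<^bsub>hom_group R F G (?r + 1)\<^esub> i x"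
        if x: "x \<in> carrier (obj F i)" for i x
        unfolding hom_comp_apply[OF x refl] T.GH.one_apply[OF T.FG.H_closed[OF aH x refl] refl] T.FG.one_apply[OF x refl]
        by (simp add: algebra_simps)
    qed (rule T.FG.one_closed)
  qed
  ultimately have "hom_diff F G ?r (hom_comp F n p \<alpha>) = \<one>\<^bsub>hom_group R F G (?r + 1)\<^esub>"
    using T.comp_leibniz[OF pH aH] T.FG.one_closed by simp
  then have Z: "hom_comp F n p \<alpha> \<in> hom_Z R F G ?r" using c by (simp add: hom_Z_def)
  have "stable_ext_mult R F G (2 * int k) n (gr_pow (stable_ext_ring R G) (stable_cl R G G 2 t) k) y =
      iota R F G ?r (ext_cl R F G ?r (hom_comp F n p \<alpha>))"
    unfolding p(2) a(2) T.FG.iota_cl[OF Z] by (rule T.stable_mult_cl[OF T.GH.hom_Z_stable[OF p(1)] a(1) refl])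
  then show ?thesis
    using T.FG.ext_cl_closed[OF Z] by (intro exI[of _ k] bexI[of _ "ext_cl R F G ?r (hom_comp F n p \<alpha>)"]) (simp_all add: add.commute)
qed

section \<open>Reduction modulo a central non-zero-divisor\<close>

locale central_regular = Q: ring Q for Q :: "'q ring" (structure) and f :: 'q +
  assumes f_closed: "f \<in> carrier Q"
    and f_central: "\<forall>q \<in> carrier Q. f \<otimes> q = q \<otimes> f"
    and f_regular: "\<forall>q \<in> carrier Q. f \<otimes> q = \<zero> \<longrightarrow> q = \<zero>"
begin

abbreviation "R \<equiv> quot_ring Q f"
abbreviation "\<pi> \<equiv> quot_proj Q f"

text \<open>Closure under multiplication from the left is where centrality is used: q(fa) = f(qa).
  Hence the generated ideal consists of plain multiples of f.\<close>

lemma principal_ideal: "ideal {f \<otimes> a | a. a \<in> carrier Q} Q"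
proof (rule idealI)
  show "subgroup {f \<otimes> a | a. a \<in> carrier Q} (add_monoid Q)"
  proof (rule Q.add.subgroupI)
    show "{f \<otimes> a | a. a \<in> carrier Q} \<subseteq> carrier Q" using f_closed by auto
    show "{f \<otimes> a | a. a \<in> carrier Q} \<noteq> {}" by auto
    show "\<ominus> x \<in> {f \<otimes> a | a. a \<in> carrier Q}" if x: "x \<in> {f \<otimes> a | a. a \<in> carrier Q}" for x
    proof -
      obtain a where "a \<in> carrier Q" "x = f \<otimes> a" using x by (elim CollectE exE conjE)
      then have "\<ominus> x = f \<otimes> (\<ominus> a)" "\<ominus> a \<in> carrier Q" using f_closed by (simp_all add: Q.r_minus)
      then show ?thesis by (intro CollectI exI conjI)
    qed
    show "x \<oplus> y \<in> {f \<otimes> a | a. a \<in> carrier Q}"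
      if xy: "x \<in> {f \<otimes> a | a. a \<in> carrier Q}" "y \<in> {f \<otimes> a | a. a \<in> carrier Q}" for x y
    proof -
      obtain a b where "a \<in> carrier Q" "x = f \<otimes> a" "b \<in> carrier Q" "y = f \<otimes> b"
        using xy by (elim CollectE exE conjE)
      then have "x \<oplus> y = f \<otimes> (a \<oplus> b)" "a \<oplus> b \<in> carrier Q" using f_closed by (simp_all add: Q.r_distr)
      then show ?thesis by (intro CollectI exI conjI)
    qed
  qed
  fix x q assume "x \<in> {f \<otimes> a | a. a \<in> carrier Q}" and q: "q \<in> carrier Q"
  then obtain a where a: "a \<in> carrier Q" "x = f \<otimes> a" by (elim CollectE exE conjE)
  have "q \<otimes> x = (q \<otimes> f) \<otimes> a" using a q f_closed by (simp add: Q.m_assoc)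
  also have "\<dots> = f \<otimes> (q \<otimes> a)" unfolding bspec[OF f_central q, symmetric] using a q f_closed by (simp add: Q.m_assoc)
  finally have "q \<otimes> x = f \<otimes> (q \<otimes> a)" .
  then show "q \<otimes> x \<in> {f \<otimes> a | a. a \<in> carrier Q}"
    using a q by (intro CollectI exI[of _ "q \<otimes> a"] conjI) simp_all
  have "x \<otimes> q = f \<otimes> (a \<otimes> q)" using a q f_closed by (simp add: Q.m_assoc)
  then show "x \<otimes> q \<in> {f \<otimes> a | a. a \<in> carrier Q}"
    using a q by (intro CollectI exI[of _ "a \<otimes> q"] conjI) simp_all
qed (rule Q.ring_axioms)

lemma Idl_eq: "Idl {f} = {f \<otimes> a | a. a \<in> carrier Q}"
proof
  have "f = f \<otimes> \<one>" using f_closed by simp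
  then show "Idl {f} \<subseteq> {f \<otimes> a | a. a \<in> carrier Q}"
    by (intro Q.genideal_minimal[OF principal_ideal]) (use Q.one_closed in blast)
  interpret I: ideal "Idl {f}" Q using f_closed by (simp add: Q.genideal_ideal)
  show "{f \<otimes> a | a. a \<in> carrier Q} \<subseteq> Idl {f}"
    using Q.genideal_self'[OF f_closed] I.I_r_closed by blast
qed

sublocale I: ideal "Idl {f}" Q
  using f_closed by (simp add: Q.genideal_ideal)

lemma R_ring: "ring R"
  unfolding quot_ring_def by (rule I.quotient_is_ring)

sublocale R: ring R by (rule R_ring)

lemma pi_hom: "\<pi> \<in> ring_hom Q R"
  using I.rcos_ring_hom by (simp add: quot_ring_def quot_proj_def[abs_def])

sublocale pi: ring_hom_ring Q R \<pi>
  by (rule ring_hom_ringI2[OF Q.ring_axioms R_ring pi_hom])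

lemma pi_surj: "r \<in> carrier R \<Longrightarrow> \<exists>q \<in> carrier Q. \<pi> q = r"
  by (auto simp: quot_ring_def quot_proj_def FactRing_def A_RCOSETS_def')

lemma pi_eq_zero:
  assumes "q \<in> carrier Q" "\<pi> q = \<zero>\<^bsub>R\<^esub>"
  shows "\<exists>a \<in> carrier Q. q = f \<otimes> a"
proof -
  have "Idl {f} +> q = Idl {f}" using assms(2) by (simp add: quot_ring_def quot_proj_def FactRing_def)
  then have "q \<in> Idl {f}" by (rule Q.a_coset_join1[OF _ assms(1) I.a_subgroup])
  then show ?thesis unfolding Idl_eq by (elim CollectE exE conjE) (rule bexI)
qed

lemma pi_eqD:
  assumes "a \<in> carrier Q" "b \<in> carrier Q" "\<pi> a = \<pi> b"
  shows "\<exists>c \<in> carrier Q. a = b \<oplus> f \<otimes> c"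
proof -
  have "\<pi> (a \<ominus> b) = \<zero>\<^bsub>R\<^esub>" using assms by (simp add: Q.minus_eq R.r_neg)
  then obtain c where "c \<in> carrier Q" "a \<ominus> b = f \<otimes> c" using pi_eq_zero assms by blast
  moreover have "b \<oplus> (a \<ominus> b) = a" using assms by (simp add: Q.minus_eq Q.a_lcomm Q.r_neg)
  ultimately show ?thesis by metis
qed

lemma pi_f: "\<pi> f = \<zero>\<^bsub>R\<^esub>"
  unfolding quot_proj_def quot_ring_def FactRing_def ring.simps
  by (rule Q.a_coset_join2[OF f_closed I.a_subgroup Q.genideal_self'[OF f_closed]])

end

section \<open>Extension of scalars from Q to Q/(f)\<close>

locale base_change = central_regular Q f + X: left_module Q X
  for Q :: "'q ring" (structure) and f and X :: "('q, 'x) module"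
begin

abbreviation "T \<equiv> tensor_free R X"
abbreviation "rels \<equiv> tensor_rels Q R \<pi> X"
abbreviation "E \<equiv> ext_scalars Q R \<pi> X"
abbreviation "cls c \<equiv> rels #>\<^bsub>T\<^esub> c"

definition tens :: "'q set \<Rightarrow> 'x \<Rightarrow> (('q set \<times> 'x) \<Rightarrow>\<^sub>0 int) set" where
  "tens r x = cls (frag_of (r, x))"

lemma T_comm_group: "comm_group T"
  unfolding tensor_free_def by (rule abelian_free_Abelian_group)

sublocale T: comm_group T by (rule T_comm_group)

lemma T_carrier: "c \<in> carrier T \<longleftrightarrow> Poly_Mapping.keys c \<subseteq> carrier R \<times> carrier X"
  by (simp add: tensor_free_def)

lemma T_mult: "c \<otimes>\<^bsub>T\<^esub> d = c + d"
  by (simp add: tensor_free_def)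

lemma T_one: "\<one>\<^bsub>T\<^esub> = 0"
  by (simp add: tensor_free_def)

lemma T_frag: "frag_of (r, x) \<in> carrier T \<longleftrightarrow> r \<in> carrier R \<and> x \<in> carrier X"
  by (simp add: T_carrier keys_frag_of)

lemma T_diff: "c \<in> carrier T \<Longrightarrow> d \<in> carrier T \<Longrightarrow> c - d \<in> carrier T"
  using keys_diff[of c d] by (auto simp: T_carrier)

definition gens :: "(('q set \<times> 'x) \<Rightarrow>\<^sub>0 int) set" where
  "gens = {frag_of (r \<oplus>\<^bsub>R\<^esub> s, x) - frag_of (r, x) - frag_of (s, x) | r s x.
        r \<in> carrier R \<and> s \<in> carrier R \<and> x \<in> carrier X} \<union>
     {frag_of (r, x \<oplus>\<^bsub>X\<^esub> y) - frag_of (r, x) - frag_of (r, y) | r x y.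
        r \<in> carrier R \<and> x \<in> carrier X \<and> y \<in> carrier X} \<union>
     {frag_of (r \<otimes>\<^bsub>R\<^esub> \<pi> q, x) - frag_of (r, q \<odot>\<^bsub>X\<^esub> x) | r q x.
        r \<in> carrier R \<and> q \<in> carrier Q \<and> x \<in> carrier X}"

lemma rels_eq: "rels = generate T gens"
  by (simp add: tensor_rels_def gens_def)

lemma gens_closed: "gens \<subseteq> carrier T"
  by (auto simp: gens_def X.smult_closed intro!: T_diff T_frag[THEN iffD2])

lemma rels_subgroup: "subgroup rels T"
  unfolding rels_eq by (rule T.generate_is_subgroup[OF gens_closed])

lemma rels_closed: "c \<in> rels \<Longrightarrow> c \<in> carrier T"
  by (rule subgroup.mem_carrier[OF rels_subgroup])

lemma gens_rels: "c \<in> gens \<Longrightarrow> c \<in> rels"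
  unfolding rels_eq by (rule generate.incl)

lemma cls_eqI: "\<lbrakk>c - d \<in> rels; c \<in> carrier T; d \<in> carrier T\<rbrakk> \<Longrightarrow> cls c = cls d"
  unfolding T.rcos_eq_iff[OF rels_subgroup] by (rule bexI[of _ "c - d"]) (simp_all add: T_mult)

lemma E_simps:
  "carrier E = carrier (T Mod rels)" "\<zero>\<^bsub>E\<^esub> = rels" "U \<oplus>\<^bsub>E\<^esub> V = U \<otimes>\<^bsub>T Mod rels\<^esub> V"
  by (simp_all add: ext_scalars_def)

lemma cls_closed: "c \<in> carrier T \<Longrightarrow> cls c \<in> carrier E"
  by (simp add: E_simps carrier_FactGroup)

lemma cls_add: "c \<in> carrier T \<Longrightarrow> d \<in> carrier T \<Longrightarrow> cls c \<oplus>\<^bsub>E\<^esub> cls d = cls (c + d)"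
  unfolding E_simps by (subst T.FactGroup_mult[OF rels_subgroup]) (simp_all add: T_mult)

lemma tens_closed: "r \<in> carrier R \<Longrightarrow> x \<in> carrier X \<Longrightarrow> tens r x \<in> carrier E"
  unfolding tens_def by (simp add: cls_closed T_frag)

lemma tens_add_right:
  assumes "r \<in> carrier R" "x \<in> carrier X" "y \<in> carrier X"
  shows "tens r (x \<oplus>\<^bsub>X\<^esub> y) = tens r x \<oplus>\<^bsub>E\<^esub> tens r y"
proof -
  have "frag_of (r, x \<oplus>\<^bsub>X\<^esub> y) - frag_of (r, x) - frag_of (r, y) \<in> gens"
    unfolding gens_def using assms by blast
  then have "frag_of (r, x \<oplus>\<^bsub>X\<^esub> y) - (frag_of (r, x) + frag_of (r, y)) \<in> rels"
    using gens_rels by (simp add: diff_diff_eq)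
  moreover have "frag_of (r, x) + frag_of (r, y) \<in> carrier T"
    using T.m_closed[of "frag_of (r, x)" "frag_of (r, y)"] assms by (simp add: T_mult T_frag)
  ultimately show ?thesis
    using assms by (simp add: tens_def cls_add T_frag cls_eqI)
qed

lemma tens_smult:
  assumes "r \<in> carrier R" "q \<in> carrier Q" "x \<in> carrier X"
  shows "tens r (q \<odot>\<^bsub>X\<^esub> x) = tens (r \<otimes>\<^bsub>R\<^esub> \<pi> q) x"
proof -
  have "frag_of (r \<otimes>\<^bsub>R\<^esub> \<pi> q, x) - frag_of (r, q \<odot>\<^bsub>X\<^esub> x) \<in> gens"
    unfolding gens_def using assms by blast
  then show ?thesis
    using assms unfolding tens_def
    by (intro cls_eqI[symmetric] gens_rels) (simp_all add: T_frag X.smult_closed)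
qed

lemma tens_one_smult: "q \<in> carrier Q \<Longrightarrow> x \<in> carrier X \<Longrightarrow> tens \<one>\<^bsub>R\<^esub> (q \<odot>\<^bsub>X\<^esub> x) = tens (\<pi> q) x"
  by (simp add: tens_smult)

lemma tens_zero: "r \<in> carrier R \<Longrightarrow> tens r \<zero>\<^bsub>X\<^esub> = \<zero>\<^bsub>E\<^esub>"
proof -
  assume r: "r \<in> carrier R"
  interpret E: comm_group "T Mod rels" by (rule T.abelian_FactGroup[OF rels_subgroup])
  have "tens r \<zero>\<^bsub>X\<^esub> \<in> carrier (T Mod rels)" using tens_closed[OF r, of "\<zero>\<^bsub>X\<^esub>"] by (simp add: E_simps)
  moreover have "tens r \<zero>\<^bsub>X\<^esub> \<otimes>\<^bsub>T Mod rels\<^esub> tens r \<zero>\<^bsub>X\<^esub> = tens r \<zero>\<^bsub>X\<^esub>"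
    using tens_add_right[OF r, of "\<zero>\<^bsub>X\<^esub>" "\<zero>\<^bsub>X\<^esub>"] by (simp add: E_simps)
  ultimately have "tens r \<zero>\<^bsub>X\<^esub> = \<one>\<^bsub>T Mod rels\<^esub>" by (metis E.l_cancel_one')
  then show ?thesis by (simp add: E_simps)
qed

text \<open>Because Q maps onto R, a generator r \<otimes> x equals 1 \<otimes> qx for any q over r.
  Differences of elements of the form 1 \<otimes> x have this form again.\<close>

lemma tens_surj:
  assumes "U \<in> carrier E"
  shows "\<exists>x \<in> carrier X. U = tens \<one>\<^bsub>R\<^esub> x"
proof -
  obtain c where c: "c \<in> carrier T" "U = cls c" using assms by (auto simp: E_simps carrier_FactGroup)
  have "Poly_Mapping.keys c \<subseteq> carrier R \<times> carrier X" using c by (simp add: T_carrier)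
  then have "c \<in> carrier T \<and> (\<exists>x \<in> carrier X. cls c = tens \<one>\<^bsub>R\<^esub> x)"
  proof (induction c rule: frag_induction)
    case zero
    have "cls 0 = \<zero>\<^bsub>E\<^esub>" using T.coset_join2[OF T.one_closed rels_subgroup subgroup.one_closed[OF rels_subgroup]] by (simp add: T_one E_simps)
    then show ?case using tens_zero[OF R.one_closed] T.one_closed by (auto simp: T_one intro!: bexI[of _ "\<zero>\<^bsub>X\<^esub>"])
  next
    case (one p)
    then obtain r x where p: "p = (r, x)" "r \<in> carrier R" "x \<in> carrier X" by auto
    obtain q where "q \<in> carrier Q" "\<pi> q = r" using pi_surj[OF p(2)] by blast
    then show ?case using p tens_one_smult[of q x]
      by (auto simp: T_frag tens_def X.smult_closed intro!: bexI[of _ "q \<odot>\<^bsub>X\<^esub> x"])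
  next
    case (diff a b)
    then obtain x y where x: "x \<in> carrier X" "cls a = tens \<one>\<^bsub>R\<^esub> x" and y: "y \<in> carrier X" "cls b = tens \<one>\<^bsub>R\<^esub> y"
      and ab: "a \<in> carrier T" "b \<in> carrier T" by blast
    have "x = (x \<ominus>\<^bsub>X\<^esub> y) \<oplus>\<^bsub>X\<^esub> y" using x y by (simp add: X.M.minus_eq X.M.a_assoc X.M.l_neg)
    then have "tens \<one>\<^bsub>R\<^esub> (x \<ominus>\<^bsub>X\<^esub> y) \<oplus>\<^bsub>E\<^esub> cls b = cls a"
      using tens_add_right[OF R.one_closed, of "x \<ominus>\<^bsub>X\<^esub> y" y] x y by simp
    moreover have "cls (a - b) \<oplus>\<^bsub>E\<^esub> cls b = cls a"
      using cls_add[OF T_diff[OF ab] ab(2)] by simp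
    ultimately have "tens \<one>\<^bsub>R\<^esub> (x \<ominus>\<^bsub>X\<^esub> y) \<oplus>\<^bsub>E\<^esub> cls b = cls (a - b) \<oplus>\<^bsub>E\<^esub> cls b" by simp
    moreover interpret E: comm_group "T Mod rels" by (rule T.abelian_FactGroup[OF rels_subgroup])
    have "tens \<one>\<^bsub>R\<^esub> (x \<ominus>\<^bsub>X\<^esub> y) \<in> carrier (T Mod rels)" "cls (a - b) \<in> carrier (T Mod rels)" "cls b \<in> carrier (T Mod rels)"
      using tens_closed[OF R.one_closed, of "x \<ominus>\<^bsub>X\<^esub> y"] cls_closed[OF T_diff[OF ab]] cls_closed[OF ab(2)] x y by (auto simp: E_simps)
    ultimately have "tens \<one>\<^bsub>R\<^esub> (x \<ominus>\<^bsub>X\<^esub> y) = cls (a - b)" by (simp only: E_simps(3) E.right_cancel)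
    then show ?case using x y ab by (auto intro!: T_diff bexI[of _ "x \<ominus>\<^bsub>X\<^esub> y"])
  qed
  then show ?thesis using c by blast
qed

definition fX :: "'x set" where "fX = {f \<odot>\<^bsub>X\<^esub> x | x. x \<in> carrier X}"

lemma fX_subgroup: "subgroup fX (add_monoid X)"
proof (rule X.M.add.subgroupI)
  show "fX \<subseteq> carrier X" using f_closed by (auto simp: fX_def X.smult_closed)
  show "fX \<noteq> {}" unfolding fX_def using X.M.zero_closed by blast
  show "\<ominus>\<^bsub>X\<^esub> x \<in> fX" if x: "x \<in> fX" for x
  proof -
    obtain a where "a \<in> carrier X" "x = f \<odot>\<^bsub>X\<^esub> a" using x by (auto simp: fX_def)
    then have "\<ominus>\<^bsub>X\<^esub> x = f \<odot>\<^bsub>X\<^esub> (\<ominus>\<^bsub>X\<^esub> a)" "\<ominus>\<^bsub>X\<^esub> a \<in> carrier X" using f_closed by (simp_all add: X.smult_r_minus)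
    then show ?thesis unfolding fX_def by (intro CollectI exI conjI)
  qed
  show "x \<oplus>\<^bsub>X\<^esub> y \<in> fX" if xy: "x \<in> fX" "y \<in> fX" for x y
  proof -
    obtain a b where "a \<in> carrier X" "x = f \<odot>\<^bsub>X\<^esub> a" "b \<in> carrier X" "y = f \<odot>\<^bsub>X\<^esub> b" using xy by (auto simp: fX_def)
    then have "x \<oplus>\<^bsub>X\<^esub> y = f \<odot>\<^bsub>X\<^esub> (a \<oplus>\<^bsub>X\<^esub> b)" "a \<oplus>\<^bsub>X\<^esub> b \<in> carrier X"
      using f_closed by (simp_all add: X.smult_r_distr)
    then show ?thesis unfolding fX_def by (intro CollectI exI conjI)
  qed
qed

abbreviation "V \<equiv> add_monoid X Mod fX"
abbreviation "vcls x \<equiv> fX #>\<^bsub>add_monoid X\<^esub> x"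

lemma X_comm_group: "comm_group (add_monoid X)"
  by (rule X.M.a_comm_group)

lemma V_comm_group: "comm_group V"
  by (rule comm_group.abelian_FactGroup[OF X_comm_group fX_subgroup])

lemma vcls_add: "x \<in> carrier X \<Longrightarrow> y \<in> carrier X \<Longrightarrow> vcls x \<otimes>\<^bsub>V\<^esub> vcls y = vcls (x \<oplus>\<^bsub>X\<^esub> y)"
  using comm_group.FactGroup_mult[OF X_comm_group fX_subgroup, of x y] by simp

text \<open>Two elements of Q over the same scalar differ by a multiple of f, so their actions on x
  differ by an element of fX.\<close>

lemma vcls_pi:
  assumes "a \<in> carrier Q" "b \<in> carrier Q" "\<pi> a = \<pi> b" and x: "x \<in> carrier X"
  shows "vcls (a \<odot>\<^bsub>X\<^esub> x) = vcls (b \<odot>\<^bsub>X\<^esub> x)"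
proof -
  obtain c where c: "c \<in> carrier Q" "a = b \<oplus> f \<otimes> c" using pi_eqD assms by blast
  then have "a \<odot>\<^bsub>X\<^esub> x = f \<odot>\<^bsub>X\<^esub> (c \<odot>\<^bsub>X\<^esub> x) \<oplus>\<^bsub>X\<^esub> b \<odot>\<^bsub>X\<^esub> x"
    using assms f_closed by (simp add: X.smult_l_distr X.smult_assoc X.smult_closed X.M.a_comm)
  moreover have "f \<odot>\<^bsub>X\<^esub> (c \<odot>\<^bsub>X\<^esub> x) \<in> fX" using c x by (auto simp: fX_def X.smult_closed)
  ultimately have "\<exists>h \<in> fX. a \<odot>\<^bsub>X\<^esub> x = h \<otimes>\<^bsub>add_monoid X\<^esub> (b \<odot>\<^bsub>X\<^esub> x)" by auto
  then show ?thesis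
    using assms by (subst comm_group.rcos_eq_iff[OF X_comm_group fX_subgroup]) (simp_all add: X.smult_closed)
qed

text \<open>The inverse of \<open>X/fX \<rightarrow> R \<otimes> X\<close>: sending \<open>r \<otimes> x\<close> to the class of \<open>q x\<close>, for any \<open>q\<close> over \<open>r\<close>,
  respects the relations.\<close>

lemma tens_eq_zeroD:
  assumes x: "x \<in> carrier X" and zero: "tens \<one>\<^bsub>R\<^esub> x = \<zero>\<^bsub>E\<^esub>"
  shows "x \<in> fX"
proof -
  note [simp del] = mult_FactGroup one_FactGroup
  \<comment> \<open>A set-theoretic section of \<pi>, neither additive nor multiplicative. By
    \<open>vcls_pi\<close> the class of s(r)x modulo fX does not depend on the choice, and this is
    what makes the relations hold.\<close>
  define s where "s r = (SOME q. q \<in> carrier Q \<and> \<pi> q = r)" for r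
  have s: "s r \<in> carrier Q" "\<pi> (s r) = r" if "r \<in> carrier R" for r
    using someI_ex[of "\<lambda>q. q \<in> carrier Q \<and> \<pi> q = r"] pi_surj[OF that] unfolding s_def by blast+
  define g where "g p = vcls (s (fst p) \<odot>\<^bsub>X\<^esub> snd p)" for p
  have "g ` (carrier R \<times> carrier X) \<subseteq> carrier V"
    by (auto simp: g_def carrier_FactGroup s X.smult_closed)
  then obtain h where h: "h \<in> hom (free_Abelian_group (carrier R \<times> carrier X)) V"
    "\<And>p. p \<in> carrier R \<times> carrier X \<Longrightarrow> h (frag_of p) = g p"
    using comm_group.free_Abelian_group_universal[OF V_comm_group] by metis
  interpret V: comm_group V by (rule V_comm_group)
  interpret h: group_hom T V h
    using h(1) V_comm_group T.group_axioms by (simp add: group_hom_def group_hom_axioms_def tensor_free_def comm_group_def)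
  have hf: "h (frag_of (r, x)) = vcls (s r \<odot>\<^bsub>X\<^esub> x)" if "r \<in> carrier R" "x \<in> carrier X" for r x
    using that h(2)[of "(r, x)"] by (simp add: g_def)
  have vc: "vcls (s r \<odot>\<^bsub>X\<^esub> x) \<in> carrier V" if "r \<in> carrier R" "x \<in> carrier X" for r x
    using that by (simp add: carrier_FactGroup s X.smult_closed)
  have hd: "h (c - d) = h c \<otimes>\<^bsub>V\<^esub> inv\<^bsub>V\<^esub> h d" if "c \<in> carrier T" "d \<in> carrier T" for c d
  proof -
    have "h c = h (c - d) \<otimes>\<^bsub>V\<^esub> h d"
      using h.hom_mult[of "c - d" d] that by (simp add: T_mult T_diff)
    then show ?thesis using that by (simp add: V.m_assoc T_diff)
  qed
  have "h c = \<one>\<^bsub>V\<^esub>" if "c \<in> gens" for c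
    using that unfolding gens_def
  proof (elim UnE CollectE exE conjE)
    fix r t y assume c: "c = frag_of (r \<oplus>\<^bsub>R\<^esub> t, y) - frag_of (r, y) - frag_of (t, y)"
      and rt: "r \<in> carrier R" "t \<in> carrier R" "y \<in> carrier X"
    have "vcls (s (r \<oplus>\<^bsub>R\<^esub> t) \<odot>\<^bsub>X\<^esub> y) = vcls ((s r \<oplus> s t) \<odot>\<^bsub>X\<^esub> y)"
      using rt by (intro vcls_pi) (simp_all add: s)
    also have "\<dots> = vcls (s r \<odot>\<^bsub>X\<^esub> y) \<otimes>\<^bsub>V\<^esub> vcls (s t \<odot>\<^bsub>X\<^esub> y)"
      using rt by (simp add: vcls_add X.smult_l_distr X.smult_closed s)
    finally have e: "vcls (s (r \<oplus>\<^bsub>R\<^esub> t) \<odot>\<^bsub>X\<^esub> y) = vcls (s r \<odot>\<^bsub>X\<^esub> y) \<otimes>\<^bsub>V\<^esub> vcls (s t \<odot>\<^bsub>X\<^esub> y)" .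
    have "h c = vcls (s (r \<oplus>\<^bsub>R\<^esub> t) \<odot>\<^bsub>X\<^esub> y) \<otimes>\<^bsub>V\<^esub> inv\<^bsub>V\<^esub> vcls (s r \<odot>\<^bsub>X\<^esub> y) \<otimes>\<^bsub>V\<^esub> inv\<^bsub>V\<^esub> vcls (s t \<odot>\<^bsub>X\<^esub> y)"
      unfolding c using rt by (simp only: hd hf T_diff T_frag R.a_closed)
    also have "\<dots> = \<one>\<^bsub>V\<^esub>"
    proof -
      have gen: "u \<otimes>\<^bsub>V\<^esub> w \<otimes>\<^bsub>V\<^esub> inv\<^bsub>V\<^esub> u \<otimes>\<^bsub>V\<^esub> inv\<^bsub>V\<^esub> w = \<one>\<^bsub>V\<^esub>" if "u \<in> carrier V" "w \<in> carrier V" for u w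
        using that by (simp add: V.m_comm[of u w] V.m_assoc V.inv_solve_right)
      show ?thesis unfolding e by (rule gen[OF vc[OF rt(1,3)] vc[OF rt(2,3)]])
    qed
    finally show ?thesis .
  next
    fix r y z assume c: "c = frag_of (r, y \<oplus>\<^bsub>X\<^esub> z) - frag_of (r, y) - frag_of (r, z)"
      and rt: "r \<in> carrier R" "y \<in> carrier X" "z \<in> carrier X"
    have e: "vcls (s r \<odot>\<^bsub>X\<^esub> (y \<oplus>\<^bsub>X\<^esub> z)) = vcls (s r \<odot>\<^bsub>X\<^esub> y) \<otimes>\<^bsub>V\<^esub> vcls (s r \<odot>\<^bsub>X\<^esub> z)"
      using rt by (simp add: vcls_add X.smult_r_distr X.smult_closed s)
    have "h c = vcls (s r \<odot>\<^bsub>X\<^esub> (y \<oplus>\<^bsub>X\<^esub> z)) \<otimes>\<^bsub>V\<^esub> inv\<^bsub>V\<^esub> vcls (s r \<odot>\<^bsub>X\<^esub> y) \<otimes>\<^bsub>V\<^esub> inv\<^bsub>V\<^esub> vcls (s r \<odot>\<^bsub>X\<^esub> z)"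
      unfolding c using rt by (simp only: hd hf T_diff T_frag X.M.a_closed)
    also have "\<dots> = \<one>\<^bsub>V\<^esub>"
    proof -
      have gen: "u \<otimes>\<^bsub>V\<^esub> w \<otimes>\<^bsub>V\<^esub> inv\<^bsub>V\<^esub> u \<otimes>\<^bsub>V\<^esub> inv\<^bsub>V\<^esub> w = \<one>\<^bsub>V\<^esub>" if "u \<in> carrier V" "w \<in> carrier V" for u w
        using that by (simp add: V.m_comm[of u w] V.m_assoc V.inv_solve_right)
      show ?thesis unfolding e by (rule gen[OF vc[OF rt(1,2)] vc[OF rt(1,3)]])
    qed
    finally show ?thesis .
  next
    fix r q y assume c: "c = frag_of (r \<otimes>\<^bsub>R\<^esub> \<pi> q, y) - frag_of (r, q \<odot>\<^bsub>X\<^esub> y)"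
      and rt: "r \<in> carrier R" "q \<in> carrier Q" "y \<in> carrier X"
    have "vcls (s (r \<otimes>\<^bsub>R\<^esub> \<pi> q) \<odot>\<^bsub>X\<^esub> y) = vcls ((s r \<otimes> q) \<odot>\<^bsub>X\<^esub> y)"
      using rt by (intro vcls_pi) (simp_all add: s)
    then have e: "vcls (s (r \<otimes>\<^bsub>R\<^esub> \<pi> q) \<odot>\<^bsub>X\<^esub> y) = vcls (s r \<odot>\<^bsub>X\<^esub> (q \<odot>\<^bsub>X\<^esub> y))"
      using rt by (simp add: X.smult_assoc s)
    have "h c = vcls (s (r \<otimes>\<^bsub>R\<^esub> \<pi> q) \<odot>\<^bsub>X\<^esub> y) \<otimes>\<^bsub>V\<^esub> inv\<^bsub>V\<^esub> vcls (s r \<odot>\<^bsub>X\<^esub> (q \<odot>\<^bsub>X\<^esub> y))"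
      unfolding c using rt by (simp only: hd hf T_frag R.m_closed pi.hom_closed X.smult_closed)
    then show ?thesis unfolding e using rt vc[OF rt(1) X.smult_closed[OF rt(2,3)]] by simp
  qed
  then have "gens \<subseteq> kernel T V h" using gens_closed by (auto simp: kernel_def)
  then have "rels \<subseteq> kernel T V h"
    unfolding rels_eq by (rule T.generate_subgroup_incl[OF _ h.subgroup_kernel])
  \<comment> \<open>The zero of the tensor product is the subgroup of relations itself, so the
    hypothesis says that the generator 1 \<otimes> x is a relation.\<close>
  moreover have "frag_of (\<one>\<^bsub>R\<^esub>, x) \<in> rels"
    using zero T.rcos_self[OF _ rels_subgroup, of "frag_of (\<one>\<^bsub>R\<^esub>, x)"] x by (simp add: tens_def E_simps T_frag)
  ultimately have "vcls (s \<one>\<^bsub>R\<^esub> \<odot>\<^bsub>X\<^esub> x) = \<one>\<^bsub>V\<^esub>"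
    using hf[OF R.one_closed x] by (auto simp: kernel_def)
  moreover have "vcls (s \<one>\<^bsub>R\<^esub> \<odot>\<^bsub>X\<^esub> x) = vcls x"
    using vcls_pi[of "s \<one>\<^bsub>R\<^esub>" \<one> x] x by (simp add: s X.smult_one)
  ultimately have "vcls x = fX" by (simp add: one_FactGroup)
  then show ?thesis using X.M.add.coset_join1[of fX x] x fX_subgroup by simp
qed

end

text \<open>A map g on pairs that carries defining relations to relations induces a map of tensor
  products, and the union over all representatives is its value. Both scalar multiplication and
  \<open>ext_scalars_map\<close> are of this kind.\<close>

lemma base_change_UN:
  assumes X: "base_change Q f X" and Y: "base_change Q f Y"
    and g: "\<And>r x. \<lbrakk>r \<in> carrier (quot_ring Q f); x \<in> carrier X\<rbrakk> \<Longrightarrow>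
      g (r, x) \<in> carrier (quot_ring Q f) \<times> carrier Y"
    and rel: "\<And>c. c \<in> base_change.gens Q f X \<Longrightarrow>
      frag_extend (\<lambda>p. frag_of (g p)) c \<in> tensor_rels Q (quot_ring Q f) (quot_proj Q f) Y"
    and r: "r \<in> carrier (quot_ring Q f)" and x: "x \<in> carrier X"
  shows "(\<Union>c \<in> base_change.tens Q f X r x. tensor_rels Q (quot_ring Q f) (quot_proj Q f) Y
      #>\<^bsub>tensor_free (quot_ring Q f) Y\<^esub> frag_extend (\<lambda>p. frag_of (g p)) c) =
    base_change.tens Q f Y (fst (g (r, x))) (snd (g (r, x)))"
proof -
  interpret X: base_change Q f X by (rule X)
  interpret Y: base_change Q f Y by (rule Y)
  let ?e = "frag_extend (\<lambda>p. frag_of (g p))"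
  have e_closed: "?e c \<in> carrier Y.T" if "c \<in> carrier X.T" for c
  proof -
    have "Poly_Mapping.keys (?e c) \<subseteq> g ` Poly_Mapping.keys c"
      using keys_frag_extend[of "\<lambda>p. frag_of (g p)" c] by (auto simp: keys_frag_of)
    moreover have "g ` Poly_Mapping.keys c \<subseteq> carrier X.R \<times> carrier Y"
    proof (rule image_subsetI)
      fix p assume "p \<in> Poly_Mapping.keys c"
      then have "fst p \<in> carrier X.R" "snd p \<in> carrier X" using that by (auto simp: X.T_carrier)
      then show "g p \<in> carrier X.R \<times> carrier Y" using g[of "fst p" "snd p"] by simp
    qed
    ultimately show ?thesis unfolding Y.T_carrier by (rule subset_trans)
  qed
  interpret e: group_hom X.T Y.T ?e
    by (intro group_hom.intro group_hom_axioms.intro homI X.T.group_axioms Y.T.group_axioms)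
      (simp_all add: e_closed X.T_mult Y.T_mult frag_extend_add)
  have sg: "subgroup {c \<in> carrier X.T. ?e c \<in> Y.rels} X.T"
  proof (rule X.T.subgroupI)
    have "?e \<one>\<^bsub>X.T\<^esub> \<in> Y.rels" using subgroup.one_closed[OF Y.rels_subgroup] by (simp add: X.T_one Y.T_one)
    then show "{c \<in> carrier X.T. ?e c \<in> Y.rels} \<noteq> {}" using X.T.one_closed by blast
  qed (use subgroup.m_closed[OF Y.rels_subgroup] subgroup.m_inv_closed[OF Y.rels_subgroup] in auto)
  have e_rels: "?e c \<in> Y.rels" if "c \<in> X.rels" for c
  proof -
    have "X.rels \<subseteq> {c \<in> carrier X.T. ?e c \<in> Y.rels}"
      unfolding X.rels_eq
      by (rule X.T.generate_subgroup_incl[OF _ sg]) (use rel X.gens_closed in auto)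
    then show ?thesis using that by blast
  qed
  have fr: "frag_of (r, x) \<in> carrier X.T" using r x by (simp add: X.T_frag)
  have "(\<Union>c \<in> X.cls (frag_of (r, x)). Y.cls (?e c)) = Y.cls (?e (frag_of (r, x)))"
  proof (rule X.T.rcos_UN[OF X.rels_subgroup fr])
    fix h assume h: "h \<in> X.rels"
    have hc: "h \<in> carrier X.T" by (rule X.rels_closed[OF h])
    show "Y.cls (?e (h \<otimes>\<^bsub>X.T\<^esub> frag_of (r, x))) = Y.cls (?e (frag_of (r, x)))"
      using e_rels[OF h] e_closed[OF hc] e_closed[OF fr] e_closed[OF X.T.m_closed[OF hc fr]]
      by (intro Y.cls_eqI) (simp_all add: X.T_mult frag_extend_add)
  qed
  then show ?thesis by (simp add: X.tens_def Y.tens_def)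
qed

context base_change
begin

lemma gens_cases:
  assumes "c \<in> gens"
  obtains r s x where "r \<in> carrier R" "s \<in> carrier R" "x \<in> carrier X"
      "c = frag_of (r \<oplus>\<^bsub>R\<^esub> s, x) - frag_of (r, x) - frag_of (s, x)"
    | r x y where "r \<in> carrier R" "x \<in> carrier X" "y \<in> carrier X"
      "c = frag_of (r, x \<oplus>\<^bsub>X\<^esub> y) - frag_of (r, x) - frag_of (r, y)"
    | r q x where "r \<in> carrier R" "q \<in> carrier Q" "x \<in> carrier X"
      "c = frag_of (r \<otimes>\<^bsub>R\<^esub> \<pi> q, x) - frag_of (r, q \<odot>\<^bsub>X\<^esub> x)"
  using assms unfolding gens_def by (elim UnE CollectE exE conjE)

lemma gensI:
  "\<lbrakk>r \<in> carrier R; s \<in> carrier R; x \<in> carrier X\<rbrakk> \<Longrightarrow>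
    frag_of (r \<oplus>\<^bsub>R\<^esub> s, x) - frag_of (r, x) - frag_of (s, x) \<in> rels"
  "\<lbrakk>r \<in> carrier R; x \<in> carrier X; y \<in> carrier X\<rbrakk> \<Longrightarrow>
    frag_of (r, x \<oplus>\<^bsub>X\<^esub> y) - frag_of (r, x) - frag_of (r, y) \<in> rels"
  "\<lbrakk>r \<in> carrier R; q \<in> carrier Q; x \<in> carrier X\<rbrakk> \<Longrightarrow>
    frag_of (r \<otimes>\<^bsub>R\<^esub> \<pi> q, x) - frag_of (r, q \<odot>\<^bsub>X\<^esub> x) \<in> rels"
  unfolding gens_def by (rule gens_rels, unfold gens_def, blast)+

text \<open>Left multiplication by s respects the relations by distributivity and, for the balancing
  relation, by associativity: s(r\<pi>(q)) = (sr)\<pi>(q).\<close>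

lemma ext_smult_tens:
  assumes s: "s \<in> carrier R" and r: "r \<in> carrier R" and x: "x \<in> carrier X"
  shows "s \<odot>\<^bsub>E\<^esub> tens r x = tens (s \<otimes>\<^bsub>R\<^esub> r) x"
proof -
  let ?g = "\<lambda>(r, x). (s \<otimes>\<^bsub>R\<^esub> r, x)"
  have g: "(\<lambda>(r, x). frag_of (s \<otimes>\<^bsub>R\<^esub> r, x)) = (\<lambda>p. frag_of (?g p))" by auto
  have "s \<odot>\<^bsub>E\<^esub> tens r x = (\<Union>c \<in> tens r x. cls (frag_extend (\<lambda>p. frag_of (?g p)) c))"
    unfolding g[symmetric] by (simp add: ext_scalars_def)
  also have "\<dots> = tens (fst (?g (r, x))) (snd (?g (r, x)))"
  proof (rule base_change_UN[OF base_change_axioms base_change_axioms _ _ r x])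
    show "?g (r, x) \<in> carrier R \<times> carrier X" if "r \<in> carrier R" "x \<in> carrier X" for r x using that s by simp
    show "frag_extend (\<lambda>p. frag_of (?g p)) c \<in> rels" if "c \<in> gens" for c
      using that
    proof (cases rule: gens_cases)
      case (1 r t x)
      then show ?thesis using gensI(1)[of "s \<otimes>\<^bsub>R\<^esub> r" "s \<otimes>\<^bsub>R\<^esub> t" x] s by (simp add: frag_extend_diff R.r_distr)
    next
      case (2 r x y)
      then show ?thesis using gensI(2)[of "s \<otimes>\<^bsub>R\<^esub> r" x y] s by (simp add: frag_extend_diff)
    next
      case (3 r q x)
      then show ?thesis using gensI(3)[of "s \<otimes>\<^bsub>R\<^esub> r" q x] s by (simp add: frag_extend_diff R.m_assoc)
    qed
  qed
  finally show ?thesis by simp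
qed

end

text \<open>Additivity of u takes care of the relations in the second argument, its Q-linearity of
  the balancing relations.\<close>

lemma ext_map_tens:
  assumes X: "base_change Q f X" and Y: "base_change Q f Y" and u: "u \<in> lin_hom Q X Y"
    and r: "r \<in> carrier (quot_ring Q f)" and x: "x \<in> carrier X"
  shows "ext_scalars_map Q (quot_ring Q f) (quot_proj Q f) Y u (base_change.tens Q f X r x) =
    base_change.tens Q f Y r (u x)"
proof -
  interpret X: base_change Q f X by (rule X)
  interpret Y: base_change Q f Y by (rule Y)
  let ?g = "\<lambda>(r, x). (r, u x)"
  have g: "(\<lambda>(r, x). frag_of (r, u x)) = (\<lambda>p. frag_of (?g p))" by auto
  have "ext_scalars_map Q X.R X.\<pi> Y u (X.tens r x) = (\<Union>c \<in> X.tens r x. Y.cls (frag_extend (\<lambda>p. frag_of (?g p)) c))"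
    unfolding ext_scalars_map_def g ..
  also have "\<dots> = Y.tens (fst (?g (r, x))) (snd (?g (r, x)))"
  proof (rule base_change_UN[OF X Y _ _ r x])
    show "?g (r, x) \<in> carrier X.R \<times> carrier Y" if "r \<in> carrier X.R" "x \<in> carrier X" for r x
      using that lin_hom_closed[OF u] by simp
    show "frag_extend (\<lambda>p. frag_of (?g p)) c \<in> Y.rels" if "c \<in> X.gens" for c
      using that
    proof (cases rule: X.gens_cases)
      case (1 r t x)
      then show ?thesis using Y.gensI(1)[of r t "u x"] lin_hom_closed[OF u] by (simp add: frag_extend_diff)
    next
      case (2 r x y)
      then show ?thesis using Y.gensI(2)[of r "u x" "u y"] lin_hom_closed[OF u]
        by (simp add: frag_extend_diff lin_hom_add[OF u])
    next
      case (3 r q x)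
      then show ?thesis using Y.gensI(3)[of r q "u x"] lin_hom_closed[OF u]
        by (simp add: frag_extend_diff lin_hom_smult[OF u])
    qed
  qed
  finally show ?thesis by simp
qed

lemma restrict_scalars_module:
  assumes "ring Q" "ring R" and p: "p \<in> ring_hom Q R" and M: "left_module R M"
  shows "left_module Q (restrict_scalars p M)"
proof -
  interpret Q: ring Q by fact
  interpret R: ring R by fact
  interpret M: left_module R M by fact
  have "\<exists>y\<in>carrier M. y \<oplus>\<^bsub>M\<^esub> x = \<zero>\<^bsub>M\<^esub>" if "x \<in> carrier M" for x
    using that by (intro bexI[of _ "\<ominus>\<^bsub>M\<^esub> x"]) (simp_all add: M.M.l_neg)
  then have "abelian_group (restrict_scalars p M)"
    by (intro abelian_groupI) (simp_all add: restrict_scalars_def M.M.a_ac)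
  then show ?thesis
    using ring_hom_closed[OF p] ring_hom_add[OF p] ring_hom_mult[OF p] ring_hom_one[OF p]
    by (intro left_module.intro left_module_axioms.intro assms(1))
      (simp_all add: restrict_scalars_def M.smult_closed M.smult_l_distr M.smult_r_distr M.smult_assoc M.smult_one)
qed

lemma restrict_scalars_simps:
  "carrier (restrict_scalars p M) = carrier M" "\<zero>\<^bsub>restrict_scalars p M\<^esub> = \<zero>\<^bsub>M\<^esub>"
  "x \<oplus>\<^bsub>restrict_scalars p M\<^esub> y = x \<oplus>\<^bsub>M\<^esub> y" "q \<odot>\<^bsub>restrict_scalars p M\<^esub> x = p q \<odot>\<^bsub>M\<^esub> x"
  by (simp_all add: restrict_scalars_def)

section \<open>The reduction map of a liftable resolution\<close>

locale lifted = central_regular Q f + liftable_resolution Q f M F \<epsilon> Ft \<phi> dt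
  for Q :: "'q ring" (structure) and f and M :: "('q set, 'm) module" and F :: "('q set, 'c) chain_complex"
    and \<epsilon> and Ft :: "int \<Rightarrow> ('q, 'l) module" and \<phi> and dt +
  assumes target_module: "left_module (quot_ring Q f) M"
begin

lemma Ft_module: "left_module Q (Ft i)"
  using lift_projective by (simp add: projective_module_def)

sublocale Ft: left_module Q "Ft i" for i by (rule Ft_module)

lemma Ft_group: "abelian_group (Ft i)"
  by (rule Ft.M.abelian_group_axioms)

lemma Ft_base_change: "base_change Q f (Ft i)"
  by (intro base_change.intro central_regular_axioms Ft_module)

lemma F_resolution: "resolution R M F \<epsilon>"
  by (rule resolution.intro[OF resolution target_module])

sublocale F: resolution R M F \<epsilon> by (rule F_resolution)

text \<open>The reduction x \<mapsto> \<phi>(1 \<otimes> x). It is additive, semilinear along \<pi>,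
  onto, and has kernel f Ft; later arguments use these properties instead of the tensor
  product.\<close>

definition rho :: "int \<Rightarrow> 'l \<Rightarrow> 'c" where
  "rho i x = \<phi> i (base_change.tens Q f (Ft i) \<one>\<^bsub>R\<^esub> x)"

lemma tens_closed: "x \<in> carrier (Ft i) \<Longrightarrow> base_change.tens Q f (Ft i) \<one>\<^bsub>R\<^esub> x \<in> carrier (ext_scalars Q R \<pi> (Ft i))"
  by (rule base_change.tens_closed[OF Ft_base_change R.one_closed])

lemma rho_closed: "x \<in> carrier (Ft i) \<Longrightarrow> j = i \<Longrightarrow> rho i x \<in> carrier (obj F j)"
  unfolding rho_def using lin_hom_closed[OF ident_lin tens_closed] by simp

lemma rho_add: "x \<in> carrier (Ft i) \<Longrightarrow> y \<in> carrier (Ft i) \<Longrightarrow> rho i (x \<oplus>\<^bsub>Ft i\<^esub> y) = rho i x \<oplus>\<^bsub>obj F i\<^esub> rho i y"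
  unfolding rho_def
  by (simp add: base_change.tens_add_right[OF Ft_base_change R.one_closed] lin_hom_add[OF ident_lin tens_closed tens_closed])

lemma rho_smult: "q \<in> carrier Q \<Longrightarrow> x \<in> carrier (Ft i) \<Longrightarrow> rho i (q \<odot>\<^bsub>Ft i\<^esub> x) = \<pi> q \<odot>\<^bsub>obj F i\<^esub> rho i x"
  unfolding rho_def
  by (simp add: base_change.tens_one_smult[OF Ft_base_change] lin_hom_smult[OF ident_lin _ tens_closed, symmetric]
      base_change.ext_smult_tens[OF Ft_base_change])

text \<open>Restriction of scalars turns the semilinear reduction into a linear map over Q, against
  which projective Q-modules can lift.\<close>

lemma rho_restrict_hom: "(\<lambda>x \<in> carrier (Ft i). rho i x) \<in> lin_hom Q (Ft i) (restrict_scalars \<pi> (obj F i))"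
  by (rule lin_homI) (simp_all add: restrict_scalars_simps rho_closed rho_add rho_smult Ft_module)

lemma rho_zero: "rho i \<zero>\<^bsub>Ft i\<^esub> = \<zero>\<^bsub>obj F i\<^esub>"
  using rho_add[of "\<zero>\<^bsub>Ft i\<^esub>" i "\<zero>\<^bsub>Ft i\<^esub>"] rho_closed[of "\<zero>\<^bsub>Ft i\<^esub>" i i] by simp

lemma rho_minus: "x \<in> carrier (Ft i) \<Longrightarrow> rho i (\<ominus>\<^bsub>Ft i\<^esub> x) = \<ominus>\<^bsub>obj F i\<^esub> rho i x"
  using rho_add[of "\<ominus>\<^bsub>Ft i\<^esub> x" i x] rho_closed[of x i i] rho_closed[of "\<ominus>\<^bsub>Ft i\<^esub> x" i i]
  by (simp add: Ft.M.l_neg rho_zero F.obj.M.minus_equality)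

lemma rho_diff: "x \<in> carrier (Ft i) \<Longrightarrow> y \<in> carrier (Ft i) \<Longrightarrow> rho i (x \<ominus>\<^bsub>Ft i\<^esub> y) = rho i x \<ominus>\<^bsub>obj F i\<^esub> rho i y"
  by (simp add: Ft.M.minus_eq F.obj.M.minus_eq rho_add rho_minus)

lemma rho_surj:
  assumes "y \<in> carrier (obj F i)"
  shows "\<exists>x \<in> carrier (Ft i). rho i x = y"
proof -
  obtain U where U: "U \<in> carrier (ext_scalars Q R \<pi> (Ft i))" "y = \<phi> i U"
    using assms ident_bij[of i] by (auto simp: bij_betw_def)
  then show ?thesis using base_change.tens_surj[OF Ft_base_change U(1)] by (auto simp: rho_def)
qed

lemma rho_eq_zeroD:
  assumes x: "x \<in> carrier (Ft i)" and zero: "rho i x = \<zero>\<^bsub>obj F i\<^esub>"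
  shows "\<exists>y \<in> carrier (Ft i). x = f \<odot>\<^bsub>Ft i\<^esub> y"
proof -
  interpret X: base_change Q f "Ft i" by (rule Ft_base_change)
  have "\<phi> i (X.tens \<one>\<^bsub>R\<^esub> x) = \<phi> i (X.tens \<one>\<^bsub>R\<^esub> \<zero>\<^bsub>Ft i\<^esub>)"
    using zero rho_zero by (simp add: rho_def)
  then have "X.tens \<one>\<^bsub>R\<^esub> x = X.tens \<one>\<^bsub>R\<^esub> \<zero>\<^bsub>Ft i\<^esub>"
    using ident_bij[of i] tens_closed[OF x] tens_closed[of "\<zero>\<^bsub>Ft i\<^esub>" i] by (auto simp: bij_betw_def inj_on_def)
  then have "x \<in> X.fX" using x by (intro X.tens_eq_zeroD) (simp_all add: X.tens_zero)
  then show ?thesis unfolding X.fX_def by blast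
qed

lemma rho_f: "x \<in> carrier (Ft i) \<Longrightarrow> rho i (f \<odot>\<^bsub>Ft i\<^esub> x) = \<zero>\<^bsub>obj F i\<^esub>"
  using f_closed by (simp add: rho_smult pi_f F.obj.smult_l_null rho_closed)

lemma f_inj:
  assumes x: "x \<in> carrier (Ft i)" and y: "y \<in> carrier (Ft i)" and eq: "f \<odot>\<^bsub>Ft i\<^esub> x = f \<odot>\<^bsub>Ft i\<^esub> y"
  shows "x = y"
proof -
  have "f \<odot>\<^bsub>Ft i\<^esub> (x \<ominus>\<^bsub>Ft i\<^esub> y) = \<zero>\<^bsub>Ft i\<^esub>"
    using x y eq f_closed by (simp add: Ft.smult_r_diff Ft.smult_closed Ft.M.diff_self)
  then have "x \<ominus>\<^bsub>Ft i\<^esub> y = \<zero>\<^bsub>Ft i\<^esub>"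
    by (rule projective_central_regular[OF lift_projective f_closed f_central f_regular Ft.M.minus_closed[OF x y]])
  then show ?thesis using x y by (simp add: Ft.M.diff_eq_zero_iff)
qed

lemma dt_lin: "j = i - 1 \<Longrightarrow> dt i \<in> lin_hom Q (Ft i) (Ft j)"
  using lift_lin by simp

lemma dt_closed: "x \<in> carrier (Ft i) \<Longrightarrow> j = i - 1 \<Longrightarrow> dt i x \<in> carrier (Ft j)"
  using lin_hom_closed[OF lift_lin] by simp

lemma dt_add: "\<lbrakk>x \<in> carrier (Ft i); y \<in> carrier (Ft i); j = i - 1\<rbrakk> \<Longrightarrow> dt i (x \<oplus>\<^bsub>Ft i\<^esub> y) = dt i x \<oplus>\<^bsub>Ft j\<^esub> dt i y"
  using lin_hom_add[OF lift_lin] by simp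

lemma dt_diff: "\<lbrakk>x \<in> carrier (Ft i); y \<in> carrier (Ft i); j = i - 1\<rbrakk> \<Longrightarrow> dt i (x \<ominus>\<^bsub>Ft i\<^esub> y) = dt i x \<ominus>\<^bsub>Ft j\<^esub> dt i y"
  using lin_hom_diff[OF lift_lin Ft_group Ft_group] by simp

lemma dt_smult: "\<lbrakk>q \<in> carrier Q; x \<in> carrier (Ft i); j = i - 1\<rbrakk> \<Longrightarrow> dt i (q \<odot>\<^bsub>Ft i\<^esub> x) = q \<odot>\<^bsub>Ft j\<^esub> dt i x"
  using lin_hom_smult[OF lift_lin] by simp

lemma rho_dt: "x \<in> carrier (Ft i) \<Longrightarrow> j = i - 1 \<Longrightarrow> rho j (dt i x) = bd F i (rho i x)"
  unfolding rho_def
  by (simp add: lift_bd[OF tens_closed] ext_map_tens[OF Ft_base_change Ft_base_change lift_lin R.one_closed])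

text \<open>Division by f is unique since f acts injectively on the projective module, and
  uniqueness yields additivity; for scalars a, the identity af = fa is used as well. The quotient is
  written with \<open>THE\<close> to match \<open>theta_lift\<close>.\<close>

lemma divide_by_f:
  assumes h: "h \<in> lin_hom Q X (Ft j)" and X: "left_module Q X"
    and div: "\<And>x. x \<in> carrier X \<Longrightarrow> \<exists>y \<in> carrier (Ft j). h x = f \<odot>\<^bsub>Ft j\<^esub> y"
  shows "(\<lambda>x \<in> carrier X. THE y. y \<in> carrier (Ft j) \<and> h x = f \<odot>\<^bsub>Ft j\<^esub> y) \<in> lin_hom Q X (Ft j)" (is "(\<lambda>x \<in> _. ?k x) \<in> _")
    and "\<And>x. x \<in> carrier X \<Longrightarrow> h x = f \<odot>\<^bsub>Ft j\<^esub> (THE y. y \<in> carrier (Ft j) \<and> h x = f \<odot>\<^bsub>Ft j\<^esub> y)"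
proof -
  interpret X: left_module Q X by (rule X)
  define K where "K x = ?k x" for x
  have "K x \<in> carrier (Ft j) \<and> h x = f \<odot>\<^bsub>Ft j\<^esub> K x" if x: "x \<in> carrier X" for x
    unfolding K_def
  proof (rule theI')
    obtain y where y: "y \<in> carrier (Ft j)" "h x = f \<odot>\<^bsub>Ft j\<^esub> y" using div[OF x] by blast
    then show "\<exists>!y. y \<in> carrier (Ft j) \<and> h x = f \<odot>\<^bsub>Ft j\<^esub> y"
      by (intro ex1I[of _ y] conjI f_inj[OF _ y(1)]) auto
  qed
  then have Kc: "K x \<in> carrier (Ft j)" and Kh: "f \<odot>\<^bsub>Ft j\<^esub> K x = h x" if "x \<in> carrier X" for x
    using that by simp_all
  show "h x = f \<odot>\<^bsub>Ft j\<^esub> ?k x" if "x \<in> carrier X" for x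
    using Kh[OF that] by (simp add: K_def)
  have "(\<lambda>x \<in> carrier X. K x) \<in> lin_hom Q X (Ft j)"
  proof (rule lin_homI[OF Kc _ _ X])
    fix x y assume x: "x \<in> carrier X" and y: "y \<in> carrier X"
    have "f \<odot>\<^bsub>Ft j\<^esub> K (x \<oplus>\<^bsub>X\<^esub> y) = h x \<oplus>\<^bsub>Ft j\<^esub> h y"
      using x y by (simp add: Kh lin_hom_add[OF h])
    also have "\<dots> = f \<odot>\<^bsub>Ft j\<^esub> (K x \<oplus>\<^bsub>Ft j\<^esub> K y)"
      using x y by (simp add: Ft.smult_r_distr[OF f_closed Kc Kc] Kh)
    finally show "K (x \<oplus>\<^bsub>X\<^esub> y) = K x \<oplus>\<^bsub>Ft j\<^esub> K y"
      by (rule f_inj[OF Kc[OF X.M.a_closed[OF x y]] Ft.M.a_closed[OF Kc[OF x] Kc[OF y]]])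
  next
    fix a x assume a: "a \<in> carrier Q" and x: "x \<in> carrier X"
    have ax: "a \<odot>\<^bsub>X\<^esub> x \<in> carrier X" using a x by (rule X.smult_closed)
    have "f \<odot>\<^bsub>Ft j\<^esub> K (a \<odot>\<^bsub>X\<^esub> x) = a \<odot>\<^bsub>Ft j\<^esub> (f \<odot>\<^bsub>Ft j\<^esub> K x)"
      using x by (simp add: Kh[OF ax] lin_hom_smult[OF h a] Kh)
    also have "\<dots> = (a \<otimes> f) \<odot>\<^bsub>Ft j\<^esub> K x" by (rule Ft.smult_assoc[OF a f_closed Kc[OF x], symmetric])
    also have "\<dots> = f \<odot>\<^bsub>Ft j\<^esub> (a \<odot>\<^bsub>Ft j\<^esub> K x)"
      unfolding bspec[OF f_central a, symmetric] by (rule Ft.smult_assoc[OF f_closed a Kc[OF x]])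
    finally show "K (a \<odot>\<^bsub>X\<^esub> x) = a \<odot>\<^bsub>Ft j\<^esub> K x"
      by (rule f_inj[OF Kc[OF ax] Ft.smult_closed[OF a Kc[OF x]]])
  qed
  then show "(\<lambda>x \<in> carrier X. ?k x) \<in> lin_hom Q X (Ft j)" unfolding K_def .
qed

abbreviation "thl \<equiv> theta_lift f Ft dt"
abbreviation "th \<equiv> theta Q f F Ft \<phi> dt"

text \<open>The square of the lifted differential reduces to the square of the differential of F,
  which is zero, so its values lie in the kernel of the reduction.\<close>

lemma dt_dt_div:
  assumes x: "x \<in> carrier (Ft i)"
  shows "\<exists>y \<in> carrier (Ft (i - 2)). dt (i - 1) (dt i x) = f \<odot>\<^bsub>Ft (i - 2)\<^esub> y"
proof (rule rho_eq_zeroD)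
  have d: "dt i x \<in> carrier (Ft (i - 1))" by (rule dt_closed[OF x refl])
  show "dt (i - 1) (dt i x) \<in> carrier (Ft (i - 2))" by (rule dt_closed[OF d]) simp
  have "rho (i - 2) (dt (i - 1) (dt i x)) = bd F (i - 1) (bd F i (rho i x))"
    by (simp add: rho_dt[OF d] rho_dt[OF x])
  then show "rho (i - 2) (dt (i - 1) (dt i x)) = \<zero>\<^bsub>obj F (i - 2)\<^esub>"
    using F.bd_bd[OF rho_closed[OF x refl] refl refl] by simp
qed

lemma dt_dt_lin: "compose (carrier (Ft i)) (dt (i - 1)) (dt i) \<in> lin_hom Q (Ft i) (Ft (i - 2))"
  by (rule lin_hom_compose[OF dt_lin dt_lin Ft_module]) simp_all

lemma thl_eq: "thl i = (\<lambda>x \<in> carrier (Ft i). THE y. y \<in> carrier (Ft (i - 2)) \<and>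
    compose (carrier (Ft i)) (dt (i - 1)) (dt i) x = f \<odot>\<^bsub>Ft (i - 2)\<^esub> y)"
  by (simp add: theta_lift_def compose_def cong: restrict_cong)

lemma thl_lin: "j = i - 2 \<Longrightarrow> thl i \<in> lin_hom Q (Ft i) (Ft j)"
  unfolding thl_eq using dt_dt_div by (simp, intro divide_by_f(1)[OF dt_dt_lin Ft_module]) (simp add: compose_def)

lemma thl_closed: "x \<in> carrier (Ft i) \<Longrightarrow> j = i - 2 \<Longrightarrow> thl i x \<in> carrier (Ft j)"
  by (rule lin_hom_closed[OF thl_lin])

lemma dt_dt:
  assumes x: "x \<in> carrier (Ft i)" and k: "k = i - 1" and j: "j = i - 2"
  shows "dt k (dt i x) = f \<odot>\<^bsub>Ft j\<^esub> thl i x"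
proof -
  have "compose (carrier (Ft i)) (dt (i - 1)) (dt i) x = f \<odot>\<^bsub>Ft (i - 2)\<^esub> (THE y. y \<in> carrier (Ft (i - 2)) \<and>
      compose (carrier (Ft i)) (dt (i - 1)) (dt i) x = f \<odot>\<^bsub>Ft (i - 2)\<^esub> y)"
    by (rule divide_by_f(2)[OF dt_dt_lin Ft_module _ x]) (simp add: compose_def dt_dt_div)
  then show ?thesis using x k j by (simp add: compose_def theta_lift_def)
qed

text \<open>f\<theta>d = (dd)d = d(dd) = d(f\<theta>) = fd\<theta>, and f can be cancelled.\<close>

lemma thl_dt:
  assumes x: "x \<in> carrier (Ft i)" and j: "j = i - 1" and l: "l = i - 2"
  shows "thl j (dt i x) = dt l (thl i x)"
proof (rule f_inj[of _ "i - 3"])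
  have d: "dt i x \<in> carrier (Ft j)" by (rule dt_closed[OF x j])
  have t: "thl i x \<in> carrier (Ft l)" by (rule thl_closed[OF x l])
  show "thl j (dt i x) \<in> carrier (Ft (i - 3))" by (rule thl_closed[OF d]) (simp add: j)
  show "dt l (thl i x) \<in> carrier (Ft (i - 3))" by (rule dt_closed[OF t]) (simp add: l)
  have "f \<odot>\<^bsub>Ft (i - 3)\<^esub> thl j (dt i x) = dt l (dt j (dt i x))"
    by (rule dt_dt[OF d, symmetric]) (simp_all add: j l)
  also have "\<dots> = dt l (f \<odot>\<^bsub>Ft l\<^esub> thl i x)" by (simp add: dt_dt[OF x j l])
  also have "\<dots> = f \<odot>\<^bsub>Ft (i - 3)\<^esub> dt l (thl i x)" by (rule dt_smult[OF f_closed t]) (simp add: l)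
  finally show "f \<odot>\<^bsub>Ft (i - 3)\<^esub> thl j (dt i x) = f \<odot>\<^bsub>Ft (i - 3)\<^esub> dt l (thl i x)" .
qed

text \<open>The definition of \<theta> passes through the inverse of \<phi>. On reductions it
  becomes the reduction of the lifted map, and as every element of F is a reduction, this formula
  replaces the definition.\<close>

lemma th_rho:
  assumes x: "x \<in> carrier (Ft i)" and j: "j = i - 2"
  shows "th i (rho i x) = rho j (thl i x)"
proof -
  have "inv_into (carrier (ext_scalars Q R \<pi> (Ft i))) (\<phi> i) (rho i x) = base_change.tens Q f (Ft i) \<one>\<^bsub>R\<^esub> x"
    unfolding rho_def using ident_bij[of i] tens_closed[OF x] by (auto simp: bij_betw_def)
  then show ?thesis
    using x j rho_closed[OF x refl] ext_map_tens[OF Ft_base_change Ft_base_change thl_lin[OF j] R.one_closed x]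
    by (simp add: theta_def rho_def)
qed

end

text \<open>A Q-linear map k followed by a map g that is semilinear along \<pi> kills f Ft, because
  \<pi> kills f; it therefore factors through the reduction. In the applications g is itself a
  reduction.\<close>

lemma (in lifted) descend:
  assumes k: "k \<in> lin_hom Q (Ft i) Y'" and Y: "left_module R Y"
    and g: "\<And>y. y \<in> carrier Y' \<Longrightarrow> g y \<in> carrier Y"
    and g_add: "\<And>y z. \<lbrakk>y \<in> carrier Y'; z \<in> carrier Y'\<rbrakk> \<Longrightarrow> g (y \<oplus>\<^bsub>Y'\<^esub> z) = g y \<oplus>\<^bsub>Y\<^esub> g z"
    and g_smult: "\<And>q y. \<lbrakk>q \<in> carrier Q; y \<in> carrier Y'\<rbrakk> \<Longrightarrow> g (q \<odot>\<^bsub>Y'\<^esub> y) = \<pi> q \<odot>\<^bsub>Y\<^esub> g y"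
  shows "\<exists>b \<in> lin_hom R (obj F i) Y. \<forall>x \<in> carrier (Ft i). b (rho i x) = g (k x)"
proof -
  interpret Y: left_module R Y by (rule Y)
  let ?h = "\<lambda>x. g (k x)"
  have kc: "k x \<in> carrier Y'" if "x \<in> carrier (Ft i)" for x using lin_hom_closed[OF k that] .
  have h_add: "?h (x \<oplus>\<^bsub>Ft i\<^esub> y) = ?h x \<oplus>\<^bsub>Y\<^esub> ?h y" if "x \<in> carrier (Ft i)" "y \<in> carrier (Ft i)" for x y
    using that by (simp add: lin_hom_add[OF k] g_add kc)
  have h_smult: "?h (q \<odot>\<^bsub>Ft i\<^esub> x) = \<pi> q \<odot>\<^bsub>Y\<^esub> ?h x" if "q \<in> carrier Q" "x \<in> carrier (Ft i)" for q x
    using that by (simp add: lin_hom_smult[OF k] g_smult kc)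
  have wd: "?h x = ?h y" if x: "x \<in> carrier (Ft i)" and y: "y \<in> carrier (Ft i)" and eq: "rho i x = rho i y" for x y
  proof -
    have "rho i (x \<ominus>\<^bsub>Ft i\<^esub> y) = \<zero>\<^bsub>obj F i\<^esub>"
      using x y eq by (simp add: rho_diff F.obj.M.diff_self rho_closed)
    then obtain z where z: "z \<in> carrier (Ft i)" "x \<ominus>\<^bsub>Ft i\<^esub> y = f \<odot>\<^bsub>Ft i\<^esub> z"
      using rho_eq_zeroD x y by (metis Ft.M.minus_closed)
    have "x = f \<odot>\<^bsub>Ft i\<^esub> z \<oplus>\<^bsub>Ft i\<^esub> y"
      using x y unfolding z(2)[symmetric] by (simp add: Ft.M.minus_eq Ft.M.a_assoc Ft.M.l_neg)
    then have "?h x = ?h (f \<odot>\<^bsub>Ft i\<^esub> z) \<oplus>\<^bsub>Y\<^esub> ?h y"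
      using h_add[of "f \<odot>\<^bsub>Ft i\<^esub> z" y] y z f_closed by (simp add: Ft.smult_closed)
    moreover have "?h (f \<odot>\<^bsub>Ft i\<^esub> z) = \<zero>\<^bsub>Y\<^esub>"
      using h_smult[OF f_closed z(1)] z by (simp add: pi_f Y.smult_l_null g kc)
    ultimately show ?thesis using y by (simp add: g kc)
  qed
  define s where "s y = (SOME x. x \<in> carrier (Ft i) \<and> rho i x = y)" for y
  have s: "s y \<in> carrier (Ft i) \<and> rho i (s y) = y" if "y \<in> carrier (obj F i)" for y
    unfolding s_def by (rule someI_ex) (use rho_surj[OF that] in blast)
  note s1 = conjunct1[OF s] and s2 = conjunct2[OF s]
  let ?b = "\<lambda>y \<in> carrier (obj F i). ?h (s y)"
  have b: "?b (rho i x) = ?h x" if "x \<in> carrier (Ft i)" for x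
    using rho_closed[OF that refl] wd[OF s1[OF rho_closed[OF that refl]] that s2[OF rho_closed[OF that refl]]] by simp
  have "?b \<in> lin_hom R (obj F i) Y"
  proof (rule lin_homI[OF _ _ _ F.obj_module])
    show "?h (s y) \<in> carrier Y" if "y \<in> carrier (obj F i)" for y by (rule g[OF kc[OF s1[OF that]]])
    fix y z assume y: "y \<in> carrier (obj F i)" and z: "z \<in> carrier (obj F i)"
    have yz: "y \<oplus>\<^bsub>obj F i\<^esub> z \<in> carrier (obj F i)" using y z by simp
    have "?h (s (y \<oplus>\<^bsub>obj F i\<^esub> z)) = ?h (s y \<oplus>\<^bsub>Ft i\<^esub> s z)"
      by (rule wd[OF s1[OF yz] Ft.M.a_closed[OF s1[OF y] s1[OF z]]])
        (simp add: s2[OF yz] s2[OF y] s2[OF z] rho_add[OF s1[OF y] s1[OF z]])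
    then show "?h (s (y \<oplus>\<^bsub>obj F i\<^esub> z)) = ?h (s y) \<oplus>\<^bsub>Y\<^esub> ?h (s z)"
      unfolding h_add[OF s1[OF y] s1[OF z]] .
  next
    fix a y assume a: "a \<in> carrier R" and y: "y \<in> carrier (obj F i)"
    obtain q where q: "q \<in> carrier Q" "\<pi> q = a" using pi_surj[OF a] by blast
    have ay: "a \<odot>\<^bsub>obj F i\<^esub> y \<in> carrier (obj F i)" using a y by (rule F.obj.smult_closed)
    have "?h (s (a \<odot>\<^bsub>obj F i\<^esub> y)) = ?h (q \<odot>\<^bsub>Ft i\<^esub> s y)"
      by (rule wd[OF s1[OF ay] Ft.smult_closed[OF q(1) s1[OF y]]])
        (simp add: s2[OF ay] s2[OF y] rho_smult[OF q(1) s1[OF y]] q(2))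
    then show "?h (s (a \<odot>\<^bsub>obj F i\<^esub> y)) = a \<odot>\<^bsub>Y\<^esub> ?h (s y)"
      unfolding h_smult[OF q(1) s1[OF y]] q(2) .
  qed
  then show ?thesis using b by blast
qed

lemma (in lifted) theta_lin: "j = i - 2 \<Longrightarrow> th i \<in> lin_hom R (obj F i) (obj F j)"
proof -
  assume j: "j = i - 2"
  obtain b where b: "b \<in> lin_hom R (obj F i) (obj F j)" "\<forall>x \<in> carrier (Ft i). b (rho i x) = rho j (thl i x)"
    using descend[OF thl_lin[OF j] F.obj_module rho_closed[OF _ refl] rho_add rho_smult] by blast
  have "th i = b"
  proof (rule extensionalityI)
    show "th i \<in> extensional (carrier (obj F i))" by (simp add: theta_def)
    show "b \<in> extensional (carrier (obj F i))" by (rule lin_hom_extensional[OF b(1)])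
    fix y assume "y \<in> carrier (obj F i)"
    then obtain x where "x \<in> carrier (Ft i)" "rho i x = y" using rho_surj by blast
    then show "th i y = b y" using b(2) th_rho[OF _ j] by auto
  qed
  then show ?thesis using b(1) by simp
qed

text \<open>In the even degree 2 the cocycle condition is commutation with the differential, and
  this is the reduction of \<open>thl_dt\<close>.\<close>

lemma (in lifted) theta_hom_Z: "th \<in> hom_Z R F F 2"
proof -
  interpret P: hom_pair R M F \<epsilon> M F \<epsilon> by (intro hom_pair.intro F_resolution)
  have c: "th \<in> P.H 2" unfolding P.H_iff by (simp add: theta_lin)
  have "hom_diff F F 2 th = \<one>\<^bsub>hom_group R F F (2 + 1)\<^esub>"
  proof (rule P.H_eqI[OF P.hom_diff_closed[OF c refl] P.one_closed])
    fix i y assume y: "y \<in> carrier (obj F i)"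
    then obtain x where x: "x \<in> carrier (Ft i)" "rho i x = y" using rho_surj by blast
    have "th (i - 1) (bd F i y) = rho (i - 3) (thl (i - 1) (dt i x))"
      using x th_rho[OF dt_closed[OF x(1) refl], of "i - 3"] by (simp add: rho_dt)
    also have "\<dots> = bd F (i - 2) (th i y)"
      using x th_rho[OF x(1) refl] thl_dt[OF x(1) refl refl] rho_dt[OF thl_closed[OF x(1) refl], of "i - 3"] by simp
    finally have e: "th (i - 1) (bd F i y) = bd F (i - 2) (th i y)" .
    have "bd F (i - 2) (th i y) \<in> carrier (obj F (i - 2 - 1))"
      by (rule F.bd_closed[OF lin_hom_closed[OF theta_lin[OF refl] y] refl])
    then show "hom_diff F F 2 th i y = \<one>\<^bsub>hom_group R F F (2 + 1)\<^esub> i y"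
      using y e by (simp add: P.diff_apply[OF y refl] P.one_apply[OF y refl] F.obj.M.diff_self diff_diff_eq)
  qed
  then show ?thesis using c by (simp add: hom_Z_def)
qed

section \<open>Commutation with the class of degree two\<close>

lemma (in abelian_group) diff_add_cancel_right: "x \<in> carrier G \<Longrightarrow> y \<in> carrier G \<Longrightarrow> (x \<ominus> y) \<oplus> y = x"
  by (simp add: minus_eq a_assoc l_neg)

lemma (in lifted) divide_by_f_ex:
  assumes h: "h \<in> lin_hom Q X (Ft j)" and X: "left_module Q X"
    and div: "\<And>x. x \<in> carrier X \<Longrightarrow> \<exists>y \<in> carrier (Ft j). h x = f \<odot>\<^bsub>Ft j\<^esub> y"
  shows "\<exists>k \<in> lin_hom Q X (Ft j). \<forall>x \<in> carrier X. h x = f \<odot>\<^bsub>Ft j\<^esub> k x"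
proof (intro bexI ballI)
  let ?k = "\<lambda>x \<in> carrier X. THE y. y \<in> carrier (Ft j) \<and> h x = f \<odot>\<^bsub>Ft j\<^esub> y"
  show "?k \<in> lin_hom Q X (Ft j)" by (rule divide_by_f(1)[OF h X div])
  fix x assume x: "x \<in> carrier X"
  show "h x = f \<odot>\<^bsub>Ft j\<^esub> ?k x" unfolding restrict_apply'[OF x] by (rule divide_by_f(2)[OF h X div x])
qed

locale lifted_pair = F: lifted Q f M F \<epsilon> Ft \<phi> dt + G: lifted Q f N G \<eta> Gt \<psi> et
  for Q :: "'q ring" (structure) and f and M :: "('q set, 'm) module" and F :: "('q set, 'c) chain_complex"
    and \<epsilon> and Ft :: "int \<Rightarrow> ('q, 'k) module" and \<phi> and dt
    and N :: "('q set, 'n) module" and G :: "('q set, 'd) chain_complex"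
    and \<eta> and Gt :: "int \<Rightarrow> ('q, 'l) module" and \<psi> and et
begin

abbreviation "S \<equiv> quot_ring Q f"

text \<open>After reduction of its argument \<beta> is Q-linear into G with restricted scalars; the
  reduction of G is onto, so the projective module Ft i lifts it.\<close>

lemma lift_hom:
  assumes b: "\<beta> \<in> lin_hom S (obj F i) (obj G j)"
  shows "\<exists>s \<in> lin_hom Q (Ft i) (Gt j). \<forall>x \<in> carrier (Ft i). G.rho j (s x) = \<beta> (F.rho i x)"
proof -
  let ?Y = "restrict_scalars (quot_proj Q f) (obj G j)"
  have Y: "left_module Q ?Y"
    by (rule restrict_scalars_module[OF F.Q.ring_axioms F.R_ring F.pi_hom G.F.obj_module])
  have h: "(\<lambda>x \<in> carrier (Ft i). \<beta> (F.rho i x)) \<in> lin_hom Q (Ft i) ?Y"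
  proof (rule lin_homI[OF _ _ _ F.Ft_module])
    show "\<beta> (F.rho i x) \<in> carrier ?Y" if "x \<in> carrier (Ft i)" for x
      using lin_hom_closed[OF b F.rho_closed[OF that refl]] by (simp add: restrict_scalars_simps)
    show "\<beta> (F.rho i (x \<oplus>\<^bsub>Ft i\<^esub> y)) = \<beta> (F.rho i x) \<oplus>\<^bsub>?Y\<^esub> \<beta> (F.rho i y)"
      if "x \<in> carrier (Ft i)" "y \<in> carrier (Ft i)" for x y
      using that by (simp add: restrict_scalars_simps F.rho_add lin_hom_add[OF b] F.rho_closed)
    show "\<beta> (F.rho i (q \<odot>\<^bsub>Ft i\<^esub> x)) = q \<odot>\<^bsub>?Y\<^esub> \<beta> (F.rho i x)"
      if "q \<in> carrier Q" "x \<in> carrier (Ft i)" for q x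
      using that by (simp add: restrict_scalars_simps F.rho_smult lin_hom_smult[OF b] F.rho_closed)
  qed
  have "\<exists>s \<in> lin_hom Q (Ft i) (Gt j). \<forall>x \<in> carrier (Ft i).
      (\<lambda>y \<in> carrier (Gt j). G.rho j y) (s x) = (\<lambda>x \<in> carrier (Ft i). \<beta> (F.rho i x)) x"
  proof (rule projective_lift[OF F.lift_projective G.Ft_module Y G.rho_restrict_hom h])
    fix x assume x: "x \<in> carrier (Ft i)"
    obtain y where "y \<in> carrier (Gt j)" "G.rho j y = \<beta> (F.rho i x)"
      using G.rho_surj[OF lin_hom_closed[OF b F.rho_closed[OF x refl]]] by blast
    then show "(\<lambda>x \<in> carrier (Ft i). \<beta> (F.rho i x)) x \<in> (\<lambda>y \<in> carrier (Gt j). G.rho j y) ` carrier (Gt j)"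
      using x by force
  qed
  then obtain s where s: "s \<in> lin_hom Q (Ft i) (Gt j)" "\<forall>x \<in> carrier (Ft i).
      (\<lambda>y \<in> carrier (Gt j). G.rho j y) (s x) = (\<lambda>x \<in> carrier (Ft i). \<beta> (F.rho i x)) x" by blast
  have "G.rho j (s x) = \<beta> (F.rho i x)" if "x \<in> carrier (Ft i)" for x
    using bspec[OF s(2) that] lin_hom_closed[OF s(1) that] that by simp
  then show ?thesis using s(1) by blast
qed

lemma pair: "hom_pair S M F \<epsilon> N G \<eta>"
  by (intro hom_pair.intro F.F_resolution G.F_resolution)

sublocale P: hom_pair S M F \<epsilon> N G \<eta> by (rule pair)

text \<open>The identity in degree i is conditional on the cocycle condition in degrees i and i - 1.
  For an absolute cocycle it then holds everywhere, for a stable one in high degrees, with the same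
  kind of \<sigma>.\<close>

lemma theta_commute:
  assumes b: "\<beta> \<in> P.H n"
  shows "\<exists>\<sigma> \<in> P.H (n + 1). \<forall>i.
    (\<forall>x \<in> carrier (obj F i). hom_diff F G n \<beta> i x = \<zero>\<^bsub>obj G (i - n - 1)\<^esub>) \<longrightarrow>
    (\<forall>x \<in> carrier (obj F (i - 1)). hom_diff F G n \<beta> (i - 1) x = \<zero>\<^bsub>obj G (i - n - 2)\<^esub>) \<longrightarrow>
    (\<forall>x \<in> carrier (obj F i). G.th (i - n) (\<beta> i x) =
      hom_diff F G (n + 1) \<sigma> i x \<oplus>\<^bsub>obj G (i - n - 2)\<^esub> \<beta> (i - 2) (F.th i x))"
proof -
  have "\<forall>i. \<exists>s \<in> lin_hom Q (Ft i) (Gt (i - n)). \<forall>x \<in> carrier (Ft i). G.rho (i - n) (s x) = \<beta> i (F.rho i x)"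
    using lift_hom[OF P.H_lin[OF b refl]] by blast
  then have "\<exists>b'. \<forall>i. b' i \<in> lin_hom Q (Ft i) (Gt (i - n)) \<and> (\<forall>x \<in> carrier (Ft i). G.rho (i - n) (b' i x) = \<beta> i (F.rho i x))"
    by (intro choice) blast
  then obtain b' where b'l: "\<And>i. b' i \<in> lin_hom Q (Ft i) (Gt (i - n))"
    and b'r: "\<And>i x. x \<in> carrier (Ft i) \<Longrightarrow> G.rho (i - n) (b' i x) = \<beta> i (F.rho i x)" by blast
  have b'c: "b' i x \<in> carrier (Gt j)" if "x \<in> carrier (Ft i)" "j = i - n" for i j x
    using lin_hom_closed[OF b'l that(1)] that(2) by simp
  \<comment> \<open>The coboundary of the lift b', with the sign rule of \<open>hom_diff\<close>.
    Its reduction is the coboundary of \<beta>, so D is divisible by f wherever the latter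
    vanishes.\<close>
  define D where "D i = (if even n
      then (\<lambda>x \<in> carrier (Ft i). compose (carrier (Ft i)) (et (i - n)) (b' i) x \<ominus>\<^bsub>Gt (i - n - 1)\<^esub>
        compose (carrier (Ft i)) (b' (i - 1)) (dt i) x)
      else (\<lambda>x \<in> carrier (Ft i). compose (carrier (Ft i)) (et (i - n)) (b' i) x \<oplus>\<^bsub>Gt (i - n - 1)\<^esub>
        compose (carrier (Ft i)) (b' (i - 1)) (dt i) x))" for i
  have b'l1: "b' (i - 1) \<in> lin_hom Q (Ft (i - 1)) (Gt (i - n - 1))" for i
    using b'l[of "i - 1"] by (simp add: diff_right_commute)
  have Dl: "D i \<in> lin_hom Q (Ft i) (Gt (i - n - 1))" for i
    unfolding D_def
    using lin_hom_sub[OF lin_hom_compose[OF G.lift_lin b'l F.Ft_module] lin_hom_compose[OF b'l1 F.lift_lin F.Ft_module] F.Ft_module G.Ft_module]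
      lin_hom_plus[OF lin_hom_compose[OF G.lift_lin b'l F.Ft_module] lin_hom_compose[OF b'l1 F.lift_lin F.Ft_module] F.Ft_module G.Ft_module]
    by simp
  have D: "D i x = (if even n then et (i - n) (b' i x) \<ominus>\<^bsub>Gt (i - n - 1)\<^esub> b' (i - 1) (dt i x)
      else et (i - n) (b' i x) \<oplus>\<^bsub>Gt (i - n - 1)\<^esub> b' (i - 1) (dt i x))" if "x \<in> carrier (Ft i)" for i x
    using that by (simp add: D_def compose_def)
  define Z where "Z i \<longleftrightarrow> (\<forall>x \<in> carrier (obj F i). hom_diff F G n \<beta> i x = \<zero>\<^bsub>obj G (i - n - 1)\<^esub>)" for i
  have "\<forall>i. \<exists>s. s \<in> lin_hom Q (Ft i) (Gt (i - n - 1)) \<and> (Z i \<longrightarrow> (\<forall>x \<in> carrier (Ft i). D i x = f \<odot>\<^bsub>Gt (i - n - 1)\<^esub> s x))"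
  proof
    fix i
    show "\<exists>s. s \<in> lin_hom Q (Ft i) (Gt (i - n - 1)) \<and> (Z i \<longrightarrow> (\<forall>x \<in> carrier (Ft i). D i x = f \<odot>\<^bsub>Gt (i - n - 1)\<^esub> s x))"
    proof (cases "Z i")
      case True
      have div: "\<exists>y \<in> carrier (Gt (i - n - 1)). D i x = f \<odot>\<^bsub>Gt (i - n - 1)\<^esub> y" if x: "x \<in> carrier (Ft i)" for x
      proof (rule G.rho_eq_zeroD[OF lin_hom_closed[OF Dl x]])
        have dx: "dt i x \<in> carrier (Ft (i - 1))" by (rule F.dt_closed[OF x refl])
        have c: "et (i - n) (b' i x) \<in> carrier (Gt (i - n - 1))" "b' (i - 1) (dt i x) \<in> carrier (Gt (i - n - 1))"
          by (rule G.dt_closed[OF b'c[OF x refl] refl]) (rule b'c[OF dx], simp)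
        have r1: "G.rho (i - n - 1) (et (i - n) (b' i x)) = bd G (i - n) (\<beta> i (F.rho i x))"
          by (simp add: G.rho_dt[OF b'c[OF x refl] refl] b'r[OF x])
        have r2: "G.rho (i - n - 1) (b' (i - 1) (dt i x)) = \<beta> (i - 1) (bd F i (F.rho i x))"
          using b'r[OF dx] F.rho_dt[OF x refl] by (simp add: diff_right_commute)
        have "G.rho (i - n - 1) (D i x) = hom_diff F G n \<beta> i (F.rho i x)"
          unfolding P.diff_apply[OF F.rho_closed[OF x refl] refl] D[OF x] using c by (simp add: G.rho_diff G.rho_add r1 r2)
        then show "G.rho (i - n - 1) (D i x) = \<zero>\<^bsub>obj G (i - n - 1)\<^esub>"
          using True F.rho_closed[OF x refl] by (simp add: Z_def)
      qed
      show ?thesis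
        using G.divide_by_f_ex[OF Dl F.Ft_module div] by blast
    next
      case False
      \<comment> \<open>In degrees where \<beta> violates the cocycle condition nothing is claimed
        of s, and zero is taken to have a map in every degree.\<close>
      then show ?thesis using lin_hom_const_zero[OF F.Ft_module G.Ft_module] by blast
    qed
  qed
  then obtain s where sl: "\<And>i. s i \<in> lin_hom Q (Ft i) (Gt (i - n - 1))"
    and sD: "\<And>i x. Z i \<Longrightarrow> x \<in> carrier (Ft i) \<Longrightarrow> f \<odot>\<^bsub>Gt (i - n - 1)\<^esub> s i x = D i x"
    by (metis (no_types, lifting))
  have sc: "s i x \<in> carrier (Gt j)" if "x \<in> carrier (Ft i)" "j = i - n - 1" for i j x
    using lin_hom_closed[OF sl that(1)] that(2) by simp
  have "\<forall>i. \<exists>a. a \<in> lin_hom S (obj F i) (obj G (i - (n + 1))) \<and> (\<forall>x \<in> carrier (Ft i). a (F.rho i x) = G.rho (i - n - 1) (s i x))"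
  proof
    fix i
    have e: "i - (n + 1) = i - n - 1" by simp
    show "\<exists>a. a \<in> lin_hom S (obj F i) (obj G (i - (n + 1))) \<and> (\<forall>x \<in> carrier (Ft i). a (F.rho i x) = G.rho (i - n - 1) (s i x))"
      unfolding e using F.descend[OF sl G.F.obj_module G.rho_closed[OF _ refl] G.rho_add G.rho_smult] by blast
  qed
  then have "\<exists>\<sigma>. \<forall>i. \<sigma> i \<in> lin_hom S (obj F i) (obj G (i - (n + 1))) \<and> (\<forall>x \<in> carrier (Ft i). \<sigma> i (F.rho i x) = G.rho (i - n - 1) (s i x))"
    by (rule choice)
  then obtain \<sigma> where sg: "\<And>i. \<sigma> i \<in> lin_hom S (obj F i) (obj G (i - (n + 1)))"
    and sgr: "\<And>i x. x \<in> carrier (Ft i) \<Longrightarrow> \<sigma> i (F.rho i x) = G.rho (i - n - 1) (s i x)" by blast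
  have \<sigma>: "\<sigma> \<in> P.H (n + 1)" unfolding P.H_iff using sg by blast
  have "G.th (i - n) (\<beta> i y) = hom_diff F G (n + 1) \<sigma> i y \<oplus>\<^bsub>obj G (i - n - 2)\<^esub> \<beta> (i - 2) (F.th i y)"
    if Zi: "Z i" and Zi1: "Z (i - 1)" and y: "y \<in> carrier (obj F i)" for i y
  proof -
    obtain x where x: "x \<in> carrier (Ft i)" "y = F.rho i x" using F.rho_surj[OF y] by blast
    let ?j = "i - n - 2"
    have dx: "dt i x \<in> carrier (Ft (i - 1))" by (rule F.dt_closed[OF x(1) refl])
    have bx: "b' i x \<in> carrier (Gt (i - n))" by (rule b'c[OF x(1) refl])
    have bdx: "b' (i - 1) (dt i x) \<in> carrier (Gt (i - n - 1))" by (rule b'c[OF dx]) simp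
    have ebx: "et (i - n) (b' i x) \<in> carrier (Gt (i - n - 1))" by (rule G.dt_closed[OF bx refl])
    have sx: "s i x \<in> carrier (Gt (i - n - 1))" by (rule sc[OF x(1) refl])
    have sdx: "s (i - 1) (dt i x) \<in> carrier (Gt ?j)" by (rule sc[OF dx]) simp
    have esx: "et (i - n - 1) (s i x) \<in> carrier (Gt ?j)" by (rule G.dt_closed[OF sx]) simp
    have tx: "F.thl i x \<in> carrier (Ft (i - 2))" by (rule F.thl_closed[OF x(1) refl])
    have btx: "b' (i - 2) (F.thl i x) \<in> carrier (Gt ?j)" by (rule b'c[OF tx]) simp
    have tbx: "G.thl (i - n) (b' i x) \<in> carrier (Gt ?j)" by (rule G.thl_closed[OF bx refl])
    \<comment> \<open>With d for either lifted differential these are ddb', db'd and b'dd. The outer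
      two are multiples of f, the middle one is not.\<close>
    let ?A = "et (i - n - 1) (et (i - n) (b' i x))" and ?B = "et (i - n - 1) (b' (i - 1) (dt i x))"
      and ?C = "b' (i - 2) (dt (i - 1) (dt i x))"
    have A: "?A = f \<odot>\<^bsub>Gt ?j\<^esub> G.thl (i - n) (b' i x)" by (rule G.dt_dt[OF bx]) simp_all
    have C: "?C = f \<odot>\<^bsub>Gt ?j\<^esub> b' (i - 2) (F.thl i x)"
      using F.dt_dt[OF x(1) refl refl] lin_hom_smult[OF b'l F.f_closed tx] by (simp add: diff_right_commute)
    have cl: "?A \<in> carrier (Gt ?j)" "?B \<in> carrier (Gt ?j)" "?C \<in> carrier (Gt ?j)"
      unfolding A C using tbx btx F.f_closed by (auto intro!: G.Ft.smult_closed G.dt_closed[OF bdx])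
    have j1: "i - 1 - n = i - n - 1" "i - 1 - n - 1 = ?j" "i - 1 - 1 = i - 2" "?j = i - n - 1 - 1" by simp_all
    have 1: "f \<odot>\<^bsub>Gt ?j\<^esub> et (i - n - 1) (s i x) = (if even n then ?A \<ominus>\<^bsub>Gt ?j\<^esub> ?B else ?A \<oplus>\<^bsub>Gt ?j\<^esub> ?B)"
    proof -
      have "f \<odot>\<^bsub>Gt ?j\<^esub> et (i - n - 1) (s i x) = et (i - n - 1) (f \<odot>\<^bsub>Gt (i - n - 1)\<^esub> s i x)"
        by (rule G.dt_smult[OF F.f_closed sx, symmetric]) simp
      also have "\<dots> = et (i - n - 1) (D i x)" by (simp only: sD[OF Zi x(1)])
      finally show ?thesis
        unfolding D[OF x(1)] using G.dt_diff[OF ebx bdx j1(4)] G.dt_add[OF ebx bdx j1(4)] by simp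
    qed
    have 2: "f \<odot>\<^bsub>Gt ?j\<^esub> s (i - 1) (dt i x) = (if even n then ?B \<ominus>\<^bsub>Gt ?j\<^esub> ?C else ?B \<oplus>\<^bsub>Gt ?j\<^esub> ?C)"
      using sD[OF Zi1 dx] unfolding D[OF dx] j1 .
    \<comment> \<open>The coboundary of s, whose degree n + 1 has parity opposite to n. In f times
      this coboundary the mixed term \<open>?B\<close> cancels and \<open>?A\<close> minus
      \<open>?C\<close>, that is f(\<theta>b' - b'\<theta>), remains; then f is cancelled.\<close>
    let ?d = "if even n then et (i - n - 1) (s i x) \<oplus>\<^bsub>Gt ?j\<^esub> s (i - 1) (dt i x)
      else et (i - n - 1) (s i x) \<ominus>\<^bsub>Gt ?j\<^esub> s (i - 1) (dt i x)"
    have "f \<odot>\<^bsub>Gt ?j\<^esub> ?d = ?A \<ominus>\<^bsub>Gt ?j\<^esub> ?C"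
      using cl by (simp add: G.Ft.smult_r_distr[OF F.f_closed esx sdx] G.Ft.smult_r_diff[OF F.f_closed esx sdx] 1 2
          G.Ft.M.telescope_diff_diff G.Ft.M.telescope_add_diff)
    also have "\<dots> = f \<odot>\<^bsub>Gt ?j\<^esub> (G.thl (i - n) (b' i x) \<ominus>\<^bsub>Gt ?j\<^esub> b' (i - 2) (F.thl i x))"
      unfolding A C by (rule G.Ft.smult_r_diff[OF F.f_closed tbx btx, symmetric])
    finally have "?d = G.thl (i - n) (b' i x) \<ominus>\<^bsub>Gt ?j\<^esub> b' (i - 2) (F.thl i x)"
      using esx sdx tbx btx by (intro G.f_inj[of ?d ?j]) simp_all
    then have "G.rho ?j (?d \<oplus>\<^bsub>Gt ?j\<^esub> b' (i - 2) (F.thl i x)) = G.rho ?j (G.thl (i - n) (b' i x))"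
      using tbx btx by (simp add: G.Ft.M.diff_add_cancel_right)
    moreover have "G.rho ?j (?d \<oplus>\<^bsub>Gt ?j\<^esub> b' (i - 2) (F.thl i x)) =
        G.rho ?j ?d \<oplus>\<^bsub>obj G ?j\<^esub> G.rho ?j (b' (i - 2) (F.thl i x))"
      by (rule G.rho_add) (use esx sdx btx in simp_all)
    moreover have "G.rho ?j ?d = hom_diff F G (n + 1) \<sigma> i y"
    proof -
      have r1: "G.rho ?j (et (i - n - 1) (s i x)) = bd G (i - n - 1) (\<sigma> i y)"
        using G.rho_dt[OF sx, of ?j] x sgr[OF x(1)] by simp
      have r2: "G.rho ?j (s (i - 1) (dt i x)) = \<sigma> (i - 1) (bd F i y)"
        using sgr[OF dx] F.rho_dt[OF x(1) refl] x(2) unfolding j1 by simp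
      have e: "i - (n + 1) = i - n - 1" by simp
      show ?thesis
        using esx sdx P.diff_apply[OF y, of ?j "n + 1" \<sigma>] unfolding e
        by (simp add: G.rho_add G.rho_diff r1 r2)
    qed
    moreover have "G.rho ?j (b' (i - 2) (F.thl i x)) = \<beta> (i - 2) (F.th i y)"
      using b'r[OF tx] F.th_rho[OF x(1) refl] x(2) by (simp add: diff_right_commute)
    moreover have "G.rho ?j (G.thl (i - n) (b' i x)) = G.th (i - n) (\<beta> i y)"
      using G.th_rho[OF bx refl] b'r[OF x(1)] x(2) by simp
    ultimately show ?thesis by simp
  qed
  then have "\<forall>i. Z i \<longrightarrow> Z (i - 1) \<longrightarrow> (\<forall>y \<in> carrier (obj F i). G.th (i - n) (\<beta> i y) =
      hom_diff F G (n + 1) \<sigma> i y \<oplus>\<^bsub>obj G (i - n - 2)\<^esub> \<beta> (i - 2) (F.th i y))" by blast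
  moreover have "i - 1 - n - 1 = i - n - 2" for i by simp
  ultimately show ?thesis unfolding Z_def using \<sigma> by auto
qed

lemma triple_left: "hom_triple S M F \<epsilon> N G \<eta> N G \<eta>"
  by (intro hom_tripleI F.F_resolution G.F_resolution)

lemma triple_right: "hom_triple S M F \<epsilon> M F \<epsilon> N G \<eta>"
  by (intro hom_tripleI F.F_resolution G.F_resolution)

lemma ext_theta_commute:
  assumes x: "x \<in> carrier (cohomology (hom_complex S F G) n)"
  shows "ext_mult S F G 2 n (ext_cl S G G 2 G.th) x = ext_mult S F G n 2 x (ext_cl S F F 2 F.th)"
proof -
  interpret L: hom_triple S M F \<epsilon> N G \<eta> N G \<eta> by (rule triple_left)
  interpret R: hom_triple S M F \<epsilon> M F \<epsilon> N G \<eta> by (rule triple_right)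
  obtain \<beta> where b: "\<beta> \<in> hom_Z S F G n" "x = ext_cl S F G n \<beta>" using P.ext_elem[OF x] .
  have bH: "\<beta> \<in> P.H n" by (rule P.hom_Z_closed[OF b(1)])
  obtain \<sigma> where s: "\<sigma> \<in> P.H (n + 1)" and eq: "\<forall>i.
    (\<forall>x \<in> carrier (obj F i). hom_diff F G n \<beta> i x = \<zero>\<^bsub>obj G (i - n - 1)\<^esub>) \<longrightarrow>
    (\<forall>x \<in> carrier (obj F (i - 1)). hom_diff F G n \<beta> (i - 1) x = \<zero>\<^bsub>obj G (i - n - 2)\<^esub>) \<longrightarrow>
    (\<forall>x \<in> carrier (obj F i). G.th (i - n) (\<beta> i x) =
      hom_diff F G (n + 1) \<sigma> i x \<oplus>\<^bsub>obj G (i - n - 2)\<^esub> \<beta> (i - 2) (F.th i x))"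
    using theta_commute[OF bH] by blast
  have Z: "hom_diff F G n \<beta> i x = \<zero>\<^bsub>obj G j\<^esub>" if "x \<in> carrier (obj F i)" "j = i - n - 1" for i j x
    using b(1) P.one_apply[OF that(1), of j "n + 1"] that(2) by (simp add: hom_Z_def)
  have "ext_cl S F G (n + 2) (hom_comp F n G.th \<beta>) = ext_cl S F G (n + 2) (hom_comp F 2 \<beta> F.th)"
  proof (rule P.ext_cl_eqI[OF _ _ s])
    show "hom_comp F n G.th \<beta> \<in> hom_Z S F G (n + 2)" by (rule L.comp_hom_Z[OF G.theta_hom_Z b(1)]) simp
    show "hom_comp F 2 \<beta> F.th \<in> hom_Z S F G (n + 2)" by (rule R.comp_hom_Z[OF b(1) F.theta_hom_Z]) simp
    fix i x assume x: "x \<in> carrier (obj F i)"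
    have e: "i - (n + 2) = i - n - 2" by simp
    show "hom_comp F n G.th \<beta> i x = hom_diff F G (n + 1) \<sigma> i x \<oplus>\<^bsub>obj G (i - (n + 2))\<^esub> hom_comp F 2 \<beta> F.th i x"
      unfolding e hom_comp_apply[OF x refl] using eq x Z by simp
  qed simp
  then show ?thesis
    unfolding b(2) L.ext_mult_cl[OF G.theta_hom_Z b(1) refl] R.ext_mult_cl[OF b(1) F.theta_hom_Z refl]
    by (simp add: add.commute)
qed

lemma stable_theta_commute:
  assumes x: "x \<in> carrier (cohomology (stable_hom_complex S F G) n)"
  shows "stable_ext_mult S F G 2 n (stable_cl S G G 2 G.th) x = stable_ext_mult S F G n 2 x (stable_cl S F F 2 F.th)"
proof -
  interpret L: hom_triple S M F \<epsilon> N G \<eta> N G \<eta> by (rule triple_left)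
  interpret R: hom_triple S M F \<epsilon> M F \<epsilon> N G \<eta> by (rule triple_right)
  obtain \<beta> where b: "\<beta> \<in> stable_Z S F G n" "x = stable_cl S F G n \<beta>" using P.stable_elem[OF x] .
  have bH: "\<beta> \<in> P.H n" and bb: "hom_diff F G n \<beta> \<in> bounded_homs S F G (n + 1)"
    using b(1) by (simp_all add: stable_Z_def)
  obtain \<sigma> where s: "\<sigma> \<in> P.H (n + 1)" and eq: "\<forall>i.
    (\<forall>x \<in> carrier (obj F i). hom_diff F G n \<beta> i x = \<zero>\<^bsub>obj G (i - n - 1)\<^esub>) \<longrightarrow>
    (\<forall>x \<in> carrier (obj F (i - 1)). hom_diff F G n \<beta> (i - 1) x = \<zero>\<^bsub>obj G (i - n - 2)\<^esub>) \<longrightarrow>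
    (\<forall>x \<in> carrier (obj F i). G.th (i - n) (\<beta> i x) =
      hom_diff F G (n + 1) \<sigma> i x \<oplus>\<^bsub>obj G (i - n - 2)\<^esub> \<beta> (i - 2) (F.th i x))"
    using theta_commute[OF bH] by blast
  obtain k where k: "\<And>i j x. k < i \<Longrightarrow> x \<in> carrier (obj F i) \<Longrightarrow> j = i - (n + 1) \<Longrightarrow> hom_diff F G n \<beta> i x = \<zero>\<^bsub>obj G j\<^esub>"
    using P.boundedE[OF bb] by blast
  have tG: "G.th \<in> stable_Z S G G 2" by (rule L.GH.hom_Z_stable[OF G.theta_hom_Z])
  have tF: "F.th \<in> stable_Z S F F 2" by (rule R.FG.hom_Z_stable[OF F.theta_hom_Z])
  have "stable_cl S F G (n + 2) (hom_comp F n G.th \<beta>) = stable_cl S F G (n + 2) (hom_comp F 2 \<beta> F.th)"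
  \<comment> \<open>One more than the bound for the coboundary of \<beta>, because the identity in
    degree i also uses the cocycle condition in degree i - 1.\<close>
  proof (rule P.stable_cl_eqI[OF _ _ s, where k = "k + 1"])
    show "hom_comp F n G.th \<beta> \<in> stable_Z S F G (n + 2)" by (rule L.comp_stable_Z[OF tG b(1)]) simp
    show "hom_comp F 2 \<beta> F.th \<in> stable_Z S F G (n + 2)" by (rule R.comp_stable_Z[OF b(1) tF]) simp
    fix i x assume i: "k + 1 < i" and x: "x \<in> carrier (obj F i)"
    have z: "\<forall>x \<in> carrier (obj F i). hom_diff F G n \<beta> i x = \<zero>\<^bsub>obj G (i - n - 1)\<^esub>"
      "\<forall>x \<in> carrier (obj F (i - 1)). hom_diff F G n \<beta> (i - 1) x = \<zero>\<^bsub>obj G (i - n - 2)\<^esub>"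
      using i by (auto intro!: k)
    have e: "i - (n + 2) = i - n - 2" by simp
    show "hom_comp F n G.th \<beta> i x = hom_diff F G (n + 1) \<sigma> i x \<oplus>\<^bsub>obj G (i - (n + 2))\<^esub> hom_comp F 2 \<beta> F.th i x"
      unfolding e hom_comp_apply[OF x refl] using eq z x by blast
  qed simp
  then show ?thesis
    unfolding b(2) L.stable_mult_cl[OF tG b(1) refl] R.stable_mult_cl[OF b(1) tF refl]
    by (simp add: add.commute)
qed

end

section \<open>Finite projective dimension\<close>

definition pair_module :: "('a, 'b) module \<Rightarrow> ('a, 'c) module \<Rightarrow> ('a, 'b \<times> 'c) module" where
  "pair_module X Y =
    \<lparr>carrier = carrier X \<times> carrier Y, monoid.mult = undefined, one = undefined,
     ring.zero = (\<zero>\<^bsub>X\<^esub>, \<zero>\<^bsub>Y\<^esub>), add = (\<lambda>p q. (fst p \<oplus>\<^bsub>X\<^esub> fst q, snd p \<oplus>\<^bsub>Y\<^esub> snd q)),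
     smult = (\<lambda>a p. (a \<odot>\<^bsub>X\<^esub> fst p, a \<odot>\<^bsub>Y\<^esub> snd p))\<rparr>"

lemma pair_module_simps:
  "carrier (pair_module X Y) = carrier X \<times> carrier Y" "\<zero>\<^bsub>pair_module X Y\<^esub> = (\<zero>\<^bsub>X\<^esub>, \<zero>\<^bsub>Y\<^esub>)"
  "p \<oplus>\<^bsub>pair_module X Y\<^esub> q = (fst p \<oplus>\<^bsub>X\<^esub> fst q, snd p \<oplus>\<^bsub>Y\<^esub> snd q)"
  "a \<odot>\<^bsub>pair_module X Y\<^esub> p = (a \<odot>\<^bsub>X\<^esub> fst p, a \<odot>\<^bsub>Y\<^esub> snd p)"
  by (simp_all add: pair_module_def)

lemma pair_module_left_module:
  assumes "left_module R X" "left_module R Y"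
  shows "left_module R (pair_module X Y)"
proof -
  interpret X: left_module R X by fact
  interpret Y: left_module R Y by fact
  have "abelian_group (pair_module X Y)"
  proof (rule abelian_groupI)
    fix p assume "p \<in> carrier (pair_module X Y)"
    then show "\<exists>q\<in>carrier (pair_module X Y). q \<oplus>\<^bsub>pair_module X Y\<^esub> p = \<zero>\<^bsub>pair_module X Y\<^esub>"
      by (intro bexI[of _ "(\<ominus>\<^bsub>X\<^esub> fst p, \<ominus>\<^bsub>Y\<^esub> snd p)"]) (auto simp: pair_module_simps X.M.l_neg Y.M.l_neg)
  qed (auto simp: pair_module_simps X.M.a_ac Y.M.a_ac)
  then show ?thesis
    by (intro left_module.intro left_module_axioms.intro X.R.ring_axioms)
      (auto simp: pair_module_simps X.smult_closed Y.smult_closed X.smult_l_distr Y.smult_l_distr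
        X.smult_r_distr Y.smult_r_distr X.smult_assoc Y.smult_assoc X.smult_one Y.smult_one)
qed

text \<open>The test modules for the sum live over the product type, not over the type of the
  summands. The two restrictions of h are therefore lifted by \<open>projective_lift\<close>, which
  allows any type, and then added.\<close>

lemma pair_module_projective:
  fixes A B :: "('a, 'b) module"
  assumes A: "projective_module R A" and B: "projective_module R B"
  shows "projective_module R (pair_module A B)"
  unfolding projective_module_def
proof (intro conjI allI ballI impI)
  have Am: "left_module R A" and Bm: "left_module R B" using A B by (simp_all add: projective_module_def)
  interpret A: left_module R A by (rule Am)
  interpret B: left_module R B by (rule Bm)
  let ?P = "pair_module A B"
  show Pm: "left_module R ?P" by (rule pair_module_left_module[OF Am Bm])
  fix X :: "('a, 'b \<times> 'b \<Rightarrow> 'a) module" and Y :: "('a, 'b \<times> 'b) module" and g h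
  assume g: "g \<in> lin_hom R X Y" and h: "h \<in> lin_hom R ?P Y" and X: "left_module R X" and Y: "left_module R Y"
    and surj: "g ` carrier X = carrier Y"
  interpret X: left_module R X by (rule X)
  have hA: "(\<lambda>x \<in> carrier A. h (x, \<zero>\<^bsub>B\<^esub>)) \<in> lin_hom R A Y"
  proof (rule lin_homI[OF _ _ _ Am])
    show "h (x, \<zero>\<^bsub>B\<^esub>) \<in> carrier Y" if "x \<in> carrier A" for x
      using lin_hom_closed[OF h] that by (simp add: pair_module_simps)
    show "h (x \<oplus>\<^bsub>A\<^esub> y, \<zero>\<^bsub>B\<^esub>) = h (x, \<zero>\<^bsub>B\<^esub>) \<oplus>\<^bsub>Y\<^esub> h (y, \<zero>\<^bsub>B\<^esub>)" if "x \<in> carrier A" "y \<in> carrier A" for x y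
      using lin_hom_add[OF h, of "(x, \<zero>\<^bsub>B\<^esub>)" "(y, \<zero>\<^bsub>B\<^esub>)"] that by (simp add: pair_module_simps)
    show "h (a \<odot>\<^bsub>A\<^esub> x, \<zero>\<^bsub>B\<^esub>) = a \<odot>\<^bsub>Y\<^esub> h (x, \<zero>\<^bsub>B\<^esub>)" if "a \<in> carrier R" "x \<in> carrier A" for a x
      using lin_hom_smult[OF h, of a "(x, \<zero>\<^bsub>B\<^esub>)"] that by (simp add: pair_module_simps B.smult_r_null)
  qed
  have hB: "(\<lambda>x \<in> carrier B. h (\<zero>\<^bsub>A\<^esub>, x)) \<in> lin_hom R B Y"
  proof (rule lin_homI[OF _ _ _ Bm])
    show "h (\<zero>\<^bsub>A\<^esub>, x) \<in> carrier Y" if "x \<in> carrier B" for x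
      using lin_hom_closed[OF h] that by (simp add: pair_module_simps)
    show "h (\<zero>\<^bsub>A\<^esub>, x \<oplus>\<^bsub>B\<^esub> y) = h (\<zero>\<^bsub>A\<^esub>, x) \<oplus>\<^bsub>Y\<^esub> h (\<zero>\<^bsub>A\<^esub>, y)" if "x \<in> carrier B" "y \<in> carrier B" for x y
      using lin_hom_add[OF h, of "(\<zero>\<^bsub>A\<^esub>, x)" "(\<zero>\<^bsub>A\<^esub>, y)"] that by (simp add: pair_module_simps)
    show "h (\<zero>\<^bsub>A\<^esub>, a \<odot>\<^bsub>B\<^esub> x) = a \<odot>\<^bsub>Y\<^esub> h (\<zero>\<^bsub>A\<^esub>, x)" if "a \<in> carrier R" "x \<in> carrier B" for a x
      using lin_hom_smult[OF h, of a "(\<zero>\<^bsub>A\<^esub>, x)"] that by (simp add: pair_module_simps A.smult_r_null)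
  qed
  obtain k where k: "k \<in> lin_hom R A X" "\<forall>x \<in> carrier A. g (k x) = (\<lambda>x \<in> carrier A. h (x, \<zero>\<^bsub>B\<^esub>)) x"
    using projective_lift[OF A X Y g hA] lin_hom_closed[OF hA] surj by blast
  obtain l where l: "l \<in> lin_hom R B X" "\<forall>x \<in> carrier B. g (l x) = (\<lambda>x \<in> carrier B. h (\<zero>\<^bsub>A\<^esub>, x)) x"
    using projective_lift[OF B X Y g hB] lin_hom_closed[OF hB] surj by blast
  let ?m = "\<lambda>p \<in> carrier ?P. k (fst p) \<oplus>\<^bsub>X\<^esub> l (snd p)"
  have "?m \<in> lin_hom R ?P X"
    by (rule lin_homI[OF _ _ _ Pm])
      (auto simp: pair_module_simps lin_hom_closed[OF k(1)] lin_hom_closed[OF l(1)] lin_hom_add[OF k(1)] lin_hom_add[OF l(1)]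
        lin_hom_smult[OF k(1)] lin_hom_smult[OF l(1)] X.M.a_ac X.smult_r_distr)
  moreover have "g (?m p) = h p" if p: "p \<in> carrier ?P" for p
  proof -
    obtain x y where xy: "p = (x, y)" "x \<in> carrier A" "y \<in> carrier B" using p by (auto simp: pair_module_simps)
    have "h p = h ((x, \<zero>\<^bsub>B\<^esub>) \<oplus>\<^bsub>?P\<^esub> (\<zero>\<^bsub>A\<^esub>, y))" using xy by (simp add: pair_module_simps)
    also have "\<dots> = h (x, \<zero>\<^bsub>B\<^esub>) \<oplus>\<^bsub>Y\<^esub> h (\<zero>\<^bsub>A\<^esub>, y)"
      by (rule lin_hom_add[OF h]) (use xy in \<open>simp_all add: pair_module_simps\<close>)
    also have "\<dots> = g (k x) \<oplus>\<^bsub>Y\<^esub> g (l y)" using bspec[OF k(2) xy(2)] bspec[OF l(2) xy(3)] xy by simp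
    also have "\<dots> = g (?m p)"
      using p xy lin_hom_add[OF g lin_hom_closed[OF k(1) xy(2)] lin_hom_closed[OF l(1) xy(3)]] by simp
    finally show ?thesis ..
  qed
  ultimately show "\<exists>k \<in> lin_hom R ?P X. \<forall>x \<in> carrier ?P. g (k x) = h x" by blast
qed

text \<open>A zero module that keeps the type and the zero element of X, so that a family of modules
  can be truncated without changing its type.\<close>

definition zero_part :: "('a, 'b) module \<Rightarrow> ('a, 'b) module" where
  "zero_part X = X\<lparr>carrier := {\<zero>\<^bsub>X\<^esub>}\<rparr>"

lemma zero_part_simps:
  "carrier (zero_part X) = {\<zero>\<^bsub>X\<^esub>}" "\<zero>\<^bsub>zero_part X\<^esub> = \<zero>\<^bsub>X\<^esub>" "x \<oplus>\<^bsub>zero_part X\<^esub> y = x \<oplus>\<^bsub>X\<^esub> y" "a \<odot>\<^bsub>zero_part X\<^esub> x = a \<odot>\<^bsub>X\<^esub> x"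
  by (simp_all add: zero_part_def)

lemma zero_part_projective:
  assumes X: "left_module R X"
  shows "projective_module R (zero_part X)"
proof -
  interpret X: left_module R X by (rule X)
  have "abelian_group (zero_part X)"
    by (rule abelian_groupI) (auto simp: zero_part_simps)
  then have Z: "left_module R (zero_part X)"
    by (intro left_module.intro left_module_axioms.intro X.R.ring_axioms)
      (auto simp: zero_part_simps X.smult_r_null)
  show ?thesis unfolding projective_module_def
  proof (intro conjI allI ballI impI)
    show "left_module R (zero_part X)" by (rule Z)
    fix U V g h assume g: "g \<in> lin_hom R U V" and h: "h \<in> lin_hom R (zero_part X) V"
      and U: "left_module R U" and V: "left_module R V"
    have "g \<zero>\<^bsub>U\<^esub> = \<zero>\<^bsub>V\<^esub>" "h \<zero>\<^bsub>zero_part X\<^esub> = \<zero>\<^bsub>V\<^esub>"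
      using lin_hom_zero[OF g] lin_hom_zero[OF h] U V Z by (auto intro: left_module_abelian_group)
    then show "\<exists>k\<in>lin_hom R (zero_part X) U. \<forall>x\<in>carrier (zero_part X). g (k x) = h x"
      by (intro bexI[OF _ lin_hom_const_zero[OF Z U]]) (simp add: zero_part_simps)
  qed
qed

section \<open>The truncated cone as a projective resolution over Q\<close>

context lifted
begin

definition tr :: "int \<Rightarrow> ('q, 'l) module" where
  "tr i = (if 0 \<le> i then Ft i else zero_part (Ft i))"

text \<open>The mapping cone of \<open>f\<close> on the lifted complex, with the homotopy \<open>\<theta>\<close> correcting the failure
  of \<open>dt\<close> to square to zero. Negative degrees are cut off because \<open>Ft\<close> may be nonzero there, namely
  where \<open>f\<close> acts bijectively.\<close>

definition cone :: "('q, 'l \<times> 'l) chain_complex" where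
  "cone = \<lparr>obj = (\<lambda>i. pair_module (tr i) (tr (i - 1))),
     bd = (\<lambda>i. \<lambda>p \<in> carrier (pair_module (tr i) (tr (i - 1))).
       (if 1 \<le> i then dt i (fst p) \<ominus>\<^bsub>Ft (i - 1)\<^esub> f \<odot>\<^bsub>Ft (i - 1)\<^esub> snd p else \<zero>\<^bsub>Ft (i - 1)\<^esub>,
        if 2 \<le> i then thl i (fst p) \<ominus>\<^bsub>Ft (i - 2)\<^esub> dt (i - 1) (snd p) else \<zero>\<^bsub>Ft (i - 2)\<^esub>))\<rparr>"

lemma tr_projective: "projective_module Q (tr i)"
  by (simp add: tr_def lift_projective zero_part_projective Ft_module)

lemma tr_simps:
  "\<zero>\<^bsub>tr i\<^esub> = \<zero>\<^bsub>Ft i\<^esub>" "x \<oplus>\<^bsub>tr i\<^esub> y = x \<oplus>\<^bsub>Ft i\<^esub> y" "a \<odot>\<^bsub>tr i\<^esub> x = a \<odot>\<^bsub>Ft i\<^esub> x"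
  by (simp_all add: tr_def zero_part_simps)

lemma tr_mem: "x \<in> carrier (tr i) \<Longrightarrow> x \<in> carrier (Ft i)"
  by (auto simp: tr_def zero_part_simps split: if_splits)

lemma tr_mem_iff: "x \<in> carrier (tr i) \<longleftrightarrow> x \<in> carrier (Ft i) \<and> (i < 0 \<longrightarrow> x = \<zero>\<^bsub>Ft i\<^esub>)"
  by (auto simp: tr_def zero_part_simps)

lemma cone_obj: "obj cone i = pair_module (tr i) (tr (i - 1))"
  by (simp add: cone_def)

lemma cone_projective: "projective_module Q (obj cone i)"
  unfolding cone_obj by (rule pair_module_projective[OF tr_projective tr_projective])

lemma cone_module: "left_module Q (obj cone i)"
  using cone_projective by (simp add: projective_module_def)

lemma cone_mem: "(x, y) \<in> carrier (obj cone i) \<longleftrightarrow> x \<in> carrier (tr i) \<and> y \<in> carrier (tr (i - 1))"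
  by (simp add: cone_obj pair_module_simps)

lemma cone_ops: "\<zero>\<^bsub>obj cone i\<^esub> = (\<zero>\<^bsub>Ft i\<^esub>, \<zero>\<^bsub>Ft (i - 1)\<^esub>)"
  "(x, y) \<oplus>\<^bsub>obj cone i\<^esub> (x', y') = (x \<oplus>\<^bsub>Ft i\<^esub> x', y \<oplus>\<^bsub>Ft (i - 1)\<^esub> y')"
  "a \<odot>\<^bsub>obj cone i\<^esub> (x, y) = (a \<odot>\<^bsub>Ft i\<^esub> x, a \<odot>\<^bsub>Ft (i - 1)\<^esub> y)"
  by (simp_all add: cone_obj pair_module_simps tr_simps)

text \<open>The thresholds 1 and 2 are the degrees from which the two target summands, in degrees i
  - 1 and i - 2, are no longer truncated.\<close>

lemma cone_bd:
  "(x, y) \<in> carrier (obj cone i) \<Longrightarrow> bd cone i (x, y) =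
    (if 1 \<le> i then dt i x \<ominus>\<^bsub>Ft (i - 1)\<^esub> f \<odot>\<^bsub>Ft (i - 1)\<^esub> y else \<zero>\<^bsub>Ft (i - 1)\<^esub>,
     if 2 \<le> i then thl i x \<ominus>\<^bsub>Ft (i - 2)\<^esub> dt (i - 1) y else \<zero>\<^bsub>Ft (i - 2)\<^esub>)"
  by (simp add: cone_def)

lemma cone_bd_lin: "bd cone i \<in> lin_hom Q (obj cone i) (obj cone (i - 1))"
proof -
  let ?b = "\<lambda>p. (if 1 \<le> i then dt i (fst p) \<ominus>\<^bsub>Ft (i - 1)\<^esub> f \<odot>\<^bsub>Ft (i - 1)\<^esub> snd p else \<zero>\<^bsub>Ft (i - 1)\<^esub>,
        if 2 \<le> i then thl i (fst p) \<ominus>\<^bsub>Ft (i - 2)\<^esub> dt (i - 1) (snd p) else \<zero>\<^bsub>Ft (i - 2)\<^esub>)"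
  have e: "i - 1 - 1 = i - 2" by simp
  have cl: "dt i x \<in> carrier (Ft (i - 1))" "f \<odot>\<^bsub>Ft (i - 1)\<^esub> y \<in> carrier (Ft (i - 1))"
    "thl i x \<in> carrier (Ft (i - 2))" "dt (i - 1) y \<in> carrier (Ft (i - 2))"
    if "x \<in> carrier (Ft i)" "y \<in> carrier (Ft (i - 1))" for x y
    using that f_closed by (auto intro: dt_closed thl_closed Ft.smult_closed)
  have lin: "(\<lambda>p \<in> carrier (obj cone i). ?b p) \<in> lin_hom Q (obj cone i) (obj cone (i - 1))"
  proof (rule lin_homI[OF _ _ _ cone_module])
    fix p assume p: "p \<in> carrier (obj cone i)"
    then obtain x y where xy: "p = (x, y)" "x \<in> carrier (Ft i)" "y \<in> carrier (Ft (i - 1))"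
      by (metis cone_mem surj_pair tr_mem)
    show "?b p \<in> carrier (obj cone (i - 1))"
      using cl[OF xy(2,3)] unfolding xy(1) by (auto simp: cone_mem tr_mem_iff e)
    show "?b (p \<oplus>\<^bsub>obj cone i\<^esub> q) = ?b p \<oplus>\<^bsub>obj cone (i - 1)\<^esub> ?b q" if q: "q \<in> carrier (obj cone i)" for q
    proof -
      obtain x' y' where xy': "q = (x', y')" "x' \<in> carrier (Ft i)" "y' \<in> carrier (Ft (i - 1))"
        using q by (metis cone_mem surj_pair tr_mem)
      show ?thesis
        using cl[OF xy(2,3)] cl[OF xy'(2,3)] unfolding xy(1) xy'(1)
        by (simp add: cone_ops e dt_add[OF xy(2) xy'(2)] dt_add[OF xy(3) xy'(3), of "i - 2"]
            lin_hom_add[OF thl_lin[OF refl] xy(2) xy'(2)] Ft.smult_r_distr[OF f_closed xy(3) xy'(3)] Ft.M.swap_diff)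
    qed
    show "?b (a \<odot>\<^bsub>obj cone i\<^esub> p) = a \<odot>\<^bsub>obj cone (i - 1)\<^esub> ?b p" if a: "a \<in> carrier Q" for a
    proof -
      have "f \<odot>\<^bsub>Ft (i - 1)\<^esub> (a \<odot>\<^bsub>Ft (i - 1)\<^esub> y) = a \<odot>\<^bsub>Ft (i - 1)\<^esub> (f \<odot>\<^bsub>Ft (i - 1)\<^esub> y)"
        using Ft.smult_assoc[OF f_closed a xy(3)] Ft.smult_assoc[OF a f_closed xy(3)] bspec[OF f_central a] by simp
      then show ?thesis
        using cl[OF xy(2,3)] a unfolding xy(1)
        by (simp add: cone_ops e dt_smult[OF a xy(2)] dt_smult[OF a xy(3), of "i - 2"]
            lin_hom_smult[OF thl_lin[OF refl] a xy(2)] Ft.smult_r_diff Ft.smult_r_null)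
    qed
  qed
  have "bd cone i = (\<lambda>p \<in> carrier (obj cone i). ?b p)" by (simp add: cone_def)
  then show ?thesis using lin by simp
qed

text \<open>For u = dx - fy and v = \<theta>x - dy one has du = fv from dd = f\<theta>, and
  \<theta>u = dv from \<theta>d = d\<theta> together with f\<theta>y = ddy. These are the two
  components of the claim.\<close>

lemma cone_bd_bd:
  assumes p: "p \<in> carrier (obj cone i)" and i: "2 \<le> i"
  shows "bd cone (i - 1) (bd cone i p) = \<zero>\<^bsub>obj cone (i - 2)\<^esub>"
proof -
  obtain x y where xy: "p = (x, y)" "x \<in> carrier (Ft i)" "y \<in> carrier (Ft (i - 1))"
    using p by (metis cone_mem surj_pair tr_mem)
  let ?u = "dt i x \<ominus>\<^bsub>Ft (i - 1)\<^esub> f \<odot>\<^bsub>Ft (i - 1)\<^esub> y" and ?v = "thl i x \<ominus>\<^bsub>Ft (i - 2)\<^esub> dt (i - 1) y"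
  have cl: "dt i x \<in> carrier (Ft (i - 1))" "f \<odot>\<^bsub>Ft (i - 1)\<^esub> y \<in> carrier (Ft (i - 1))"
    "thl i x \<in> carrier (Ft (i - 2))" "dt (i - 1) y \<in> carrier (Ft (i - 2))"
    using xy f_closed by (auto intro: dt_closed thl_closed Ft.smult_closed)
  have b: "bd cone i p = (?u, ?v)" using p i xy by (simp add: cone_bd)
  have uv: "(?u, ?v) \<in> carrier (obj cone (i - 1))"
    using lin_hom_closed[OF cone_bd_lin p] b by simp
  have e: "i - 1 - 1 = i - 2" "i - 1 - 2 = i - 3" "i - 2 - 1 = i - 3" by simp_all
  have u1: "dt (i - 1) ?u = f \<odot>\<^bsub>Ft (i - 2)\<^esub> ?v"
    using dt_diff[OF cl(1,2), of "i - 2"] dt_dt[OF xy(2) refl refl] dt_smult[OF f_closed xy(3), of "i - 2"]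
      Ft.smult_r_diff[OF f_closed cl(3,4)] by simp
  have v1: "thl (i - 1) ?u = dt (i - 2) ?v"
  proof -
    have "thl (i - 1) ?u = thl (i - 1) (dt i x) \<ominus>\<^bsub>Ft (i - 3)\<^esub> thl (i - 1) (f \<odot>\<^bsub>Ft (i - 1)\<^esub> y)"
      by (rule lin_hom_diff[OF thl_lin Ft_group Ft_group cl(1,2)]) simp
    also have "\<dots> = dt (i - 2) (thl i x) \<ominus>\<^bsub>Ft (i - 3)\<^esub> dt (i - 2) (dt (i - 1) y)"
      using thl_dt[OF xy(2) refl refl] lin_hom_smult[OF thl_lin[of "i - 3" "i - 1"] f_closed xy(3)]
        dt_dt[OF xy(3), of "i - 2" "i - 3"] by simp
    also have "\<dots> = dt (i - 2) ?v" by (rule dt_diff[OF cl(3,4), symmetric]) simp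
    finally show ?thesis .
  qed
  have uvc: "?u \<in> carrier (Ft (i - 1))" "?v \<in> carrier (Ft (i - 2))" using cl by simp_all
  have "dt (i - 1) ?u \<ominus>\<^bsub>Ft (i - 2)\<^esub> f \<odot>\<^bsub>Ft (i - 2)\<^esub> ?v = \<zero>\<^bsub>Ft (i - 2)\<^esub>"
    unfolding u1 by (rule Ft.M.diff_self) (rule Ft.smult_closed[OF f_closed uvc(2)])
  moreover have "thl (i - 1) ?u \<ominus>\<^bsub>Ft (i - 3)\<^esub> dt (i - 2) ?v = \<zero>\<^bsub>Ft (i - 3)\<^esub>"
    unfolding v1 by (rule Ft.M.diff_self) (rule dt_closed[OF uvc(2)], simp)
  ultimately show ?thesis
    unfolding b cone_bd[OF uv] e cone_ops using i by auto
qed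

text \<open>If the reduction of x is a boundary, then x = dw - fv for some w and v. Applying d to
  this and using dx = fy gives fy = f(\<theta>w - dv), so cancelling f yields the second component.
  The boundary condition is put on the reduction of x so that degree zero, where it comes from the
  augmentation, is included.\<close>

lemma cone_exact:
  assumes i: "0 \<le> i" and x: "x \<in> carrier (Ft i)" and y: "y \<in> carrier (tr (i - 1))"
    and dx: "1 \<le> i \<Longrightarrow> dt i x = f \<odot>\<^bsub>Ft (i - 1)\<^esub> y"
    and bx: "rho i x \<in> bd F (i + 1) ` carrier (obj F (i + 1))"
  shows "(x, y) \<in> bd cone (i + 1) ` carrier (obj cone (i + 1))"
proof -
  obtain z where z: "z \<in> carrier (obj F (i + 1))" "rho i x = bd F (i + 1) z" using bx by blast
  obtain w where w: "w \<in> carrier (Ft (i + 1))" "rho (i + 1) w = z" using rho_surj[OF z(1)] by blast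
  have dw: "dt (i + 1) w \<in> carrier (Ft i)" by (rule dt_closed[OF w(1)]) simp
  have "rho i (dt (i + 1) w \<ominus>\<^bsub>Ft i\<^esub> x) = \<zero>\<^bsub>obj F i\<^esub>"
    using rho_dt[OF w(1), of i] w z x dw rho_closed[OF x refl] by (simp add: rho_diff F.obj.M.diff_self)
  then obtain v where v: "v \<in> carrier (Ft i)" "dt (i + 1) w \<ominus>\<^bsub>Ft i\<^esub> x = f \<odot>\<^bsub>Ft i\<^esub> v"
    using rho_eq_zeroD[of "dt (i + 1) w \<ominus>\<^bsub>Ft i\<^esub> x" i] dw x by auto
  have fv: "f \<odot>\<^bsub>Ft i\<^esub> v \<in> carrier (Ft i)" by (rule Ft.smult_closed[OF f_closed v(1)])
  have "dt (i + 1) w \<ominus>\<^bsub>Ft i\<^esub> f \<odot>\<^bsub>Ft i\<^esub> v = x"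
    unfolding v(2)[symmetric] using dw x
    by (simp add: Ft.M.minus_eq Ft.M.minus_add Ft.M.a_assoc[symmetric] Ft.M.r_neg)
  then have x_eq: "x = dt (i + 1) w \<ominus>\<^bsub>Ft i\<^esub> f \<odot>\<^bsub>Ft i\<^esub> v" ..
  have wv: "(w, v) \<in> carrier (obj cone (i + 1))" using w v i by (simp add: cone_mem tr_mem_iff)
  have tw: "thl (i + 1) w \<in> carrier (Ft (i - 1))" by (rule thl_closed[OF w(1)]) simp
  have dv: "dt i v \<in> carrier (Ft (i - 1))" by (rule dt_closed[OF v(1) refl])
  \<comment> \<open>In degree zero the second summand is truncated, so y is zero and so is the value
    of the boundary there.\<close>
  have "(if 2 \<le> i + 1 then thl (i + 1) w \<ominus>\<^bsub>Ft (i - 1)\<^esub> dt i v else \<zero>\<^bsub>Ft (i - 1)\<^esub>) = y"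
  proof (cases "1 \<le> i")
    case True
    have "f \<odot>\<^bsub>Ft (i - 1)\<^esub> y = dt i (dt (i + 1) w) \<ominus>\<^bsub>Ft (i - 1)\<^esub> dt i (f \<odot>\<^bsub>Ft i\<^esub> v)"
      unfolding dx[OF True, symmetric] x_eq by (rule dt_diff[OF dw fv refl])
    also have "\<dots> = f \<odot>\<^bsub>Ft (i - 1)\<^esub> (thl (i + 1) w \<ominus>\<^bsub>Ft (i - 1)\<^esub> dt i v)"
      using dt_dt[OF w(1), of i "i - 1"] dt_smult[OF f_closed v(1) refl] Ft.smult_r_diff[OF f_closed tw dv] by simp
    finally have "y = thl (i + 1) w \<ominus>\<^bsub>Ft (i - 1)\<^esub> dt i v"
      by (rule f_inj[OF tr_mem[OF y] Ft.M.minus_closed[OF tw dv]])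
    then show ?thesis using True by simp
  next
    case False
    then show ?thesis using i y by (simp add: tr_mem_iff)
  qed
  then have "bd cone (i + 1) (w, v) = (x, y)"
    using i x_eq by (simp add: cone_bd[OF wv] split: if_split_asm)
  then show ?thesis using wv by force
qed

lemma restrict_target: "left_module Q (restrict_scalars \<pi> M)"
  by (rule restrict_scalars_module[OF Q.ring_axioms R_ring pi_hom target_module])

text \<open>Only the first summand counts, as the second one is zero in degree zero.\<close>

definition cone_aug :: "'l \<times> 'l \<Rightarrow> 'm" where
  "cone_aug = (\<lambda>p \<in> carrier (obj cone 0). \<epsilon> (rho 0 (fst p)))"

text \<open>A cycle (x, y) has dx = fy, so the reduction of x is a cycle of F, hence a boundary, and
  \<open>cone_exact\<close> applies. In degree zero the augmentation of F plays the part of the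
  boundary. The augmentation of the cone kills boundaries because the multiple of f reduces to
  zero.\<close>

lemma cone_resolution: "resolution Q (restrict_scalars \<pi> M) cone cone_aug"
proof (intro resolution.intro restrict_target)
  note aug = F.augmentation
  have mem0: "x \<in> carrier (Ft 0)" if "(x, y) \<in> carrier (obj cone 0)" for x y
    using that by (auto simp: cone_mem dest: tr_mem)
  show "projective_resolution Q (restrict_scalars \<pi> M) cone cone_aug"
    unfolding projective_resolution_def
  proof (intro conjI allI impI)
    show "projective_module Q (obj cone i)" for i by (rule cone_projective)
    show "carrier (obj cone i) = {\<zero>\<^bsub>obj cone i\<^esub>}" if "i < 0" for i
      using that by (simp add: cone_obj pair_module_simps tr_def zero_part_simps)
    show "bd cone i \<in> lin_hom Q (obj cone i) (obj cone (i - 1))" for i by (rule cone_bd_lin)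
    show "{p \<in> carrier (obj cone i). bd cone i p = \<zero>\<^bsub>obj cone (i - 1)\<^esub>} = bd cone (i + 1) ` carrier (obj cone (i + 1))"
      if i: "0 < i" for i
    proof (intro equalityI subsetI)
      fix p assume "p \<in> {p \<in> carrier (obj cone i). bd cone i p = \<zero>\<^bsub>obj cone (i - 1)\<^esub>}"
      then have p: "p \<in> carrier (obj cone i)" and bp: "bd cone i p = \<zero>\<^bsub>obj cone (i - 1)\<^esub>" by auto
      obtain x y where xy: "p = (x, y)" by (cases p)
      have x: "x \<in> carrier (Ft i)" and y: "y \<in> carrier (tr (i - 1))"
        using p unfolding xy by (auto simp: cone_mem dest: tr_mem)
      have fy: "f \<odot>\<^bsub>Ft (i - 1)\<^esub> y \<in> carrier (Ft (i - 1))" by (rule Ft.smult_closed[OF f_closed tr_mem[OF y]])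
      have dx: "dt i x \<in> carrier (Ft (i - 1))" by (rule dt_closed[OF x refl])
      have "dt i x \<ominus>\<^bsub>Ft (i - 1)\<^esub> f \<odot>\<^bsub>Ft (i - 1)\<^esub> y = \<zero>\<^bsub>Ft (i - 1)\<^esub>"
        using bp p i unfolding xy by (simp add: cone_bd cone_ops)
      then have eq: "dt i x = f \<odot>\<^bsub>Ft (i - 1)\<^esub> y" using dx fy by (simp add: Ft.M.diff_eq_zero_iff)
      have "bd F i (rho i x) = \<zero>\<^bsub>obj F (i - 1)\<^esub>"
        using rho_dt[OF x refl] rho_f[OF tr_mem[OF y]] by (simp add: eq)
      then have "rho i x \<in> bd F (i + 1) ` carrier (obj F (i + 1))"
        by (rule F.exact[OF i rho_closed[OF x refl] refl _ refl])
      then show "p \<in> bd cone (i + 1) ` carrier (obj cone (i + 1))"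
        unfolding xy by (intro cone_exact x y) (use i eq in auto)
    next
      fix p assume "p \<in> bd cone (i + 1) ` carrier (obj cone (i + 1))"
      then obtain q where q: "q \<in> carrier (obj cone (i + 1))" "p = bd cone (i + 1) q" by blast
      have "bd cone i p = \<zero>\<^bsub>obj cone (i - 1)\<^esub>" using cone_bd_bd[OF q(1)] i q(2) by simp
      moreover have "p \<in> carrier (obj cone i)" using lin_hom_closed[OF cone_bd_lin q(1)] q(2) by simp
      ultimately show "p \<in> {p \<in> carrier (obj cone i). bd cone i p = \<zero>\<^bsub>obj cone (i - 1)\<^esub>}" by simp
    qed
    show "cone_aug \<in> lin_hom Q (obj cone 0) (restrict_scalars \<pi> M)"
      unfolding cone_aug_def
    proof (rule lin_homI[OF _ _ _ cone_module])
      fix p assume p: "p \<in> carrier (obj cone 0)"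
      obtain x y where xy: "p = (x, y)" by (cases p)
      have x: "x \<in> carrier (Ft 0)" using p mem0 unfolding xy by blast
      show "\<epsilon> (rho 0 (fst p)) \<in> carrier (restrict_scalars \<pi> M)"
        unfolding xy using lin_hom_closed[OF aug rho_closed[OF x refl]] by (simp add: restrict_scalars_simps)
      show "\<epsilon> (rho 0 (fst (p \<oplus>\<^bsub>obj cone 0\<^esub> q))) = \<epsilon> (rho 0 (fst p)) \<oplus>\<^bsub>restrict_scalars \<pi> M\<^esub> \<epsilon> (rho 0 (fst q))"
        if q: "q \<in> carrier (obj cone 0)" for q
      proof -
        obtain x' y' where xy': "q = (x', y')" by (cases q)
        have x': "x' \<in> carrier (Ft 0)" using q mem0 unfolding xy' by blast
        show ?thesis unfolding xy xy'
          using x x' lin_hom_add[OF aug rho_closed[OF x refl] rho_closed[OF x' refl]]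
          by (simp add: cone_ops restrict_scalars_simps rho_add)
      qed
      show "\<epsilon> (rho 0 (fst (a \<odot>\<^bsub>obj cone 0\<^esub> p))) = a \<odot>\<^bsub>restrict_scalars \<pi> M\<^esub> \<epsilon> (rho 0 (fst p))"
        if a: "a \<in> carrier Q" for a
        unfolding xy using x a lin_hom_smult[OF aug pi.hom_closed[OF a] rho_closed[OF x refl]]
        by (simp add: cone_ops restrict_scalars_simps rho_smult)
    qed
    show "cone_aug ` carrier (obj cone 0) = carrier (restrict_scalars \<pi> M)"
    proof (intro equalityI subsetI)
      fix m assume "m \<in> cone_aug ` carrier (obj cone 0)"
      then obtain x y where "(x, y) \<in> carrier (obj cone 0)" "m = \<epsilon> (rho 0 x)"
        by (auto simp: cone_aug_def)
      then show "m \<in> carrier (restrict_scalars \<pi> M)"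
        using lin_hom_closed[OF aug rho_closed[OF mem0 refl]] by (simp add: restrict_scalars_simps)
    next
      fix m assume "m \<in> carrier (restrict_scalars \<pi> M)"
      then have "m \<in> \<epsilon> ` carrier (obj F 0)" by (intro F.augmentation_surj) (simp add: restrict_scalars_simps)
      then obtain z where z: "z \<in> carrier (obj F 0)" "m = \<epsilon> z" by blast
      then obtain x where x: "x \<in> carrier (Ft 0)" "rho 0 x = z" using rho_surj by blast
      have "(x, \<zero>\<^bsub>Ft (- 1)\<^esub>) \<in> carrier (obj cone 0)" using x by (simp add: cone_mem tr_mem_iff)
      then show "m \<in> cone_aug ` carrier (obj cone 0)"
        using x z by (intro image_eqI[of _ _ "(x, \<zero>\<^bsub>Ft (- 1)\<^esub>)"]) (simp_all add: cone_aug_def)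
    qed
    show "{p \<in> carrier (obj cone 0). cone_aug p = \<zero>\<^bsub>restrict_scalars \<pi> M\<^esub>} = bd cone 1 ` carrier (obj cone 1)"
    proof (intro equalityI subsetI)
      fix p assume p: "p \<in> {p \<in> carrier (obj cone 0). cone_aug p = \<zero>\<^bsub>restrict_scalars \<pi> M\<^esub>}"
      obtain x y where xy: "p = (x, y)" by (cases p)
      have x: "x \<in> carrier (Ft 0)" and y: "y \<in> carrier (tr (0 - 1))" and ex: "\<epsilon> (rho 0 x) = \<zero>\<^bsub>M\<^esub>"
        using p unfolding xy by (auto simp: cone_mem cone_aug_def restrict_scalars_simps dest: tr_mem)
      have "rho 0 x \<in> bd F (0 + 1) ` carrier (obj F (0 + 1))"
        using F.augmentation_exact[OF rho_closed[OF x refl] ex] by simp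
      then have "(x, y) \<in> bd cone (0 + 1) ` carrier (obj cone (0 + 1))"
        by (intro cone_exact x y) auto
      then show "p \<in> bd cone 1 ` carrier (obj cone 1)" unfolding xy by simp
    next
      fix p assume "p \<in> bd cone 1 ` carrier (obj cone 1)"
      then obtain q where q: "q \<in> carrier (obj cone 1)" "p = bd cone 1 q" by blast
      have pc: "p \<in> carrier (obj cone 0)" using lin_hom_closed[OF cone_bd_lin q(1)] q(2) by simp
      obtain x y where xy: "q = (x, y)" by (cases q)
      have x: "x \<in> carrier (Ft 1)" and y: "y \<in> carrier (Ft 0)"
        using q(1) unfolding xy by (auto simp: cone_mem dest: tr_mem)
      have dx: "dt 1 x \<in> carrier (Ft 0)" by (rule dt_closed[OF x]) simp
      have fy: "f \<odot>\<^bsub>Ft 0\<^esub> y \<in> carrier (Ft 0)" by (rule Ft.smult_closed[OF f_closed y])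
      have "rho 0 (fst p) = bd F 1 (rho 1 x)"
        using cone_bd[OF q(1)[unfolded xy]] q(2) rho_dt[OF x, of 0] rho_closed[OF dx refl] dx fy unfolding xy
        by (simp add: rho_diff rho_f[OF y] F.obj.M.diff_zero)
      then have "cone_aug p = \<zero>\<^bsub>M\<^esub>"
        using pc F.augmentation_bd[OF rho_closed[OF x refl]] by (simp add: cone_aug_def)
      then show "p \<in> {p \<in> carrier (obj cone 0). cone_aug p = \<zero>\<^bsub>restrict_scalars \<pi> M\<^esub>}"
        using pc by (simp add: restrict_scalars_simps)
    qed
  qed
qed

end

section \<open>A stable inverse of \<theta> from a contraction of the cone\<close>

context lifted
begin

text \<open>\<open>a\<close>, \<open>p\<close> and \<open>b\<close> are entries of a contraction of the cone, written as a matrix. The multiples of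
  \<open>f\<close> vanish over \<open>R\<close>, where the three equations make \<open>a\<close> and \<open>b\<close> homotopies and \<open>p\<close> a stable cocycle
  inverse to \<open>\<theta>\<close>.\<close>

lemma cone_contraction_components:
  assumes res: "projective_resolution Q (restrict_scalars \<pi> M) T \<eta>"
    and fin: "\<forall>i>N. carrier (obj T i) = {\<zero>\<^bsub>obj T i\<^esub>}"
  shows "\<exists>a p b k. (\<forall>i. a i \<in> lin_hom Q (Ft i) (Ft (i + 1)) \<and> p i \<in> lin_hom Q (Ft i) (Ft (i + 2)) \<and>
      b i \<in> lin_hom Q (Ft i) (Ft (i + 1))) \<and>
    (\<forall>i>k. \<forall>x \<in> carrier (Ft i). \<exists>c \<in> carrier (Ft i). \<exists>d \<in> carrier (Ft (i + 1)). \<exists>e \<in> carrier (Ft i).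
      (dt (i + 1) (a i x) \<ominus>\<^bsub>Ft i\<^esub> f \<odot>\<^bsub>Ft i\<^esub> c) \<oplus>\<^bsub>Ft i\<^esub> (a (i - 1) (dt i x) \<oplus>\<^bsub>Ft i\<^esub> p (i - 2) (thl i x)) = x \<and>
      dt (i + 2) (p i x) = f \<odot>\<^bsub>Ft (i + 1)\<^esub> d \<oplus>\<^bsub>Ft (i + 1)\<^esub> p (i - 1) (dt i x) \<and>
      thl (i + 2) (p i x) = (dt (i + 1) (b i x) \<oplus>\<^bsub>Ft i\<^esub> (f \<odot>\<^bsub>Ft i\<^esub> e \<oplus>\<^bsub>Ft i\<^esub> b (i - 1) (dt i x))) \<oplus>\<^bsub>Ft i\<^esub> x)"
proof -
  have T: "resolution Q (restrict_scalars \<pi> M) T \<eta>" by (intro resolution.intro res restrict_target)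
  obtain h where hl: "\<And>i. h i \<in> lin_hom Q (obj cone i) (obj cone (i + 1))"
    and hh: "\<And>i x. max 0 N < i \<Longrightarrow> x \<in> carrier (obj cone i) \<Longrightarrow>
      bd cone (i + 1) (h i x) \<oplus>\<^bsub>obj cone i\<^esub> h (i - 1) (bd cone i x) = x"
    using finite_resolution_contraction[OF cone_resolution T] fin by blast
  let ?z = "\<lambda>i. \<zero>\<^bsub>Ft i\<^esub>"
  have mem: "(x, y) \<in> carrier (obj cone i) \<longleftrightarrow> x \<in> carrier (Ft i) \<and> y \<in> carrier (Ft (i - 1))" if "1 \<le> i" for i x y
    using that by (simp add: cone_mem tr_mem_iff)
  have hc: "fst (h i (x, y)) \<in> carrier (Ft (i + 1)) \<and> snd (h i (x, y)) \<in> carrier (Ft i)"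
    if "1 \<le> i" "x \<in> carrier (Ft i)" "y \<in> carrier (Ft (i - 1))" for i x y
    using lin_hom_closed[OF hl, of "(x, y)" i] that mem[of i x y] mem[of "i + 1" "fst (h i (x, y))" "snd (h i (x, y))"] by simp
  have ha: "h i (x \<oplus>\<^bsub>Ft i\<^esub> x', y \<oplus>\<^bsub>Ft (i - 1)\<^esub> y') =
      (fst (h i (x, y)) \<oplus>\<^bsub>Ft (i + 1)\<^esub> fst (h i (x', y')), snd (h i (x, y)) \<oplus>\<^bsub>Ft i\<^esub> snd (h i (x', y')))"
    if "1 \<le> i" "x \<in> carrier (Ft i)" "x' \<in> carrier (Ft i)" "y \<in> carrier (Ft (i - 1))" "y' \<in> carrier (Ft (i - 1))" for i x x' y y'
    using lin_hom_add[OF hl, of "(x, y)" i "(x', y')"] that mem cone_ops(2)[where i = i and x = x and y = y and x' = x' and y' = y']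
      cone_ops(2)[where i = "i + 1" and x = "fst (h i (x, y))" and y = "snd (h i (x, y))"
        and x' = "fst (h i (x', y'))" and y' = "snd (h i (x', y'))"] by simp
  have hs: "h i (q \<odot>\<^bsub>Ft i\<^esub> x, q \<odot>\<^bsub>Ft (i - 1)\<^esub> y) = (q \<odot>\<^bsub>Ft (i + 1)\<^esub> fst (h i (x, y)), q \<odot>\<^bsub>Ft i\<^esub> snd (h i (x, y)))"
    if "1 \<le> i" "q \<in> carrier Q" "x \<in> carrier (Ft i)" "y \<in> carrier (Ft (i - 1))" for i q x y
    using lin_hom_smult[OF hl, of q "(x, y)" i] that mem cone_ops(3)[where i = i and x = x and y = y and a = q]
      cone_ops(3)[where i = "i + 1" and a = q and x = "fst (h i (x, y))" and y = "snd (h i (x, y))"] by simp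
  \<comment> \<open>Entries of the matrix of the contraction h. The second column is taken in degree
    i + 1, so that all three maps start at Ft i. Below degree 1 they are set to zero, away from the
    truncation of the cone.\<close>
  define a where "a i = (\<lambda>x \<in> carrier (Ft i). if 1 \<le> i then fst (h i (x, ?z (i - 1))) else ?z (i + 1))" for i
  define p where "p i = (\<lambda>x \<in> carrier (Ft i). if 1 \<le> i then fst (h (i + 1) (?z (i + 1), x)) else ?z (i + 2))" for i
  define b where "b i = (\<lambda>x \<in> carrier (Ft i). if 1 \<le> i then snd (h (i + 1) (?z (i + 1), x)) else ?z (i + 1))" for i
  have al: "a i \<in> lin_hom Q (Ft i) (Ft (i + 1))" for i
    unfolding a_def
  proof (rule lin_homI[OF _ _ _ Ft_module])
    fix x assume x: "x \<in> carrier (Ft i)"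
    show "(if 1 \<le> i then fst (h i (x, ?z (i - 1))) else ?z (i + 1)) \<in> carrier (Ft (i + 1))"
      using hc x by simp
    show "(if 1 \<le> i then fst (h i (x \<oplus>\<^bsub>Ft i\<^esub> y, ?z (i - 1))) else ?z (i + 1)) =
      (if 1 \<le> i then fst (h i (x, ?z (i - 1))) else ?z (i + 1)) \<oplus>\<^bsub>Ft (i + 1)\<^esub>
      (if 1 \<le> i then fst (h i (y, ?z (i - 1))) else ?z (i + 1))" if "y \<in> carrier (Ft i)" for y
      using ha[of i x y "?z (i - 1)" "?z (i - 1)"] x that by simp
    show "(if 1 \<le> i then fst (h i (q \<odot>\<^bsub>Ft i\<^esub> x, ?z (i - 1))) else ?z (i + 1)) =
      q \<odot>\<^bsub>Ft (i + 1)\<^esub> (if 1 \<le> i then fst (h i (x, ?z (i - 1))) else ?z (i + 1))" if "q \<in> carrier Q" for q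
      using hs[of i q x "?z (i - 1)"] x that by (simp add: Ft.smult_r_null)
  qed
  have pb: "p i \<in> lin_hom Q (Ft i) (Ft (i + 2)) \<and> b i \<in> lin_hom Q (Ft i) (Ft (i + 1))" for i
  proof (cases "1 \<le> i")
    case True
    have e: "i + 1 - 1 = i" "i + 1 + 1 = i + 2" by simp_all
    have c: "fst (h (i + 1) (?z (i + 1), x)) \<in> carrier (Ft (i + 2))" "snd (h (i + 1) (?z (i + 1), x)) \<in> carrier (Ft (i + 1))"
      if "x \<in> carrier (Ft i)" for x
      using hc[of "i + 1" "?z (i + 1)" x] that True unfolding e by simp_all
    have "h (i + 1) (?z (i + 1), x \<oplus>\<^bsub>Ft i\<^esub> y) = (fst (h (i + 1) (?z (i + 1), x)) \<oplus>\<^bsub>Ft (i + 2)\<^esub> fst (h (i + 1) (?z (i + 1), y)),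
        snd (h (i + 1) (?z (i + 1), x)) \<oplus>\<^bsub>Ft (i + 1)\<^esub> snd (h (i + 1) (?z (i + 1), y)))"
      if "x \<in> carrier (Ft i)" "y \<in> carrier (Ft i)" for x y
      using ha[of "i + 1" "?z (i + 1)" "?z (i + 1)" x y] that True unfolding e by simp
    moreover have "h (i + 1) (?z (i + 1), q \<odot>\<^bsub>Ft i\<^esub> x) = (q \<odot>\<^bsub>Ft (i + 2)\<^esub> fst (h (i + 1) (?z (i + 1), x)),
        q \<odot>\<^bsub>Ft (i + 1)\<^esub> snd (h (i + 1) (?z (i + 1), x)))"
      if "q \<in> carrier Q" "x \<in> carrier (Ft i)" for q x
      using hs[of "i + 1" q "?z (i + 1)" x] that True unfolding e by (simp add: Ft.smult_r_null)
    ultimately show ?thesis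
      unfolding p_def b_def using True c by (intro conjI lin_homI Ft_module) simp_all
  next
    case False
    then show ?thesis
      using lin_hom_const_zero[OF Ft_module Ft_module] by (simp add: p_def b_def)
  qed
  have main: "\<exists>c \<in> carrier (Ft i). \<exists>d \<in> carrier (Ft (i + 1)). \<exists>e \<in> carrier (Ft i).
      (dt (i + 1) (a i x) \<ominus>\<^bsub>Ft i\<^esub> f \<odot>\<^bsub>Ft i\<^esub> c) \<oplus>\<^bsub>Ft i\<^esub> (a (i - 1) (dt i x) \<oplus>\<^bsub>Ft i\<^esub> p (i - 2) (thl i x)) = x \<and>
      dt (i + 2) (p i x) = f \<odot>\<^bsub>Ft (i + 1)\<^esub> d \<oplus>\<^bsub>Ft (i + 1)\<^esub> p (i - 1) (dt i x) \<and>
      thl (i + 2) (p i x) = (dt (i + 1) (b i x) \<oplus>\<^bsub>Ft i\<^esub> (f \<odot>\<^bsub>Ft i\<^esub> e \<oplus>\<^bsub>Ft i\<^esub> b (i - 1) (dt i x))) \<oplus>\<^bsub>Ft i\<^esub> x"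
    if i: "max 0 N + 3 < i" and x: "x \<in> carrier (Ft i)" for i x
  proof -
    \<comment> \<open>The margin of 3 ensures that the maps at i - 1 and i - 2 which occur in the
      equations are true entries of h and not the zero defaults.\<close>
    have i1: "1 \<le> i" "1 \<le> i - 1" "1 \<le> i - 2" "1 \<le> i + 1" "2 \<le> i" "2 \<le> i + 1" "2 \<le> i + 2" "1 \<le> i + 2" using i by simp_all
    have dx: "dt i x \<in> carrier (Ft (i - 1))" by (rule dt_closed[OF x refl])
    have tx: "thl i x \<in> carrier (Ft (i - 2))" by (rule thl_closed[OF x refl])
    have e: "i + 1 - 1 = i" "i + 1 - 2 = i - 1" "i - 1 - 1 = i - 2" "i - 1 + 1 = i" "i + 2 - 1 = i + 1" "i + 2 - 2 = i"
      "i - 2 + 1 = i - 1" "i + 1 + 1 = i + 2" by simp_all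
    have hcx: "fst (h i (x, ?z (i - 1))) \<in> carrier (Ft (i + 1))" "snd (h i (x, ?z (i - 1))) \<in> carrier (Ft i)"
      using hc[OF i1(1) x, of "?z (i - 1)"] by simp_all
    let ?c = "snd (h i (x, ?z (i - 1)))"
    have ax: "a i x = fst (h i (x, ?z (i - 1)))" using x i1 by (simp add: a_def)
    \<comment> \<open>First component of Dh + hD = 1 at (x, 0), with D the boundary of the cone and
      D(x, 0) = (dx, \<theta>x); the second coordinate \<theta>x, of degree i - 2, enters through
      p.\<close>
    have one: "(dt (i + 1) (a i x) \<ominus>\<^bsub>Ft i\<^esub> f \<odot>\<^bsub>Ft i\<^esub> ?c) \<oplus>\<^bsub>Ft i\<^esub> (a (i - 1) (dt i x) \<oplus>\<^bsub>Ft i\<^esub> p (i - 2) (thl i x)) = x"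
    proof -
      have m: "(x, ?z (i - 1)) \<in> carrier (obj cone i)" using x i1 by (simp add: mem)
      have m': "(fst (h i (x, ?z (i - 1))), ?c) \<in> carrier (obj cone (i + 1))" unfolding mem[OF i1(4)] e using hcx by (intro conjI)
      have b1: "bd cone i (x, ?z (i - 1)) = (dt i x, thl i x)"
        using dx tx i1 lin_hom_zero[OF dt_lin[of "i - 2" "i - 1"] Ft_group Ft_group]
        by (simp add: cone_bd[OF m] Ft.smult_r_null f_closed Ft.M.diff_zero)
      have "h (i - 1) (dt i x, thl i x) = (a (i - 1) (dt i x) \<oplus>\<^bsub>Ft i\<^esub> p (i - 2) (thl i x),
          snd (h (i - 1) (dt i x, ?z (i - 2))) \<oplus>\<^bsub>Ft (i - 1)\<^esub> snd (h (i - 1) (?z (i - 1), thl i x)))"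
        using ha[of "i - 1" "dt i x" "?z (i - 1)" "?z (i - 2)" "thl i x"] dx tx i1 unfolding e
        by (simp add: a_def p_def e)
      moreover have "bd cone (i + 1) (h i (x, ?z (i - 1))) =
          (dt (i + 1) (a i x) \<ominus>\<^bsub>Ft i\<^esub> f \<odot>\<^bsub>Ft i\<^esub> ?c, thl (i + 1) (a i x) \<ominus>\<^bsub>Ft (i - 1)\<^esub> dt i ?c)"
        using cone_bd[OF m'] i1 unfolding e ax by simp
      moreover have "bd cone (i + 1) (h i (x, ?z (i - 1))) \<oplus>\<^bsub>obj cone i\<^esub> h (i - 1) (bd cone i (x, ?z (i - 1))) = (x, ?z (i - 1))"
        by (rule hh[OF _ m]) (use i in linarith)
      ultimately show ?thesis unfolding b1 by (simp add: cone_ops)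
    qed
    let ?p = "p i x" and ?b = "b i x"
    have e2: "i - 1 + 2 = i + 1" by simp
    have px: "?p \<in> carrier (Ft (i + 2))" and bx: "?b \<in> carrier (Ft (i + 1))"
      using lin_hom_closed[OF pb[THEN conjunct1] x] lin_hom_closed[OF pb[THEN conjunct2] x] .
    have hx: "h (i + 1) (?z (i + 1), x) = (?p, ?b)" using x i1 by (simp add: p_def b_def)
    have m: "(?z (i + 1), x) \<in> carrier (obj cone (i + 1))" using x i1 by (simp add: mem e)
    have m': "(?p, ?b) \<in> carrier (obj cone (i + 2))" using px bx i1 by (simp add: mem e)
    have fx: "f \<odot>\<^bsub>Ft i\<^esub> x \<in> carrier (Ft i)" by (rule Ft.smult_closed[OF f_closed x])
    let ?A = "a i x" and ?P = "p (i - 1) (dt i x)" and ?B = "b (i - 1) (dt i x)"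
    have Ac: "?A \<in> carrier (Ft (i + 1))" using hcx ax by simp
    have Pc: "?P \<in> carrier (Ft (i + 1))" and Bc: "?B \<in> carrier (Ft i)"
      using lin_hom_closed[OF pb[THEN conjunct1] dx] lin_hom_closed[OF pb[THEN conjunct2] dx] unfolding e e2 .
    have b1: "bd cone (i + 1) (?z (i + 1), x) = (\<ominus>\<^bsub>Ft i\<^esub> (f \<odot>\<^bsub>Ft i\<^esub> x), \<ominus>\<^bsub>Ft (i - 1)\<^esub> dt i x)"
      using cone_bd[OF m] i1 fx dx lin_hom_zero[OF dt_lin[of i "i + 1"] Ft_group Ft_group]
        lin_hom_zero[OF thl_lin[of "i - 1" "i + 1"] Ft_group Ft_group] unfolding e
      by (simp add: Ft.M.minus_eq)
    have hf: "h i (f \<odot>\<^bsub>Ft i\<^esub> x, dt i x) = (f \<odot>\<^bsub>Ft (i + 1)\<^esub> ?A \<oplus>\<^bsub>Ft (i + 1)\<^esub> ?P, f \<odot>\<^bsub>Ft i\<^esub> ?c \<oplus>\<^bsub>Ft i\<^esub> ?B)"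
    proof -
      have "h i (f \<odot>\<^bsub>Ft i\<^esub> x, ?z (i - 1)) = (f \<odot>\<^bsub>Ft (i + 1)\<^esub> ?A, f \<odot>\<^bsub>Ft i\<^esub> ?c)"
        using hs[OF i1(1) f_closed x, of "?z (i - 1)"] by (simp add: Ft.smult_r_null f_closed ax)
      moreover have "h i (?z i, dt i x) = (?P, ?B)" using dx i1 by (simp add: p_def b_def e)
      ultimately show ?thesis using ha[OF i1(1) fx _ _ dx, of "?z i" "?z (i - 1)"] fx dx by simp
    qed
    have hneg: "h i (\<ominus>\<^bsub>Ft i\<^esub> (f \<odot>\<^bsub>Ft i\<^esub> x), \<ominus>\<^bsub>Ft (i - 1)\<^esub> dt i x) =
      (\<ominus>\<^bsub>Ft (i + 1)\<^esub> (f \<odot>\<^bsub>Ft (i + 1)\<^esub> ?A \<oplus>\<^bsub>Ft (i + 1)\<^esub> ?P), \<ominus>\<^bsub>Ft i\<^esub> (f \<odot>\<^bsub>Ft i\<^esub> ?c \<oplus>\<^bsub>Ft i\<^esub> ?B))"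
      (is "?l = _")
    proof -
      have lc: "fst ?l \<in> carrier (Ft (i + 1))" "snd ?l \<in> carrier (Ft i)"
        using hc[OF i1(1), of "\<ominus>\<^bsub>Ft i\<^esub> (f \<odot>\<^bsub>Ft i\<^esub> x)" "\<ominus>\<^bsub>Ft (i - 1)\<^esub> dt i x"] fx dx by simp_all
      have "h i (?z i, ?z (i - 1)) = (?z (i + 1), ?z i)"
        using lin_hom_zero[OF hl[of i]] left_module_abelian_group[OF cone_module] by (simp add: cone_ops e)
      then have "(fst ?l \<oplus>\<^bsub>Ft (i + 1)\<^esub> (f \<odot>\<^bsub>Ft (i + 1)\<^esub> ?A \<oplus>\<^bsub>Ft (i + 1)\<^esub> ?P), snd ?l \<oplus>\<^bsub>Ft i\<^esub> (f \<odot>\<^bsub>Ft i\<^esub> ?c \<oplus>\<^bsub>Ft i\<^esub> ?B)) = (?z (i + 1), ?z i)"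
        using ha[OF i1(1) Ft.M.a_inv_closed[OF fx] fx Ft.M.a_inv_closed[OF dx] dx] fx dx
        by (simp add: hf Ft.M.l_neg)
      moreover have "f \<odot>\<^bsub>Ft (i + 1)\<^esub> ?A \<oplus>\<^bsub>Ft (i + 1)\<^esub> ?P \<in> carrier (Ft (i + 1))" "f \<odot>\<^bsub>Ft i\<^esub> ?c \<oplus>\<^bsub>Ft i\<^esub> ?B \<in> carrier (Ft i)"
        using Ac Pc Bc hcx f_closed by (simp_all add: Ft.smult_closed)
      ultimately have "\<ominus>\<^bsub>Ft (i + 1)\<^esub> (f \<odot>\<^bsub>Ft (i + 1)\<^esub> ?A \<oplus>\<^bsub>Ft (i + 1)\<^esub> ?P) = fst ?l" "\<ominus>\<^bsub>Ft i\<^esub> (f \<odot>\<^bsub>Ft i\<^esub> ?c \<oplus>\<^bsub>Ft i\<^esub> ?B) = snd ?l"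
        using lc by (auto intro!: Ft.M.minus_equality)
      then show ?thesis by (metis prod.collapse)
    qed
    have fA: "f \<odot>\<^bsub>Ft (i + 1)\<^esub> ?A \<in> carrier (Ft (i + 1))" "f \<odot>\<^bsub>Ft i\<^esub> ?c \<in> carrier (Ft i)" "f \<odot>\<^bsub>Ft (i + 1)\<^esub> ?b \<in> carrier (Ft (i + 1))"
      using Ac hcx bx f_closed by (simp_all add: Ft.smult_closed)
    have dp: "dt (i + 2) ?p \<in> carrier (Ft (i + 1))" "dt (i + 1) ?b \<in> carrier (Ft i)" "thl (i + 2) ?p \<in> carrier (Ft i)"
      using px bx by (auto intro: dt_closed thl_closed)
    have "bd cone (i + 2) (?p, ?b) = (dt (i + 2) ?p \<ominus>\<^bsub>Ft (i + 1)\<^esub> f \<odot>\<^bsub>Ft (i + 1)\<^esub> ?b, thl (i + 2) ?p \<ominus>\<^bsub>Ft i\<^esub> dt (i + 1) ?b)"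
      using cone_bd[OF m'] i1 unfolding e by simp
    moreover have "bd cone (i + 1 + 1) (h (i + 1) (?z (i + 1), x)) \<oplus>\<^bsub>obj cone (i + 1)\<^esub> h (i + 1 - 1) (bd cone (i + 1) (?z (i + 1), x)) = (?z (i + 1), x)"
      by (rule hh[OF _ m]) (use i in linarith)
    \<comment> \<open>Both components of Dh + hD = 1 at (0, x) in degree i + 1, where D(0, x) =
      (-fx, -dx).\<close>
    ultimately have eqs: "(dt (i + 2) ?p \<ominus>\<^bsub>Ft (i + 1)\<^esub> f \<odot>\<^bsub>Ft (i + 1)\<^esub> ?b) \<oplus>\<^bsub>Ft (i + 1)\<^esub>
        \<ominus>\<^bsub>Ft (i + 1)\<^esub> (f \<odot>\<^bsub>Ft (i + 1)\<^esub> ?A \<oplus>\<^bsub>Ft (i + 1)\<^esub> ?P) = ?z (i + 1)"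
      "(thl (i + 2) ?p \<ominus>\<^bsub>Ft i\<^esub> dt (i + 1) ?b) \<oplus>\<^bsub>Ft i\<^esub> \<ominus>\<^bsub>Ft i\<^esub> (f \<odot>\<^bsub>Ft i\<^esub> ?c \<oplus>\<^bsub>Ft i\<^esub> ?B) = x"
      unfolding e hx b1 hneg by (simp_all add: cone_ops e)
    have two: "dt (i + 2) ?p = f \<odot>\<^bsub>Ft (i + 1)\<^esub> (?b \<oplus>\<^bsub>Ft (i + 1)\<^esub> ?A) \<oplus>\<^bsub>Ft (i + 1)\<^esub> ?P"
    proof -
      have "dt (i + 2) ?p \<ominus>\<^bsub>Ft (i + 1)\<^esub> f \<odot>\<^bsub>Ft (i + 1)\<^esub> ?b = f \<odot>\<^bsub>Ft (i + 1)\<^esub> ?A \<oplus>\<^bsub>Ft (i + 1)\<^esub> ?P"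
        using eqs(1) dp fA Pc by (simp add: Ft.M.minus_eq[symmetric] Ft.M.diff_eq_zero_iff)
      then have "(dt (i + 2) ?p \<ominus>\<^bsub>Ft (i + 1)\<^esub> f \<odot>\<^bsub>Ft (i + 1)\<^esub> ?b) \<oplus>\<^bsub>Ft (i + 1)\<^esub> f \<odot>\<^bsub>Ft (i + 1)\<^esub> ?b =
          (f \<odot>\<^bsub>Ft (i + 1)\<^esub> ?A \<oplus>\<^bsub>Ft (i + 1)\<^esub> ?P) \<oplus>\<^bsub>Ft (i + 1)\<^esub> f \<odot>\<^bsub>Ft (i + 1)\<^esub> ?b" by simp
      then have "dt (i + 2) ?p = (f \<odot>\<^bsub>Ft (i + 1)\<^esub> ?A \<oplus>\<^bsub>Ft (i + 1)\<^esub> ?P) \<oplus>\<^bsub>Ft (i + 1)\<^esub> f \<odot>\<^bsub>Ft (i + 1)\<^esub> ?b"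
        by (simp only: Ft.M.diff_add_cancel_right[OF dp(1) fA(3)])
      then show ?thesis
        using fA Pc by (simp add: Ft.smult_r_distr[OF f_closed bx Ac] Ft.M.a_ac)
    qed
    have three: "thl (i + 2) ?p = (dt (i + 1) ?b \<oplus>\<^bsub>Ft i\<^esub> (f \<odot>\<^bsub>Ft i\<^esub> ?c \<oplus>\<^bsub>Ft i\<^esub> ?B)) \<oplus>\<^bsub>Ft i\<^esub> x"
    proof -
      let ?u = "f \<odot>\<^bsub>Ft i\<^esub> ?c \<oplus>\<^bsub>Ft i\<^esub> ?B"
      have u: "?u \<in> carrier (Ft i)" using fA Bc by simp
      have "(dt (i + 1) ?b \<oplus>\<^bsub>Ft i\<^esub> ?u) \<oplus>\<^bsub>Ft i\<^esub> x =
          (dt (i + 1) ?b \<oplus>\<^bsub>Ft i\<^esub> ?u) \<oplus>\<^bsub>Ft i\<^esub> ((thl (i + 2) ?p \<ominus>\<^bsub>Ft i\<^esub> dt (i + 1) ?b) \<oplus>\<^bsub>Ft i\<^esub> \<ominus>\<^bsub>Ft i\<^esub> ?u)"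
        by (simp only: eqs(2))
      also have "\<dots> = ((thl (i + 2) ?p \<ominus>\<^bsub>Ft i\<^esub> dt (i + 1) ?b) \<oplus>\<^bsub>Ft i\<^esub> dt (i + 1) ?b) \<oplus>\<^bsub>Ft i\<^esub> (?u \<oplus>\<^bsub>Ft i\<^esub> \<ominus>\<^bsub>Ft i\<^esub> ?u)"
        using dp u Ft.M.minus_closed[OF dp(3) dp(2)] Ft.M.a_inv_closed[OF u]
        by (simp only: Ft.M.a_ac Ft.M.a_closed)
      also have "\<dots> = thl (i + 2) ?p"
        using dp u by (simp add: Ft.M.diff_add_cancel_right Ft.M.r_neg)
      finally show ?thesis ..
    qed
    \<comment> \<open>The lower left entry of h is the factor of f in the first and the third
      equation; in the second it is the sum of the diagonal entries b and a.\<close>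
    show ?thesis
      by (intro bexI[of _ ?c] bexI[of _ "?b \<oplus>\<^bsub>Ft (i + 1)\<^esub> ?A"] conjI one two three) (use hcx bx Ac in simp_all)
  qed
  show ?thesis
    by (intro exI[of _ a] exI[of _ p] exI[of _ b] exI[of _ "max 0 N + 3"] conjI allI impI ballI al main)
      (use pb in blast)+
qed

text \<open>After reduction the equations read 1 = (dA + Ad) + \<psi>\<theta>, d\<psi> = \<psi>d and
  \<theta>\<psi> = (dB + Bd) + 1 above some degree. The first column of the contraction gives the
  left inverse and the second one the right inverse, with the same \<psi>.\<close>

lemma theta_stable_unit:
  assumes res: "projective_resolution Q (restrict_scalars \<pi> M) T \<eta>"
    and fin: "\<forall>i>N. carrier (obj T i) = {\<zero>\<^bsub>obj T i\<^esub>}"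
  shows "\<exists>\<psi> \<in> stable_Z R F F (- 2).
    stable_ext_mult R F F (- 2) 2 (stable_cl R F F (- 2) \<psi>) (stable_cl R F F 2 th) = stable_cl R F F 0 (hom_ident F) \<and>
    stable_ext_mult R F F 2 (- 2) (stable_cl R F F 2 th) (stable_cl R F F (- 2) \<psi>) = stable_cl R F F 0 (hom_ident F)"
proof -
  interpret P: hom_pair R M F \<epsilon> M F \<epsilon> by (intro hom_pair.intro F_resolution)
  interpret T: hom_triple R M F \<epsilon> M F \<epsilon> M F \<epsilon> by (intro hom_tripleI F_resolution)
  obtain a p b k where al: "\<And>i. a i \<in> lin_hom Q (Ft i) (Ft (i + 1))" and pl: "\<And>i. p i \<in> lin_hom Q (Ft i) (Ft (i + 2))"
    and bl: "\<And>i. b i \<in> lin_hom Q (Ft i) (Ft (i + 1))"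
    and main: "\<And>i x. k < i \<Longrightarrow> x \<in> carrier (Ft i) \<Longrightarrow> \<exists>c \<in> carrier (Ft i). \<exists>d \<in> carrier (Ft (i + 1)). \<exists>e \<in> carrier (Ft i).
      (dt (i + 1) (a i x) \<ominus>\<^bsub>Ft i\<^esub> f \<odot>\<^bsub>Ft i\<^esub> c) \<oplus>\<^bsub>Ft i\<^esub> (a (i - 1) (dt i x) \<oplus>\<^bsub>Ft i\<^esub> p (i - 2) (thl i x)) = x \<and>
      dt (i + 2) (p i x) = f \<odot>\<^bsub>Ft (i + 1)\<^esub> d \<oplus>\<^bsub>Ft (i + 1)\<^esub> p (i - 1) (dt i x) \<and>
      thl (i + 2) (p i x) = (dt (i + 1) (b i x) \<oplus>\<^bsub>Ft i\<^esub> (f \<odot>\<^bsub>Ft i\<^esub> e \<oplus>\<^bsub>Ft i\<^esub> b (i - 1) (dt i x))) \<oplus>\<^bsub>Ft i\<^esub> x"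
    using cone_contraction_components[OF res fin] by blast
  have desc: "\<exists>\<beta>. \<forall>i. \<beta> i \<in> lin_hom R (obj F i) (obj F (i - n)) \<and> (\<forall>x \<in> carrier (Ft i). \<beta> i (rho i x) = rho (i - n) (u i x))"
    if "\<And>i. u i \<in> lin_hom Q (Ft i) (Ft (i - n))" for u n
    by (rule choice) (use descend[OF that F.obj_module rho_closed[OF _ refl] rho_add rho_smult] in blast)
  have e: "i - - 1 = i + 1" "i - - 2 = i + 2" for i :: int by simp_all
  obtain A where A: "\<And>i. A i \<in> lin_hom R (obj F i) (obj F (i - - 1))"
    "\<And>i x. x \<in> carrier (Ft i) \<Longrightarrow> A i (rho i x) = rho (i + 1) (a i x)"
    using desc[of a "- 1"] al unfolding e by blast
  obtain B where B: "\<And>i. B i \<in> lin_hom R (obj F i) (obj F (i - - 1))"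
    "\<And>i x. x \<in> carrier (Ft i) \<Longrightarrow> B i (rho i x) = rho (i + 1) (b i x)"
    using desc[of b "- 1"] bl unfolding e by blast
  obtain \<psi> where \<psi>: "\<And>i. \<psi> i \<in> lin_hom R (obj F i) (obj F (i - - 2))"
    "\<And>i x. x \<in> carrier (Ft i) \<Longrightarrow> \<psi> i (rho i x) = rho (i + 2) (p i x)"
    using desc[of p "- 2"] pl unfolding e by blast
  have AH: "A \<in> P.H (- 1)" and BH: "B \<in> P.H (- 1)" and \<psi>H: "\<psi> \<in> P.H (- 2)"
    unfolding P.H_iff using A(1) B(1) \<psi>(1) by blast+
  \<comment> \<open>Every y in F i is the reduction of some x, and each of the three equations over
    Q is reduced at x. The homotopies have odd degree -1, so their coboundary carries a plus sign,
    as in the equations of the contraction.\<close>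
  have facts: "y = hom_diff F F (- 1) A i y \<oplus>\<^bsub>obj F i\<^esub> \<psi> (i - 2) (th i y)"
    "hom_diff F F (- 2) \<psi> i y = \<zero>\<^bsub>obj F (i + 1)\<^esub>"
    "th (i + 2) (\<psi> i y) = hom_diff F F (- 1) B i y \<oplus>\<^bsub>obj F i\<^esub> y"
    if i: "k < i" and y: "y \<in> carrier (obj F i)" for i y
  proof -
    obtain x where x: "x \<in> carrier (Ft i)" "y = rho i x" using rho_surj[OF y] by blast
    obtain c d g where c: "c \<in> carrier (Ft i)" and d: "d \<in> carrier (Ft (i + 1))" and g: "g \<in> carrier (Ft i)"
      and one: "(dt (i + 1) (a i x) \<ominus>\<^bsub>Ft i\<^esub> f \<odot>\<^bsub>Ft i\<^esub> c) \<oplus>\<^bsub>Ft i\<^esub> (a (i - 1) (dt i x) \<oplus>\<^bsub>Ft i\<^esub> p (i - 2) (thl i x)) = x"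
      and two: "dt (i + 2) (p i x) = f \<odot>\<^bsub>Ft (i + 1)\<^esub> d \<oplus>\<^bsub>Ft (i + 1)\<^esub> p (i - 1) (dt i x)"
      and three: "thl (i + 2) (p i x) = (dt (i + 1) (b i x) \<oplus>\<^bsub>Ft i\<^esub> (f \<odot>\<^bsub>Ft i\<^esub> g \<oplus>\<^bsub>Ft i\<^esub> b (i - 1) (dt i x))) \<oplus>\<^bsub>Ft i\<^esub> x"
      using main[OF i x(1)] by blast
    have dx: "dt i x \<in> carrier (Ft (i - 1))" by (rule dt_closed[OF x(1) refl])
    have tx: "thl i x \<in> carrier (Ft (i - 2))" by (rule thl_closed[OF x(1) refl])
    have s: "i - 1 + 1 = i" "i - 2 + 2 = i" "i - 1 + 2 = i + 1" by simp_all
    have ax: "a i x \<in> carrier (Ft (i + 1))" and adx: "a (i - 1) (dt i x) \<in> carrier (Ft i)"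
      using lin_hom_closed[OF al x(1)] lin_hom_closed[OF al dx] unfolding s .
    have bx: "b i x \<in> carrier (Ft (i + 1))" and bdx: "b (i - 1) (dt i x) \<in> carrier (Ft i)"
      using lin_hom_closed[OF bl x(1)] lin_hom_closed[OF bl dx] unfolding s .
    have px: "p i x \<in> carrier (Ft (i + 2))" and pdx: "p (i - 1) (dt i x) \<in> carrier (Ft (i + 1))"
      and ptx: "p (i - 2) (thl i x) \<in> carrier (Ft i)"
      using lin_hom_closed[OF pl x(1)] lin_hom_closed[OF pl dx] lin_hom_closed[OF pl tx] unfolding s .
    have dax: "dt (i + 1) (a i x) \<in> carrier (Ft i)" "dt (i + 1) (b i x) \<in> carrier (Ft i)"
      by (rule dt_closed[OF ax], simp) (rule dt_closed[OF bx], simp)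
    have fc: "f \<odot>\<^bsub>Ft i\<^esub> c \<in> carrier (Ft i)" "f \<odot>\<^bsub>Ft i\<^esub> g \<in> carrier (Ft i)" "f \<odot>\<^bsub>Ft (i + 1)\<^esub> d \<in> carrier (Ft (i + 1))"
      by (rule Ft.smult_closed[OF f_closed c] Ft.smult_closed[OF f_closed g] Ft.smult_closed[OF f_closed d])+
    have bdy: "bd F i y = rho (i - 1) (dt i x)" using rho_dt[OF x(1) refl] x(2) by simp
    have bdy_c: "bd F i y \<in> carrier (obj F (i - 1))" by (rule F.bd_closed[OF y refl])
    have dA: "hom_diff F F (- 1) A i y = rho i (dt (i + 1) (a i x)) \<oplus>\<^bsub>obj F i\<^esub> rho i (a (i - 1) (dt i x))"
      using P.diff_apply[OF y, of i "- 1" A] A(2)[OF x(1)] A(2)[OF dx] rho_dt[OF ax, of i] by (simp add: x(2) bdy[unfolded x(2)])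
    have dB: "hom_diff F F (- 1) B i y = rho i (dt (i + 1) (b i x)) \<oplus>\<^bsub>obj F i\<^esub> rho i (b (i - 1) (dt i x))"
      using P.diff_apply[OF y, of i "- 1" B] B(2)[OF x(1)] B(2)[OF dx] rho_dt[OF bx, of i] by (simp add: x(2) bdy[unfolded x(2)])
    have pt: "\<psi> (i - 2) (th i y) = rho i (p (i - 2) (thl i x))"
      using th_rho[OF x(1) refl] \<psi>(2)[OF tx] by (simp add: x(2))
    have rc: "rho i z \<in> carrier (obj F i)" if "z \<in> carrier (Ft i)" for i z by (rule rho_closed[OF that refl])
    have "y = rho i (dt (i + 1) (a i x) \<ominus>\<^bsub>Ft i\<^esub> f \<odot>\<^bsub>Ft i\<^esub> c) \<oplus>\<^bsub>obj F i\<^esub> (rho i (a (i - 1) (dt i x)) \<oplus>\<^bsub>obj F i\<^esub> rho i (p (i - 2) (thl i x)))"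
      using arg_cong[OF one, of "rho i"] dax fc adx ptx x(2) by (simp add: rho_add)
    then show "y = hom_diff F F (- 1) A i y \<oplus>\<^bsub>obj F i\<^esub> \<psi> (i - 2) (th i y)"
      unfolding dA pt using dax fc adx ptx
      by (simp add: rho_diff rho_f[OF c] F.obj.M.diff_zero rc F.obj.M.a_assoc)
    have "bd F (i + 2) (\<psi> i y) = rho (i + 1) (p (i - 1) (dt i x))"
      using rho_dt[OF px, of "i + 1"] \<psi>(2)[OF x(1)] two fc pdx by (simp add: rho_add rho_f[OF d] rc x(2))
    moreover have "\<psi> (i - 1) (bd F i y) = rho (i + 1) (p (i - 1) (dt i x))"
      using \<psi>(2)[OF dx] unfolding s by (simp add: bdy)
    ultimately show "hom_diff F F (- 2) \<psi> i y = \<zero>\<^bsub>obj F (i + 1)\<^esub>"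
      using P.diff_apply[OF y, of "i + 1" "- 2" \<psi>] rc[OF pdx] by (simp add: F.obj.M.diff_self)
    have "th (i + 2) (\<psi> i y) = rho i (thl (i + 2) (p i x))"
      using th_rho[OF px, of i] \<psi>(2)[OF x(1)] x(2) by simp
    also have "\<dots> = hom_diff F F (- 1) B i y \<oplus>\<^bsub>obj F i\<^esub> y"
      unfolding three dB using dax fc bdx x by (simp add: rho_add rho_f[OF g] rc)
    finally show "th (i + 2) (\<psi> i y) = hom_diff F F (- 1) B i y \<oplus>\<^bsub>obj F i\<^esub> y" .
  qed
  have \<psi>Z: "\<psi> \<in> stable_Z R F F (- 2)"
    unfolding stable_Z_def
  proof (intro CollectI conjI \<psi>H P.boundedI[where k = k])
    show "hom_diff F F (- 2) \<psi> \<in> P.H (- 2 + 1)" by (rule P.hom_diff_closed[OF \<psi>H refl])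
    show "hom_diff F F (- 2) \<psi> i x = \<zero>\<^bsub>obj F (i - (- 2 + 1))\<^esub>" if "k < i" "x \<in> carrier (obj F i)" for i x
      using facts(2)[OF that] by simp
  qed
  have thZ: "th \<in> stable_Z R F F 2" by (rule P.hom_Z_stable[OF theta_hom_Z])
  have idZ: "hom_ident F \<in> stable_Z R F F 0" by (rule P.hom_Z_stable[OF ident_hom_Z[OF F_resolution]])
  have id: "hom_ident F i x = x" if "x \<in> carrier (obj F i)" for i x using that by (simp add: hom_ident_def)
  have "stable_cl R F F 0 (hom_ident F) = stable_cl R F F 0 (hom_comp F 2 \<psi> th)"
  proof (rule P.stable_cl_eqI[OF idZ _ AH, where k = k])
    show "hom_comp F 2 \<psi> th \<in> stable_Z R F F 0" by (rule T.comp_stable_Z[OF \<psi>Z thZ]) simp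
    show "hom_ident F i x = hom_diff F F (- 1) A i x \<oplus>\<^bsub>obj F (i - 0)\<^esub> hom_comp F 2 \<psi> th i x"
      if "k < i" "x \<in> carrier (obj F i)" for i x
      using facts(1)[OF that] that by (simp add: id hom_comp_apply)
  qed simp
  moreover have "stable_cl R F F 0 (hom_comp F (- 2) th \<psi>) = stable_cl R F F 0 (hom_ident F)"
  proof (rule P.stable_cl_eqI[OF _ idZ BH, where k = k])
    show "hom_comp F (- 2) th \<psi> \<in> stable_Z R F F 0" by (rule T.comp_stable_Z[OF thZ \<psi>Z]) simp
    show "hom_comp F (- 2) th \<psi> i x = hom_diff F F (- 1) B i x \<oplus>\<^bsub>obj F (i - 0)\<^esub> hom_ident F i x"
      if "k < i" "x \<in> carrier (obj F i)" for i x
      using facts(3)[OF that] that by (simp add: id hom_comp_apply)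
  qed simp
  ultimately show ?thesis
    using T.stable_mult_cl[OF \<psi>Z thZ, of 0] T.stable_mult_cl[OF thZ \<psi>Z, of 0] by (intro bexI[OF _ \<psi>Z]) simp
qed

end

section \<open>The localized comparison maps\<close>

context lifted
begin

lemma self_hom_pair: "hom_pair R M F \<epsilon> M F \<epsilon>"
  by (intro hom_pair.intro F_resolution)

lemma self_pair: "lifted_pair Q f M F \<epsilon> Ft \<phi> dt M F \<epsilon> Ft \<phi> dt"
  by (intro lifted_pair.intro lifted_axioms)

lemma iota_theta: "iota R F F 2 (ext_cl R F F 2 th) = stable_cl R F F 2 th"
  by (rule hom_pair.iota_cl[OF self_hom_pair theta_hom_Z])

text \<open>Centrality is the commutation result for two equal lifted resolutions.\<close>

lemma theta_central: "central_element (ext_ring R F) (ext_cl R F F 2 th)"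
  by (intro central_element.intro central_element_axioms.intro ext_graded_ring[OF F_resolution];
      unfold ext_ring_simps)
    (rule hom_pair.ext_cl_closed[OF self_hom_pair theta_hom_Z] lifted_pair.ext_theta_commute[OF self_pair]; assumption?)+

lemma theta_stable_central: "central_element (stable_ext_ring R F) (stable_cl R F F 2 th)"
  by (intro central_element.intro central_element_axioms.intro stable_ext_graded_ring[OF F_resolution];
      unfold ext_ring_simps)
    (rule hom_pair.stable_cl_closed[OF self_hom_pair hom_pair.hom_Z_stable[OF self_hom_pair theta_hom_Z]]
      lifted_pair.stable_theta_commute[OF self_pair]; assumption?)+

lemma iota_central_hom:
  "central_ring_hom (ext_ring R F) (ext_cl R F F 2 th) (stable_ext_ring R F) (stable_cl R F F 2 th) (iota R F F)"
  by (intro central_ring_hom.intro central_ring_hom_axioms.intro theta_central theta_stable_central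
      iota_ring_hom[OF F_resolution] iota_theta)

lemma ext_loc_iso:
  "graded_ring_iso (gr_loc (ext_ring R F) (ext_cl R F F 2 th)) (gr_loc (stable_ext_ring R F) (stable_cl R F F 2 th))
    (loc_induced (gr_comp (stable_ext_ring R F)) (gr_act (stable_ext_ring R F) (stable_cl R F F 2 th)) (iota R F F))"
  by (rule central_ring_hom.gr_loc_iso[OF iota_central_hom]; unfold gr_act_def ext_ring_simps)
    (rule iota_kernel_nilpotent[OF F_resolution F_resolution theta_hom_Z]
      iota_cokernel_nilpotent[OF F_resolution F_resolution theta_hom_Z]; assumption)+

end

section \<open>Localized bimodules and multiplication by the class of degree two\<close>

context lifted_pair
begin

abbreviation "tF \<equiv> ext_cl S F F 2 F.th"
abbreviation "tG \<equiv> ext_cl S G G 2 G.th"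
abbreviation "uF \<equiv> stable_cl S F F 2 F.th"
abbreviation "uG \<equiv> stable_cl S G G 2 G.th"

lemma ext_central_bimodule: "central_bimodule (ext_ring S G) (ext_ring S F) (ext_bimod S F G) tG tF"
  by (intro central_bimodule.intro central_bimodule_axioms.intro F.theta_central G.theta_central
      ext_graded_bimodule[OF F.F_resolution G.F_resolution]; unfold ext_bimod_simps)
    (rule ext_theta_commute)

lemma stable_central_bimodule:
  "central_bimodule (stable_ext_ring S G) (stable_ext_ring S F) (stable_ext_bimod S F G) uG uF"
  by (intro central_bimodule.intro central_bimodule_axioms.intro F.theta_stable_central G.theta_stable_central
      stable_ext_graded_bimodule[OF F.F_resolution G.F_resolution]; unfold ext_bimod_simps)
    (rule stable_theta_commute)

lemma iota_central_bimodule_hom: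
  "central_bimodule_hom (ext_ring S G) (ext_ring S F) (ext_bimod S F G) tG tF
    (stable_ext_ring S G) (stable_ext_ring S F) (stable_ext_bimod S F G) uG uF (iota S G G) (iota S F F) (iota S F G)"
  by (intro central_bimodule_hom.intro central_bimodule_hom_axioms.intro ext_central_bimodule stable_central_bimodule
      F.iota_central_hom G.iota_central_hom iota_bimodule_hom[OF F.F_resolution G.F_resolution])

lemma ext_bimod_loc_iso:
  "graded_bimodule_iso (gr_loc (ext_ring S G) tG) (gr_loc (ext_ring S F) tF)
    (bm_loc (ext_bimod S F G) (bm_act side (ext_ring S G) tG (ext_ring S F) tF (ext_bimod S F G)))
    (bm_loc (stable_ext_bimod S F G) (bm_act side (stable_ext_ring S G) uG (stable_ext_ring S F) uF (stable_ext_bimod S F G)))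
    (loc_induced (gr_comp (stable_ext_ring S G)) (gr_act (stable_ext_ring S G) uG) (iota S G G))
    (loc_induced (gr_comp (stable_ext_ring S F)) (gr_act (stable_ext_ring S F) uF) (iota S F F))
    (loc_induced (bm_comp (stable_ext_bimod S F G))
      (bm_act side (stable_ext_ring S G) uG (stable_ext_ring S F) uF (stable_ext_bimod S F G)) (iota S F G))"
  by (rule central_bimodule_hom.bm_loc_iso[OF iota_central_bimodule_hom]; unfold ext_bimod_simps)
    (rule iota_kernel_nilpotent[OF F.F_resolution G.F_resolution G.theta_hom_Z]
      iota_cokernel_nilpotent[OF F.F_resolution G.F_resolution G.theta_hom_Z]; assumption)+

text \<open>If \<open>uG\<close> is a unit, left multiplication by its inverse is the inverse map.
  If \<open>uF\<close> is a unit, left multiplication by \<open>uG\<close> is first rewritten as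
  right multiplication by \<open>uF\<close>, and the inverse map multiplies by the inverse of
  \<open>uF\<close> on the right.\<close>

lemma theta_mult_bij:
  assumes "finite_proj_dim TYPE('p) Q (restrict_scalars (quot_proj Q f) M) \<or>
    finite_proj_dim TYPE('p) Q (restrict_scalars (quot_proj Q f) N)"
  shows "bij_betw (stable_ext_mult S F G 2 n uG) (carrier (cohomology (stable_hom_complex S F G) n))
    (carrier (cohomology (stable_hom_complex S F G) (n + 2)))"
proof -
  interpret L: hom_triple S M F \<epsilon> N G \<eta> N G \<eta> by (rule triple_left)
  interpret R: hom_triple S M F \<epsilon> M F \<epsilon> N G \<eta> by (rule triple_right)
  let ?E = "\<lambda>n. carrier (cohomology (stable_hom_complex S F G) n)"
  have tG: "G.th \<in> stable_Z S G G 2" by (rule hom_pair.hom_Z_stable[OF G.self_hom_pair G.theta_hom_Z])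
  have tF: "F.th \<in> stable_Z S F F 2" by (rule hom_pair.hom_Z_stable[OF F.self_hom_pair F.theta_hom_Z])
  have uG: "uG \<in> carrier (cohomology (stable_hom_complex S G G) 2)" by (rule hom_pair.stable_cl_closed[OF G.self_hom_pair tG])
  have uF: "uF \<in> carrier (cohomology (stable_hom_complex S F F) 2)" by (rule hom_pair.stable_cl_closed[OF F.self_hom_pair tF])
  have closed: "stable_ext_mult S F G 2 n uG x \<in> ?E (n + 2)" if "x \<in> ?E n" for x
    by (rule graded_pairingD(1)[OF L.stable_pairing uG that]) simp
  note one_left = stable_mult_one_left[OF F.F_resolution G.F_resolution]
  note one_right = stable_mult_one_right[OF F.F_resolution G.F_resolution]
  note res = F.F_resolution G.F_resolution
  consider (G) \<xi> where "\<xi> \<in> stable_Z S G G (- 2)"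
      "stable_ext_mult S G G (- 2) 2 (stable_cl S G G (- 2) \<xi>) uG = stable_cl S G G 0 (hom_ident G)"
      "stable_ext_mult S G G 2 (- 2) uG (stable_cl S G G (- 2) \<xi>) = stable_cl S G G 0 (hom_ident G)"
    | (F) \<xi> where "\<xi> \<in> stable_Z S F F (- 2)"
      "stable_ext_mult S F F (- 2) 2 (stable_cl S F F (- 2) \<xi>) uF = stable_cl S F F 0 (hom_ident F)"
      "stable_ext_mult S F F 2 (- 2) uF (stable_cl S F F (- 2) \<xi>) = stable_cl S F F 0 (hom_ident F)"
  proof -
    note assms[unfolded finite_proj_dim_def]
    then show thesis
    proof (elim disjE exE conjE)
      fix T \<eta>' m
      assume "projective_resolution Q (restrict_scalars (quot_proj Q f) M) T \<eta>'" "\<forall>i>m. carrier (obj T i) = {\<zero>\<^bsub>obj T i\<^esub>}"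
      then show thesis using F.theta_stable_unit F by blast
    next
      fix T \<eta>' m
      assume "projective_resolution Q (restrict_scalars (quot_proj Q f) N) T \<eta>'" "\<forall>i>m. carrier (obj T i) = {\<zero>\<^bsub>obj T i\<^esub>}"
      then show thesis using G.theta_stable_unit G by blast
    qed
  qed
  then show ?thesis
  proof cases
    case G
    let ?w = "stable_cl S G G (- 2) \<xi>"
    have w: "?w \<in> carrier (cohomology (stable_hom_complex S G G) (- 2))"
      by (rule hom_pair.stable_cl_closed[OF G.self_hom_pair G(1)])
    note assoc = stable_ext_mult_assoc[OF res res(2) res(2)]
    show ?thesis
    proof (rule bij_betw_byWitness[where f' = "stable_ext_mult S F G (- 2) (n + 2) ?w"])
      show "\<forall>x \<in> ?E n. stable_ext_mult S F G (- 2) (n + 2) ?w (stable_ext_mult S F G 2 n uG x) = x"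
        using assoc[OF w uG] G(2) one_left by (simp add: add.commute)
      show "\<forall>x \<in> ?E (n + 2). stable_ext_mult S F G 2 n uG (stable_ext_mult S F G (- 2) (n + 2) ?w x) = x"
        using assoc[OF uG w, of _ "n + 2"] G(3) one_left by simp
      show "stable_ext_mult S F G 2 n uG ` ?E n \<subseteq> ?E (n + 2)" using closed by blast
      show "stable_ext_mult S F G (- 2) (n + 2) ?w ` ?E (n + 2) \<subseteq> ?E n"
        using graded_pairingD(1)[OF L.stable_pairing w, of _ "n + 2" n] by auto
    qed
  next
    case F
    let ?w = "stable_cl S F F (- 2) \<xi>"
    have w: "?w \<in> carrier (cohomology (stable_hom_complex S F F) (- 2))"
      by (rule hom_pair.stable_cl_closed[OF F.self_hom_pair F(1)])
    note assoc = stable_ext_mult_assoc[OF res(1) res(1) res]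
    have wc: "stable_ext_mult S F G (n + 2) (- 2) x ?w \<in> ?E n" if "x \<in> ?E (n + 2)" for x
      using graded_pairingD(1)[OF R.stable_pairing that w] by simp
    show ?thesis
    proof (rule bij_betw_byWitness[where f' = "\<lambda>x. stable_ext_mult S F G (n + 2) (- 2) x ?w"])
      show "\<forall>x \<in> ?E n. stable_ext_mult S F G (n + 2) (- 2) (stable_ext_mult S F G 2 n uG x) ?w = x"
        using assoc[OF _ uF w] F(3) one_right by (simp add: stable_theta_commute)
      show "\<forall>x \<in> ?E (n + 2). stable_ext_mult S F G 2 n uG (stable_ext_mult S F G (n + 2) (- 2) x ?w) = x"
        using assoc[OF _ w uF, of _ "n + 2"] F(2) one_right wc by (simp add: stable_theta_commute)
      show "stable_ext_mult S F G 2 n uG ` ?E n \<subseteq> ?E (n + 2)" using closed by blast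
      show "(\<lambda>x. stable_ext_mult S F G (n + 2) (- 2) x ?w) ` ?E (n + 2) \<subseteq> ?E n" using wc by blast
    qed
  qed
qed

end

theorem corollary4p2:
  fixes Q :: "'q ring" and f :: 'q
    and M :: "('q set, 'm) module" and N :: "('q set, 'n) module"
    and F :: "('q set, 'c) chain_complex" and Ft :: "int \<Rightarrow> ('q, 'k) module"
    and G :: "('q set, 'd) chain_complex" and Gt :: "int \<Rightarrow> ('q, 'l) module"
    and side :: loc_side
  assumes "ring Q"
    and "f \<in> carrier Q"
    and "\<forall>q \<in> carrier Q. f \<otimes>\<^bsub>Q\<^esub> q = q \<otimes>\<^bsub>Q\<^esub> f"
    and "\<forall>q \<in> carrier Q. f \<otimes>\<^bsub>Q\<^esub> q = \<zero>\<^bsub>Q\<^esub> \<longrightarrow> q = \<zero>\<^bsub>Q\<^esub>"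
    and "left_module (quot_ring Q f) M"
    and "left_module (quot_ring Q f) N"
    and "liftable_resolution Q f M F \<epsilon>\<^sub>F Ft \<phi>\<^sub>F dFt"
    and "liftable_resolution Q f N G \<epsilon>\<^sub>G Gt \<phi>\<^sub>G dGt"
  shows
    "let R = quot_ring Q f;
         \<comment> \<open>absolute cohomology\<close>
         EM = ext_ring R F; EN = ext_ring R G; E = ext_bimod R F G;
         tM = vartheta Q f F Ft \<phi>\<^sub>F dFt; tN = vartheta Q f G Gt \<phi>\<^sub>G dGt;
         a = bm_act side EN tN EM tM E;
         \<comment> \<open>stable cohomology\<close>
         SM = stable_ext_ring R F; SN = stable_ext_ring R G; S = stable_ext_bimod R F G;
         uM = iota R F F 2 tM; uN = iota R G G 2 tN;
         b = bm_act side SN uN SM uM S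
     in
       \<comment> \<open>induced structures on the localizations\<close>
       graded_ring (gr_loc EN tN) \<and>
       graded_ring_hom EN (gr_loc EN tN) (loc_map (gr_comp EN) (gr_act EN tN)) \<and>
       graded_ring (gr_loc EM tM) \<and>
       graded_ring_hom EM (gr_loc EM tM) (loc_map (gr_comp EM) (gr_act EM tM)) \<and>
       graded_bimodule (gr_loc EN tN) (gr_loc EM tM) (bm_loc E a) \<and>
       graded_bimodule_hom EN EM E (bm_loc E a)
         (loc_map (gr_comp EN) (gr_act EN tN)) (loc_map (gr_comp EM) (gr_act EM tM))
         (loc_map (bm_comp E) a) \<and>
       graded_ring (gr_loc SN uN) \<and>
       graded_ring_hom SN (gr_loc SN uN) (loc_map (gr_comp SN) (gr_act SN uN)) \<and>
       graded_ring (gr_loc SM uM) \<and>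
       graded_ring_hom SM (gr_loc SM uM) (loc_map (gr_comp SM) (gr_act SM uM)) \<and>
       graded_bimodule (gr_loc SN uN) (gr_loc SM uM) (bm_loc S b) \<and>
       graded_bimodule_hom SN SM S (bm_loc S b)
         (loc_map (gr_comp SN) (gr_act SN uN)) (loc_map (gr_comp SM) (gr_act SM uM))
         (loc_map (bm_comp S) b) \<and>
       \<comment> \<open>isomorphisms induced by iota\<close>
       graded_ring_iso (gr_loc EN tN) (gr_loc SN uN)
         (loc_induced (gr_comp SN) (gr_act SN uN) (iota R G G)) \<and>
       graded_ring_iso (gr_loc EM tM) (gr_loc SM uM)
         (loc_induced (gr_comp SM) (gr_act SM uM) (iota R F F)) \<and>
       graded_bimodule_iso (gr_loc EN tN) (gr_loc EM tM) (bm_loc E a) (bm_loc S b)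
         (loc_induced (gr_comp SN) (gr_act SN uN) (iota R G G))
         (loc_induced (gr_comp SM) (gr_act SM uM) (iota R F F))
         (loc_induced (bm_comp S) b (iota R F G)) \<and>
       \<comment> \<open>finite projective dimension over Q\<close>
       (finite_proj_dim TYPE('p) Q (restrict_scalars (quot_proj Q f) M) \<or>
        finite_proj_dim TYPE('p) Q (restrict_scalars (quot_proj Q f) N) \<longrightarrow>
        (\<forall>n. bij_betw (loc_map (bm_comp S) b n) (bm_elts S n) (bm_elts (bm_loc S b) n)))"
proof -
  interpret lifted_pair Q f M F \<epsilon>\<^sub>F Ft \<phi>\<^sub>F dFt N G \<epsilon>\<^sub>G Gt \<phi>\<^sub>G dGt
    by (intro lifted_pair.intro lifted.intro central_regular.intro central_regular_axioms.intro lifted_axioms.intro assms)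
  have bij: "bij_betw (loc_map (bm_comp (stable_ext_bimod S F G))
      (bm_act side (stable_ext_ring S G) uG (stable_ext_ring S F) uF (stable_ext_bimod S F G)) n)
      (bm_elts (stable_ext_bimod S F G) n) (bm_elts (bm_loc (stable_ext_bimod S F G)
        (bm_act side (stable_ext_ring S G) uG (stable_ext_ring S F) uF (stable_ext_bimod S F G))) n)"
    if fin: "finite_proj_dim TYPE('p) Q (restrict_scalars (quot_proj Q f) M) \<or>
      finite_proj_dim TYPE('p) Q (restrict_scalars (quot_proj Q f) N)" for n
    by (rule central_bimodule.bm_loc_map_bij[OF stable_central_bimodule])
      (unfold ext_bimod_simps, rule theta_mult_bij[OF fin])
  \<comment> \<open>The statement speaks of images under \<iota>; \<open>iota_theta\<close>
    identifies them with the stable classes of the same cochains, for which all structures were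
    established.\<close>
  show ?thesis
    unfolding Let_def vartheta_def F.iota_theta G.iota_theta
    by (intro conjI impI allI bij
        F.theta_central[THEN central_element.gr_loc_graded_ring] F.theta_central[THEN central_element.gr_loc_hom]
        G.theta_central[THEN central_element.gr_loc_graded_ring] G.theta_central[THEN central_element.gr_loc_hom]
        F.theta_stable_central[THEN central_element.gr_loc_graded_ring]
        F.theta_stable_central[THEN central_element.gr_loc_hom]
        G.theta_stable_central[THEN central_element.gr_loc_graded_ring]
        G.theta_stable_central[THEN central_element.gr_loc_hom]
        ext_central_bimodule[THEN central_bimodule.bm_loc_graded_bimodule]
        ext_central_bimodule[THEN central_bimodule.bm_loc_hom]
        stable_central_bimodule[THEN central_bimodule.bm_loc_graded_bimodule]
        stable_central_bimodule[THEN central_bimodule.bm_loc_hom]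
        F.ext_loc_iso G.ext_loc_iso ext_bimod_loc_iso)
qed

end
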